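(* Let $A$ be a unital separable AF-algebra and let $x,y\in A$ be two normal elements. Then $$\mathrm{dist}(\mathcal U(x),\mathcal U(y))\le D_c(x,y).$$
   Context: For a normal element $x$ of a unital $C^*$-algebra $A$ with unitary group $U(A)$, $\mathcal U(x)$ is the norm closure of $\{u^*xu:u\in U(A)\}$, and $\mathrm{dist}(\mathcal U(x),\mathcal U(y))=\inf\{\|a-b\|:a\in\mathcal U(x),\,b\in\mathcal U(y)\}$. For positive $a,b\in A$, $a\lesssim b$ means there is a sequence $\{x_n\}\subset A$ with $x_n^*bx_n\to a$. For a compact metric space $\Omega$ and an open set $O\subset\Omega$, $f_O\in C(\Omega)$ denotes any function with $0\le f_O\le1$, $f_O(t)>0$ for $t\in O$ and $f_O(t)=0$ for $t\notin O$; for $d>0$, $O_d=\{t\in\Omega:\mathrm{dist}(t,O)<d\}$. For unital homomorphisms $\kappa_1,\kappa_2:C(\Omega)\to A$, $$D_c(\kappa_1,\kappa_2)=\sup\big\{\inf\{d>0:\kappa_1(f_O)\lesssim\kappa_2(f_{O_d})\}: O\subset\Omega\text{ open}\big\}$$ (independent of the choice of the functions $f_O$). For normal $x,y\in A$ with $X=\mathrm{sp}(x)$, $Y=\mathrm{sp}(y)$, put $\Omega=X\cup Y\subset\mathbb C$, $\phi_X(f)=f(x)$, $\phi_Y(f)=f(y)$ for $f\in C(\Omega)$, and $D_c(x,y)=D_c(\phi_X,\phi_Y)$. *)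

theory Defs
  imports "HOL-Analysis.Analysis"
begin

text \<open>Unital complex C*-algebras. The superclass real_normed_algebra_1 provides the real
  structure and \<open>norm 1 = 1\<close>, so the zero algebra is excluded.\<close>

class cstar_algebra = real_normed_algebra_1 + banach +
  fixes scaleC :: "complex \<Rightarrow> 'a \<Rightarrow> 'a"  (infixr "*\<^sub>C" 75)
    and star :: "'a \<Rightarrow> 'a"
  assumes scaleC_add_right: "c *\<^sub>C (x + y) = c *\<^sub>C x + c *\<^sub>C y"
    and scaleC_add_left: "(c + d) *\<^sub>C x = c *\<^sub>C x + d *\<^sub>C x"
    and scaleC_scaleC: "c *\<^sub>C d *\<^sub>C x = (c * d) *\<^sub>C x"
    and scaleC_of_real: "complex_of_real r *\<^sub>C x = r *\<^sub>R x"
    and norm_scaleC: "norm (c *\<^sub>C x) = cmod c * norm x"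
    and mult_scaleC_left: "(c *\<^sub>C x) * y = c *\<^sub>C (x * y)"
    and mult_scaleC_right: "x * (c *\<^sub>C y) = c *\<^sub>C (x * y)"
    and star_add: "star (x + y) = star x + star y"
    and star_scaleC: "star (c *\<^sub>C x) = cnj c *\<^sub>C star x"
    and star_mult: "star (x * y) = star y * star x"
    and star_star: "star (star x) = x"
    and norm_star_mult_self: "norm (star x * x) = (norm x)\<^sup>2"

global_interpretation complex_vector:
  vector_space "scaleC :: complex \<Rightarrow> 'a \<Rightarrow> 'a::cstar_algebra"
proof
  show "1 *\<^sub>C x = x" for x :: 'a
    using scaleC_of_real [of 1 x] by simp
qed (simp_all add: scaleC_add_right scaleC_add_left scaleC_scaleC)

definition star_subalgebra :: "'a::cstar_algebra set \<Rightarrow> bool" where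
  "star_subalgebra B \<longleftrightarrow> complex_vector.subspace B \<and>
     (\<forall>a\<in>B. \<forall>b\<in>B. a * b \<in> B) \<and> (\<forall>a\<in>B. star a \<in> B)"

text \<open>Finite-dimensional subspaces are automatically norm closed, so the sets below are exactly the
  finite-dimensional C*-subalgebras; they need not contain the unit of the ambient algebra.\<close>

definition finite_dim_subalgebra :: "'a::cstar_algebra set \<Rightarrow> bool" where
  "finite_dim_subalgebra B \<longleftrightarrow>
     star_subalgebra B \<and> (\<exists>F. finite F \<and> B = complex_vector.span F)"

definition AF_algebra :: "'a::cstar_algebra itself \<Rightarrow> bool" where
  "AF_algebra _ \<longleftrightarrow>
     (\<exists>B :: nat \<Rightarrow> 'a set. (\<forall>n. finite_dim_subalgebra (B n)) \<and> incseq B \<and>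
        closure (\<Union>n. B n) = UNIV)"

definition normal_element :: "'a::cstar_algebra \<Rightarrow> bool" where
  "normal_element x \<longleftrightarrow> star x * x = x * star x"

definition unitary :: "'a::cstar_algebra \<Rightarrow> bool" where
  "unitary u \<longleftrightarrow> star u * u = 1 \<and> u * star u = 1"

definition unitary_orbit :: "'a::cstar_algebra \<Rightarrow> 'a set" where
  "unitary_orbit x = closure {star u * x * u | u. unitary u}"

definition spectrum :: "'a::cstar_algebra \<Rightarrow> complex set" where
  "spectrum x =
     {z. \<not> (\<exists>b. b * (x - z *\<^sub>C 1) = 1 \<and> (x - z *\<^sub>C 1) * b = 1)}"

text \<open>An element of \<open>C(\<Omega>)\<close> is represented by any function on the ambient type that is continuous
  on \<open>\<Omega>\<close>; two functions agreeing on \<open>\<Omega>\<close> represent the same element.\<close>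

definition unital_star_hom :: "'t::topological_space set \<Rightarrow> (('t \<Rightarrow> complex) \<Rightarrow> 'a::cstar_algebra) \<Rightarrow> bool"
  where
  "unital_star_hom \<Omega> \<Phi> \<longleftrightarrow>
     (\<forall>f g. continuous_on \<Omega> f \<longrightarrow> continuous_on \<Omega> g \<longrightarrow>
        ((\<forall>t\<in>\<Omega>. f t = g t) \<longrightarrow> \<Phi> f = \<Phi> g) \<and>
        \<Phi> (\<lambda>t. f t + g t) = \<Phi> f + \<Phi> g \<and>
        \<Phi> (\<lambda>t. f t * g t) = \<Phi> f * \<Phi> g) \<and>
     (\<forall>f c. continuous_on \<Omega> f \<longrightarrow> \<Phi> (\<lambda>t. c * f t) = c *\<^sub>C \<Phi> f) \<and>
     (\<forall>f. continuous_on \<Omega> f \<longrightarrow> \<Phi> (\<lambda>t. cnj (f t)) = star (\<Phi> f)) \<and>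
     \<Phi> (\<lambda>t. 1) = 1"

text \<open>Continuous functional calculus \<open>f(x)\<close>. For normal \<open>x\<close>, Gelfand theory provides exactly one
  unital *-homomorphism \<open>C(sp(x)) \<rightarrow> A\<close> that maps the identity function to \<open>x\<close>; the
  choice operator only affects the irrelevant values at functions not continuous on the spectrum.\<close>

definition cfc :: "'a::cstar_algebra \<Rightarrow> (complex \<Rightarrow> complex) \<Rightarrow> 'a" where
  "cfc x = (SOME \<Phi>. unital_star_hom (spectrum x) \<Phi> \<and> \<Phi> (\<lambda>z. z) = x)"

definition cuntz_le :: "'a::cstar_algebra \<Rightarrow> 'a \<Rightarrow> bool"  (infix "\<lesssim>" 50) where
  "a \<lesssim> b \<longleftrightarrow> (\<exists>X :: nat \<Rightarrow> 'a. (\<lambda>n. star (X n) * b * X n) \<longlonglongrightarrow> a)"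

text \<open>The functions \<open>f\<^sub>G\<close> for relatively open \<open>G \<subseteq> \<Omega>\<close>.\<close>

definition is_support_fun :: "'t::metric_space set \<Rightarrow> 't set \<Rightarrow> ('t \<Rightarrow> complex) \<Rightarrow> bool" where
  "is_support_fun \<Omega> G f \<longleftrightarrow> continuous_on \<Omega> f \<and>
     (\<forall>t\<in>\<Omega>. \<exists>r. f t = complex_of_real r \<and> 0 \<le> r \<and> r \<le> 1 \<and>
        (if t \<in> G then 0 < r else r = 0))"

definition support_fun :: "'t::metric_space set \<Rightarrow> 't set \<Rightarrow> 't \<Rightarrow> complex" where
  "support_fun \<Omega> G = (SOME f. is_support_fun \<Omega> G f)"

lemma is_support_fun_support_fun:
  fixes \<Omega> G :: "'t::metric_space set"
  assumes "openin (top_of_set \<Omega>) G"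
  shows "is_support_fun \<Omega> G (support_fun \<Omega> G)"
proof -
  obtain T where T: "open T" "G = \<Omega> \<inter> T"
    using assms by (auto simp: openin_open)
  define h :: "'t \<Rightarrow> real" where
    "h t = (if T = UNIV then 1 else min 1 (infdist t (- T)))" for t
  have cont: "continuous_on \<Omega> h"
    unfolding h_def by (cases "T = UNIV") (auto intro!: continuous_intros)
  have bounds: "0 \<le> h t" "h t \<le> 1" for t
    by (auto simp: h_def infdist_nonneg)
  have support: "if t \<in> T then 0 < h t else h t = 0" for t
  proof (cases "T = UNIV")
    case False
    then have "- T \<noteq> {}" "closed (- T)"
      using T by auto
    then have "infdist t (- T) = 0 \<longleftrightarrow> t \<notin> T"
      using in_closed_iff_infdist_zero [of "- T" t] by simp
    then show ?thesis
      using False infdist_nonneg [of t "- T"] by (auto simp: h_def)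
  qed (simp add: h_def)
  have "is_support_fun \<Omega> G (\<lambda>t. complex_of_real (h t))"
    unfolding is_support_fun_def
  proof (intro conjI ballI)
    fix t assume "t \<in> \<Omega>"
    then show "\<exists>r. complex_of_real (h t) = complex_of_real r \<and> 0 \<le> r \<and> r \<le> 1 \<and>
        (if t \<in> G then 0 < r else r = 0)"
      using bounds [of t] support [of t] T by (intro exI [of _ "h t"]) auto
  qed (intro continuous_intros cont)
  then show ?thesis
    unfolding support_fun_def by (rule someI [of "is_support_fun \<Omega> G"])
qed

text \<open>\<open>{t \<in> \<Omega>. dist(t, G) < d}\<close> with \<open>dist(t, \<emptyset>) = \<infinity>\<close>, whereas \<open>infdist t {} = 0\<close>.\<close>

definition nbhd :: "'t::metric_space set \<Rightarrow> 't set \<Rightarrow> real \<Rightarrow> 't set" where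
  "nbhd \<Omega> G d = {t \<in> \<Omega>. \<exists>s\<in>G. dist t s < d}"

text \<open>For compact \<open>\<Omega>\<close> and unital *-homomorphisms the infima are over nonempty sets and bounded by
  the diameter of \<open>\<Omega>\<close>: if \<open>d\<close> exceeds the diameter and \<open>G \<noteq> \<emptyset>\<close> then
  \<open>nbhd \<Omega> G d = \<Omega>\<close>, and \<open>\<kappa>2\<close> maps a strictly positive function to an invertible element. Hence the
  real-valued infima and supremum are the genuine ones.\<close>

definition Dc_hom :: "'t::metric_space set \<Rightarrow>
    (('t \<Rightarrow> complex) \<Rightarrow> 'a::cstar_algebra) \<Rightarrow> (('t \<Rightarrow> complex) \<Rightarrow> 'a) \<Rightarrow> real" where
  "Dc_hom \<Omega> \<kappa>1 \<kappa>2 =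
     Sup {Inf {d. 0 < d \<and> \<kappa>1 (support_fun \<Omega> G) \<lesssim> \<kappa>2 (support_fun \<Omega> (nbhd \<Omega> G d))} | G.
            openin (top_of_set \<Omega>) G}"

definition Dc :: "'a::cstar_algebra \<Rightarrow> 'a \<Rightarrow> real" where
  "Dc x y = Dc_hom (spectrum x \<union> spectrum y) (cfc x) (cfc y)"

end

theory Submission
  imports Defs "HOL-Computational_Algebra.Fundamental_Theorem_Algebra"
begin

text \<open>Inside a finite-dimensional algebra the inequality is a matching problem. Suppose that \<open>x\<close> and \<open>y\<close> are normal elements of
  one finite-dimensional algebra, written as linear combinations of orthogonal minimal projections. Comparison of the support
  functions of neighbourhoods of a set \<open>K\<close> says that the eigenprojections of \<open>x\<close> with eigenvalues in \<open>K\<close> are subequivalent to the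
  eigenprojections of \<open>y\<close> with eigenvalues within little more than \<open>Dc x y\<close> of \<open>K\<close>. Counting, within one equivalence class of
  minimal projections, this is the hypothesis of the marriage theorem. A perfect matching pairs equivalent minimal projections whose
  eigenvalues differ by little more than \<open>Dc x y\<close>, and partial isometries between the paired projections add up to a unitary
  which carries \<open>x\<close> to within that distance of \<open>y\<close>.

  The reduction to this case has two ingredients. The first is that normal elements of an AF-algebra are limits of
  \<^emph>\<open>normal\<close> elements of the finite-dimensional subalgebras (\<open>normal_dense\<close>). For the proof, the spectrum is first pushed out
  of a disc in every cell of a square grid: near the centre \<open>l\<close> of a cell the element is replaced by \<open>l\<close> plus a multiple of a unitary
  (\<open>hole_hom\<close>), the unitary part of an invertible element that agrees with \<open>x - l\<close> away from the disc. Such an invertible element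
  exists because invertible elements are dense. What is left of the spectrum lies near the grid lines. It is cut across the middle of
  every edge by spectral projections of finite-dimensional approximations of unitaries, which yields an approximation of \<open>x\<close> by
  a polynomial in one self-adjoint element (\<open>polynomial_approximation\<close>); self-adjoint elements have self-adjoint finite-dimensional
  approximations. All errors are bounded by an absolute constant, so scaling makes them small.

  The second ingredient is the transfer of Cuntz comparison to the approximations. A bump function \<open>g\<close> at \<open>K\<close> factorises
  as \<open>g(x) = U h(y) V\<close> up to an error of norm less than \<open>1\<close>, where \<open>h\<close> is a bump function at \<open>K\<close> with slightly larger support
  (\<open>bump_factorization\<close>). Only finitely many sets \<open>K\<close> of points of a finite net of the spectrum have to be considered, so the
  factorisations survive when \<open>x\<close> and \<open>y\<close> are replaced by close normal elements of one finite-dimensional subalgebra. An error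
  of norm less than \<open>1\<close> suffices to compare numbers of minimal projections (\<open>card_comparison\<close>); \<open>unitary_from_matching\<close> and
  \<open>unitary_near\<close> draw the conclusion.

  The existence of the continuous functional calculus, on which the definition of \<open>Dc\<close> rests, also comes from finite-dimensional
  approximation (\<open>normal_calculus\<close>, \<open>cfc_hom\<close>): self-adjoint elements inherit it from their approximations, and a normal element is
  treated as a pair of commuting self-adjoint elements.\<close>

section \<open>Arithmetic in C*-algebras\<close>

lemma scaleC_one [simp]: "1 *\<^sub>C (x::'a::cstar_algebra) = x"
  by (rule complex_vector.scale_one)

lemma star_0 [simp]: "star (0::'a::cstar_algebra) = 0"
  using star_add[of 0 0] by simp

lemma star_1 [simp]: "star (1::'a::cstar_algebra) = 1"
proof -
  have "star (star (1::'a) * 1) = star 1 * star (star 1)" by (rule star_mult)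
  then show ?thesis by (simp add: star_star)
qed

lemma star_minus [simp]: "star (- x) = - star (x::'a::cstar_algebra)"
  using star_add[of x "- x"] by (simp add: eq_neg_iff_add_eq_0 add.commute)

lemma star_diff: "star (x - y) = star x - star (y::'a::cstar_algebra)"
  using star_add[of x "- y"] by simp

lemma star_sum: "star (sum f S) = (\<Sum>i\<in>S. star (f i :: 'a::cstar_algebra))"
  by (induction S rule: infinite_finite_induct) (auto simp: star_add)

lemma star_power: "star (x ^ n) = star (x::'a::cstar_algebra) ^ n"
  by (induction n) (auto simp: star_mult power_commutes)

lemma norm_star [simp]: "norm (star x) = norm (x::'a::cstar_algebra)"
proof -
  have le: "norm y \<le> norm (star y)" for y :: 'a
  proof (cases "y = 0")
    case False
    have "norm y * norm y = norm (star y * y)"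
      by (simp add: norm_star_mult_self power2_eq_square)
    also have "\<dots> \<le> norm (star y) * norm y" by (rule norm_mult_ineq)
    finally show ?thesis using False by simp
  qed simp
  show ?thesis using le[of x] le[of "star x"] by (simp add: star_star)
qed

lemma norm_mult_star_self: "norm (x * star x) = (norm (x::'a::cstar_algebra))\<^sup>2"
  using norm_star_mult_self[of "star x"] by (simp add: star_star)

lemma star_scaleR: "star (r *\<^sub>R x) = r *\<^sub>R star (x::'a::cstar_algebra)"
  using star_scaleC[of "complex_of_real r" x] by (simp add: scaleC_of_real)

lemma bounded_linear_star: "bounded_linear (star :: 'a::cstar_algebra \<Rightarrow> 'a)"
  by (rule bounded_linear_intro[of _ 1]) (auto simp: star_add star_scaleR)

lemma bounded_linear_scaleC: "bounded_linear (\<lambda>x::'a::cstar_algebra. c *\<^sub>C x)"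
proof (rule bounded_linear_intro[of _ "cmod c"])
  fix r and x :: 'a
  have "c *\<^sub>C (complex_of_real r *\<^sub>C x) = complex_of_real r *\<^sub>C (c *\<^sub>C x)"
    by (simp add: scaleC_scaleC mult.commute)
  then show "c *\<^sub>C (r *\<^sub>R x) = r *\<^sub>R (c *\<^sub>C x)" by (simp only: scaleC_of_real)
qed (auto simp: scaleC_add_right norm_scaleC mult.commute)

lemmas tendsto_star [tendsto_intros] = bounded_linear.tendsto[OF bounded_linear_star]
lemmas tendsto_scaleC [tendsto_intros] = bounded_linear.tendsto[OF bounded_linear_scaleC]

lemma scaleC_minus_one [simp]: "(-1) *\<^sub>C x = - (x::'a::cstar_algebra)"
  using complex_vector.scale_minus_left[of 1 x] by simp

lemma scaleC_sum_right: "c *\<^sub>C sum f S = (\<Sum>i\<in>S. c *\<^sub>C (f i :: 'a::cstar_algebra))"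
  by (rule complex_vector.scale_sum_right)

lemma norm_unitary: "unitary u \<Longrightarrow> norm (u::'a::cstar_algebra) = 1"
proof -
  assume "unitary u"
  then have "(norm u)\<^sup>2 = 1" using norm_star_mult_self[of u] by (simp add: unitary_def)
  then have "norm u = 1 \<or> norm u = -1" by (simp add: power2_eq_1_iff)
  then show ?thesis using norm_ge_zero[of u] by linarith
qed

lemma norm_isometry_le:
  fixes u :: "'a::cstar_algebra"
  assumes "norm (star u * u) \<le> 1"
  shows "norm u \<le> 1"
  using assms abs_square_le_1[of "norm u"] by (simp add: norm_star_mult_self)

section \<open>Invertible elements\<close>

definition invertible_elt :: "'a::cstar_algebra \<Rightarrow> bool" where
  "invertible_elt a \<longleftrightarrow> (\<exists>b. b * a = 1 \<and> a * b = 1)"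

lemma spectrum_alt: "spectrum x = {z. \<not> invertible_elt (x - z *\<^sub>C 1)}"
  by (simp add: spectrum_def invertible_elt_def)

lemma invertible_elt_mult:
  assumes "invertible_elt a" "invertible_elt b"
  shows "invertible_elt (a * b)"
proof -
  obtain a' b' where "a' * a = 1" "a * a' = 1" "b' * b = 1" "b * b' = 1"
    using assms by (auto simp: invertible_elt_def)
  then have "(b' * a') * (a * b) = 1" "(a * b) * (b' * a') = 1"
    by (metis mult.assoc mult_1_right)+
  then show ?thesis by (auto simp: invertible_elt_def)
qed

lemma invertible_elt_star: "invertible_elt a \<Longrightarrow> invertible_elt (star a)"
  unfolding invertible_elt_def by (metis star_mult star_1)

lemma neumann_inverse:
  fixes y :: "'a::cstar_algebra"
  assumes "norm y < 1"
  obtains b where "b * (1 - y) = 1" "(1 - y) * b = 1" "norm b \<le> 1 / (1 - norm y)"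
proof -
  define b where "b = (\<Sum>n. y ^ n)"
  have s: "summable (\<lambda>n. y ^ n)" by (rule complete_algebra_summable_geometric[OF assms])
  have *: "b = 1 + (\<Sum>n. y ^ Suc n)"
    unfolding b_def using suminf_split_head[OF s] by simp
  have "(\<Sum>n. y ^ Suc n) = y * b" unfolding b_def power_Suc by (rule suminf_mult[OF s])
  then have 1: "b = 1 + y * b" using * by simp
  have "(\<Sum>n. y ^ Suc n) = b * y"
    unfolding b_def power_Suc2 by (rule suminf_mult2[OF s, symmetric])
  then have 2: "b = 1 + b * y" using * by simp
  have "norm b \<le> 1 + norm y * norm b"
    by (metis 1 norm_triangle_ineq norm_one norm_mult_ineq add_left_mono order_trans)
  then have "norm b \<le> 1 / (1 - norm y)" using assms by (simp add: field_simps)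
  with that[of b] 1 2 show ?thesis by (simp add: algebra_simps)
qed

lemma invertible_elt_one_minus: "norm y < 1 \<Longrightarrow> invertible_elt (1 - y)"
  by (metis invertible_elt_def neumann_inverse)

lemma invertible_elt_scale:
  assumes "c \<noteq> 0" "invertible_elt a"
  shows "invertible_elt (c *\<^sub>C a)"
proof -
  obtain b where "b * a = 1" "a * b = 1" using assms by (auto simp: invertible_elt_def)
  then have "(inverse c *\<^sub>C b) * (c *\<^sub>C a) = 1" "(c *\<^sub>C a) * (inverse c *\<^sub>C b) = 1"
    using assms by (auto simp: mult_scaleC_left mult_scaleC_right scaleC_scaleC)
  then show ?thesis by (auto simp: invertible_elt_def)
qed

lemma invertible_elt_perturb:
  fixes a :: "'a::cstar_algebra"
  assumes "b * a = 1" "a * b = 1" "norm b * norm (a - c) < 1"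
  shows "invertible_elt c"
proof -
  have "norm (b * (a - c)) < 1" using assms(3) norm_mult_ineq[of b "a - c"] by linarith
  then have "invertible_elt (1 - b * (a - c))" by (rule invertible_elt_one_minus)
  moreover have "invertible_elt a" using assms by (auto simp: invertible_elt_def)
  ultimately have "invertible_elt (a * (1 - b * (a - c)))" by (rule invertible_elt_mult[rotated])
  moreover have "a * (1 - b * (a - c)) = c"
    using assms(2) by (simp add: algebra_simps flip: mult.assoc)
  ultimately show ?thesis by simp
qed

lemma spectrum_bound:
  fixes x :: "'a::cstar_algebra"
  assumes "z \<in> spectrum x"
  shows "cmod z \<le> norm x"
proof (rule ccontr)
  assume "\<not> cmod z \<le> norm x"
  then have z: "norm x < cmod z" by simp
  then have "z \<noteq> 0" by auto
  have "norm (inverse z *\<^sub>C x) < 1" using z \<open>z \<noteq> 0\<close>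
    by (simp add: norm_scaleC norm_divide divide_simps)
  then have "invertible_elt (- z *\<^sub>C (1 - inverse z *\<^sub>C x))"
    by (intro invertible_elt_scale invertible_elt_one_minus) (use \<open>z \<noteq> 0\<close> in auto)
  moreover have "- z *\<^sub>C (1 - inverse z *\<^sub>C x) = x - z *\<^sub>C 1"
    using \<open>z \<noteq> 0\<close> by (simp add: complex_vector.scale_right_diff_distrib scaleC_scaleC)
  ultimately show False using assms by (simp add: spectrum_alt)
qed

lemma closed_spectrum: "closed (spectrum (x::'a::cstar_algebra))"
proof -
  have "open {z. invertible_elt (x - z *\<^sub>C 1)}"
  proof (rule openI, clarsimp)
    fix z assume "invertible_elt (x - z *\<^sub>C 1)"
    then obtain b where b: "b * (x - z *\<^sub>C 1) = 1" "(x - z *\<^sub>C 1) * b = 1"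
      by (auto simp: invertible_elt_def)
    then have "b \<noteq> 0" by auto
    have "invertible_elt (x - w *\<^sub>C 1)" if "w \<in> ball z (1 / norm b)" for w
    proof (rule invertible_elt_perturb[OF b])
      have "x - z *\<^sub>C 1 - (x - w *\<^sub>C 1) = (w - z) *\<^sub>C 1"
        by (simp add: complex_vector.scale_left_diff_distrib)
      then have "norm (x - z *\<^sub>C 1 - (x - w *\<^sub>C 1)) = cmod (w - z)" by (simp add: norm_scaleC)
      then show "norm b * norm (x - z *\<^sub>C 1 - (x - w *\<^sub>C 1)) < 1"
        using that \<open>b \<noteq> 0\<close> by (simp add: dist_norm norm_minus_commute field_simps)
    qed
    then show "\<exists>T>0. ball z T \<subseteq> {z. invertible_elt (x - z *\<^sub>C 1)}"
      using \<open>b \<noteq> 0\<close> by (intro exI[of _ "1 / norm b"]) auto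
  qed
  moreover have "spectrum x = - {z. invertible_elt (x - z *\<^sub>C 1)}" by (auto simp: spectrum_alt)
  ultimately show ?thesis by (simp add: closed_Compl)
qed

lemma compact_spectrum: "compact (spectrum (x::'a::cstar_algebra))"
  unfolding compact_eq_bounded_closed bounded_iff using closed_spectrum[of x] spectrum_bound[of _ x]
  by blast

section \<open>Unital *-homomorphisms on continuous functions\<close>

locale star_hom =
  fixes K :: "'t::topological_space set" and \<Phi> :: "('t \<Rightarrow> complex) \<Rightarrow> 'a::cstar_algebra"
  assumes unital_star_hom: "unital_star_hom K \<Phi>"
begin

lemma hom_cong:
  assumes "continuous_on K f" "\<And>t. t \<in> K \<Longrightarrow> f t = g t"
  shows "\<Phi> f = \<Phi> g"
proof -
  have "continuous_on K g" using assms continuous_on_cong by metis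
  then have "(\<forall>t\<in>K. f t = g t) \<longrightarrow> \<Phi> f = \<Phi> g"
    using unital_star_hom[unfolded unital_star_hom_def] assms(1) by blast
  then show ?thesis using assms(2) by blast
qed

lemma hom_add: "continuous_on K f \<Longrightarrow> continuous_on K g \<Longrightarrow> \<Phi> (\<lambda>t. f t + g t) = \<Phi> f + \<Phi> g"
  and hom_mult: "continuous_on K f \<Longrightarrow> continuous_on K g \<Longrightarrow> \<Phi> (\<lambda>t. f t * g t) = \<Phi> f * \<Phi> g"
  and hom_cmult: "continuous_on K f \<Longrightarrow> \<Phi> (\<lambda>t. c * f t) = c *\<^sub>C \<Phi> f"
  and hom_star: "continuous_on K f \<Longrightarrow> \<Phi> (\<lambda>t. cnj (f t)) = star (\<Phi> f)"
  and hom_one: "\<Phi> (\<lambda>t. 1) = 1"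
  using unital_star_hom[unfolded unital_star_hom_def] by blast+

lemma hom_const: "\<Phi> (\<lambda>t. c) = c *\<^sub>C 1"
  using hom_cmult[of "\<lambda>_. 1" c] by (simp add: hom_one)

lemma hom_zero: "\<Phi> (\<lambda>t. 0) = 0"
  using hom_const[of 0] by simp

lemma hom_minus: "continuous_on K f \<Longrightarrow> \<Phi> (\<lambda>t. - f t) = - \<Phi> f"
  using hom_cmult[of f "-1"] by simp

lemma hom_diff: "continuous_on K f \<Longrightarrow> continuous_on K g \<Longrightarrow> \<Phi> (\<lambda>t. f t - g t) = \<Phi> f - \<Phi> g"
  using hom_add[of f "\<lambda>t. - g t"] by (simp add: hom_minus continuous_on_minus)

lemma hom_sum:
  "(\<And>i. i \<in> I \<Longrightarrow> continuous_on K (f i)) \<Longrightarrow> \<Phi> (\<lambda>t. \<Sum>i\<in>I. f i t) = (\<Sum>i\<in>I. \<Phi> (f i))"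
  by (induction I rule: infinite_finite_induct)
    (auto simp: hom_zero hom_add continuous_on_sum)

lemma hom_commute: "continuous_on K f \<Longrightarrow> continuous_on K g \<Longrightarrow> \<Phi> f * \<Phi> g = \<Phi> g * \<Phi> f"
  using hom_mult[of f g] hom_mult[of g f] by (simp add: mult.commute)

lemma hom_selfadjoint:
  assumes "continuous_on K f" "\<And>t. t \<in> K \<Longrightarrow> f t \<in> \<real>"
  shows "star (\<Phi> f) = \<Phi> f"
  using hom_star[OF assms(1)] hom_cong[OF assms(1), of "\<lambda>t. cnj (f t)"] assms(2)
  by (metis Reals_cnj_iff)

text \<open>A function \<open>h\<close> with \<open>0 \<le> h \<le> 1\<close> is the real part of the unimodular function \<open>h + i sqrt (1 - h\<^sup>2)\<close>, and
  unimodular functions are sent to isometries. Applied to the square of the modulus of a function, this bounds its image.\<close>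

lemma hom_norm_le:
  assumes f: "continuous_on K f" and M: "\<And>t. t \<in> K \<Longrightarrow> cmod (f t) \<le> M" and "0 \<le> M"
  shows "norm (\<Phi> f) \<le> M"
proof (cases "M = 0")
  case True
  then have "\<Phi> f = \<Phi> (\<lambda>t. 0)" using M f by (intro hom_cong) auto
  then show ?thesis using True by (simp add: hom_zero)
next
  case False
  with \<open>0 \<le> M\<close> have "M > 0" by simp
  define g where "g t = (1 / M) * f t" for t
  have g: "continuous_on K g" unfolding g_def by (intro continuous_intros f)
  have g1: "cmod (g t) \<le> 1" if "t \<in> K" for t
    using M[OF that] \<open>M > 0\<close> by (simp add: g_def norm_divide)
  define h where "h t = (cmod (g t))\<^sup>2" for t
  have h: "continuous_on K h" unfolding h_def by (intro continuous_intros g)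
  have h1: "0 \<le> h t" "t \<in> K \<Longrightarrow> h t \<le> 1" for t
    using g1[of t] by (auto simp: h_def abs_square_le_1)
  define w where "w t = Complex (h t) (sqrt (1 - (h t)\<^sup>2))" for t
  have w: "continuous_on K w" unfolding w_def Complex_eq
    by (intro continuous_intros h)
  have "cnj (w t) * w t = 1" if "t \<in> K" for t
  proof -
    have "0 \<le> h t" "h t \<le> 1" using h1 that by auto
    then have "(h t)\<^sup>2 \<le> 1" by (simp add: abs_square_le_1)
    then have "h t * h t + sqrt (1 - (h t)\<^sup>2) * sqrt (1 - (h t)\<^sup>2) = 1"
      by (simp add: power2_eq_square[symmetric])
    then show ?thesis by (simp add: w_def complex_eq_iff)
  qed
  then have "\<Phi> (\<lambda>t. cnj (w t) * w t) = \<Phi> (\<lambda>t. 1)"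
    by (intro hom_cong continuous_intros w) auto
  then have "star (\<Phi> w) * \<Phi> w = 1"
    using hom_mult[of "\<lambda>t. cnj (w t)" w] hom_star[OF w] w by (simp add: hom_one continuous_on_cnj)
  then have w1: "norm (\<Phi> w) \<le> 1" using norm_isometry_le[of "\<Phi> w"] by simp
  have "\<Phi> (\<lambda>t. (1/2) * (w t + cnj (w t))) = (1/2) *\<^sub>C (\<Phi> w + star (\<Phi> w))"
    using hom_cmult[of "\<lambda>t. w t + cnj (w t)" "1/2"] hom_add[of w "\<lambda>t. cnj (w t)"] w
    by (simp add: hom_star continuous_on_cnj continuous_on_add)
  moreover have "\<Phi> (\<lambda>t. (1/2) * (w t + cnj (w t))) = \<Phi> (\<lambda>t. cnj (g t) * g t)"
  proof (rule hom_cong)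
    fix t
    have "w t + cnj (w t) = 2 * of_real (h t)" by (simp add: w_def complex_eq_iff)
    then show "(1/2) * (w t + cnj (w t)) = cnj (g t) * g t"
      by (simp add: h_def complex_norm_square mult.commute del: of_real_power)
  qed (intro continuous_intros w)
  moreover have "\<Phi> (\<lambda>t. cnj (g t) * g t) = star (\<Phi> g) * \<Phi> g"
    using g by (simp add: hom_mult hom_star continuous_on_cnj)
  ultimately have "star (\<Phi> g) * \<Phi> g = (1/2) *\<^sub>C (\<Phi> w + star (\<Phi> w))"
    by simp
  then have "norm (star (\<Phi> g) * \<Phi> g) = (1/2) * norm (\<Phi> w + star (\<Phi> w))"
    by (simp only: norm_scaleC) simp
  also have "\<dots> \<le> 1" using norm_triangle_ineq[of "\<Phi> w" "star (\<Phi> w)"] w1 by simp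
  finally have "norm (star (\<Phi> g) * \<Phi> g) \<le> 1" .
  then have "norm (\<Phi> g) \<le> 1" by (rule norm_isometry_le)
  moreover have "\<Phi> g = (1 / M) *\<^sub>C \<Phi> f" unfolding g_def using hom_cmult[OF f, of "1/M"] by simp
  ultimately show ?thesis using \<open>M > 0\<close> by (simp add: norm_scaleC norm_divide field_simps)
qed

lemma hom_norm_diff_le:
  assumes "continuous_on K f" "continuous_on K g" "0 \<le> M" "\<And>t. t \<in> K \<Longrightarrow> cmod (f t - g t) \<le> M"
  shows "norm (\<Phi> f - \<Phi> g) \<le> M"
  using hom_norm_le[of "\<lambda>t. f t - g t" M] assms by (simp add: hom_diff continuous_on_diff)

lemma hom_unitary:
  assumes "continuous_on K f" "\<And>t. t \<in> K \<Longrightarrow> cmod (f t) = 1"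
  shows "unitary (\<Phi> f)"
proof -
  have "\<Phi> (\<lambda>t. cnj (f t) * f t) = \<Phi> (\<lambda>t. 1)"
    by (intro hom_cong continuous_intros assms)
      (use assms(2) in \<open>simp add: complex_norm_square[symmetric] mult.commute\<close>)
  then have "star (\<Phi> f) * \<Phi> f = 1"
    using assms(1) by (simp add: hom_mult hom_star hom_one continuous_on_cnj)
  moreover have "star (\<Phi> f) * \<Phi> f = \<Phi> f * star (\<Phi> f)"
    using hom_commute[of f "\<lambda>t. cnj (f t)"] assms(1) by (simp add: hom_star continuous_on_cnj)
  ultimately show ?thesis by (simp add: unitary_def)
qed

end

lemma star_homI: "unital_star_hom K \<Phi> \<Longrightarrow> star_hom K \<Phi>"
  by (rule star_hom.intro)

lemma unital_star_hom_mono: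
  assumes "unital_star_hom S \<Phi>" "S \<subseteq> K"
  shows "unital_star_hom K \<Phi>"
  unfolding unital_star_hom_def
proof (intro conjI allI impI, goal_cases)
  case (1 f g)
  then have "continuous_on S f" "continuous_on S g" using assms(2) continuous_on_subset by blast+
  then have "(\<forall>t\<in>S. f t = g t) \<longrightarrow> \<Phi> f = \<Phi> g"
    using assms(1)[unfolded unital_star_hom_def] by blast
  then show ?case using 1 assms(2) by blast
next
  case (2 f g)
  then have "continuous_on S f" "continuous_on S g" using assms(2) continuous_on_subset by blast+
  then show ?case using assms(1)[unfolded unital_star_hom_def] by blast
next
  case (3 f g)
  then have "continuous_on S f" "continuous_on S g" using assms(2) continuous_on_subset by blast+
  then show ?case using assms(1)[unfolded unital_star_hom_def] by blast
next
  case (4 f c)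
  then have "continuous_on S f" using assms(2) continuous_on_subset by blast
  then show ?case using assms(1)[unfolded unital_star_hom_def] by blast
next
  case (5 f)
  then have "continuous_on S f" using assms(2) continuous_on_subset by blast
  then show ?case using assms(1)[unfolded unital_star_hom_def] by blast
next
  case 6
  then show ?case using assms(1)[unfolded unital_star_hom_def] by blast
qed

section \<open>Polynomials in an element and its adjoint\<close>

inductive_set zpoly :: "(complex \<Rightarrow> complex) set" where
  zpoly_const: "(\<lambda>_. c) \<in> zpoly"
| zpoly_id: "(\<lambda>z. z) \<in> zpoly"
| zpoly_cnj: "cnj \<in> zpoly"
| zpoly_add: "F \<in> zpoly \<Longrightarrow> G \<in> zpoly \<Longrightarrow> (\<lambda>z. F z + G z) \<in> zpoly"
| zpoly_mult: "F \<in> zpoly \<Longrightarrow> G \<in> zpoly \<Longrightarrow> (\<lambda>z. F z * G z) \<in> zpoly"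

lemma continuous_on_zpoly: "F \<in> zpoly \<Longrightarrow> continuous_on K F"
  by (induction rule: zpoly.induct) (auto intro: continuous_intros)

lemma zpoly_sum:
  "(\<And>i. i \<in> I \<Longrightarrow> F i \<in> zpoly) \<Longrightarrow> (\<lambda>z. \<Sum>i\<in>I. F i z) \<in> zpoly"
  by (induction I rule: infinite_finite_induct) (auto intro: zpoly.intros)

lemma zpoly_prod:
  "(\<And>i. i \<in> I \<Longrightarrow> F i \<in> zpoly) \<Longrightarrow> (\<lambda>z. \<Prod>i\<in>I. F i z) \<in> zpoly"
  by (induction I rule: infinite_finite_induct) (auto intro: zpoly.intros)

lemma zpoly_interpolation:
  assumes "finite L"
  obtains F where "F \<in> zpoly" "\<And>z. z \<in> L \<Longrightarrow> F z = g z"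
proof
  define F where "F z = (\<Sum>w\<in>L. g w * (\<Prod>v\<in>L - {w}. (z + - v) * inverse (w - v)))" for z
  show "F \<in> zpoly" unfolding F_def
    by (intro zpoly_sum zpoly_prod zpoly.intros)
  fix z assume z: "z \<in> L"
  have "g w * (\<Prod>v\<in>L - {w}. (z + - v) * inverse (w - v)) = (if w = z then g z else 0)" if "w \<in> L" for w
  proof (cases "w = z")
    case True
    then have "(\<Prod>v\<in>L - {w}. (z + - v) * inverse (w - v)) = 1"
      by (intro prod.neutral) (auto intro!: right_inverse)
    with True show ?thesis by simp
  next
    case False
    then have "(\<Prod>v\<in>L - {w}. (z + - v) * inverse (w - v)) = 0"
      using z assms by (intro prod_zero bexI[of _ z]) auto
    with False show ?thesis by simp
  qed
  then have "F z = (\<Sum>w\<in>L. if w = z then g z else 0)" unfolding F_def by (intro sum.cong) auto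
  then show "F z = g z" using z assms by simp
qed

text \<open>Stone-Weierstrass for the real-valued members of \<open>zpoly\<close>, applied to the real and the imaginary part.\<close>

lemma zpoly_dense:
  assumes K: "compact K" and f: "continuous_on K f" and "e > 0"
  obtains F where "F \<in> zpoly" "\<And>z. z \<in> K \<Longrightarrow> cmod (f z - F z) < e"
proof -
  define P where "P h \<longleftrightarrow> (\<lambda>z. complex_of_real (h z)) \<in> zpoly" for h
  have dense: "\<exists>h. P h \<and> (\<forall>z\<in>K. \<bar>g z - h z\<bar> < e/2)" if "continuous_on K g" for g :: "complex \<Rightarrow> real"
  proof (rule Stone_Weierstrass_HOL[OF K, of P])
    show "P (\<lambda>x. c)" for c by (auto simp: P_def intro: zpoly.intros)
    show "continuous_on K h" if "P h" for h
      using continuous_on_Re[OF continuous_on_zpoly[OF that[unfolded P_def]]] by simp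
    show "P (\<lambda>x. h x + k x)" if "P h \<and> P k" for h k
      using that zpoly_add by (fastforce simp: P_def)
    show "P (\<lambda>x. h x * k x)" if "P h \<and> P k" for h k
      using that zpoly_mult by (fastforce simp: P_def)
    show "\<exists>h. P h \<and> h x \<noteq> h y" if "x \<in> K \<and> y \<in> K \<and> x \<noteq> y" for x y
    proof -
      have "(\<lambda>z. (1/2) * (z + cnj z)) \<in> zpoly" by (intro zpoly.intros)
      moreover have "(\<lambda>z. (1/2) * (z + cnj z)) = (\<lambda>z. complex_of_real (Re z))"
        by (auto simp: complex_eq_iff)
      ultimately have "P Re" by (simp add: P_def)
      have "(\<lambda>z. (- \<i>/2) * (z + (-1) * cnj z)) \<in> zpoly" by (intro zpoly.intros)
      moreover have "(\<lambda>z. (- \<i>/2) * (z + (-1) * cnj z)) = (\<lambda>z. complex_of_real (Im z))"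
        by (auto simp: complex_eq_iff)
      ultimately have "P Im" by (simp add: P_def)
      show ?thesis
      proof (cases "Re x = Re y")
        case True
        then have "Im x \<noteq> Im y" using that by (auto simp: complex_eq_iff)
        then show ?thesis using \<open>P Im\<close> by blast
      qed (use \<open>P Re\<close> in blast)
    qed
    show "continuous_on K g" by fact
    show "0 < e/2" using \<open>e > 0\<close> by simp
  qed
  obtain h k where h: "P h" "\<And>z. z \<in> K \<Longrightarrow> \<bar>Re (f z) - h z\<bar> < e/2"
    and k: "P k" "\<And>z. z \<in> K \<Longrightarrow> \<bar>Im (f z) - k z\<bar> < e/2"
    using dense[OF continuous_on_Re[OF f]] dense[OF continuous_on_Im[OF f]] by blast
  show ?thesis
  proof (rule that[of "\<lambda>z. of_real (h z) + \<i> * of_real (k z)"])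
    show "(\<lambda>z. complex_of_real (h z) + \<i> * complex_of_real (k z)) \<in> zpoly"
      using h(1) k(1) unfolding P_def by (intro zpoly.intros)
    fix z assume "z \<in> K"
    have "cmod (f z - (of_real (h z) + \<i> * of_real (k z))) \<le> \<bar>Re (f z) - h z\<bar> + \<bar>Im (f z) - k z\<bar>"
      using cmod_le[of "f z - (of_real (h z) + \<i> * of_real (k z))"] by simp
    also have "\<dots> < e" using h(2)[OF \<open>z \<in> K\<close>] k(2)[OF \<open>z \<in> K\<close>] by simp
    finally show "cmod (f z - (of_real (h z) + \<i> * of_real (k z))) < e" .
  qed
qed

text \<open>\<open>(F, y) \<in> gen x\<close> records that \<open>y\<close> is one of the values obtained by substituting \<open>x\<close> and \<open>star x\<close>
  for the variable and its conjugate in some expression for the function \<open>F\<close>. A relation is used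
  because, before the functional calculus exists, \<open>y\<close> might depend on the expression.\<close>

inductive_set gen :: "'a::cstar_algebra \<Rightarrow> ((complex \<Rightarrow> complex) \<times> 'a) set" for x where
  gen_const: "((\<lambda>_. c), c *\<^sub>C 1) \<in> gen x"
| gen_id: "((\<lambda>z. z), x) \<in> gen x"
| gen_cnj: "(cnj, star x) \<in> gen x"
| gen_add: "(F, y) \<in> gen x \<Longrightarrow> (G, z) \<in> gen x \<Longrightarrow> ((\<lambda>t. F t + G t), y + z) \<in> gen x"
| gen_mult: "(F, y) \<in> gen x \<Longrightarrow> (G, z) \<in> gen x \<Longrightarrow> ((\<lambda>t. F t * G t), y * z) \<in> gen x"

lemma gen_zpoly: "(F, y) \<in> gen x \<Longrightarrow> F \<in> zpoly"
  by (induction rule: gen.induct) (auto intro: zpoly.intros)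

lemma zpoly_gen:
  assumes "F \<in> zpoly" obtains y where "(F, y) \<in> gen x"
proof -
  have "\<exists>y. (F, y) \<in> gen x"
    using assms by (induction rule: zpoly.induct) (auto intro: gen.intros)
  then show ?thesis using that by blast
qed

lemma gen_cmult: "(F, y) \<in> gen x \<Longrightarrow> ((\<lambda>t. c * F t), c *\<^sub>C y) \<in> gen x"
  using gen_mult[OF gen_const[of c x]] by (fastforce simp: mult_scaleC_left)

lemma gen_diff: "(F, y) \<in> gen x \<Longrightarrow> (G, z) \<in> gen x \<Longrightarrow> ((\<lambda>t. F t - G t), y - z) \<in> gen x"
  using gen_add[OF _ gen_cmult[of G z x "-1"]] by fastforce

lemma gen_star: "(F, y) \<in> gen x \<Longrightarrow> ((\<lambda>t. cnj (F t)), star y) \<in> gen x"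
proof (induction rule: gen.induct)
  case (gen_const c)
  then show ?case using gen.gen_const[of "cnj c" x] by (simp add: star_scaleC)
next
  case (gen_mult F y G z)
  then show ?case using gen.gen_mult[OF gen_mult.IH(2,1)] by (simp add: star_mult mult.commute)
qed (auto simp: star_add star_star intro: gen.intros)

lemma gen_commute:
  assumes x: "normal_element x" and "(F, y) \<in> gen x" "(G, z) \<in> gen x"
  shows "y * z = z * y"
proof -
  have 1: "y * w = w * y" if "(F, y) \<in> gen x" "x * w = w * x" "star x * w = w * star x" for F y w
    using that
  proof (induction rule: gen.induct)
    case (gen_const c)
    then show ?case by (simp add: mult_scaleC_left mult_scaleC_right)
  next
    case (gen_mult F y G z)
    then show ?case by (metis mult.assoc)
  qed (auto simp: algebra_simps)
  have 2: "star x * x = x * star x" using x by (simp add: normal_element_def)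
  have "x * z = z * x" using 1[OF assms(3), of x] 2 by simp
  moreover have "star x * z = z * star x" using 1[OF assms(3), of "star x"] 2 by simp
  ultimately show ?thesis using 1[OF assms(2)] by blast
qed

lemma gen_normal: "normal_element x \<Longrightarrow> (F, y) \<in> gen x \<Longrightarrow> normal_element y"
  unfolding normal_element_def[of y] by (rule gen_commute[OF _ gen_star])

lemma (in star_hom) hom_gen:
  assumes "continuous_on K i" "\<Phi> i = x" "(F, y) \<in> gen x"
  shows "\<Phi> (\<lambda>t. F (i t)) = y \<and> continuous_on K (\<lambda>t. F (i t))"
  using assms(3)
proof (induction rule: gen.induct)
  case (gen_const c) then show ?case by (simp add: hom_const)
next
  case gen_id then show ?case using assms by simp
next
  case gen_cnj then show ?case using assms by (auto simp: hom_star continuous_on_cnj)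
next
  case gen_add then show ?case by (auto simp: hom_add continuous_on_add)
next
  case gen_mult then show ?case by (auto simp: hom_mult continuous_on_mult)
qed

text \<open>Substitution is continuous: the same expression is evaluated along the sequence.\<close>

lemma gen_tendsto:
  assumes "X \<longlonglongrightarrow> x" "(F, y) \<in> gen x"
  shows "\<exists>Y. (\<forall>n. (F, Y n) \<in> gen (X n)) \<and> Y \<longlonglongrightarrow> y"
  using assms(2)
proof (induction rule: gen.induct)
  case (gen_const c)
  then show ?case by (intro exI[of _ "\<lambda>n. c *\<^sub>C 1"]) (auto intro: gen.intros)
next
  case gen_id
  then show ?case using assms(1) by (intro exI[of _ X]) (auto intro: gen.intros)
next
  case gen_cnj
  then show ?case using tendsto_star[OF assms(1)] by (intro exI[of _ "\<lambda>n. star (X n)"]) (auto intro: gen.intros)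
next
  case (gen_add F y G z)
  then obtain Y Z where "\<forall>n. (F, Y n) \<in> gen (X n)" "Y \<longlonglongrightarrow> y" "\<forall>n. (G, Z n) \<in> gen (X n)" "Z \<longlonglongrightarrow> z" by blast
  then show ?case by (intro exI[of _ "\<lambda>n. Y n + Z n"]) (auto intro: gen.intros tendsto_add)
next
  case (gen_mult F y G z)
  then obtain Y Z where "\<forall>n. (F, Y n) \<in> gen (X n)" "Y \<longlonglongrightarrow> y" "\<forall>n. (G, Z n) \<in> gen (X n)" "Z \<longlonglongrightarrow> z" by blast
  then show ?case by (intro exI[of _ "\<lambda>n. Y n * Z n"]) (auto intro: gen.intros tendsto_mult)
qed

section \<open>Extending a bounded polynomial calculus to continuous functions\<close>

text \<open>A bound for the polynomial calculus by the supremum norm makes its values independent of the expression and extends it by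
  continuity. The factor \<open>C\<close> is harmless, because the resulting homomorphism is contractive anyway.\<close>

theorem calculus_extension:
  fixes x :: "'a::cstar_algebra"
  assumes K: "compact K" and "C > 0"
    and bound: "\<And>F y M. (F, y) \<in> gen x \<Longrightarrow> 0 \<le> M \<Longrightarrow> (\<And>z. z \<in> K \<Longrightarrow> cmod (F z) \<le> M) \<Longrightarrow> norm y \<le> C * M"
  obtains \<Phi> where "unital_star_hom K \<Phi>" "\<Phi> (\<lambda>z. z) = x"
proof -
  \<comment> \<open>the closure of the relation \<open>gen x\<close> in the topology of uniform convergence on \<open>K\<close>\<close>
  define R where "R f l \<longleftrightarrow> (\<forall>e>0. \<exists>F y. (F, y) \<in> gen x \<and> (\<forall>z\<in>K. cmod (f z - F z) \<le> e) \<and> norm (y - l) \<le> e)" for f l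
  have RI: "R f l" if f: "\<And>n. (F n, Y n) \<in> gen x" "\<And>n z. z \<in> K \<Longrightarrow> cmod (f z - F n z) \<le> e n" "e \<longlonglongrightarrow> 0" "Y \<longlonglongrightarrow> l" for f l F Y and e :: "nat \<Rightarrow> real"
    unfolding R_def
  proof (intro allI impI)
    fix d :: real assume "d > 0"
    have "eventually (\<lambda>n. e n < d) sequentially" using f(3) \<open>d > 0\<close> by (rule order_tendstoD)
    moreover have "eventually (\<lambda>n. dist (Y n) l < d) sequentially" using f(4) \<open>d > 0\<close> by (rule tendstoD)
    ultimately have "eventually (\<lambda>n. e n < d \<and> dist (Y n) l < d) sequentially" by (rule eventually_conj)
    then obtain n where "e n < d" "dist (Y n) l < d" by (auto dest: eventually_happens)
    then show "\<exists>F y. (F, y) \<in> gen x \<and> (\<forall>z\<in>K. cmod (f z - F z) \<le> d) \<and> norm (y - l) \<le> d"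
      using f(1)[of n] f(2)[of _ n] by (intro exI[of _ "F n"] exI[of _ "Y n"]) (auto simp: dist_norm intro: order_trans less_imp_le)
  qed
  have RE: "\<exists>F Y. (\<forall>n. (F n, Y n) \<in> gen x) \<and> (\<forall>n. \<forall>z\<in>K. cmod (f z - F n z) \<le> 1 / Suc n) \<and> Y \<longlonglongrightarrow> l"
    if "R f l" for f l
  proof -
    have "\<forall>n. \<exists>F y. (F, y) \<in> gen x \<and> (\<forall>z\<in>K. cmod (f z - F z) \<le> 1 / Suc n) \<and> norm (y - l) \<le> 1 / Suc n"
      using that unfolding R_def by auto
    then obtain F Y where FY: "\<forall>n. (F n, Y n) \<in> gen x \<and> (\<forall>z\<in>K. cmod (f z - F n z) \<le> 1 / Suc n) \<and> norm (Y n - l) \<le> 1 / Suc n"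
      by metis
    have "(\<lambda>n. Y n - l) \<longlonglongrightarrow> 0"
      by (rule Lim_null_comparison[OF _ LIMSEQ_inverse_real_of_nat]) (use FY in \<open>auto simp: inverse_eq_divide\<close>)
    then have "Y \<longlonglongrightarrow> l" using LIM_zero_cancel by blast
    then show ?thesis using FY by blast
  qed
  have RU: "l = l'" if "R f l" "\<And>z. z \<in> K \<Longrightarrow> f z = g z" "R g l'" for f g l l'
  proof -
    have "norm (l - l') \<le> d" if "d > 0" for d
    proof -
      define e where "e = d / (2 + 2 * C)"
      have "e > 0" using \<open>C > 0\<close> \<open>d > 0\<close> by (simp add: e_def)
      obtain F y where F: "(F, y) \<in> gen x" "\<forall>z\<in>K. cmod (f z - F z) \<le> e" "norm (y - l) \<le> e"
        using \<open>R f l\<close> \<open>e > 0\<close> unfolding R_def by blast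
      obtain G y' where G: "(G, y') \<in> gen x" "\<forall>z\<in>K. cmod (g z - G z) \<le> e" "norm (y' - l') \<le> e"
        using \<open>R g l'\<close> \<open>e > 0\<close> unfolding R_def by blast
      have "norm (y - y') \<le> C * (2 * e)"
      proof (rule bound[OF gen_diff[OF F(1) G(1)]])
        fix z assume "z \<in> K"
        then have "cmod (f z - F z) \<le> e" "cmod (f z - G z) \<le> e" using F(2) G(2) \<open>\<And>z. z \<in> K \<Longrightarrow> f z = g z\<close> by auto
        then show "cmod (F z - G z) \<le> 2 * e"
          using norm_triangle_ineq4[of "f z - G z" "f z - F z"] by simp
      qed (use \<open>e > 0\<close> in simp)
      moreover have "norm (l - l') \<le> norm (y - y') + norm (y - l) + norm (y' - l')"
        using norm_triangle_ineq4[of "y - y'" "(y - l) - (y' - l')"] norm_triangle_ineq4[of "y - l" "y' - l'"] by simp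
      ultimately have "norm (l - l') \<le> (2 + 2 * C) * e" using F(3) G(3) by (simp add: algebra_simps)
      then show ?thesis using \<open>C > 0\<close> by (simp add: e_def)
    qed
    then have "norm (l - l') = 0" by (metis dense_ge norm_le_zero_iff norm_eq_zero)
    then show ?thesis by simp
  qed
  have Rex: "\<exists>l. R f l" if f: "continuous_on K f" for f
  proof -
    have "\<forall>n. \<exists>F. F \<in> zpoly \<and> (\<forall>z\<in>K. cmod (f z - F z) < 1 / Suc n)"
      using zpoly_dense[OF K f] by (metis of_nat_0_less_iff zero_less_Suc zero_less_divide_1_iff)
    then obtain F where F: "\<forall>n. F n \<in> zpoly \<and> (\<forall>z\<in>K. cmod (f z - F n z) < 1 / Suc n)" by metis
    have "\<forall>n. \<exists>y. (F n, y) \<in> gen x" using zpoly_gen F by metis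
    then obtain Y where Y: "\<And>n. (F n, Y n) \<in> gen x" by metis
    have "Cauchy Y"
    proof (rule CauchyI)
      fix e :: real assume "e > 0"
      obtain N where N: "1 / Suc N < e / (2 * C)" using nat_approx_posE[of "e / (2*C)"] \<open>e > 0\<close> \<open>C > 0\<close> by auto
      have "norm (Y m - Y n) < e" if "m \<ge> N" "n \<ge> N" for m n
      proof -
        have le: "1 / real (Suc m) \<le> 1 / Suc N" "1 / real (Suc n) \<le> 1 / Suc N"
          using that by (auto simp: divide_simps)
        have "norm (Y m - Y n) \<le> C * (2 * (1 / Suc N))"
        proof (rule bound[OF gen_diff[OF Y Y]])
          fix z assume "z \<in> K"
          then have "cmod (f z - F m z) \<le> 1 / Suc N" "cmod (f z - F n z) \<le> 1 / Suc N"
            using F le by (meson order_trans less_imp_le)+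
          then show "cmod (F m z - F n z) \<le> 2 * (1 / Suc N)"
            using norm_triangle_ineq4[of "f z - F n z" "f z - F m z"] by simp
        qed simp
        also have "\<dots> < e" using N \<open>C > 0\<close> by (simp add: field_simps)
        finally show ?thesis .
      qed
      then show "\<exists>M. \<forall>m\<ge>M. \<forall>n\<ge>M. norm (Y m - Y n) < e" by blast
    qed
    then obtain l where "Y \<longlonglongrightarrow> l" using Cauchy_convergent convergent_def by blast
    have "R f l"
      by (rule RI[OF Y _ LIMSEQ_inverse_real_of_nat \<open>Y \<longlonglongrightarrow> l\<close>])
        (use F in \<open>auto simp: inverse_eq_divide intro: less_imp_le\<close>)
    then show ?thesis by blast
  qed
  define \<Phi> where "\<Phi> f = (SOME l. R f l)" for f
  have \<Phi>: "R f (\<Phi> f)" if "continuous_on K f" for f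
    unfolding \<Phi>_def using Rex[OF that] by (rule someI_ex)
  have eq: "\<Phi> f = l" if "continuous_on K f" "R f l" for f l
    using RU[OF \<Phi>[OF that(1)] _ that(2)] by simp
  have Rgen: "R F y" if "(F, y) \<in> gen x" for F y unfolding R_def using that by force
  have "unital_star_hom K \<Phi>" unfolding unital_star_hom_def
  proof (intro conjI allI impI)
    fix f g :: "complex \<Rightarrow> complex" assume f: "continuous_on K f" and g: "continuous_on K g"
    show "\<Phi> f = \<Phi> g" if "\<forall>t\<in>K. f t = g t" using RU[OF \<Phi>[OF f] _ \<Phi>[OF g]] that by blast
    obtain F Y where F: "\<forall>n. (F n, Y n) \<in> gen x" "\<forall>n. \<forall>z\<in>K. cmod (f z - F n z) \<le> 1 / Suc n" "Y \<longlonglongrightarrow> \<Phi> f"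
      using RE[OF \<Phi>[OF f]] by blast
    obtain G Z where G: "\<forall>n. (G n, Z n) \<in> gen x" "\<forall>n. \<forall>z\<in>K. cmod (g z - G n z) \<le> 1 / Suc n" "Z \<longlonglongrightarrow> \<Phi> g"
      using RE[OF \<Phi>[OF g]] by blast
    show "\<Phi> (\<lambda>t. f t + g t) = \<Phi> f + \<Phi> g"
    proof (rule eq[OF continuous_on_add[OF f g]], rule RI[of "\<lambda>n t. F n t + G n t" "\<lambda>n. Y n + Z n"])
      show "cmod (f z + g z - (F n z + G n z)) \<le> 2 * inverse (real (Suc n))" if "z \<in> K" for n z
      proof -
        have "cmod (f z - F n z) \<le> 1 / Suc n" "cmod (g z - G n z) \<le> 1 / Suc n" using F G that by auto
        then show ?thesis using norm_triangle_ineq[of "f z - F n z" "g z - G n z"] by (simp add: algebra_simps inverse_eq_divide)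
      qed
      show "(\<lambda>n. 2 * inverse (real (Suc n))) \<longlonglongrightarrow> 0"
        using tendsto_mult_right_zero[OF LIMSEQ_inverse_real_of_nat] .
    qed (use F G in \<open>auto intro: gen.intros tendsto_intros\<close>)
    obtain A B where A: "\<And>z. z \<in> K \<Longrightarrow> cmod (f z) \<le> A" and B: "\<And>z. z \<in> K \<Longrightarrow> cmod (g z) \<le> B"
      using compact_imp_bounded[OF compact_continuous_image[OF f K]] compact_imp_bounded[OF compact_continuous_image[OF g K]]
      unfolding bounded_iff by auto
    show "\<Phi> (\<lambda>t. f t * g t) = \<Phi> f * \<Phi> g"
    proof (rule eq[OF continuous_on_mult[OF f g]], rule RI[of "\<lambda>n t. F n t * G n t" "\<lambda>n. Y n * Z n"])
      show "cmod (f z * g z - F n z * G n z) \<le> (\<bar>A\<bar> + \<bar>B\<bar> + 1) * inverse (real (Suc n))" if "z \<in> K" for n z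
      proof -
        let ?e = "1 / real (Suc n)"
        have 1: "cmod (f z - F n z) \<le> ?e" "cmod (g z - G n z) \<le> ?e" using F G that by auto
        have e: "0 \<le> ?e" "?e \<le> 1" by auto
        have "cmod (G n z) \<le> cmod (g z) + cmod (g z - G n z)"
          using norm_triangle_ineq4[of "g z" "g z - G n z"] by simp
        then have "cmod (G n z) \<le> \<bar>B\<bar> + 1" using B[OF that] 1(2) e by linarith
        have "f z * g z - F n z * G n z = f z * (g z - G n z) + (f z - F n z) * G n z"
          by (simp add: algebra_simps)
        then have "cmod (f z * g z - F n z * G n z) \<le> cmod (f z) * cmod (g z - G n z) + cmod (f z - F n z) * cmod (G n z)"
          by (metis norm_mult norm_triangle_ineq)
        also have "\<dots> \<le> \<bar>A\<bar> * ?e + ?e * (\<bar>B\<bar> + 1)"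
          using A[OF that] 1 \<open>cmod (G n z) \<le> \<bar>B\<bar> + 1\<close> by (intro add_mono mult_mono) auto
        finally show ?thesis by (simp add: algebra_simps inverse_eq_divide add_divide_distrib)
      qed
      show "(\<lambda>n. (\<bar>A\<bar> + \<bar>B\<bar> + 1) * inverse (real (Suc n))) \<longlonglongrightarrow> 0"
        using tendsto_mult_right_zero[OF LIMSEQ_inverse_real_of_nat] .
    qed (use F G in \<open>auto intro: gen.intros tendsto_intros\<close>)
  next
    fix f :: "complex \<Rightarrow> complex" and c assume f: "continuous_on K f"
    obtain F Y where F: "\<forall>n. (F n, Y n) \<in> gen x" "\<forall>n. \<forall>z\<in>K. cmod (f z - F n z) \<le> 1 / Suc n" "Y \<longlonglongrightarrow> \<Phi> f"
      using RE[OF \<Phi>[OF f]] by blast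
    show "\<Phi> (\<lambda>t. c * f t) = c *\<^sub>C \<Phi> f"
    proof (rule eq[OF continuous_on_mult_left[OF f]], rule RI[of "\<lambda>n t. c * F n t" "\<lambda>n. c *\<^sub>C Y n"])
      show "cmod (c * f z - c * F n z) \<le> cmod c * inverse (real (Suc n))" if "z \<in> K" for n z
      proof -
        have "cmod (f z - F n z) \<le> inverse (Suc n)" using F that by (simp add: inverse_eq_divide)
        then have "cmod c * cmod (f z - F n z) \<le> cmod c * inverse (Suc n)" by (intro mult_left_mono) auto
        then show ?thesis by (simp add: right_diff_distrib[symmetric] norm_mult)
      qed
      show "(\<lambda>n. cmod c * inverse (real (Suc n))) \<longlonglongrightarrow> 0"
        using tendsto_mult_right_zero[OF LIMSEQ_inverse_real_of_nat] .
    qed (use F in \<open>auto intro: gen_cmult tendsto_intros\<close>)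
  next
    fix f :: "complex \<Rightarrow> complex" assume f: "continuous_on K f"
    obtain F Y where F: "\<forall>n. (F n, Y n) \<in> gen x" "\<forall>n. \<forall>z\<in>K. cmod (f z - F n z) \<le> 1 / Suc n" "Y \<longlonglongrightarrow> \<Phi> f"
      using RE[OF \<Phi>[OF f]] by blast
    show "\<Phi> (\<lambda>t. cnj (f t)) = star (\<Phi> f)"
    proof (rule eq[OF continuous_on_cnj[OF f]], rule RI[of "\<lambda>n t. cnj (F n t)" "\<lambda>n. star (Y n)"])
      show "cmod (cnj (f z) - cnj (F n z)) \<le> inverse (real (Suc n))" if "z \<in> K" for n z
        using F that by (simp add: inverse_eq_divide flip: complex_cnj_diff)
      show "(\<lambda>n. inverse (real (Suc n))) \<longlonglongrightarrow> 0" by (rule LIMSEQ_inverse_real_of_nat)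
    qed (use F in \<open>auto intro: gen_star tendsto_intros\<close>)
  next
    show "\<Phi> (\<lambda>t. 1) = 1" using eq[OF _ Rgen[OF gen_const]] by simp
  qed
  moreover have "\<Phi> (\<lambda>z. z) = x" using eq[OF _ Rgen[OF gen_id]] by simp
  ultimately show ?thesis using that by blast
qed

text \<open>On polynomials, convergence is \<open>gen_tendsto\<close>, and the limit inherits contractivity, so that \<open>calculus_extension\<close> applies.
  Contractivity also carries convergence over to all continuous functions.\<close>

theorem calculus_limit:
  fixes x :: "'a::cstar_algebra"
  assumes K: "compact K" and hom: "\<And>n. unital_star_hom K (\<Psi> n)" and id: "\<And>n. \<Psi> n (\<lambda>z. z) = X n"
    and lim: "X \<longlonglongrightarrow> x"
  obtains \<Phi> where "unital_star_hom K \<Phi>" "\<Phi> (\<lambda>z. z) = x"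
    "\<And>f. continuous_on K f \<Longrightarrow> (\<lambda>n. \<Psi> n f) \<longlonglongrightarrow> \<Phi> f"
proof -
  interpret h: star_hom K "\<Psi> n" for n by (rule star_homI[OF hom])
  have gen: "\<Psi> n F = y" if "(F, y) \<in> gen (X n)" for F y n
    using h.hom_gen[OF continuous_on_id id that] by simp
  have conv: "(\<lambda>n. \<Psi> n F) \<longlonglongrightarrow> y" if F: "(F, y) \<in> gen x" for F y
  proof -
    obtain Y where Y: "\<forall>n. (F, Y n) \<in> gen (X n)" "Y \<longlonglongrightarrow> y" using gen_tendsto[OF lim F] by blast
    then have "\<Psi> n F = Y n" for n using gen by blast
    with Y(2) show ?thesis by simp
  qed
  obtain \<Phi> where \<Phi>: "unital_star_hom K \<Phi>" "\<Phi> (\<lambda>z. z) = x"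
  proof (rule calculus_extension[OF K, of 1 x])
    fix F y M assume F: "(F, y) \<in> gen x" "0 \<le> M" "\<And>z. z \<in> K \<Longrightarrow> cmod (F z) \<le> M"
    have "norm (\<Psi> n F) \<le> M" for n
      by (rule h.hom_norm_le[OF continuous_on_zpoly[OF gen_zpoly[OF F(1)]] F(3,2)])
    then have "norm y \<le> M" by (intro Lim_norm_ubound[OF _ conv[OF F(1)]]) auto
    then show "norm y \<le> 1 * M" by simp
  qed auto
  interpret p: star_hom K \<Phi> by (rule star_homI[OF \<Phi>(1)])
  have "(\<lambda>n. \<Psi> n f) \<longlonglongrightarrow> \<Phi> f" if f: "continuous_on K f" for f
  proof (rule LIMSEQ_I)
    fix e :: real assume "e > 0"
    then obtain F where F: "F \<in> zpoly" "\<And>z. z \<in> K \<Longrightarrow> cmod (f z - F z) < e/4"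
      using zpoly_dense[OF K f, of "e/4"] by auto
    obtain y where y: "(F, y) \<in> gen x" using zpoly_gen[OF F(1)] by blast
    have [simp]: "\<Phi> F = y" using p.hom_gen[OF continuous_on_id \<Phi>(2) y] by simp
    obtain N where N: "\<forall>n\<ge>N. norm (\<Psi> n F - y) < e/4" using LIMSEQ_D[OF conv[OF y], of "e/4"] \<open>e > 0\<close> by auto
    have "norm (\<Psi> n f - \<Phi> f) < e" if "n \<ge> N" for n
    proof -
      have 1: "norm (\<Psi> n f - \<Psi> n F) \<le> e/4"
        by (rule h.hom_norm_diff_le[OF f continuous_on_zpoly[OF F(1)]]) (use F(2) \<open>e > 0\<close> in \<open>auto intro: less_imp_le\<close>)
      have 2: "norm (\<Phi> f - \<Phi> F) \<le> e/4"
        by (rule p.hom_norm_diff_le[OF f continuous_on_zpoly[OF F(1)]]) (use F(2) \<open>e > 0\<close> in \<open>auto intro: less_imp_le\<close>)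
      have "\<Psi> n f - \<Phi> f = (\<Psi> n f - \<Psi> n F) + (\<Psi> n F - y) - (\<Phi> f - \<Phi> F)" by simp
      then have "norm (\<Psi> n f - \<Phi> f) \<le> norm (\<Psi> n f - \<Psi> n F) + norm (\<Psi> n F - y) + norm (\<Phi> f - \<Phi> F)"
        by (metis (no_types, lifting) norm_triangle_ineq4 norm_triangle_ineq order_trans add_right_mono)
      then show ?thesis using 1 2 N that \<open>e > 0\<close> by fastforce
    qed
    then show "\<exists>N. \<forall>n\<ge>N. norm (\<Psi> n f - \<Phi> f) < e" by blast
  qed
  with \<Phi> show ?thesis using that by blast
qed

section \<open>The spectral theorem for algebraic normal elements\<close>

text \<open>Evaluation of a complex polynomial at an element, by Horner's scheme.\<close>

definition ev :: "'a::cstar_algebra \<Rightarrow> complex poly \<Rightarrow> 'a" where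
  "ev b p = fold_coeffs (\<lambda>c y. c *\<^sub>C 1 + b * y) p 0"

lemma ev_0 [simp]: "ev b 0 = 0"
  by (simp add: ev_def)

lemma ev_pCons [simp]: "ev b (pCons a p) = a *\<^sub>C 1 + b * ev b p"
  by (cases "p = 0 \<and> a = 0") (auto simp: ev_def)

lemma ev_1 [simp]: "ev b 1 = 1"
  by (simp add: one_pCons)

lemma ev_add: "ev b (p + q) = ev b p + ev b q"
  by (induction p q rule: poly_induct2) (auto simp: algebra_simps scaleC_add_left)

lemma ev_smult: "ev b (smult c p) = c *\<^sub>C ev b p"
  by (induction p) (auto simp: scaleC_add_right scaleC_scaleC mult_scaleC_right)

lemma ev_diff: "ev b (p - q) = ev b p - ev b q"
  using ev_add[of b p "smult (-1) q"] by (simp only: ev_smult) simp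

lemma ev_mult: "ev b (p * q) = ev b p * ev b q"
  by (induction p) (auto simp: ev_add ev_smult algebra_simps mult_scaleC_left)

lemma ev_power: "ev b (p ^ n) = ev b p ^ n"
  by (induction n) (auto simp: ev_mult)

lemma ev_sum: "ev b (sum f S) = (\<Sum>i\<in>S. ev b (f i))"
  by (induction S rule: infinite_finite_induct) (auto simp: ev_add)

lemma ev_monom: "ev b (monom c n) = c *\<^sub>C b ^ n"
  by (induction n) (auto simp: monom_0 monom_Suc mult_scaleC_right)

lemma ev_gen: "(poly p, ev b p) \<in> gen b"
proof (induction p)
  case 0
  have "poly (0::complex poly) = (\<lambda>_. 0)" by auto
  then show ?case using gen_const[of 0 b] by simp
next
  case (pCons a p)
  have "((\<lambda>t. a + t * poly p t), a *\<^sub>C 1 + b * ev b p) \<in> gen b"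
    by (intro gen.intros pCons)
  moreover have "(\<lambda>t. a + t * poly p t) = poly (pCons a p)" by auto
  ultimately show ?case by simp
qed

lemma norm_power_selfadjoint:
  fixes h :: "'a::cstar_algebra"
  assumes "star h = h"
  shows "norm (h ^ (2 ^ j)) = norm h ^ (2 ^ j)"
proof (induction j)
  case (Suc j)
  have "norm (h ^ (2 ^ Suc j)) = norm (star (h ^ (2 ^ j)) * h ^ (2 ^ j))"
    using assms by (simp add: star_power flip: power_add mult_2)
  also have "\<dots> = (norm (h ^ (2 ^ j)))\<^sup>2" by (rule norm_star_mult_self)
  finally show ?case using Suc by (simp add: power_mult[symmetric] mult.commute)
qed simp

text \<open>For self-adjoint \<open>h = star n * n\<close> the norm is multiplicative on powers of \<open>h\<close> with exponents \<open>2 ^ j\<close>.\<close>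

lemma normal_nilpotent:
  fixes n :: "'a::cstar_algebra"
  assumes "normal_element n" "n ^ k = 0"
  shows "n = 0"
proof -
  define h where "h = star n * n"
  have [simp]: "star h = h" by (simp add: h_def star_mult star_star)
  have c: "star n * n ^ i = n ^ i * star n" for i
    using assms(1) by (metis normal_element_def power_commuting_commutes)
  have "h ^ i = star n ^ i * n ^ i" for i
  proof (induction i)
    case (Suc i)
    have "h ^ Suc i = star n ^ i * n ^ i * (star n * n)" by (metis Suc power_Suc2 h_def)
    also have "\<dots> = star n ^ i * (n ^ i * star n) * n" by (simp add: mult.assoc)
    also have "\<dots> = star n ^ Suc i * n ^ Suc i" by (simp add: c[symmetric] mult.assoc power_Suc2 del: power_Suc)
    finally show ?case .
  qed simp
  then have "h ^ k = 0" using assms(2) by simp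
  moreover have "k \<le> 2 ^ k" by (simp add: less_imp_le)
  ultimately have "h ^ (2 ^ k) = 0" by (metis le_Suc_ex power_add mult_zero_left)
  then have "norm h ^ (2 ^ k) = 0" using norm_power_selfadjoint[of h k] by simp
  then have "h = 0" by simp
  then show ?thesis using norm_star_mult_self[of n] by (simp add: h_def)
qed

text \<open>By the Nullstellensatz some power of \<open>p\<close> is divisible by \<open>q\<close>, so \<open>ev b p\<close> is nilpotent.\<close>

lemma ev_eq_0:
  fixes b :: "'a::cstar_algebra"
  assumes b: "normal_element b" and q: "ev b q = 0" "q \<noteq> 0"
    and p: "\<And>z. poly q z = 0 \<Longrightarrow> poly p z = 0"
  shows "ev b p = 0"
proof -
  have "q dvd p ^ degree q" using nullstellensatz_univariate[of q p] p q(2) by auto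
  then obtain r where r: "p ^ degree q = q * r" by (elim dvdE)
  have "ev b p ^ degree q = ev b q * ev b r" by (metis r ev_power ev_mult)
  then have "ev b p ^ degree q = 0" using q by simp
  then show ?thesis by (rule normal_nilpotent[OF gen_normal[OF b ev_gen]])
qed

lemma poly_interpolation:
  assumes "finite S"
  obtains p :: "complex poly" where "\<And>z. z \<in> S \<Longrightarrow> poly p z = g z"
proof
  define p where "p = (\<Sum>w\<in>S. smult (g w) (\<Prod>v\<in>S - {w}. smult (inverse (w - v)) [:- v, 1:]))"
  fix z assume z: "z \<in> S"
  have "poly p z = (\<Sum>w\<in>S. g w * (\<Prod>v\<in>S - {w}. inverse (w - v) * (z - v)))"
    by (simp add: p_def poly_sum poly_prod algebra_simps)
  also have "\<dots> = (\<Sum>w\<in>S. if w = z then g z else 0)"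
  proof (rule sum.cong[OF refl])
    fix w assume w: "w \<in> S"
    show "g w * (\<Prod>v\<in>S - {w}. inverse (w - v) * (z - v)) = (if w = z then g z else 0)"
    proof (cases "w = z")
      case True
      then have "(\<Prod>v\<in>S - {w}. inverse (w - v) * (z - v)) = 1"
        by (intro prod.neutral) (auto intro!: left_inverse)
      with True show ?thesis by simp
    next
      case False
      then have "(\<Prod>v\<in>S - {w}. inverse (w - v) * (z - v)) = 0"
        using z assms by (intro prod_zero bexI[of _ z]) auto
      with False show ?thesis by simp
    qed
  qed
  finally show "poly p z = g z" using z assms by simp
qed

definition projection :: "'a::cstar_algebra \<Rightarrow> bool" where
  "projection p \<longleftrightarrow> star p = p \<and> p * p = p"

lemma projection_star: "projection p \<Longrightarrow> star p = p"
  and projection_idem: "projection p \<Longrightarrow> p * p = p"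
  by (auto simp: projection_def)

lemma norm_projection:
  assumes "projection p" "p \<noteq> 0" shows "norm p = 1"
proof -
  have "norm p * norm p = norm p"
    using assms(1) norm_star_mult_self[of p] by (simp add: projection_def power2_eq_square)
  then show ?thesis using assms(2) by simp
qed

lemma norm_projection_le: "projection p \<Longrightarrow> norm p \<le> 1"
  using norm_projection[of p] by (cases "p = 0") auto

lemma projection_compl: "projection p \<Longrightarrow> projection (1 - p)"
  by (auto simp: projection_def star_diff algebra_simps)

definition resolution :: "'i set \<Rightarrow> ('i \<Rightarrow> 'a::cstar_algebra) \<Rightarrow> bool" where
  "resolution S P \<longleftrightarrow> finite S \<and> (\<forall>i\<in>S. projection (P i) \<and> P i \<noteq> 0) \<and>
     (\<forall>i\<in>S. \<forall>j\<in>S. i \<noteq> j \<longrightarrow> P i * P j = 0) \<and> (\<Sum>i\<in>S. P i) = 1"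

lemma resolution_mult:
  assumes "resolution S P" "j \<in> S"
  shows "(\<Sum>i\<in>S. f i *\<^sub>C P i) * P j = f j *\<^sub>C P j" "P j * (\<Sum>i\<in>S. f i *\<^sub>C P i) = f j *\<^sub>C P j"
proof -
  have fin: "finite S" using assms by (simp add: resolution_def)
  have "(\<Sum>i\<in>S. f i *\<^sub>C P i) * P j = (\<Sum>i\<in>S. if i = j then f j *\<^sub>C P j else 0)"
    unfolding sum_distrib_right using assms
    by (intro sum.cong) (auto simp: resolution_def mult_scaleC_left projection_def)
  then show "(\<Sum>i\<in>S. f i *\<^sub>C P i) * P j = f j *\<^sub>C P j" using fin assms(2) by simp
  have "P j * (\<Sum>i\<in>S. f i *\<^sub>C P i) = (\<Sum>i\<in>S. if i = j then f j *\<^sub>C P j else 0)"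
    unfolding sum_distrib_left using assms
    by (intro sum.cong) (auto simp: resolution_def mult_scaleC_right projection_def)
  then show "P j * (\<Sum>i\<in>S. f i *\<^sub>C P i) = f j *\<^sub>C P j" using fin assms(2) by simp
qed

lemma resolution_hom:
  fixes P :: "'i::topological_space \<Rightarrow> 'a::cstar_algebra"
  assumes "resolution S P"
  shows "unital_star_hom S (\<lambda>f. \<Sum>i\<in>S. f i *\<^sub>C P i)"
  unfolding unital_star_hom_def
proof (intro conjI allI impI)
  fix f g :: "'i \<Rightarrow> complex" and c
  show "(\<Sum>i\<in>S. f i *\<^sub>C P i) = (\<Sum>i\<in>S. g i *\<^sub>C P i)" if "\<forall>t\<in>S. f t = g t"
    using that by (intro sum.cong) auto
  show "(\<Sum>i\<in>S. (f i + g i) *\<^sub>C P i) = (\<Sum>i\<in>S. f i *\<^sub>C P i) + (\<Sum>i\<in>S. g i *\<^sub>C P i)"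
    by (simp add: scaleC_add_left sum.distrib)
  have "(\<Sum>i\<in>S. f i *\<^sub>C P i) * (\<Sum>j\<in>S. g j *\<^sub>C P j) = (\<Sum>j\<in>S. g j *\<^sub>C ((\<Sum>i\<in>S. f i *\<^sub>C P i) * P j))"
    by (simp add: sum_distrib_left mult_scaleC_right)
  also have "\<dots> = (\<Sum>j\<in>S. (f j * g j) *\<^sub>C P j)"
    by (intro sum.cong refl) (simp add: resolution_mult(1)[OF assms] scaleC_scaleC mult.commute)
  finally show "(\<Sum>i\<in>S. (f i * g i) *\<^sub>C P i) = (\<Sum>i\<in>S. f i *\<^sub>C P i) * (\<Sum>i\<in>S. g i *\<^sub>C P i)" by simp
  show "(\<Sum>i\<in>S. (c * f i) *\<^sub>C P i) = c *\<^sub>C (\<Sum>i\<in>S. f i *\<^sub>C P i)"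
    by (simp add: scaleC_sum_right scaleC_scaleC)
  show "(\<Sum>i\<in>S. cnj (f i) *\<^sub>C P i) = star (\<Sum>i\<in>S. f i *\<^sub>C P i)"
    using assms by (simp add: star_sum star_scaleC resolution_def projection_def)
  show "(\<Sum>i\<in>S. 1 *\<^sub>C P i) = 1" using assms by (simp add: resolution_def)
qed

lemma resolution_norm_le:
  fixes P :: "'i::t1_space \<Rightarrow> 'a::cstar_algebra"
  assumes "resolution S P" "\<And>i. i \<in> S \<Longrightarrow> cmod (f i) \<le> M" "0 \<le> M"
  shows "norm (\<Sum>i\<in>S. f i *\<^sub>C P i) \<le> M"
proof -
  interpret star_hom S "\<lambda>f. \<Sum>i\<in>S. f i *\<^sub>C P i" by (rule star_homI[OF resolution_hom[OF assms(1)]])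
  show ?thesis using assms by (intro hom_norm_le continuous_on_finite) (auto simp: resolution_def)
qed

text \<open>By \<open>ev_eq_0\<close>, \<open>ev b p\<close> depends only on the values of \<open>p\<close> at the roots of \<open>q\<close>. The Lagrange polynomials of the roots
  evaluate to orthogonal idempotents, and normal idempotents are self-adjoint.\<close>

theorem algebraic_normal_spectral:
  fixes b :: "'a::cstar_algebra"
  assumes b: "normal_element b" and q: "ev b q = 0" "q \<noteq> 0"
  obtains S P where "resolution S P" "b = (\<Sum>l\<in>S. l *\<^sub>C P l)" "\<And>l. l \<in> S \<Longrightarrow> \<exists>p. P l = ev b p"
proof -
  define S where "S = {z. poly q z = 0}"
  have S: "finite S" unfolding S_def by (rule poly_roots_finite[OF q(2)])
  have eqI: "ev b p = ev b r" if "\<And>z. z \<in> S \<Longrightarrow> poly p z = poly r z" for p r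
  proof -
    have "ev b (p - r) = 0" by (rule ev_eq_0[OF b q]) (use that in \<open>auto simp: S_def\<close>)
    then show ?thesis by (simp add: ev_diff)
  qed
  have "\<exists>L. \<forall>z\<in>S. poly L z = (if z = l then 1 else 0)" for l :: complex
    by (rule poly_interpolation[OF S, of "\<lambda>z. if z = l then 1 else 0"]) (rule exI, blast)
  then obtain L where L: "\<And>l z. z \<in> S \<Longrightarrow> poly (L l) z = (if z = l then 1 else 0)" by metis
  define P where "P l = ev b (L l)" for l
  have idem: "P l * P l = P l" for l
    unfolding P_def ev_mult[symmetric] by (rule eqI) (simp add: L)
  have nrm: "normal_element (P l)" for l unfolding P_def by (rule gen_normal[OF b ev_gen])
  have sa: "star (P l) = P l" for l
  proof -
    let ?p = "P l"
    have c: "star ?p * ?p = ?p * star ?p" using nrm[of l] by (simp add: normal_element_def)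
    have i2: "star ?p * star ?p = star ?p" using idem[of l] by (metis star_mult)
    have "star (?p - star ?p * ?p) * (?p - star ?p * ?p) =
        star ?p * ?p - star ?p * star ?p * ?p - star ?p * (?p * ?p) + star ?p * ?p * (star ?p * ?p)"
      by (simp add: star_diff star_mult star_star algebra_simps)
    also have "star ?p * ?p * (star ?p * ?p) = star ?p * (?p * star ?p) * ?p" by (simp add: mult.assoc)
    also have "\<dots> = (star ?p * star ?p) * (?p * ?p)" by (simp add: c[symmetric] mult.assoc)
    finally have "star (?p - star ?p * ?p) * (?p - star ?p * ?p) = 0" by (simp add: idem i2)
    then have "norm (?p - star ?p * ?p) = 0" using norm_star_mult_self[of "?p - star ?p * ?p"] by simp
    then have "?p = star ?p * ?p" by simp
    then show ?thesis by (metis star_mult star_star)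
  qed
  have orth: "P l * P m = 0" if "l \<in> S" "m \<in> S" "l \<noteq> m" for l m
    unfolding P_def ev_mult[symmetric] using eqI[of "L l * L m" 0] that by (auto simp: L)
  have sum1: "(\<Sum>l\<in>S. P l) = 1"
  proof -
    have "ev b (\<Sum>l\<in>S. L l) = ev b 1" by (rule eqI) (use S in \<open>simp add: poly_sum L\<close>)
    then show ?thesis by (simp add: ev_sum P_def)
  qed
  have sumb: "(\<Sum>l\<in>S. l *\<^sub>C P l) = b"
  proof -
    have "ev b (\<Sum>l\<in>S. smult l (L l)) = ev b [:0, 1:]"
      by (rule eqI) (use S in \<open>simp add: poly_sum L if_distrib cong: if_cong\<close>)
    then show ?thesis by (simp add: ev_sum P_def ev_smult)
  qed
  define S' where "S' = {l\<in>S. P l \<noteq> 0}"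
  have "(\<Sum>l\<in>S'. P l) = (\<Sum>l\<in>S. P l)"
    unfolding S'_def using S by (intro sum.mono_neutral_left) auto
  moreover have "(\<Sum>l\<in>S'. l *\<^sub>C P l) = (\<Sum>l\<in>S. l *\<^sub>C P l)"
    unfolding S'_def using S by (intro sum.mono_neutral_left) auto
  ultimately have "(\<Sum>l\<in>S'. P l) = 1" "(\<Sum>l\<in>S'. l *\<^sub>C P l) = b"
    using sum1 sumb by auto
  moreover then have "resolution S' P"
    unfolding resolution_def S'_def projection_def using S sa idem orth by auto
  ultimately show ?thesis using that[of S' P] by (auto simp: P_def)
qed

lemma resolution_eigen:
  assumes "resolution S P" "b = (\<Sum>l\<in>S. l *\<^sub>C P l)" "l \<in> S"
  shows "b * P l = l *\<^sub>C P l" "P l * b = l *\<^sub>C P l" "norm (P l) = 1" "star (P l) = P l" "P l * P l = P l"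
    "projection (P l)"
  using resolution_mult[OF assms(1,3), of "\<lambda>l. l"] assms
  by (auto simp: resolution_def norm_projection projection_def)

lemma eigen_norm_diff:
  fixes b :: "'a::cstar_algebra"
  assumes "b * p = l *\<^sub>C p" "norm p = 1"
  shows "cmod (l - c) \<le> norm (b - c *\<^sub>C 1)"
proof -
  have "(b - c *\<^sub>C 1) * p = (l - c) *\<^sub>C p"
    using assms by (simp add: left_diff_distrib mult_scaleC_left complex_vector.scale_left_diff_distrib)
  then have "cmod (l - c) = norm ((b - c *\<^sub>C 1) * p)" using assms by (simp add: norm_scaleC)
  also have "\<dots> \<le> norm (b - c *\<^sub>C 1)" using norm_mult_ineq[of "b - c *\<^sub>C 1" p] assms by simp
  finally show ?thesis .
qed

lemma eigen_norm_le:
  fixes b :: "'a::cstar_algebra"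
  assumes "b * p = l *\<^sub>C p" "norm p = 1"
  shows "cmod l \<le> norm b"
  using eigen_norm_diff[OF assms, of 0] by simp

section \<open>Finite-dimensional subalgebras\<close>

lemma star_subalgebraD:
  assumes "star_subalgebra B"
  shows "a \<in> B \<Longrightarrow> b \<in> B \<Longrightarrow> a + b \<in> B" "a \<in> B \<Longrightarrow> c *\<^sub>C a \<in> B" "0 \<in> B"
    "a \<in> B \<Longrightarrow> b \<in> B \<Longrightarrow> a * b \<in> B" "a \<in> B \<Longrightarrow> star a \<in> B"
    "a \<in> B \<Longrightarrow> b \<in> B \<Longrightarrow> a - b \<in> B" "(\<And>i. i \<in> I \<Longrightarrow> h i \<in> B) \<Longrightarrow> sum h I \<in> B"
  using assms unfolding star_subalgebra_def
  by (auto intro: complex_vector.subspace_add complex_vector.subspace_scale complex_vector.subspace_0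
      complex_vector.subspace_diff complex_vector.subspace_sum)

text \<open>The powers of \<open>b\<close> with positive exponents lie in \<open>B\<close> and are linearly dependent.\<close>

lemma finite_dim_annihilator:
  fixes b :: "'a::cstar_algebra"
  assumes "finite_dim_subalgebra B" "b \<in> B"
  obtains q where "ev b q = 0" "q \<noteq> 0"
proof -
  obtain F where sub: "star_subalgebra B" and F: "finite F" "B = complex_vector.span F"
    using assms(1) by (auto simp: finite_dim_subalgebra_def)
  define N where "N = card F"
  have pow: "b ^ Suc i \<in> B" for i
    by (induction i) (use assms(2) star_subalgebraD(4)[OF sub] in auto)
  show ?thesis
  proof (cases "inj_on (\<lambda>i. b ^ Suc i) {..N}")
    case False
    then obtain i j where ij: "i \<noteq> j" "b ^ Suc i = b ^ Suc j" by (auto simp: inj_on_def)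
    have "monom (1::complex) (Suc i) - monom 1 (Suc j) \<noteq> 0"
    proof
      assume "monom (1::complex) (Suc i) - monom 1 (Suc j) = 0"
      then have "coeff (monom (1::complex) (Suc i) - monom 1 (Suc j)) (Suc i) = 0" by simp
      then show False using ij(1) by simp
    qed
    moreover have "ev b (monom 1 (Suc i) - monom 1 (Suc j)) = 0"
      using ij(2) by (simp only: ev_diff ev_monom) simp
    ultimately show ?thesis using that by blast
  next
    case True
    let ?X = "(\<lambda>i. b ^ Suc i) ` {..N}"
    have "complex_vector.dependent ?X"
    proof (rule ccontr)
      assume "\<not> complex_vector.dependent ?X"
      then have "card ?X \<le> card F"
        using complex_vector.independent_span_bound[OF F(1), of ?X] pow F(2) by auto
      then show False using True by (simp add: card_image N_def)
    qed
    then obtain u where u: "\<exists>v\<in>?X. u v \<noteq> 0" "(\<Sum>v\<in>?X. u v *\<^sub>C v) = 0"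
      using complex_vector.dependent_finite[of ?X] by auto
    define q where "q = (\<Sum>i\<le>N. monom (u (b ^ Suc i)) (Suc i))"
    have "ev b q = (\<Sum>i\<le>N. u (b ^ Suc i) *\<^sub>C b ^ Suc i)"
      unfolding q_def ev_sum ev_monom ..
    also have "\<dots> = (\<Sum>v\<in>?X. u v *\<^sub>C v)" by (simp only: sum.reindex[OF True] o_def)
    finally have "ev b q = 0" using u(2) by simp
    moreover obtain i where i: "i \<le> N" "u (b ^ Suc i) \<noteq> 0" using u(1) by auto
    have "coeff q (Suc i) = (\<Sum>j\<le>N. if j = i then u (b ^ Suc i) else 0)"
      unfolding q_def coeff_sum by (intro sum.cong) auto
    then have "coeff q (Suc i) \<noteq> 0" using i by simp
    then have "q \<noteq> 0" by auto
    ultimately show ?thesis using that by blast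
  qed
qed

lemma ev_in_subalgebra: "star_subalgebra B \<Longrightarrow> 1 \<in> B \<Longrightarrow> b \<in> B \<Longrightarrow> ev b p \<in> B"
  by (induction p) (auto intro: star_subalgebraD)

lemma gen_in_subalgebra:
  assumes "star_subalgebra B" "1 \<in> B" "b \<in> B" "(F, y) \<in> gen b"
  shows "y \<in> B"
  using assms(4) by (induction rule: gen.induct) (auto intro: star_subalgebraD assms)

lemma finite_dim_spectral:
  fixes b :: "'a::cstar_algebra"
  assumes B: "finite_dim_subalgebra B" "1 \<in> B" and b: "b \<in> B" "normal_element b"
  obtains S P where "resolution S P" "b = (\<Sum>l\<in>S. l *\<^sub>C P l)" "\<And>l. l \<in> S \<Longrightarrow> P l \<in> B"
proof -
  obtain q where q: "ev b q = 0" "q \<noteq> 0" by (rule finite_dim_annihilator[OF B(1) b(1)])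
  obtain S P where SP: "resolution S P" "b = (\<Sum>l\<in>S. l *\<^sub>C P l)" "\<And>l. l \<in> S \<Longrightarrow> \<exists>p. P l = ev b p"
    using algebraic_normal_spectral[OF b(2) q] by blast
  have "P l \<in> B" if "l \<in> S" for l
    using SP(3)[OF that] ev_in_subalgebra[of B b] B b by (auto simp: finite_dim_subalgebra_def)
  then show ?thesis using that SP by blast
qed

text \<open>After division by a power of the invertible \<open>b\<close>, an annihilating polynomial has a nonzero constant term, which exhibits \<open>1\<close> as a
  polynomial in \<open>b\<close> without constant term.\<close>

lemma finite_dim_contains_one:
  fixes b :: "'a::cstar_algebra"
  assumes B: "finite_dim_subalgebra B" and b: "b \<in> B" "invertible_elt b"
  shows "1 \<in> B"
proof -
  have sub: "star_subalgebra B" using B by (simp add: finite_dim_subalgebra_def)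
  obtain q where q: "ev b q = 0" "q \<noteq> 0" by (rule finite_dim_annihilator[OF B b(1)])
  obtain b' where b': "b' * b = 1" using b(2) by (auto simp: invertible_elt_def)
  have "\<exists>c s. c \<noteq> 0 \<and> ev b (pCons c s) = 0"
    using q
  proof (induction q)
    case (pCons a q)
    show ?case
    proof (cases "a = 0")
      case True
      then have "b * ev b q = 0" using pCons.prems by simp
      then have "ev b q = 0" using b' by (metis mult.assoc mult_1 mult_zero_right)
      moreover have "q \<noteq> 0" using True pCons.prems by auto
      ultimately show ?thesis using pCons.IH by blast
    qed (use pCons.prems in blast)
  qed simp
  then obtain c s where cs: "c \<noteq> 0" "c *\<^sub>C 1 + b * ev b s = 0" by auto
  have "b * ev b s \<in> B"
  proof (induction s)
    case (pCons a s)
    then show ?case using b(1) by (auto simp: distrib_left mult_scaleC_right intro!: star_subalgebraD[OF sub])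
  qed (simp add: star_subalgebraD[OF sub])
  moreover have "1 = (- inverse c) *\<^sub>C (b * ev b s)"
  proof -
    have "b * ev b s = - (c *\<^sub>C 1)" using cs(2) by (simp add: eq_neg_iff_add_eq_0 add.commute)
    then show ?thesis using cs(1) by (simp add: scaleC_scaleC)
  qed
  ultimately show ?thesis using star_subalgebraD(2)[OF sub] by metis
qed

text \<open>Only the finitely many roots of an annihilating polynomial have to be avoided.\<close>

lemma finite_dim_invertible_dense:
  fixes b :: "'a::cstar_algebra"
  assumes "finite_dim_subalgebra B" "b \<in> B" "e > 0"
  obtains t where "t > 0" "t < e" "invertible_elt (b - complex_of_real t *\<^sub>C 1)"
proof -
  obtain q where q: "ev b q = 0" "q \<noteq> 0" by (rule finite_dim_annihilator[OF assms(1,2)])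
  have "finite {z. poly q z = 0}" by (rule poly_roots_finite[OF q(2)])
  then have "finite (complex_of_real -` {z. poly q z = 0})"
    by (rule finite_vimageI) (simp add: inj_on_def)
  then have "finite {t. poly q (complex_of_real t) = 0}" by (simp add: vimage_def)
  then have "infinite ({0<..<e} - {t. poly q (complex_of_real t) = 0})"
    using \<open>e > 0\<close> by (simp add: infinite_Ioo)
  then obtain t where "t \<in> {0<..<e} - {t. poly q (complex_of_real t) = 0}"
    using infinite_imp_nonempty by blast
  then have t: "0 < t" "t < e" "poly q (complex_of_real t) \<noteq> 0" by auto
  let ?c = "poly q (complex_of_real t)"
  have "poly (q - [:?c:]) (complex_of_real t) = 0" by simp
  then obtain r where r: "q - [:?c:] = [:- complex_of_real t, 1:] * r" unfolding poly_eq_0_iff_dvd by (elim dvdE)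
  define d where "d = b - complex_of_real t *\<^sub>C 1"
  have e1: "ev b [:- complex_of_real t, 1:] = d" by (simp add: d_def)
  have "ev b (q - [:?c:]) = - (?c *\<^sub>C 1)" using q(1) by (simp add: ev_diff)
  then have "d * ev b r = - (?c *\<^sub>C 1)" "ev b r * d = - (?c *\<^sub>C 1)"
    using r e1 ev_mult[of b] by (metis mult.commute)+
  then have "d * ((- inverse ?c) *\<^sub>C ev b r) = 1" "((- inverse ?c) *\<^sub>C ev b r) * d = 1"
    using t(3) by (simp_all add: mult_scaleC_left mult_scaleC_right scaleC_scaleC)
  then have "invertible_elt d" unfolding invertible_elt_def by blast
  then show ?thesis using that t by (auto simp: d_def)
qed

section \<open>AF-algebras\<close>

lemma calculus_from_approximations:
  fixes x :: "'a::cstar_algebra"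
  assumes K: "compact K"
    and approx: "\<And>e. e > 0 \<Longrightarrow> \<exists>b \<Psi>. unital_star_hom K \<Psi> \<and> \<Psi> (\<lambda>z. z) = b \<and> norm (b - x) < e"
  obtains \<Phi> where "unital_star_hom K \<Phi>" "\<Phi> (\<lambda>z. z) = x"
proof -
  have "\<forall>n. \<exists>\<Psi>. unital_star_hom K \<Psi> \<and> norm (\<Psi> (\<lambda>z. z) - x) < inverse (real (Suc n))"
    using approx[of "inverse (real (Suc n))" for n] by (metis inverse_positive_iff_positive of_nat_0_less_iff zero_less_Suc)
  then obtain \<Psi> where \<Psi>: "\<And>n. unital_star_hom K (\<Psi> n)"
    "\<And>n. norm (\<Psi> n (\<lambda>z. z) - x) < inverse (real (Suc n))" by metis
  define X where "X n = \<Psi> n (\<lambda>z. z)" for n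
  have X: "\<And>n. unital_star_hom K (\<Psi> n)" "\<And>n. \<Psi> n (\<lambda>z. z) = X n"
    "\<And>n. norm (X n - x) < inverse (real (Suc n))" using \<Psi> by (auto simp: X_def)
  have "(\<lambda>n. X n - x) \<longlonglongrightarrow> 0"
    by (rule Lim_null_comparison[OF always_eventually LIMSEQ_inverse_real_of_nat])
      (intro allI less_imp_le X(3))
  then have "X \<longlonglongrightarrow> x" using LIM_zero_cancel by blast
  then show ?thesis by (rule calculus_limit[OF K X(1,2)]) (rule that)
qed

lemma norm_diff_star_mult:
  fixes b z :: "'a::cstar_algebra"
  shows "norm (star b * b - star z * z) \<le> (norm b + norm z) * norm (b - z)"
proof -
  have "star b * b - star z * z = star b * (b - z) + star (b - z) * z"
    by (simp add: star_diff algebra_simps)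
  then have "norm (star b * b - star z * z) \<le> norm (star b * (b - z)) + norm (star (b - z) * z)"
    by (metis norm_triangle_ineq)
  also have "\<dots> \<le> norm b * norm (b - z) + norm (b - z) * norm z"
    using norm_mult_ineq[of "star b" "b - z"] norm_mult_ineq[of "star (b - z)" z]
    by (simp only: norm_star add_mono)
  finally show ?thesis by (simp add: algebra_simps)
qed

lemma normal_if_selfadjoint: "star a = a \<Longrightarrow> normal_element a"
  by (simp add: normal_element_def)

lemma normal_unitary: "unitary u \<Longrightarrow> normal_element u"
  by (simp add: normal_element_def unitary_def)

lemma normal_eigen_star:
  fixes b :: "'a::cstar_algebra"
  assumes "resolution S P" "b = (\<Sum>l\<in>S. l *\<^sub>C P l)" "l \<in> S"
  shows "star b * P l = cnj l *\<^sub>C P l"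
proof -
  have "star (P l * b) = star (l *\<^sub>C P l)" using resolution_eigen(2)[OF assms] by simp
  then show ?thesis using resolution_eigen(4)[OF assms] by (simp add: star_mult star_scaleC)
qed

lemma selfadjoint_eigen_real:
  fixes b :: "'a::cstar_algebra"
  assumes "resolution S P" "b = (\<Sum>l\<in>S. l *\<^sub>C P l)" "l \<in> S" "star b = b"
  shows "l \<in> \<real>"
proof -
  have "cnj l *\<^sub>C P l = l *\<^sub>C P l"
    using normal_eigen_star[OF assms(1-3)] resolution_eigen(1)[OF assms(1-3)] assms(4) by metis
  moreover have "P l \<noteq> 0" using resolution_eigen(3)[OF assms(1-3)] by auto
  ultimately have "cnj l = l" using complex_vector.scale_right_imp_eq by blast
  then show ?thesis using Reals_cnj_iff by blast
qed

lemma unitary_eigen_circle: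
  fixes b :: "'a::cstar_algebra"
  assumes "resolution S P" "b = (\<Sum>l\<in>S. l *\<^sub>C P l)" "l \<in> S" "unitary b"
  shows "cmod l = 1"
proof -
  have "star b * (b * P l) = P l" using assms(4) by (simp add: unitary_def flip: mult.assoc)
  then have "(l * cnj l - 1) *\<^sub>C P l = 0"
    using normal_eigen_star[OF assms(1-3)] resolution_eigen(1)[OF assms(1-3)]
    by (simp add: complex_vector.scale_left_diff_distrib mult_scaleC_right scaleC_scaleC)
  moreover have "P l \<noteq> 0" using resolution_eigen(3)[OF assms(1-3)] by auto
  ultimately have "l * cnj l = 1" by (simp add: complex_vector.scale_eq_0_iff)
  then have "(cmod l)\<^sup>2 = 1" by (metis complex_norm_square of_real_eq_1_iff)
  then show ?thesis using norm_ge_zero[of l] by (simp add: power2_eq_1_iff)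
qed

text \<open>Here the subalgebras contain the unit, so that polynomials in their elements stay inside; \<open>AF_algebra_imp_af\<close> reduces the
  general case to this one.\<close>

locale af =
  fixes B :: "nat \<Rightarrow> 'a::cstar_algebra set"
  assumes fd: "finite_dim_subalgebra (B n)" and one_in: "1 \<in> B n" and inc: "incseq B"
    and dense: "closure (\<Union>n. B n) = UNIV"
begin

abbreviation "D \<equiv> \<Union>n. B n"

lemma sub: "star_subalgebra (B n)"
  using fd by (simp add: finite_dim_subalgebra_def)

lemma mono: "m \<le> n \<Longrightarrow> B m \<subseteq> B n"
  using inc by (simp add: incseq_def)

lemma D_closed:
  shows "1 \<in> D" "a \<in> D \<Longrightarrow> star a \<in> D" "a \<in> D \<Longrightarrow> c *\<^sub>C a \<in> D"
    "a \<in> D \<Longrightarrow> b \<in> D \<Longrightarrow> a + b \<in> D" "a \<in> D \<Longrightarrow> b \<in> D \<Longrightarrow> a * b \<in> D"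
    "a \<in> D \<Longrightarrow> b \<in> D \<Longrightarrow> a - b \<in> D"
proof -
  have two: "\<exists>n. a \<in> B n \<and> b \<in> B n" if ab: "a \<in> D" "b \<in> D" for a b
  proof -
    obtain m n where "a \<in> B m" "b \<in> B n" using ab by blast
    then have "a \<in> B (max m n)" "b \<in> B (max m n)" using mono[of m "max m n"] mono[of n "max m n"] by auto
    then show ?thesis by blast
  qed
  show "1 \<in> D" using one_in by blast
  show "star a \<in> D" if "a \<in> D" using that star_subalgebraD(5)[OF sub] by blast
  show "c *\<^sub>C a \<in> D" if "a \<in> D" using that star_subalgebraD(2)[OF sub] by blast
  show "a + b \<in> D" if "a \<in> D" "b \<in> D" using two[OF that] star_subalgebraD(1)[OF sub] by blast
  show "a * b \<in> D" if "a \<in> D" "b \<in> D" using two[OF that] star_subalgebraD(4)[OF sub] by blast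
  show "a - b \<in> D" if "a \<in> D" "b \<in> D" using two[OF that] star_subalgebraD(6)[OF sub] by blast
qed

lemma approx:
  assumes "e > 0"
  obtains b where "b \<in> D" "norm (b - x) < e"
proof -
  have "x \<in> closure D" using dense by simp
  then show ?thesis using that assms unfolding closure_approachable by (auto simp: dist_norm)
qed

lemma approx_selfadjoint:
  assumes "star x = x" "e > 0"
  obtains b where "b \<in> D" "star b = b" "norm (b - x) < e"
proof -
  obtain b where b: "b \<in> D" "norm (b - x) < e" by (rule approx[OF assms(2)])
  define c where "c = (1/2) *\<^sub>C (b + star b)"
  have "c - x = (1/2) *\<^sub>C ((b - x) + star (b - x))"
  proof -
    have "(1/2) *\<^sub>C (x + x) = x"
      using scaleC_add_right[of "1/2" x x] scaleC_add_left[of "1/2" "1/2" x] by simp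
    then have "c - x = (1/2) *\<^sub>C ((b + star b) - (x + x))"
      by (simp only: c_def complex_vector.scale_right_diff_distrib)
    also have "(b + star b) - (x + x) = (b - x) + star (b - x)" using assms(1) by (simp add: star_diff)
    finally show ?thesis .
  qed
  then have "norm (c - x) = (1/2) * norm ((b - x) + star (b - x))" by (simp add: norm_scaleC)
  also have "\<dots> \<le> (1/2) * (norm (b - x) + norm (b - x))"
    using norm_triangle_ineq[of "b - x" "star (b - x)"] by (simp del: star_diff)
  finally have "norm (c - x) < e" using b(2) by simp
  moreover have "star c = c" by (simp add: c_def star_scaleC star_add star_star add.commute)
  moreover have "c \<in> D" unfolding c_def using b(1) by (intro D_closed)
  ultimately show ?thesis using that by blast
qed

lemma spectral_D:
  assumes "b \<in> D" "normal_element b"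
  obtains S P where "resolution S P" "b = (\<Sum>l\<in>S. l *\<^sub>C P l)" "\<And>l. l \<in> S \<Longrightarrow> P l \<in> D"
proof -
  obtain n where "b \<in> B n" using assms(1) by blast
  then show ?thesis
  proof (rule finite_dim_spectral[OF fd one_in _ assms(2)])
    fix S P assume "resolution S P" "b = (\<Sum>l\<in>S. l *\<^sub>C P l)" "\<And>l. l \<in> S \<Longrightarrow> P l \<in> B n"
    then show ?thesis using that[of S P] by blast
  qed
qed

lemma spectral_calculus:
  assumes "resolution S P" "b = (\<Sum>l\<in>S. l *\<^sub>C P l)" "S \<subseteq> K"
  shows "\<exists>\<Psi>. unital_star_hom K \<Psi> \<and> \<Psi> (\<lambda>z. z) = b"
  using unital_star_hom_mono[OF resolution_hom[OF assms(1)] assms(3)] assms(2) by blast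

lemma invertible_dense:
  fixes x :: 'a
  assumes "e > 0"
  obtains y where "invertible_elt y" "norm (x - y) < e"
proof -
  obtain b where b: "b \<in> D" "norm (b - x) < e/2" using approx[of "e/2"] assms by auto
  then obtain n where "b \<in> B n" by blast
  then obtain t where t: "0 < t" "t < e/2" "invertible_elt (b - complex_of_real t *\<^sub>C 1)"
    using finite_dim_invertible_dense[OF fd, of b n "e/2"] assms by auto
  have "norm (x - (b - complex_of_real t *\<^sub>C 1)) \<le> norm (x - b) + norm (complex_of_real t *\<^sub>C (1::'a))"
    by (metis diff_diff_eq2 add_diff_eq diff_add_eq norm_triangle_ineq)
  also have "\<dots> < e" using b(2) t by (simp add: norm_scaleC norm_minus_commute)
  finally show ?thesis using that t(3) by blast
qed

text \<open>Finiteness of the algebra, a consequence of the density of the invertible elements.\<close>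

lemma right_inverse_imp_left_inverse:
  fixes v w :: 'a
  assumes "w * v = 1"
  shows "v * w = 1"
proof -
  have "v \<noteq> 0" using assms by auto
  then obtain y where y: "invertible_elt y" "norm (w - y) < 1 / norm v"
    using invertible_dense[of "1 / norm v" w] by auto
  have "norm ((w - y) * v) \<le> norm (w - y) * norm v" by (rule norm_mult_ineq)
  also have "\<dots> < 1" using y(2) \<open>v \<noteq> 0\<close> by (simp add: field_simps)
  finally have "invertible_elt (1 - (w - y) * v)" by (rule invertible_elt_one_minus)
  then have yv: "invertible_elt (y * v)" using assms by (simp add: algebra_simps)
  obtain y' where y': "y' * y = 1" "y * y' = 1" using y(1) by (auto simp: invertible_elt_def)
  then have "invertible_elt y'" by (auto simp: invertible_elt_def)
  from invertible_elt_mult[OF this yv] have "invertible_elt v" using y' by (simp flip: mult.assoc)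
  then obtain v' where "v' * v = 1" "v * v' = 1" by (auto simp: invertible_elt_def)
  then show ?thesis using assms by (metis mult.assoc mult_1 mult_1_right)
qed

text \<open>A finite-dimensional approximation \<open>b\<close> of \<open>u\<close> is corrected to the unitary \<open>b (b\<^sup>* b)\<^sup>-\<^sup>1\<^sup>/\<^sup>2\<close>.\<close>

lemma approx_unitary:
  assumes u: "unitary u" and "e > 0"
  obtains v where "v \<in> D" "unitary v" "norm (v - u) < e"
proof -
  \<comment> \<open>\<open>1/6\<close> keeps the eigenvalues of \<open>star b * b\<close> at least \<open>1/2\<close>; the total error is at most \<open>13 * d\<close>\<close>
  define d where "d = min (1/6) (e / 14)"
  have d: "d > 0" "d \<le> 1/6" "d \<le> e / 14" using \<open>e > 0\<close> by (auto simp: d_def)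
  obtain b where b: "b \<in> D" "norm (b - u) < d" by (rule approx[OF d(1)])
  have nb: "norm b \<le> 1 + d" using norm_triangle_ineq[of u "b - u"] b(2) norm_unitary[OF u] by simp
  have cD: "star b * b \<in> D" using b(1) by (intro D_closed)
  have csa: "star (star b * b) = star b * b" by (simp add: star_mult star_star)
  have "norm (star b * b - 1 *\<^sub>C 1) \<le> (norm b + 1) * norm (b - u)"
    using norm_diff_star_mult[of b u] u norm_unitary[OF u] by (simp add: unitary_def)
  also have "\<dots> \<le> 3 * d" using nb b(2) d by (intro mult_mono) auto
  finally have c1: "norm (star b * b - 1 *\<^sub>C 1) \<le> 3 * d" .
  obtain S P where SP: "resolution S P" "star b * b = (\<Sum>l\<in>S. l *\<^sub>C P l)" "\<And>l. l \<in> S \<Longrightarrow> P l \<in> D"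
    using spectral_D[OF cD normal_if_selfadjoint[OF csa]] by blast
  have real: "l = complex_of_real (Re l)" "\<bar>Re l - 1\<bar> \<le> 3 * d" if "l \<in> S" for l
  proof -
    show 1: "l = complex_of_real (Re l)" using selfadjoint_eigen_real[OF SP(1,2) that csa] by simp
    have "cmod (l - 1) \<le> norm (star b * b - 1 *\<^sub>C 1)"
      by (rule eigen_norm_diff) (use resolution_eigen[OF SP(1,2) that] in auto)
    moreover have "cmod (l - 1) = \<bar>Re l - 1\<bar>" by (subst 1) (metis norm_of_real of_real_1 of_real_diff)
    ultimately show "\<bar>Re l - 1\<bar> \<le> 3 * d" using c1 by simp
  qed
  define g where "g l = 1 / sqrt (Re l)" for l
  have g: "\<bar>g l - 1\<bar> \<le> 6 * d" "g l * Re l * g l = 1" if "l \<in> S" for l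
  proof -
    let ?t = "Re l"
    have t: "1/2 \<le> ?t" "\<bar>?t - 1\<bar> \<le> 3 * d" using real(2)[OF that] d by auto
    define s where "s = sqrt ?t"
    have s: "s > 0" "s * s = ?t" "s \<ge> 1/2"
    proof -
      show "s > 0" "s * s = ?t" using t by (auto simp: s_def)
      have "sqrt (1/4) \<le> s" unfolding s_def using t by (intro real_sqrt_le_mono) simp
      then show "s \<ge> 1/2" by (simp add: real_sqrt_divide)
    qed
    show "g l * Re l * g l = 1" using s t unfolding g_def s_def[symmetric] by (simp add: field_simps)
    have "(1 / s - 1) * (s * (1 + s)) = 1 - ?t" using s by (simp add: field_simps)
    then have "\<bar>1 / s - 1\<bar> * (s * (1 + s)) = \<bar>1 - ?t\<bar>"
      using s by (metis abs_mult abs_of_pos add_pos_pos mult_pos_pos zero_less_one)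
    moreover have "s * (1 + s) \<ge> 1/2 * 1" using s by (intro mult_mono) auto
    ultimately have "\<bar>1 / s - 1\<bar> * (1/2) \<le> \<bar>1 - ?t\<bar>"
      by (metis abs_ge_zero mult.right_neutral mult_left_mono)
    moreover have "a * (1/2) \<le> b \<Longrightarrow> b \<le> 3 * d \<Longrightarrow> a \<le> 6 * d" for a b :: real by linarith
    ultimately have "\<bar>1 / s - 1\<bar> \<le> 6 * d" using t(2) abs_minus_commute[of "Re l" 1] by metis
    then show "\<bar>g l - 1\<bar> \<le> 6 * d" by (simp only: g_def s_def)
  qed
  define h where "h = (\<Sum>l\<in>S. complex_of_real (g l) *\<^sub>C P l)"
  interpret sh: star_hom S "\<lambda>f. \<Sum>l\<in>S. f l *\<^sub>C P l" by (rule star_homI[OF resolution_hom[OF SP(1)]])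
  have cont: "continuous_on S f" for f :: "complex \<Rightarrow> complex"
    using SP(1) by (intro continuous_on_finite) (simp add: resolution_def)
  define v where "v = b * h"
  have "star h = h" unfolding h_def using sh.hom_star[OF cont, of "\<lambda>l. complex_of_real (g l)"] by simp
  then have "star v * v = h * (star b * b) * h" by (simp add: v_def star_mult mult.assoc)
  also have "\<dots> = (\<Sum>l\<in>S. (complex_of_real (g l) * l * complex_of_real (g l)) *\<^sub>C P l)"
    unfolding h_def SP(2) by (simp only: sh.hom_mult[OF cont cont])
  also have "\<dots> = (\<Sum>l\<in>S. 1 *\<^sub>C P l)"
  proof (rule sum.cong[OF refl])
    fix l assume "l \<in> S"
    then have "complex_of_real (g l) * l * complex_of_real (g l) = complex_of_real (g l * Re l * g l)"
      by (subst real(1)) auto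
    then show "(complex_of_real (g l) * l * complex_of_real (g l)) *\<^sub>C P l = 1 *\<^sub>C P l"
      using g(2)[OF \<open>l \<in> S\<close>] by simp
  qed
  also have "\<dots> = 1" by (rule sh.hom_one)
  finally have "star v * v = 1" .
  then have "unitary v" using right_inverse_imp_left_inverse by (auto simp: unitary_def)
  moreover have "norm (v - u) < e"
  proof -
    have "h - 1 = (\<Sum>l\<in>S. (complex_of_real (g l) - 1) *\<^sub>C P l)"
      unfolding h_def using sh.hom_diff[OF cont cont, of "\<lambda>l. complex_of_real (g l)" "\<lambda>_. 1"] sh.hom_one by simp
    moreover have "cmod (complex_of_real (g l) - 1) \<le> 6 * d" if "l \<in> S" for l
      using g(1)[OF that] by (metis norm_of_real of_real_1 of_real_diff)
    ultimately have "norm (h - 1) \<le> 6 * d" using resolution_norm_le[OF SP(1)] d(1) by simp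
    then have "norm (b * (h - 1)) \<le> 2 * (6 * d)"
      using norm_mult_ineq[of b "h - 1"] nb d mult_mono[of "norm b" 2 "norm (h - 1)" "6 * d"] by auto
    moreover have "v - u = b * (h - 1) + (b - u)" by (simp add: v_def algebra_simps)
    ultimately have "norm (v - u) \<le> 12 * d + norm (b - u)"
      using norm_triangle_ineq[of "b * (h - 1)" "b - u"] by (simp only:)
    then show ?thesis using b(2) d by simp
  qed
  moreover have "v \<in> D"
  proof -
    obtain n where n: "b \<in> B n" using b(1) by blast
    have cn: "star b * b \<in> B n" by (rule star_subalgebraD(4)[OF sub star_subalgebraD(5)[OF sub n] n])
    obtain F where F: "F \<in> zpoly" "\<And>l. l \<in> S \<Longrightarrow> F l = complex_of_real (g l)"
      using zpoly_interpolation[of S "\<lambda>l. complex_of_real (g l)"] SP(1) by (auto simp: resolution_def)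
    obtain y where y: "(F, y) \<in> gen (star b * b)" using zpoly_gen[OF F(1)] by blast
    have "(\<Sum>l\<in>S. F l *\<^sub>C P l) = y"
      using sh.hom_gen[OF cont[of "\<lambda>z. z"] SP(2)[symmetric] y] by simp
    then have "h = y" unfolding h_def using F(2) by (metis (mono_tags, lifting) sum.cong)
    then have "h \<in> B n" using gen_in_subalgebra[OF sub one_in cn y] by simp
    then show ?thesis unfolding v_def using n star_subalgebraD(4)[OF sub] by blast
  qed
  ultimately show ?thesis using that by blast
qed

lemma selfadjoint_calculus:
  fixes a :: 'a
  assumes a: "star a = a" and R: "norm a < R"
  obtains \<Phi> where "unital_star_hom (complex_of_real ` {-R..R}) \<Phi>" "\<Phi> (\<lambda>z. z) = a"
proof (rule calculus_from_approximations[of "complex_of_real ` {-R..R}" a])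
  show "compact (complex_of_real ` {-R..R})"
    by (intro compact_continuous_image continuous_intros) auto
  fix e :: real assume "e > 0"
  then have "min e (R - norm a) > 0" using R by simp
  from approx_selfadjoint[OF a this] obtain b where b: "b \<in> D" "star b = b" "norm (b - a) < min e (R - norm a)" by blast
  obtain S P where SP: "resolution S P" "b = (\<Sum>l\<in>S. l *\<^sub>C P l)" "\<And>l. l \<in> S \<Longrightarrow> P l \<in> D"
    using spectral_D[OF b(1) normal_if_selfadjoint[OF b(2)]] by blast
  have nb: "norm b \<le> R" using norm_triangle_ineq[of a "b - a"] b(3) by simp
  have "S \<subseteq> complex_of_real ` {-R..R}"
  proof
    fix l assume l: "l \<in> S"
    then have "l = complex_of_real (Re l)" using selfadjoint_eigen_real[OF SP(1,2) l b(2)] by simp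
    moreover have "cmod l \<le> norm b" by (rule eigen_norm_le) (use resolution_eigen[OF SP(1,2) l] in auto)
    then have "\<bar>Re l\<bar> \<le> R" using nb abs_Re_le_cmod[of l] by simp
    ultimately show "l \<in> complex_of_real ` {-R..R}" by (metis abs_le_iff atLeastAtMost_iff image_eqI minus_le_iff)
  qed
  from spectral_calculus[OF SP(1,2) this]
  show "\<exists>b \<Psi>. unital_star_hom (complex_of_real ` {-R..R}) \<Psi> \<and> \<Psi> (\<lambda>z. z) = b \<and> norm (b - a) < e"
    using b(3) by auto
qed (use that in blast)

lemma unitary_calculus:
  fixes u :: 'a
  assumes u: "unitary u"
  obtains \<Phi> where "unital_star_hom (sphere 0 1) \<Phi>" "\<Phi> (\<lambda>z. z) = u"
proof (rule calculus_from_approximations[of "sphere 0 1" u])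
  fix e :: real assume "e > 0"
  from approx_unitary[OF u this] obtain b where b: "b \<in> D" "unitary b" "norm (b - u) < e" by blast
  obtain S P where SP: "resolution S P" "b = (\<Sum>l\<in>S. l *\<^sub>C P l)" "\<And>l. l \<in> S \<Longrightarrow> P l \<in> D"
    using spectral_D[OF b(1) normal_unitary[OF b(2)]] by blast
  have "S \<subseteq> sphere 0 1" using unitary_eigen_circle[OF SP(1,2) _ b(2)] by auto
  from spectral_calculus[OF SP(1,2) this]
  show "\<exists>b \<Psi>. unital_star_hom (sphere 0 1) \<Psi> \<and> \<Psi> (\<lambda>z. z) = b \<and> norm (b - u) < e"
    using b(3) by auto
qed (use that in auto)

lemma norm_one_minus_square:
  assumes "h \<in> D" "star h = h" "norm h \<le> 1"
  shows "norm (1 - h * h) \<le> 1"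
proof -
  obtain S P where SP: "resolution S P" "h = (\<Sum>l\<in>S. l *\<^sub>C P l)" "\<And>l. l \<in> S \<Longrightarrow> P l \<in> D"
    using spectral_D[OF assms(1) normal_if_selfadjoint[OF assms(2)]] by blast
  interpret sh: star_hom S "\<lambda>f. \<Sum>l\<in>S. f l *\<^sub>C P l" by (rule star_homI[OF resolution_hom[OF SP(1)]])
  have cont: "continuous_on S f" for f :: "complex \<Rightarrow> complex"
    using SP(1) by (intro continuous_on_finite) (simp add: resolution_def)
  have "1 - h * h = (\<Sum>l\<in>S. (1 - l * l) *\<^sub>C P l)"
    unfolding SP(2) using sh.hom_diff[OF cont cont, of "\<lambda>_. 1" "\<lambda>l. l * l"] sh.hom_mult[OF cont cont, of "\<lambda>l. l" "\<lambda>l. l"] sh.hom_one by simp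
  moreover have "cmod (1 - l * l) \<le> 1" if l: "l \<in> S" for l
  proof -
    have r: "l = complex_of_real (Re l)" using selfadjoint_eigen_real[OF SP(1,2) l assms(2)] by simp
    have "cmod l \<le> norm h" by (rule eigen_norm_le) (use resolution_eigen[OF SP(1,2) l] in auto)
    then have "\<bar>Re l\<bar> \<le> 1" using assms(3) abs_Re_le_cmod[of l] by simp
    then have "(Re l)\<^sup>2 \<le> 1" by (simp add: abs_square_le_1)
    moreover have "1 - l * l = complex_of_real (1 - (Re l)\<^sup>2)" by (subst (1 2) r) (simp add: power2_eq_square)
    ultimately show ?thesis by (simp only: norm_of_real) (simp add: abs_le_iff)
  qed
  ultimately show ?thesis using resolution_norm_le[OF SP(1), of "\<lambda>l. 1 - l * l" 1] by simp
qed

text \<open>The positivity of \<open>star b * b\<close> rests on this fact. If \<open>star d * d = - p\<close>, then \<open>f = - d * star d\<close> is a projection as well, and the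
  self-adjoint real and imaginary parts \<open>h\<close>, \<open>k\<close> of \<open>d\<close> satisfy \<open>h\<^sup>2 + k\<^sup>2 = - (p + f) / 2\<close>. Hence
  \<open>(1 - f/2) + (1 - h\<^sup>2) + (1 - k\<^sup>2) = 3 + p/2\<close>. The summands on the left are contractions, so the norm is at most \<open>3\<close>, whereas
  the right-hand side multiplies a nonzero \<open>p\<close> by \<open>7/2\<close>.\<close>

lemma star_mult_self_not_negative:
  assumes d: "d \<in> D" "star d * d = - p" and p: "projection p"
  shows "p = 0"
proof -
  have dp: "d * p = d"
  proof -
    have "star (d - d * p) * (d - d * p) = star d * d - star d * d * p - star p * (star d * d) + star p * (star d * d) * p"
      by (simp add: star_diff star_mult algebra_simps)
    also have "\<dots> = 0" using p by (simp add: d(2) projection_def)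
    finally have "norm (d - d * p) = 0" using norm_star_mult_self[of "d - d * p"] by simp
    then show ?thesis by simp
  qed
  define f where "f = - (d * star d)"
  have f: "projection f"
  proof -
    have "d * star d * (d * star d) = d * (star d * d) * star d" by (simp add: mult.assoc)
    also have "\<dots> = - (d * star d)" by (simp add: d(2) dp)
    finally show ?thesis by (simp add: projection_def f_def star_mult star_star)
  qed
  have "(norm d)\<^sup>2 = norm p" using norm_star_mult_self[of d] d(2) by simp
  then have nd: "norm d \<le> 1" using norm_projection_le[OF p] abs_square_le_1[of "norm d"] by simp
  define h k where "h = (1/2) *\<^sub>C (d + star d)" and "k = (\<i>/2) *\<^sub>C (star d - d)"
  have hD: "h \<in> D" "k \<in> D" unfolding h_def k_def by (intro D_closed d(1))+
  have hsa: "star h = h" "star k = k"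
    by (simp_all add: h_def k_def star_scaleC star_add star_diff star_star add.commute)
      (metis complex_vector.scale_minus_left complex_vector.scale_minus_right minus_diff_eq)
  have hn: "norm h \<le> 1" "norm k \<le> 1"
    using norm_triangle_ineq[of d "star d"] norm_triangle_ineq4[of "star d" d] nd
    by (auto simp: h_def k_def norm_scaleC norm_divide)
  have "h * h + k * k = (1/2) *\<^sub>C (star d * d + d * star d)"
  proof -
    have "h * h = (1/4) *\<^sub>C ((d + star d) * (d + star d))"
      by (simp add: h_def mult_scaleC_left mult_scaleC_right scaleC_scaleC)
    moreover have "k * k = (1/4) *\<^sub>C (- ((star d - d) * (star d - d)))"
      by (simp add: k_def mult_scaleC_left mult_scaleC_right scaleC_scaleC)
    ultimately have "h * h + k * k = (1/4) *\<^sub>C ((d + star d) * (d + star d) + - ((star d - d) * (star d - d)))"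
      by (simp only: scaleC_add_right)
    also have "(d + star d) * (d + star d) + - ((star d - d) * (star d - d)) = 2 *\<^sub>C (star d * d + d * star d)"
    proof -
      have "2 *\<^sub>C y = y + y" for y :: 'a using scaleC_add_left[of 1 1 y] by simp
      then show ?thesis by (simp add: algebra_simps)
    qed
    finally show ?thesis by (simp add: scaleC_scaleC)
  qed
  moreover have "star d * d + d * star d = - (p + f)" using d(2) by (simp add: f_def)
  ultimately have hk: "h * h + k * k = - ((1/2) *\<^sub>C (p + f))" by (simp only: complex_vector.scale_minus_right)
  have "(1/2) *\<^sub>C 1 + (1/2) *\<^sub>C 1 = (1::'a)" using scaleC_add_left[of "1/2" "1/2" "1::'a"] by simp
  then have "1 - (1/2) *\<^sub>C f = (1/2) *\<^sub>C (1 + (1 - f))"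
    by (simp only: scaleC_add_right complex_vector.scale_right_diff_distrib add_diff_eq)
  then have nf: "norm (1 - (1/2) *\<^sub>C f) \<le> 1"
    using norm_projection_le[OF projection_compl[OF f]] norm_triangle_ineq[of 1 "1 - f"] by (simp add: norm_scaleC)
  define w where "w = (1 - (1/2) *\<^sub>C f) + (1 - h * h) + (1 - k * k)"
  have "norm w \<le> norm (1 - (1/2) *\<^sub>C f) + norm (1 - h * h) + norm (1 - k * k)"
    unfolding w_def by (rule order_trans[OF norm_triangle_ineq add_right_mono[OF norm_triangle_ineq]])
  then have w3: "norm w \<le> 3"
    using nf norm_one_minus_square[OF hD(1) hsa(1) hn(1)] norm_one_minus_square[OF hD(2) hsa(2) hn(2)] by simp
  have "w = 3 *\<^sub>C 1 - (1/2) *\<^sub>C f - (h * h + k * k)"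
  proof -
    have "3 *\<^sub>C (1::'a) = 1 + 1 + 1" using scaleC_add_left[of 2 1 "1::'a"] scaleC_add_left[of 1 1 "1::'a"] by simp
    then show ?thesis by (simp add: w_def)
  qed
  then have w: "w = 3 *\<^sub>C 1 + (1/2) *\<^sub>C p" by (simp add: hk scaleC_add_right)
  have "w * p = (7/2) *\<^sub>C p"
    using scaleC_add_left[of 3 "1/2" p] p by (simp add: w distrib_right mult_scaleC_left projection_def)
  then have "7/2 * norm p \<le> norm w * norm p"
    using norm_mult_ineq[of w p] by (simp add: norm_scaleC norm_divide)
  also have "\<dots> \<le> 3 * norm p" using w3 by (intro mult_right_mono) auto
  finally show ?thesis by simp
qed

text \<open>A negative eigenvalue \<open>l\<close> would give \<open>star d * d = - P l\<close> for a multiple \<open>d\<close> of \<open>b * P l\<close>.\<close>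

lemma star_mult_self_eigen_nonneg:
  assumes b: "b \<in> D" and SP: "resolution S P" "star b * b = (\<Sum>l\<in>S. l *\<^sub>C P l)" and l: "l \<in> S" "P l \<in> D"
  shows "0 \<le> Re l" "l = complex_of_real (Re l)"
proof -
  show 1: "l = complex_of_real (Re l)"
    using selfadjoint_eigen_real[OF SP l(1)] by (simp add: star_mult star_star)
  show "0 \<le> Re l"
  proof (rule ccontr)
    assume "\<not> 0 \<le> Re l"
    define s where "s = sqrt (- Re l)"
    have s: "s > 0" "s * s = - Re l" using \<open>\<not> 0 \<le> Re l\<close> by (auto simp: s_def)
    define d where "d = complex_of_real (1 / s) *\<^sub>C (b * P l)"
    have "star d * d = complex_of_real (1 / s * (1 / s)) *\<^sub>C (P l * (star b * b * P l))"
      using resolution_eigen(4)[OF SP l(1)]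
      by (simp add: d_def star_scaleC star_mult mult_scaleC_left mult_scaleC_right scaleC_scaleC mult.assoc)
    also have "P l * (star b * b * P l) = l *\<^sub>C P l"
      using resolution_eigen(1,5)[OF SP l(1)] by (simp add: mult_scaleC_right)
    also have "complex_of_real (1 / s * (1 / s)) *\<^sub>C l *\<^sub>C P l = complex_of_real (1 / s * (1 / s) * Re l) *\<^sub>C P l"
      by (subst 1) (simp add: scaleC_scaleC)
    also have "1 / s * (1 / s) * Re l = -1" using s \<open>\<not> 0 \<le> Re l\<close> by (simp add: field_simps)
    finally have "star d * d = - P l" by simp
    moreover have "d \<in> D" unfolding d_def using b l(2) by (intro D_closed)
    ultimately have "P l = 0" using star_mult_self_not_negative resolution_eigen(6)[OF SP l(1)] by blast
    then show False using resolution_eigen(3)[OF SP l(1)] by simp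
  qed
qed

text \<open>The approximations \<open>star b * b\<close> have nonnegative eigenvalues, and the inverse of \<open>star z * z\<close> keeps these away from \<open>0\<close>.\<close>

lemma positive_calculus:
  fixes z :: 'a
  assumes z: "invertible_elt z"
  obtains \<eta> M \<Phi> where "0 < \<eta>" "unital_star_hom (complex_of_real ` {\<eta>..M}) \<Phi>" "\<Phi> (\<lambda>t. t) = star z * z"
proof -
  define c where "c = star z * z"
  have "invertible_elt c" unfolding c_def by (intro invertible_elt_mult invertible_elt_star z)
  then obtain d where d: "d * c = 1" "c * d = 1" by (auto simp: invertible_elt_def)
  then have "d \<noteq> 0" by auto
  define \<eta> M where "\<eta> = 1 / (2 * norm d)" and "M = norm c + 1"
  have "\<eta> > 0" using \<open>d \<noteq> 0\<close> by (simp add: \<eta>_def)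
  show ?thesis
  proof (rule calculus_from_approximations[of "complex_of_real ` {\<eta>..M}" c])
    show "compact (complex_of_real ` {\<eta>..M})"
      by (intro compact_continuous_image continuous_intros) auto
    fix e :: real assume "e > 0"
    define e' where "e' = Min {e, 1, \<eta>}"
    have e': "e' > 0" "e' \<le> e" "e' \<le> 1" "e' \<le> \<eta>" using \<open>e > 0\<close> \<open>\<eta> > 0\<close> by (auto simp: e'_def)
    define r where "r = min 1 (e' / (2 * norm z + 2))"
    have nz: "2 * norm z + 2 > 0" using norm_ge_zero[of z] by linarith
    have r: "r > 0" "r \<le> 1" using e' nz by (auto simp: r_def)
    have "r \<le> e' / (2 * norm z + 2)" by (simp add: r_def)
    then have r3: "r * (2 * norm z + 2) \<le> e'" using nz by (simp only: pos_le_divide_eq)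
    obtain b where b: "b \<in> D" "norm (b - z) < r" by (rule approx[OF r(1)])
    have "norm b \<le> norm z + 1" using norm_triangle_ineq[of z "b - z"] b(2) r(2) by simp
    then have "(norm b + norm z) * norm (b - z) \<le> (2 * norm z + 2) * norm (b - z)"
      by (intro mult_right_mono) auto
    also have "\<dots> < (2 * norm z + 2) * r" by (rule mult_strict_left_mono[OF b(2) nz])
    finally have "(norm b + norm z) * norm (b - z) < (2 * norm z + 2) * r" .
    then have cb: "norm (star b * b - c) < e'"
      using norm_diff_star_mult[of b z] r3 by (simp add: c_def mult.commute)
    have csa: "star (star b * b) = star b * b" by (simp add: star_mult star_star)
    have cD: "star b * b \<in> D" using b(1) by (intro D_closed)
    obtain S P where SP: "resolution S P" "star b * b = (\<Sum>l\<in>S. l *\<^sub>C P l)" "\<And>l. l \<in> S \<Longrightarrow> P l \<in> D"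
      using spectral_D[OF cD normal_if_selfadjoint[OF csa]] by blast
    have "S \<subseteq> complex_of_real ` {\<eta>..M}"
    proof
      fix l assume l: "l \<in> S"
      note pos = star_mult_self_eigen_nonneg[OF b(1) SP(1,2) l SP(3)[OF l]]
      note eig = resolution_eigen[OF SP(1,2) l]
      have "cmod l \<le> norm (star b * b)" by (rule eigen_norm_le[OF eig(1,3)])
      also have "\<dots> \<le> M" using norm_triangle_ineq[of c "star b * b - c"] cb e' by (simp add: M_def)
      finally have "Re l \<le> M" using abs_Re_le_cmod[of l] by simp
      have "P l = d * (star b * b * P l) - d * ((star b * b - c) * P l)"
        using d(1) by (simp add: algebra_simps flip: mult.assoc)
      then have "1 \<le> norm (d * (l *\<^sub>C P l)) + norm (d * ((star b * b - c) * P l))"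
        using norm_triangle_ineq4[of "d * (star b * b * P l)" "d * ((star b * b - c) * P l)"] eig(1,3) by simp
      also have "norm (d * (l *\<^sub>C P l)) \<le> norm d * Re l"
      proof -
        have "cmod l = Re l" using pos by (metis abs_of_nonneg norm_of_real)
        then show ?thesis using norm_mult_ineq[of d "l *\<^sub>C P l"] eig(3) by (simp add: norm_scaleC)
      qed
      also have "norm (d * ((star b * b - c) * P l)) \<le> norm d * \<eta>"
      proof -
        have "norm ((star b * b - c) * P l) \<le> \<eta>"
          using norm_mult_ineq[of "star b * b - c" "P l"] eig(3) cb e' by simp
        then show ?thesis using norm_mult_ineq[of d "(star b * b - c) * P l"] mult_left_mono[of _ \<eta> "norm d"]
          by (meson norm_ge_zero order_trans)
      qed
      finally have "1 \<le> norm d * Re l + 1/2" using \<open>d \<noteq> 0\<close> by (simp add: \<eta>_def)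
      then have "\<eta> \<le> Re l" using \<open>d \<noteq> 0\<close> by (simp add: \<eta>_def field_simps)
      then show "l \<in> complex_of_real ` {\<eta>..M}" using \<open>Re l \<le> M\<close> pos(2) by (metis atLeastAtMost_iff image_eqI)
    qed
    from spectral_calculus[OF SP(1,2) this]
    show "\<exists>b \<Psi>. unital_star_hom (complex_of_real ` {\<eta>..M}) \<Psi> \<and> \<Psi> (\<lambda>z. z) = b \<and> norm (b - c) < e"
      using cb e' by auto
  qed (use that \<open>\<eta> > 0\<close> c_def in blast)
qed

end

text \<open>The subalgebras need not contain the unit at first, but an element of one of them is close to \<open>1\<close>, hence invertible, and
  \<open>finite_dim_contains_one\<close> applies from that stage on.\<close>

lemma AF_algebra_imp_af:
  assumes "AF_algebra TYPE('a::cstar_algebra)"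
  obtains B :: "nat \<Rightarrow> 'a::cstar_algebra set" where "af B"
proof -
  obtain B :: "nat \<Rightarrow> 'a set" where B: "\<And>n. finite_dim_subalgebra (B n)" "incseq B" "closure (\<Union>n. B n) = UNIV"
    using assms by (auto simp: AF_algebra_def)
  have "1 \<in> closure (\<Union>n. B n)" using B(3) by simp
  then obtain b where "b \<in> (\<Union>n. B n)" "dist b 1 < 1" unfolding closure_approachable by (meson zero_less_one)
  then obtain n where b: "b \<in> B n" "norm (1 - b) < 1" by (auto simp: dist_norm norm_minus_commute)
  then have "invertible_elt b" using invertible_elt_one_minus[OF b(2)] by simp
  have one: "1 \<in> B (n + m)" for m
  proof (rule finite_dim_contains_one[OF B(1) _ \<open>invertible_elt b\<close>])
    show "b \<in> B (n + m)" using b(1) B(2) by (meson incseqD le_add1 subsetD)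
  qed
  have "(\<Union>m. B m) \<subseteq> (\<Union>m. B (n + m))"
  proof (rule UN_least)
    fix m
    have "B m \<subseteq> B (n + m)" using B(2) by (rule incseqD) simp
    then show "B m \<subseteq> (\<Union>m. B (n + m))" by blast
  qed
  then have "closure (\<Union>m. B (n + m)) = UNIV" using closure_mono B(3) by (metis top.extremum_uniqueI)
  moreover have "incseq (\<lambda>m. B (n + m))" using B(2) by (simp add: incseq_def)
  ultimately have "af (\<lambda>m. B (n + m))" using B(1) one by unfold_locales auto
  then show ?thesis using that by blast
qed

section \<open>Functional calculus of normal elements\<close>

lemma gen_commute_elt:
  assumes "(F, y) \<in> gen x" "x * w = w * x" "star x * w = w * star x"
  shows "y * w = w * y"
  using assms
proof (induction rule: gen.induct)
  case (gen_const c)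
  then show ?case by (simp add: mult_scaleC_left mult_scaleC_right)
next
  case (gen_mult F y G z)
  then show ?case by (metis mult.assoc)
qed (auto simp: algebra_simps)

lemma (in star_hom) hom_approx:
  fixes i :: "'t \<Rightarrow> complex"
  assumes K: "compact (i ` K)" and i: "continuous_on K i" "\<Phi> i = x" and f: "continuous_on (i ` K) f" and "e > 0"
  obtains F y where "(F, y) \<in> gen x" "\<And>z. z \<in> i ` K \<Longrightarrow> cmod (f z - F z) < e" "norm (\<Phi> (\<lambda>t. f (i t)) - y) \<le> e"
proof -
  obtain F where F: "F \<in> zpoly" "\<And>z. z \<in> i ` K \<Longrightarrow> cmod (f z - F z) < e"
    using zpoly_dense[OF K f \<open>e > 0\<close>] by blast
  obtain y where y: "(F, y) \<in> gen x" using zpoly_gen[OF F(1)] by blast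
  have h: "\<Phi> (\<lambda>t. F (i t)) = y" "continuous_on K (\<lambda>t. F (i t))" using hom_gen[OF i y] by auto
  have "norm (\<Phi> (\<lambda>t. f (i t)) - \<Phi> (\<lambda>t. F (i t))) \<le> e"
    by (rule hom_norm_diff_le[OF continuous_on_compose2[OF f i(1)] h(2)])
      (use F(2) \<open>e > 0\<close> in \<open>auto intro: less_imp_le\<close>)
  then show ?thesis using that[OF y F(2)] h(1) by simp
qed

lemma (in star_hom) hom_in_closed:
  fixes i :: "'t \<Rightarrow> complex"
  assumes "compact (i ` K)" "continuous_on K i" "\<Phi> i = x" "continuous_on (i ` K) f"
    and C: "closed C" "\<And>F y. (F, y) \<in> gen x \<Longrightarrow> y \<in> C"
  shows "\<Phi> (\<lambda>t. f (i t)) \<in> C"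
proof -
  have "\<exists>y\<in>C. dist y (\<Phi> (\<lambda>t. f (i t))) < e" if "e > 0" for e
  proof -
    from \<open>e > 0\<close> have "e/2 > 0" by simp
    obtain F y where "(F, y) \<in> gen x" "\<And>z. z \<in> i ` K \<Longrightarrow> cmod (f z - F z) < e/2"
      "norm (\<Phi> (\<lambda>t. f (i t)) - y) \<le> e/2"
      by (rule hom_approx[OF assms(1-4) \<open>e/2 > 0\<close>]) blast
    then show ?thesis using C(2) \<open>e > 0\<close> by (intro bexI[of _ y]) (auto simp: dist_norm norm_minus_commute)
  qed
  then have "\<Phi> (\<lambda>t. f (i t)) \<in> closure C" by (simp add: closure_approachable)
  then show ?thesis using C(1) by simp
qed

lemma hom_commute_elt:
  fixes \<Phi> :: "(complex \<Rightarrow> complex) \<Rightarrow> 'a::cstar_algebra"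
  assumes "unital_star_hom K \<Phi>" "compact K" "\<Phi> (\<lambda>z. z) = x" "continuous_on K f"
    and w: "x * w = w * x" "star x * w = w * star x"
  shows "\<Phi> f * w = w * \<Phi> f"
proof -
  interpret star_hom K \<Phi> by (rule star_homI[OF assms(1)])
  have "closed {y. y * w = w * y}" by (intro closed_Collect_eq continuous_intros)
  then have "\<Phi> (\<lambda>t. f t) \<in> {y. y * w = w * y}"
    using assms gen_commute_elt[OF _ w] by (intro hom_in_closed[where i = "\<lambda>z. z" and x = x]) auto
  then show ?thesis by simp
qed

subsection \<open>Two commuting self-adjoint elements\<close>

definition ramp :: "real \<Rightarrow> real" where "ramp u = min 1 (max 0 u)"

lemma ramp_simps: "u \<le> 0 \<Longrightarrow> ramp u = 0" "1 \<le> u \<Longrightarrow> ramp u = 1" "0 \<le> u \<Longrightarrow> u \<le> 1 \<Longrightarrow> ramp u = u"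
  by (auto simp: ramp_def)

lemma ramp_bounds: "0 \<le> ramp u" "ramp u \<le> 1"
  by (auto simp: ramp_def)

lemma continuous_on_ramp [continuous_intros]:
  "continuous_on S f \<Longrightarrow> continuous_on S (\<lambda>x. ramp (f x))"
  unfolding ramp_def by (intro continuous_intros)

text \<open>The piecewise linear hat function with peak at \<open>i\<close>, vanishing outside the two adjacent unit intervals.\<close>

definition hat :: "nat \<Rightarrow> real \<Rightarrow> real" where "hat i u = ramp (u - real i + 1) - ramp (u - real i)"

lemma hat_bounds: "0 \<le> hat i u" "hat i u \<le> 1"
  by (auto simp: hat_def ramp_def min_def max_def)

lemma hat_nonzero: "hat i u \<noteq> 0 \<Longrightarrow> \<bar>u - real i\<bar> < 1"
  by (auto simp: hat_def ramp_def min_def max_def abs_if split: if_splits)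

lemma hat_sum: "0 \<le> u \<Longrightarrow> u \<le> real N \<Longrightarrow> (\<Sum>i\<le>N. hat i u) = 1"
proof -
  assume u: "0 \<le> u" "u \<le> real N"
  have "(\<Sum>i\<le>M. hat i u) = ramp (u + 1) - ramp (u - real M)" for M
    by (induction M) (auto simp: hat_def algebra_simps)
  then show ?thesis using u by (simp add: ramp_simps)
qed

lemma hat_orth: "i + 2 \<le> j \<or> j + 2 \<le> i \<Longrightarrow> hat i u * hat j u = 0"
  using hat_nonzero[of i u] hat_nonzero[of j u] by (cases "hat i u = 0"; cases "hat j u = 0") (auto simp: abs_if split: if_splits)

lemma continuous_on_hat [continuous_intros]:
  "continuous_on S f \<Longrightarrow> continuous_on S (\<lambda>x. hat i (f x))"
  unfolding hat_def by (intro continuous_intros)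

definition interval :: "real \<Rightarrow> complex set" where "interval R = complex_of_real ` {-R..R}"

definition square :: "real \<Rightarrow> complex set" where "square R = cbox (Complex (-R) (-R)) (Complex R R)"

lemma square_iff: "z \<in> square R \<longleftrightarrow> \<bar>Re z\<bar> \<le> R \<and> \<bar>Im z\<bar> \<le> R"
  by (auto simp: square_def in_cbox_complex_iff abs_le_iff)

lemma compact_square: "compact (square R)" by (simp add: square_def)

lemma compact_interval: "compact (interval R)"
  unfolding interval_def by (intro compact_continuous_image continuous_intros) auto

lemma interval_iff: "z \<in> interval R \<longleftrightarrow> Im z = 0 \<and> \<bar>Re z\<bar> \<le> R"
  by (auto simp: interval_def image_iff complex_eq_iff abs_le_iff intro!: bexI[of _ "Re z"])

text \<open>Finite sums of products \<open>f(a) g(b)\<close>, together with the functions they represent. As for \<open>gen\<close>, a relation is used because the value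
  might depend on the representation.\<close>

inductive_set tensor :: "real \<Rightarrow> ((complex \<Rightarrow> complex) \<Rightarrow> 'a::cstar_algebra) \<Rightarrow> ((complex \<Rightarrow> complex) \<Rightarrow> 'a)
    \<Rightarrow> ((complex \<Rightarrow> complex) \<times> 'a) set" for R \<Phi>1 \<Phi>2 where
  tensor_elem: "continuous_on (interval R) f \<Longrightarrow> continuous_on (interval R) g \<Longrightarrow>
    ((\<lambda>z. f (complex_of_real (Re z)) * g (complex_of_real (Im z))), \<Phi>1 f * \<Phi>2 g) \<in> tensor R \<Phi>1 \<Phi>2"
| tensor_add: "(F, S) \<in> tensor R \<Phi>1 \<Phi>2 \<Longrightarrow> (G, T) \<in> tensor R \<Phi>1 \<Phi>2 \<Longrightarrow>
    ((\<lambda>z. F z + G z), S + T) \<in> tensor R \<Phi>1 \<Phi>2"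

locale commuting_homs =
  fixes R :: real and \<Phi>1 \<Phi>2 :: "(complex \<Rightarrow> complex) \<Rightarrow> 'a::cstar_algebra"
  assumes R: "R > 0" and hom1: "unital_star_hom (interval R) \<Phi>1" and hom2: "unital_star_hom (interval R) \<Phi>2"
    and commute: "continuous_on (interval R) f \<Longrightarrow> continuous_on (interval R) g \<Longrightarrow> \<Phi>1 f * \<Phi>2 g = \<Phi>2 g * \<Phi>1 f"
begin

sublocale h1: star_hom "interval R" \<Phi>1 by (rule star_homI[OF hom1])
sublocale h2: star_hom "interval R" \<Phi>2 by (rule star_homI[OF hom2])

lemma tensor_continuous:
  assumes "(F, T) \<in> tensor R \<Phi>1 \<Phi>2" shows "continuous_on (square R) F"
  using assms
proof (induction rule: tensor.induct)
  case (tensor_elem f g)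
  have "continuous_on (square R) (\<lambda>z. f (complex_of_real (Re z)))"
    by (rule continuous_on_compose2[OF tensor_elem(1)]) (auto intro!: continuous_intros simp: square_iff interval_iff)
  moreover have "continuous_on (square R) (\<lambda>z. g (complex_of_real (Im z)))"
    by (rule continuous_on_compose2[OF tensor_elem(2)]) (auto intro!: continuous_intros simp: square_iff interval_iff)
  ultimately show ?case by (rule continuous_on_mult)
qed (auto intro: continuous_intros)

lemma tensor_mult:
  assumes "(F, S) \<in> tensor R \<Phi>1 \<Phi>2" "(G, T) \<in> tensor R \<Phi>1 \<Phi>2"
  shows "((\<lambda>z. F z * G z), S * T) \<in> tensor R \<Phi>1 \<Phi>2"
  using assms(1)
proof (induction rule: tensor.induct)
  case (tensor_elem f g)
  note fg = tensor_elem
  show ?case using assms(2)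
  proof (induction rule: tensor.induct)
    case (tensor_elem f' g')
    have "((\<lambda>z. (f (complex_of_real (Re z)) * f' (complex_of_real (Re z))) * (g (complex_of_real (Im z)) * g' (complex_of_real (Im z)))),
        \<Phi>1 (\<lambda>t. f t * f' t) * \<Phi>2 (\<lambda>t. g t * g' t)) \<in> tensor R \<Phi>1 \<Phi>2"
      using tensor_elem fg by (intro tensor.tensor_elem[of R "\<lambda>t. f t * f' t" "\<lambda>t. g t * g' t"] continuous_intros)
    moreover have "\<Phi>1 (\<lambda>t. f t * f' t) * \<Phi>2 (\<lambda>t. g t * g' t) = \<Phi>1 f * \<Phi>2 g * (\<Phi>1 f' * \<Phi>2 g')"
      using tensor_elem fg commute[of f' g] by (simp add: h1.hom_mult h2.hom_mult) (metis mult.assoc)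
    ultimately show ?case by (simp add: mult_ac)
  next
    case (tensor_add F S G T)
    then show ?case using tensor.tensor_add by (fastforce simp: distrib_left)
  qed
next
  case (tensor_add F S G T)
  then show ?case using tensor.tensor_add by (fastforce simp: distrib_right)
qed

definition node :: "nat \<Rightarrow> nat \<Rightarrow> real" where "node N i = 2 * R * real i / real N - R"

definition bump :: "nat \<Rightarrow> nat \<Rightarrow> complex \<Rightarrow> complex" where
  "bump N i z = complex_of_real (hat i ((Re z + R) * real N / (2 * R)))"

definition slice :: "(complex \<Rightarrow> complex) \<Rightarrow> real \<Rightarrow> complex \<Rightarrow> complex" where
  "slice F s w = F (Complex s (Re w))"

text \<open>A value for \<open>F(a, b)\<close> that manifestly depends only on the function \<open>F\<close>: the interpolant of \<open>F\<close> that is piecewise linear in the first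
  variable with nodes \<open>node N i\<close>. Comparing it with elements of \<open>tensor\<close> yields the norm bound needed for \<open>calculus_extension\<close>.\<close>

definition interp :: "nat \<Rightarrow> (complex \<Rightarrow> complex) \<Rightarrow> 'a" where
  "interp N F = (\<Sum>i\<le>N. \<Phi>2 (slice F (node N i)) * \<Phi>1 (bump N i))"

lemma node_in: "0 < N \<Longrightarrow> i \<le> N \<Longrightarrow> \<bar>node N i\<bar> \<le> R"
  using R by (auto simp: node_def abs_le_iff field_simps)

lemma cont_bump: "continuous_on S (bump N i)"
  unfolding bump_def using R by (intro continuous_intros) auto

lemma cont_slice:
  assumes "continuous_on (square R) F" "\<bar>s\<bar> \<le> R"
  shows "continuous_on (interval R) (slice F s)"
  unfolding slice_def
  by (rule continuous_on_compose2[OF assms(1)]) (use assms(2) in \<open>auto simp: square_iff interval_iff Complex_eq intro!: continuous_intros\<close>)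

lemma scaled_coordinate: "z \<in> interval R \<Longrightarrow> 0 \<le> (Re z + R) * real N / (2 * R)"
  "z \<in> interval R \<Longrightarrow> (Re z + R) * real N / (2 * R) \<le> real N"
proof -
  assume "z \<in> interval R"
  then have z: "0 \<le> Re z + R" "Re z + R \<le> 2 * R" by (auto simp: interval_iff)
  show "0 \<le> (Re z + R) * real N / (2 * R)" using z R by simp
  have "(Re z + R) * real N \<le> 2 * R * real N" using z by (intro mult_right_mono) auto
  then show "(Re z + R) * real N / (2 * R) \<le> real N" using R by (simp add: divide_le_eq mult.commute)
qed

lemma bump_sum: "z \<in> interval R \<Longrightarrow> (\<Sum>i\<le>N. bump N i z) = 1"
  unfolding bump_def of_real_sum[symmetric] using hat_sum[OF scaled_coordinate] by simp

lemma bump_near: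
  assumes "0 < N" "bump N i z \<noteq> 0"
  shows "\<bar>Re z - node N i\<bar> \<le> 2 * R / real N"
proof -
  have "\<bar>(Re z + R) * real N / (2 * R) - real i\<bar> < 1" using assms(2) hat_nonzero by (auto simp: bump_def)
  moreover have "Re z - node N i = ((Re z + R) * real N / (2 * R) - real i) * (2 * R / real N)"
    using R assms(1) by (simp add: node_def field_simps)
  ultimately show ?thesis
    using R assms(1) mult_right_mono[of "\<bar>(Re z + R) * real N / (2 * R) - real i\<bar>" 1 "2 * R / real N"]
    by (simp only: abs_mult) simp
qed

lemma interp_add:
  assumes "continuous_on (square R) F" "continuous_on (square R) G" "0 < N"
  shows "interp N (\<lambda>z. F z + G z) = interp N F + interp N G"
proof -
  have "\<Phi>2 (slice (\<lambda>z. F z + G z) (node N i)) = \<Phi>2 (slice F (node N i)) + \<Phi>2 (slice G (node N i))" if "i \<le> N" for i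
    using h2.hom_add[OF cont_slice[OF assms(1)] cont_slice[OF assms(2)]] node_in[OF assms(3) that]
    by (simp add: slice_def[abs_def])
  then show ?thesis by (simp add: interp_def distrib_right sum.distrib)
qed

lemma interp_cmult:
  assumes "continuous_on (square R) F" "0 < N"
  shows "interp N (\<lambda>z. c * F z) = c *\<^sub>C interp N F"
proof -
  have "\<Phi>2 (slice (\<lambda>z. c * F z) (node N i)) = c *\<^sub>C \<Phi>2 (slice F (node N i))" if "i \<le> N" for i
    using h2.hom_cmult[OF cont_slice[OF assms(1)]] node_in[OF assms(2) that] by (simp add: slice_def[abs_def])
  then show ?thesis by (simp add: interp_def scaleC_sum_right mult_scaleC_left)
qed

text \<open>Hats whose indices differ by at least \<open>2\<close> are orthogonal, so for unimodular coefficients \<open>star u * u\<close> of the sum \<open>u\<close> is a function of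
  the first variable bounded by \<open>1\<close>.\<close>

lemma orthogonal_bumps_norm:
  assumes J: "J \<subseteq> {..N}" "\<And>i j. i \<in> J \<Longrightarrow> j \<in> J \<Longrightarrow> i \<noteq> j \<Longrightarrow> i + 2 \<le> j \<or> j + 2 \<le> i"
    and w: "\<And>i. i \<in> J \<Longrightarrow> continuous_on (interval R) (w i)" "\<And>i t. i \<in> J \<Longrightarrow> t \<in> interval R \<Longrightarrow> cmod (w i t) = 1"
  shows "norm (\<Sum>i\<in>J. \<Phi>2 (w i) * \<Phi>1 (bump N i)) \<le> 1"
proof -
  have fin: "finite J" using J(1) finite_subset by blast
  define u where "u = (\<Sum>i\<in>J. \<Phi>2 (w i) * \<Phi>1 (bump N i))"
  note cb = cont_bump[of "interval R"]
  have sb: "star (\<Phi>1 (bump N i)) = \<Phi>1 (bump N i)" for i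
    by (rule h1.hom_selfadjoint[OF cb]) (simp add: bump_def)
  have trm: "star (\<Phi>2 (w i) * \<Phi>1 (bump N i)) * (\<Phi>2 (w j) * \<Phi>1 (bump N j)) =
      (if i = j then \<Phi>1 (\<lambda>t. bump N i t * bump N i t) else 0)" if ij: "i \<in> J" "j \<in> J" for i j
  proof -
    have "star (\<Phi>2 (w i) * \<Phi>1 (bump N i)) * (\<Phi>2 (w j) * \<Phi>1 (bump N j)) =
        \<Phi>1 (bump N i) * (star (\<Phi>2 (w i)) * \<Phi>2 (w j)) * \<Phi>1 (bump N j)"
      by (simp add: star_mult sb mult.assoc)
    also have "star (\<Phi>2 (w i)) * \<Phi>2 (w j) = \<Phi>2 (\<lambda>t. cnj (w i t) * w j t)"
      using w(1) ij by (simp add: h2.hom_mult h2.hom_star continuous_on_cnj)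
    also have "\<Phi>1 (bump N i) * \<Phi>2 (\<lambda>t. cnj (w i t) * w j t) * \<Phi>1 (bump N j) =
        \<Phi>2 (\<lambda>t. cnj (w i t) * w j t) * (\<Phi>1 (bump N i) * \<Phi>1 (bump N j))"
      using commute[OF cb, of "\<lambda>t. cnj (w i t) * w j t" N i] w(1) ij
      by (simp add: continuous_on_mult continuous_on_cnj mult.assoc)
    also have "\<dots> = \<Phi>2 (\<lambda>t. cnj (w i t) * w j t) * \<Phi>1 (\<lambda>t. bump N i t * bump N j t)"
      using cb by (simp add: h1.hom_mult)
    finally have *: "star (\<Phi>2 (w i) * \<Phi>1 (bump N i)) * (\<Phi>2 (w j) * \<Phi>1 (bump N j)) =
        \<Phi>2 (\<lambda>t. cnj (w i t) * w j t) * \<Phi>1 (\<lambda>t. bump N i t * bump N j t)" .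
    show ?thesis
    proof (cases "i = j")
      case True
      have "\<Phi>2 (\<lambda>t. cnj (w i t) * w i t) = \<Phi>2 (\<lambda>t. 1)"
      proof (rule h2.hom_cong)
        show "continuous_on (interval R) (\<lambda>t. cnj (w i t) * w i t)" using w(1)[OF ij(1)] by (intro continuous_intros)
        show "cnj (w i t) * w i t = 1" if "t \<in> interval R" for t
          using w(2)[OF ij(1) that] complex_norm_square[of "w i t"] by (simp add: mult.commute)
      qed
      then show ?thesis using * True by (simp add: h2.hom_one)
    next
      case False
      have "(\<lambda>t. bump N i t * bump N j t) = (\<lambda>t. 0)"
        using hat_orth[OF J(2)[OF ij False]] by (auto simp: bump_def simp flip: of_real_mult)
      then show ?thesis using * False by (simp add: h1.hom_zero)
    qed
  qed
  have "star u * u = (\<Sum>i\<in>J. \<Sum>j\<in>J. if i = j then \<Phi>1 (\<lambda>t. bump N i t * bump N i t) else 0)"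
    unfolding u_def star_sum sum_product by (intro sum.cong refl trm)
  also have "\<dots> = (\<Sum>i\<in>J. \<Phi>1 (\<lambda>t. bump N i t * bump N i t))" using fin by simp
  also have "\<dots> = \<Phi>1 (\<lambda>t. \<Sum>i\<in>J. bump N i t * bump N i t)"
    by (rule h1.hom_sum[symmetric]) (intro continuous_intros cb)
  finally have uu: "star u * u = \<Phi>1 (\<lambda>t. \<Sum>i\<in>J. bump N i t * bump N i t)" .
  have "norm (\<Phi>1 (\<lambda>t. \<Sum>i\<in>J. bump N i t * bump N i t)) \<le> 1"
  proof (rule h1.hom_norm_le)
    show "continuous_on (interval R) (\<lambda>t. \<Sum>i\<in>J. bump N i t * bump N i t)" by (intro continuous_intros cb)
    fix t assume t: "t \<in> interval R"
    let ?u = "(Re t + R) * real N / (2 * R)"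
    have "(\<Sum>i\<in>J. hat i ?u * hat i ?u) \<le> (\<Sum>i\<in>J. hat i ?u)"
      using hat_bounds by (intro sum_mono) (simp add: mult_left_le)
    also have "\<dots> \<le> (\<Sum>i\<le>N. hat i ?u)" using J(1) hat_bounds by (intro sum_mono2) auto
    also have "\<dots> = 1" by (rule hat_sum[OF scaled_coordinate[OF t]])
    finally have "(\<Sum>i\<in>J. hat i ?u * hat i ?u) \<le> 1" .
    moreover have "0 \<le> (\<Sum>i\<in>J. hat i ?u * hat i ?u)" using hat_bounds by (intro sum_nonneg) simp
    moreover have "(\<Sum>i\<in>J. bump N i t * bump N i t) = complex_of_real (\<Sum>i\<in>J. hat i ?u * hat i ?u)"
      by (simp add: bump_def)
    ultimately show "cmod (\<Sum>i\<in>J. bump N i t * bump N i t) \<le> 1" by (simp only: norm_of_real abs_of_nonneg)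
  qed simp
  then have "norm u \<le> 1" using uu by (intro norm_isometry_le[of u]) simp
  then show ?thesis by (simp add: u_def)
qed

text \<open>A real coefficient in \<open>[-1, 1]\<close> is the average of two conjugate unimodular ones.\<close>

lemma orthogonal_bumps_norm_real:
  assumes J: "J \<subseteq> {..N}" "\<And>i j. i \<in> J \<Longrightarrow> j \<in> J \<Longrightarrow> i \<noteq> j \<Longrightarrow> i + 2 \<le> j \<or> j + 2 \<le> i"
    and g: "\<And>i. i \<in> J \<Longrightarrow> continuous_on (interval R) (g i)"
      "\<And>i t. i \<in> J \<Longrightarrow> t \<in> interval R \<Longrightarrow> \<bar>g i t\<bar> \<le> (1::real)"
  shows "norm (\<Sum>i\<in>J. \<Phi>2 (\<lambda>t. complex_of_real (g i t)) * \<Phi>1 (bump N i)) \<le> 1"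
proof -
  define w where "w i t = Complex (g i t) (sqrt (1 - (g i t)\<^sup>2))" for i t
  have wc: "continuous_on (interval R) (w i)" if "i \<in> J" for i
    unfolding w_def Complex_eq by (intro continuous_intros g that)
  have w1: "cmod (w i t) = 1" if "i \<in> J" "t \<in> interval R" for i t
    using g(2)[OF that] by (simp add: w_def cmod_def abs_square_le_1)
  have half: "\<Phi>2 (\<lambda>t. complex_of_real (g i t)) = (1/2) *\<^sub>C (\<Phi>2 (w i) + \<Phi>2 (\<lambda>t. cnj (w i t)))" if "i \<in> J" for i
  proof -
    have "(\<lambda>t. complex_of_real (g i t)) = (\<lambda>t. (1/2) * (w i t + cnj (w i t)))"
      by (auto simp: w_def complex_eq_iff)
    then show ?thesis
      using h2.hom_cmult[of "\<lambda>t. w i t + cnj (w i t)" "1/2"] h2.hom_add[OF wc[OF that] continuous_on_cnj[OF wc[OF that]]] wc[OF that]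
      by (simp add: continuous_on_add continuous_on_cnj)
  qed
  have "(\<Sum>i\<in>J. \<Phi>2 (\<lambda>t. complex_of_real (g i t)) * \<Phi>1 (bump N i)) =
      (1/2) *\<^sub>C ((\<Sum>i\<in>J. \<Phi>2 (w i) * \<Phi>1 (bump N i)) + (\<Sum>i\<in>J. \<Phi>2 (\<lambda>t. cnj (w i t)) * \<Phi>1 (bump N i)))"
    unfolding sum.distrib[symmetric] scaleC_sum_right
    by (intro sum.cong refl) (simp add: half mult_scaleC_left distrib_right)
  then have "norm (\<Sum>i\<in>J. \<Phi>2 (\<lambda>t. complex_of_real (g i t)) * \<Phi>1 (bump N i)) =
      (1/2) * norm ((\<Sum>i\<in>J. \<Phi>2 (w i) * \<Phi>1 (bump N i)) + (\<Sum>i\<in>J. \<Phi>2 (\<lambda>t. cnj (w i t)) * \<Phi>1 (bump N i)))"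
    by (simp add: norm_scaleC)
  also have "\<dots> \<le> (1/2) * (1 + 1)"
    by (intro mult_left_mono order_trans[OF norm_triangle_ineq] add_mono orthogonal_bumps_norm J)
      (use wc w1 in \<open>auto intro: continuous_on_cnj\<close>)
  finally show ?thesis by simp
qed

text \<open>The even and the odd indices are estimated separately, by \<open>orthogonal_bumps_norm_real\<close>.\<close>

lemma interp_norm_real:
  assumes F: "continuous_on (square R) (\<lambda>z. complex_of_real (F z))" and M: "\<And>z. z \<in> square R \<Longrightarrow> \<bar>F z\<bar> \<le> 1" and "0 < N"
  shows "norm (interp N (\<lambda>z. complex_of_real (F z))) \<le> 2"
proof -
  let ?t = "\<lambda>i. \<Phi>2 (slice (\<lambda>z. complex_of_real (F z)) (node N i)) * \<Phi>1 (bump N i)"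
  have part: "norm (\<Sum>i\<in>J. ?t i) \<le> 1"
    if J: "J \<subseteq> {..N}" "\<And>i j. i \<in> J \<Longrightarrow> j \<in> J \<Longrightarrow> i \<noteq> j \<Longrightarrow> i + 2 \<le> j \<or> j + 2 \<le> i" for J
  proof -
    have "norm (\<Sum>i\<in>J. \<Phi>2 (\<lambda>t. complex_of_real (F (Complex (node N i) (Re t)))) * \<Phi>1 (bump N i)) \<le> 1"
    proof (rule orthogonal_bumps_norm_real[OF J])
      fix i assume "i \<in> J"
      then have n: "\<bar>node N i\<bar> \<le> R" using J(1) node_in[OF \<open>0 < N\<close>] by auto
      show "continuous_on (interval R) (\<lambda>t. F (Complex (node N i) (Re t)))"
        using continuous_on_Re[OF cont_slice[OF F n]] by (simp add: slice_def)
      show "\<bar>F (Complex (node N i) (Re t))\<bar> \<le> 1" if "t \<in> interval R" for t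
        using that n by (intro M) (auto simp: square_iff interval_iff)
    qed
    then show ?thesis by (simp add: slice_def[abs_def])
  qed
  have "{..N} = {i. i \<le> N \<and> even i} \<union> {i. i \<le> N \<and> odd i}" by auto
  then have "interp N (\<lambda>z. complex_of_real (F z)) = (\<Sum>i\<in>{i. i \<le> N \<and> even i}. ?t i) + (\<Sum>i\<in>{i. i \<le> N \<and> odd i}. ?t i)"
    unfolding interp_def using sum.union_disjoint[of "{i. i \<le> N \<and> even i}" "{i. i \<le> N \<and> odd i}" ?t] by auto
  also have "norm \<dots> \<le> 1 + 1"
  proof (intro order_trans[OF norm_triangle_ineq] add_mono part)
    show "i + 2 \<le> j \<or> j + 2 \<le> i" if "i \<in> {i. i \<le> N \<and> even i}" "j \<in> {i. i \<le> N \<and> even i}" "i \<noteq> j" for i j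
      using that by (auto elim!: evenE)
    show "i + 2 \<le> j \<or> j + 2 \<le> i" if "i \<in> {i. i \<le> N \<and> odd i}" "j \<in> {i. i \<le> N \<and> odd i}" "i \<noteq> j" for i j
      using that by (auto elim!: oddE)
  qed auto
  finally show ?thesis by simp
qed

lemma interp_norm:
  assumes F: "continuous_on (square R) F" and M: "\<And>z. z \<in> square R \<Longrightarrow> cmod (F z) \<le> M" "M > 0" and "0 < N"
  shows "norm (interp N F) \<le> 4 * M"
proof -
  define G H where "G z = Re (F z) / M" and "H z = Im (F z) / M" for z
  have c: "continuous_on (square R) (\<lambda>z. complex_of_real (G z))" "continuous_on (square R) (\<lambda>z. complex_of_real (H z))"
    unfolding G_def H_def using M(2) by (auto intro!: continuous_intros F)
  have b: "\<bar>G z\<bar> \<le> 1" "\<bar>H z\<bar> \<le> 1" if "z \<in> square R" for z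
    using M(1)[OF that] M(2) abs_Re_le_cmod[of "F z"] abs_Im_le_cmod[of "F z"] by (auto simp: G_def H_def)
  have "F = (\<lambda>z. complex_of_real M * complex_of_real (G z) + (\<i> * complex_of_real M) * complex_of_real (H z))"
    using M(2) by (auto simp: G_def H_def complex_eq_iff)
  then have "interp N F = complex_of_real M *\<^sub>C interp N (\<lambda>z. complex_of_real (G z)) + (\<i> * complex_of_real M) *\<^sub>C interp N (\<lambda>z. complex_of_real (H z))"
    using c \<open>0 < N\<close> by (simp add: interp_add interp_cmult continuous_on_mult_left)
  also have "norm \<dots> \<le> M * 2 + M * 2"
    using interp_norm_real[OF c(1) b(1) \<open>0 < N\<close>] interp_norm_real[OF c(2) b(2) \<open>0 < N\<close>] M(2)
    by (intro order_trans[OF norm_triangle_ineq] add_mono) (auto simp: norm_scaleC norm_mult)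
  finally show ?thesis by simp
qed

text \<open>For a product \<open>f(a) g(b)\<close> the interpolation concerns \<open>f\<close> only, and converges by uniform continuity.\<close>

lemma interp_tendsto:
  assumes "(F, T) \<in> tensor R \<Phi>1 \<Phi>2"
  shows "(\<lambda>n. interp (Suc n) F) \<longlonglongrightarrow> T"
  using assms
proof (induction rule: tensor.induct)
  case (tensor_elem f g)
  define F where "F z = f (complex_of_real (Re z)) * g (complex_of_real (Im z))" for z
  define p where "p N t = (\<Sum>i\<le>N. f (complex_of_real (node N i)) * bump N i t)" for N t
  have pc: "continuous_on (interval R) (p N)" for N unfolding p_def by (intro continuous_intros cont_bump)
  have eq: "interp N F = \<Phi>2 g * \<Phi>1 (p N)" for N
  proof -
    have "\<Phi>2 (slice F (node N i)) = f (complex_of_real (node N i)) *\<^sub>C \<Phi>2 g" for i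
    proof -
      have "\<Phi>2 (\<lambda>t. f (complex_of_real (node N i)) * g t) = \<Phi>2 (slice F (node N i))"
      proof (rule h2.hom_cong)
        show "continuous_on (interval R) (\<lambda>t. f (complex_of_real (node N i)) * g t)"
          by (intro continuous_intros tensor_elem)
        fix t assume "t \<in> interval R"
        then have "complex_of_real (Re t) = t" by (simp add: interval_iff complex_eq_iff)
        then show "f (complex_of_real (node N i)) * g t = slice F (node N i) t" by (simp add: slice_def F_def)
      qed
      then show ?thesis using h2.hom_cmult[OF tensor_elem(2)] by simp
    qed
    moreover have "\<Phi>1 (p N) = (\<Sum>i\<le>N. f (complex_of_real (node N i)) *\<^sub>C \<Phi>1 (bump N i))"
      unfolding p_def using cont_bump[of "interval R" N]
      by (subst h1.hom_sum) (auto intro!: continuous_intros simp: h1.hom_cmult)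
    ultimately show ?thesis
      by (simp add: interp_def sum_distrib_left mult_scaleC_left mult_scaleC_right)
  qed
  have "(\<lambda>n. \<Phi>1 (p (Suc n))) \<longlonglongrightarrow> \<Phi>1 f"
  proof (rule LIMSEQ_I)
    fix e :: real assume "e > 0"
    have "uniformly_continuous_on (interval R) f"
      by (rule compact_uniformly_continuous[OF tensor_elem(1) compact_interval])
    then obtain d where d: "d > 0" "\<And>s t. s \<in> interval R \<Longrightarrow> t \<in> interval R \<Longrightarrow> dist t s < d \<Longrightarrow> dist (f t) (f s) < e/2"
      unfolding uniformly_continuous_on_def using \<open>e > 0\<close> by (metis half_gt_zero)
    obtain n0 where n0: "2 * R / d < real n0" using reals_Archimedean2 by blast
    have "norm (\<Phi>1 (p (Suc n)) - \<Phi>1 f) < e" if "n \<ge> n0" for n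
    proof -
      have N: "2 * R / real (Suc n) < d" using n0 that \<open>d > 0\<close> R by (simp add: field_simps) (smt (verit) mult_left_mono of_nat_mono)
      have "norm (\<Phi>1 (p (Suc n)) - \<Phi>1 f) \<le> e/2"
      proof (rule h1.hom_norm_diff_le[OF pc tensor_elem(1)])
        fix t assume t: "t \<in> interval R"
        have "p (Suc n) t - f t = (\<Sum>i\<le>Suc n. (f (complex_of_real (node (Suc n) i)) - f t) * bump (Suc n) i t)"
          using bump_sum[OF t, of "Suc n"] unfolding p_def left_diff_distrib sum_subtractf sum_distrib_left[symmetric] by simp
        also have "cmod \<dots> \<le> (\<Sum>i\<le>Suc n. e/2 * cmod (bump (Suc n) i t))"
        proof (rule sum_norm_le)
          fix i assume i: "i \<in> {..Suc n}"
          show "cmod ((f (complex_of_real (node (Suc n) i)) - f t) * bump (Suc n) i t) \<le> e/2 * cmod (bump (Suc n) i t)"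
          proof (cases "bump (Suc n) i t = 0")
            case False
            have "t = complex_of_real (Re t)" using t by (simp add: interval_iff complex_eq_iff)
            then have "dist (complex_of_real (node (Suc n) i)) t = \<bar>node (Suc n) i - Re t\<bar>"
              by (metis dist_norm norm_of_real of_real_diff)
            also have "\<dots> \<le> 2 * R / real (Suc n)" using bump_near[OF _ False] by (simp add: abs_minus_commute)
            also have "\<dots> < d" by (rule N)
            finally have "dist (f (complex_of_real (node (Suc n) i))) (f t) < e/2"
              using t i node_in[of "Suc n" i] by (intro d(2)) (auto simp: interval_iff)
            then show ?thesis unfolding norm_mult by (intro mult_right_mono) (auto simp: dist_norm)
          qed simp
        qed
        also have "\<dots> = e/2 * (\<Sum>i\<le>Suc n. hat i ((Re t + R) * real (Suc n) / (2 * R)))"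
          unfolding sum_distrib_left[symmetric] bump_def using hat_bounds(1) by simp
        also have "\<dots> = e/2" using hat_sum[OF scaled_coordinate[OF t], of "Suc n"] by simp
        finally show "cmod (p (Suc n) t - f t) \<le> e/2" .
      qed (use \<open>e > 0\<close> in simp)
      then show ?thesis using \<open>e > 0\<close> by simp
    qed
    then show "\<exists>n0. \<forall>n\<ge>n0. norm (\<Phi>1 (p (Suc n)) - \<Phi>1 f) < e" by blast
  qed
  then have "(\<lambda>n. interp (Suc n) F) \<longlonglongrightarrow> \<Phi>2 g * \<Phi>1 f" unfolding eq by (intro tendsto_mult tendsto_const)
  then show ?case using commute[OF tensor_elem] by (simp add: F_def[abs_def])
next
  case (tensor_add F S G T)
  have "interp (Suc n) (\<lambda>z. F z + G z) = interp (Suc n) F + interp (Suc n) G" for n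
    by (rule interp_add[OF tensor_continuous[OF tensor_add(1)] tensor_continuous[OF tensor_add(2)]]) simp
  then show ?case using tendsto_add[OF tensor_add.IH] by simp
qed

lemma tensor_norm:
  assumes "(F, T) \<in> tensor R \<Phi>1 \<Phi>2" "0 \<le> M" "\<And>z. z \<in> square R \<Longrightarrow> cmod (F z) \<le> M"
  shows "norm T \<le> 4 * M"
proof -
  have *: "norm T \<le> 4 * (M + e)" if "e > 0" for e
  proof -
    have "norm (interp (Suc n) F) \<le> 4 * (M + e)" for n
      by (rule interp_norm[OF tensor_continuous[OF assms(1)]]) (use assms(2,3) that in \<open>auto intro: add_increasing2\<close>)
    then show ?thesis by (intro Lim_norm_ubound[OF _ interp_tendsto[OF assms(1)]]) auto
  qed
  have "norm T / 4 \<le> M + e" if "e > 0" for e using *[OF that] by simp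
  then have "norm T / 4 \<le> M" by (rule field_le_epsilon)
  then show ?thesis by simp
qed

lemma gen_tensor:
  assumes x: "x = \<Phi>1 (\<lambda>z. z) + \<i> *\<^sub>C \<Phi>2 (\<lambda>z. z)" and "(F, y) \<in> gen x"
  shows "(F, y) \<in> tensor R \<Phi>1 \<Phi>2"
  using assms(2)
proof (induction rule: gen.induct)
  case (gen_const c)
  have "((\<lambda>z. c * 1), \<Phi>1 (\<lambda>_. c) * \<Phi>2 (\<lambda>_. 1)) \<in> tensor R \<Phi>1 \<Phi>2"
    using tensor_elem[of R "\<lambda>_. c" "\<lambda>_. 1"] by simp
  then show ?case by (simp add: h1.hom_const h2.hom_one)
next
  case gen_id
  have "((\<lambda>z. complex_of_real (Re z) * 1 + 1 * (\<i> * complex_of_real (Im z))),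
      \<Phi>1 (\<lambda>z. z) * \<Phi>2 (\<lambda>z. 1) + \<Phi>1 (\<lambda>z. 1) * \<Phi>2 (\<lambda>z. \<i> * z)) \<in> tensor R \<Phi>1 \<Phi>2"
    by (intro tensor_add tensor_elem[of R "\<lambda>z. z" "\<lambda>_. 1"] tensor_elem[of R "\<lambda>_. 1" "\<lambda>z. \<i> * z"] continuous_intros)
  moreover have "(\<lambda>z. complex_of_real (Re z) * 1 + 1 * (\<i> * complex_of_real (Im z))) = (\<lambda>z. z)"
    by (auto simp: complex_eq_iff)
  ultimately show ?case by (simp add: x h1.hom_one h2.hom_one h2.hom_cmult)
next
  case gen_cnj
  have "((\<lambda>z. complex_of_real (Re z) * 1 + 1 * (- \<i> * complex_of_real (Im z))),
      \<Phi>1 (\<lambda>z. z) * \<Phi>2 (\<lambda>z. 1) + \<Phi>1 (\<lambda>z. 1) * \<Phi>2 (\<lambda>z. - \<i> * z)) \<in> tensor R \<Phi>1 \<Phi>2"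
    by (intro tensor_add tensor_elem[of R "\<lambda>z. z" "\<lambda>_. 1"] tensor_elem[of R "\<lambda>_. 1" "\<lambda>z. - \<i> * z"] continuous_intros)
  moreover have "(\<lambda>z. complex_of_real (Re z) * 1 + 1 * (- \<i> * complex_of_real (Im z))) = cnj"
    by (auto simp: complex_eq_iff)
  moreover have "\<Phi>2 (\<lambda>z. - \<i> * z) = - \<i> *\<^sub>C \<Phi>2 (\<lambda>z. z)" by (rule h2.hom_cmult) simp
  moreover have "star (\<Phi>1 (\<lambda>z. z)) = \<Phi>1 (\<lambda>z. z)" "star (\<Phi>2 (\<lambda>z. z)) = \<Phi>2 (\<lambda>z. z)"
    by (rule h1.hom_selfadjoint h2.hom_selfadjoint; simp add: interval_iff complex_is_Real_iff)+
  ultimately show ?case by (simp add: x h1.hom_one h2.hom_one star_add star_scaleC)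
qed (auto intro: tensor_add tensor_mult)

end

text \<open>The real and imaginary parts commute, and every polynomial in \<open>x\<close> and \<open>star x\<close> lies in their \<open>tensor\<close>.\<close>

theorem (in af) normal_calculus:
  fixes x :: 'a
  assumes x: "normal_element x" and R: "norm x < R"
  obtains \<Phi> where "unital_star_hom (square R) \<Phi>" "\<Phi> (\<lambda>z. z) = x"
proof -
  define a b where "a = (1/2) *\<^sub>C (x + star x)" and "b = (- \<i>/2) *\<^sub>C (x - star x)"
  have xab: "x = a + \<i> *\<^sub>C b"
  proof -
    have "\<i> *\<^sub>C b = (1/2) *\<^sub>C (x - star x)" by (simp add: b_def scaleC_scaleC)
    then have "a + \<i> *\<^sub>C b = (1/2) *\<^sub>C ((x + star x) + (x - star x))"
      by (simp only: a_def scaleC_add_right)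
    also have "(x + star x) + (x - star x) = x + x" by simp
    also have "(1/2) *\<^sub>C (x + x) = (1/2) *\<^sub>C x + (1/2) *\<^sub>C x" by (rule scaleC_add_right)
    also have "\<dots> = x" using scaleC_add_left[of "1/2" "1/2" x] by simp
    finally show ?thesis by simp
  qed
  have sa: "star a = a" "star b = b"
  proof -
    show "star a = a" by (simp add: a_def star_scaleC star_add star_star add.commute)
    have "star b = (\<i>/2) *\<^sub>C (star x - x)" by (simp add: b_def star_scaleC star_diff star_star)
    also have "\<dots> = (\<i>/2) *\<^sub>C (- (x - star x))" by simp
    also have "\<dots> = b" unfolding b_def complex_vector.scale_minus_right by (simp flip: complex_vector.scale_minus_left)
    finally show "star b = b" .
  qed
  have na: "norm a < R" "norm b < R"
    using norm_triangle_ineq[of x "star x"] norm_triangle_ineq4[of x "star x"] R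
    by (auto simp: a_def b_def norm_scaleC norm_divide)
  have "R > 0" using R norm_ge_zero[of x] by linarith
  have ab: "a * b = b * a"
    using x by (simp add: a_def b_def mult_scaleC_left mult_scaleC_right normal_element_def algebra_simps)
  obtain \<Phi>1 where \<Phi>1: "unital_star_hom (interval R) \<Phi>1" "\<Phi>1 (\<lambda>z. z) = a"
    unfolding interval_def by (rule selfadjoint_calculus[OF sa(1) na(1)])
  obtain \<Phi>2 where \<Phi>2: "unital_star_hom (interval R) \<Phi>2" "\<Phi>2 (\<lambda>z. z) = b"
    unfolding interval_def by (rule selfadjoint_calculus[OF sa(2) na(2)])
  have c1: "\<Phi>1 f * b = b * \<Phi>1 f" if "continuous_on (interval R) f" for f
    by (rule hom_commute_elt[OF \<Phi>1(1) compact_interval \<Phi>1(2) that]) (use ab sa in auto)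
  have c2: "\<Phi>2 g * \<Phi>1 f = \<Phi>1 f * \<Phi>2 g" if "continuous_on (interval R) f" "continuous_on (interval R) g" for f g
    by (rule hom_commute_elt[OF \<Phi>2(1) compact_interval \<Phi>2(2) that(2)]) (use c1[OF that(1)] sa in auto)
  interpret commuting_homs R \<Phi>1 \<Phi>2
    using \<open>R > 0\<close> \<Phi>1(1) \<Phi>2(1) c2 by unfold_locales auto
  show ?thesis
  proof (rule calculus_extension[OF compact_square[of R], of 4 x])
    fix F y M assume "(F, y) \<in> gen x" "0 \<le> M" "\<And>z. z \<in> square R \<Longrightarrow> cmod (F z) \<le> M"
    then show "norm y \<le> 4 * M" using gen_tensor[of x F y] xab \<Phi>1(2) \<Phi>2(2) by (intro tensor_norm) auto
  qed (use that in auto)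
qed

subsection \<open>Restriction to the spectrum\<close>

text \<open>Since \<open>b\<close> is a left inverse of \<open>x - l\<close>, \<open>\<Phi> f = b ^ n * \<Phi> ((z - l) ^ n * f)\<close>, whose norm decays like \<open>(d * norm b) ^ n\<close>.\<close>

lemma hom_zero_near:
  assumes hom: "unital_star_hom K \<Phi>" "\<Phi> (\<lambda>z. z) = x" and K: "compact K"
    and b: "b * (x - l *\<^sub>C 1) = 1" and d: "d * norm b < 1" "0 \<le> d"
    and f: "continuous_on K f" "\<And>z. z \<in> K \<Longrightarrow> d \<le> cmod (z - l) \<Longrightarrow> f z = 0"
  shows "\<Phi> f = 0"
proof -
  interpret star_hom K \<Phi> by (rule star_homI[OF hom(1)])
  obtain M where M: "\<And>z. z \<in> K \<Longrightarrow> cmod (f z) \<le> M" "0 \<le> M"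
    using compact_imp_bounded[OF compact_continuous_image[OF f(1) K]] unfolding bounded_iff
    by (metis abs_ge_zero abs_ge_self image_eqI order_trans)
  have id: "\<Phi> (\<lambda>z. z - l) = x - l *\<^sub>C 1" by (simp add: hom_diff hom_const hom(2))
  have eq: "\<Phi> f = b ^ n * \<Phi> (\<lambda>z. (z - l) ^ n * f z)" for n
  proof (induction n)
    case (Suc n)
    have "\<Phi> (\<lambda>z. (z - l) * ((z - l) ^ n * f z)) = (x - l *\<^sub>C 1) * \<Phi> (\<lambda>z. (z - l) ^ n * f z)"
      unfolding id[symmetric] by (rule hom_mult) (intro continuous_intros f(1))+
    moreover have "(\<lambda>z. (z - l) ^ Suc n * f z) = (\<lambda>z. (z - l) * ((z - l) ^ n * f z))"
      by (simp add: mult.assoc)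
    moreover have "b ^ Suc n = b ^ n * b" by (rule power_Suc2)
    ultimately have "b ^ Suc n * \<Phi> (\<lambda>z. (z - l) ^ Suc n * f z) = b ^ n * (b * (x - l *\<^sub>C 1)) * \<Phi> (\<lambda>z. (z - l) ^ n * f z)"
      by (simp only: mult.assoc)
    then show ?case using Suc b by simp
  qed simp
  have "norm (\<Phi> f) \<le> (d * norm b) ^ n * M" for n
  proof -
    have "norm (\<Phi> (\<lambda>z. (z - l) ^ n * f z)) \<le> d ^ n * M"
    proof (rule hom_norm_le)
      fix z assume z: "z \<in> K"
      show "cmod ((z - l) ^ n * f z) \<le> d ^ n * M"
      proof (cases "d \<le> cmod (z - l)")
        case True then show ?thesis using f(2)[OF z True] M(2) d(2) by simp
      next
        case False
        then show ?thesis using M(1)[OF z] d(2) M(2)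
          by (auto simp: norm_mult norm_power intro!: mult_mono power_mono)
      qed
    qed (use M d in \<open>auto intro!: continuous_intros f(1)\<close>)
    moreover have "norm (\<Phi> f) \<le> norm b ^ n * norm (\<Phi> (\<lambda>z. (z - l) ^ n * f z))"
      (is "_ \<le> _ * ?N")
    proof -
      have "norm (\<Phi> f) \<le> norm (b ^ n) * ?N" by (subst eq[of n]) (rule norm_mult_ineq)
      also have "\<dots> \<le> norm b ^ n * ?N" by (intro mult_right_mono norm_power_ineq norm_ge_zero)
      finally show ?thesis .
    qed
    ultimately have "norm (\<Phi> f) \<le> norm b ^ n * (d ^ n * M)"
      by (meson mult_left_mono norm_ge_zero order_trans zero_le_power)
    then show ?thesis by (simp add: power_mult_distrib mult_ac)
  qed
  moreover have lim: "(\<lambda>n. (d * norm b) ^ n * M) \<longlonglongrightarrow> 0"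
    using d by (intro tendsto_mult_left_zero LIMSEQ_realpow_zero) auto
  ultimately have "norm (\<Phi> f) \<le> 0" by (intro LIMSEQ_le_const[OF lim]) blast
  then show ?thesis by simp
qed

text \<open>Finitely many discs as in \<open>hom_zero_near\<close> cover the support, and a partition of unity decomposes \<open>f\<close>.\<close>

lemma hom_zero_off_spectrum:
  assumes hom: "unital_star_hom K \<Phi>" "\<Phi> (\<lambda>z. z) = x" and K: "compact K"
    and f: "continuous_on K f" and C: "compact C" "C \<subseteq> K" "C \<inter> spectrum x = {}" "\<And>z. z \<in> K \<Longrightarrow> z \<notin> C \<Longrightarrow> f z = 0"
  shows "\<Phi> f = 0"
proof -
  interpret star_hom K \<Phi> by (rule star_homI[OF hom(1)])
  have "\<exists>b d. b * (x - l *\<^sub>C 1) = 1 \<and> d * norm b < 1 \<and> 0 < d" if l: "l \<in> C" for l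
  proof -
    have "invertible_elt (x - l *\<^sub>C 1)" using l C(3) by (auto simp: spectrum_alt)
    then obtain b where b: "b * (x - l *\<^sub>C 1) = 1" by (auto simp: invertible_elt_def)
    have "0 < norm b + 1" using norm_ge_zero[of b] by linarith
    then have "1 / (norm b + 1) * norm b < 1" "0 < 1 / (norm b + 1)" by (auto simp: field_simps)
    with b show ?thesis by blast
  qed
  then obtain b d where bd: "\<And>l. l \<in> C \<Longrightarrow> b l * (x - l *\<^sub>C 1) = 1 \<and> d l * norm (b l) < 1 \<and> 0 < d l" by metis
  have "C \<subseteq> (\<Union>l\<in>C. ball l (d l))" using bd by auto
  then obtain L where L: "L \<subseteq> C" "finite L" "C \<subseteq> (\<Union>l\<in>L. ball l (d l))"
    using compactE_image[OF C(1), of C "\<lambda>l. ball l (d l)"] by auto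
  define w where "w l z = max 0 (d l - cmod (z - l))" for l z
  define W where "W z = (\<Sum>l\<in>L. w l z)" for z
  have wc: "continuous_on S (w l)" "continuous_on S W" for l S
    unfolding w_def W_def by (intro continuous_intros)+
  have W: "W z > 0" if zC: "z \<in> C" for z
  proof -
    obtain l where l: "l \<in> L" "z \<in> ball l (d l)" using L(3) zC by blast
    then have "w l z > 0" by (simp add: w_def dist_norm norm_minus_commute)
    moreover have "w l z \<le> W z" unfolding W_def using l L(2) by (intro member_le_sum) (auto simp: w_def)
    ultimately show ?thesis by simp
  qed
  obtain m where m: "m > 0" "\<And>z. z \<in> C \<Longrightarrow> m \<le> W z"
  proof (cases "C = {}")
    case False
    then obtain z0 where "z0 \<in> C" "\<And>z. z \<in> C \<Longrightarrow> W z0 \<le> W z"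
      using continuous_attains_inf[OF C(1) _ wc(2)] by metis
    then show ?thesis using that[of "W z0"] W by blast
  qed (use that[of 1] in auto)
  define g where "g z = f z / complex_of_real (max m (W z))" for z
  have gc: "continuous_on K g" unfolding g_def using m(1)
    by (intro continuous_intros f wc) (auto simp: max_def)
  have "\<Phi> f = \<Phi> (\<lambda>z. \<Sum>l\<in>L. g z * complex_of_real (w l z))"
  proof (rule hom_cong[OF f])
    fix z assume z: "z \<in> K"
    show "f z = (\<Sum>l\<in>L. g z * complex_of_real (w l z))"
    proof (cases "z \<in> C")
      case True
      then have "g z = f z / complex_of_real (W z)" "W z > 0" using m(2)[OF True] W by (auto simp: g_def)
      then have "f z = g z * complex_of_real (W z)" by simp
      then show ?thesis by (simp add: W_def sum_distrib_left)
    next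
      case False then show ?thesis using C(4)[OF z] by (simp add: g_def)
    qed
  qed
  also have "\<dots> = (\<Sum>l\<in>L. \<Phi> (\<lambda>z. g z * complex_of_real (w l z)))"
    by (rule hom_sum) (intro continuous_intros gc wc)
  also have "\<dots> = 0"
  proof (rule sum.neutral, rule ballI)
    fix l assume "l \<in> L"
    then have l: "b l * (x - l *\<^sub>C 1) = 1" "d l * norm (b l) < 1" "0 \<le> d l" using bd L(1) by (auto intro: less_imp_le)
    show "\<Phi> (\<lambda>z. g z * complex_of_real (w l z)) = 0"
      by (rule hom_zero_near[OF hom K l]) (auto intro!: continuous_intros gc wc simp: w_def)
  qed
  finally show ?thesis .
qed

text \<open>Cutting off the small values changes \<open>f\<close> by at most \<open>e\<close> and makes it vanish near the spectrum.\<close>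

lemma hom_zero_if_zero_on_spectrum:
  assumes hom: "unital_star_hom K \<Phi>" "\<Phi> (\<lambda>z. z) = x" and K: "compact K"
    and f: "continuous_on K f" "\<And>z. z \<in> K \<Longrightarrow> z \<in> spectrum x \<Longrightarrow> f z = 0"
  shows "\<Phi> f = 0"
proof -
  interpret star_hom K \<Phi> by (rule star_homI[OF hom(1)])
  have "norm (\<Phi> f) \<le> e" if "e > 0" for e
  proof -
    define g where "g z = f z * complex_of_real (ramp (2 * cmod (f z) / e - 1))" for z
    have gc: "continuous_on K g" unfolding g_def using \<open>e > 0\<close> by (intro continuous_intros f(1)) auto
    define C where "C = {z\<in>K. e / 2 \<le> cmod (f z)}"
    have "closedin (top_of_set K) (K \<inter> (\<lambda>z. cmod (f z)) -` {e/2..})"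
      by (rule continuous_closedin_preimage) (auto intro!: continuous_intros f(1))
    moreover have "K \<inter> (\<lambda>z. cmod (f z)) -` {e/2..} = {z\<in>K. e / 2 \<le> cmod (f z)}" by auto
    ultimately have C: "compact C" unfolding C_def using closedin_compact[OF K] by auto
    have "\<Phi> g = 0"
    proof (rule hom_zero_off_spectrum[OF hom K gc C])
      show "C \<inter> spectrum x = {}" using f(2) \<open>e > 0\<close> by (force simp: C_def)
      fix z assume "z \<in> K" "z \<notin> C"
      then have "2 * cmod (f z) / e - 1 \<le> 0" using \<open>e > 0\<close> by (simp add: C_def field_simps)
      then show "g z = 0" by (simp add: g_def ramp_simps)
    qed (auto simp: C_def)
    moreover have "norm (\<Phi> f - \<Phi> g) \<le> e"
    proof (rule hom_norm_diff_le[OF f(1) gc])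
      fix z assume "z \<in> K"
      let ?r = "ramp (2 * cmod (f z) / e - 1)"
      have "f z - g z = complex_of_real (1 - ?r) * f z" by (simp add: g_def algebra_simps)
      then have "cmod (f z - g z) = (1 - ?r) * cmod (f z)" using ramp_bounds[of "2 * cmod (f z) / e - 1"]
        by (simp only: norm_mult norm_of_real)
      also have "\<dots> \<le> e"
      proof (cases "cmod (f z) \<le> e")
        case True
        then show ?thesis using ramp_bounds[of "2 * cmod (f z) / e - 1"] mult_left_le_one_le[of "cmod (f z)" "1 - ?r"] by simp
      next
        case False
        then have "1 \<le> 2 * cmod (f z) / e - 1" using \<open>e > 0\<close> by (simp add: field_simps)
        then show ?thesis using \<open>e > 0\<close> by (simp add: ramp_simps)
      qed
      finally show "cmod (f z - g z) \<le> e" .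
    qed (use \<open>e > 0\<close> in simp)
    ultimately show ?thesis by simp
  qed
  then have "norm (\<Phi> f) \<le> 0" by (rule dense_ge)
  then show ?thesis by simp
qed

lemma spectrum_subset_square: "norm x < R \<Longrightarrow> spectrum x \<subseteq> square R"
  using spectrum_bound[of _ x] abs_Re_le_cmod abs_Im_le_cmod
  by (fastforce simp: square_iff intro: order_trans less_imp_le)

text \<open>The calculus on a square annihilates the functions that vanish on the spectrum, so it factors through restriction to the spectrum;
  continuous functions on the spectrum are extended by Tietze's theorem.\<close>

theorem (in af) cfc_hom:
  fixes x :: 'a
  assumes x: "normal_element x"
  shows "unital_star_hom (spectrum x) (cfc x)" "cfc x (\<lambda>z. z) = x"
proof -
  define R where "R = norm x + 1"
  obtain \<Phi> where \<Phi>: "unital_star_hom (square R) \<Phi>" "\<Phi> (\<lambda>z. z) = x"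
    using normal_calculus[OF x, of R] by (auto simp: R_def)
  interpret star_hom "square R" \<Phi> by (rule star_homI[OF \<Phi>(1)])
  have sp: "spectrum x \<subseteq> square R" by (rule spectrum_subset_square) (simp add: R_def)
  have eqI: "\<Phi> f = \<Phi> g" if "continuous_on (square R) f" "continuous_on (square R) g" "\<And>z. z \<in> spectrum x \<Longrightarrow> f z = g z" for f g
  proof -
    have "\<Phi> (\<lambda>z. f z - g z) = 0"
      by (rule hom_zero_if_zero_on_spectrum[OF \<Phi> compact_square]) (use that in \<open>auto intro: continuous_intros\<close>)
    then show ?thesis using that by (simp add: hom_diff)
  qed
  have "\<exists>g. continuous_on UNIV g \<and> (\<forall>z\<in>spectrum x. g z = f z)" if f: "continuous_on (spectrum x) f" for f :: "complex \<Rightarrow> complex"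
    using Tietze_unbounded[OF f, of UNIV] closed_spectrum[of x] by (metis closed_closedin subtopology_UNIV)
  then obtain E where E: "\<And>f. continuous_on (spectrum x) f \<Longrightarrow> continuous_on UNIV (E f :: complex \<Rightarrow> complex)"
    "\<And>f z. continuous_on (spectrum x) f \<Longrightarrow> z \<in> spectrum x \<Longrightarrow> E f z = f z" by metis
  have Ec: "continuous_on (square R) (E f)" if "continuous_on (spectrum x) f" for f
    using E(1)[OF that] continuous_on_subset by blast
  define \<Psi> where "\<Psi> f = \<Phi> (E f)" for f
  have \<Psi>: "\<Psi> f = \<Phi> g" if "continuous_on (square R) g" "\<And>z. z \<in> spectrum x \<Longrightarrow> f z = g z" for f g
  proof -
    have "continuous_on (spectrum x) f"
      using continuous_on_subset[OF that(1) sp] that(2) by (metis (no_types, lifting) continuous_on_cong)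
    then show ?thesis unfolding \<Psi>_def using that E by (intro eqI Ec) auto
  qed
  have "unital_star_hom (spectrum x) \<Psi>"
    unfolding unital_star_hom_def
  proof (intro conjI allI impI)
    fix f g :: "complex \<Rightarrow> complex"
    assume f: "continuous_on (spectrum x) f" and g: "continuous_on (spectrum x) g"
    note c = Ec[OF f] Ec[OF g]
    show "\<Psi> f = \<Psi> g" if "\<forall>t\<in>spectrum x. f t = g t"
      using \<Psi>[OF c(2), of f] \<Psi>[OF c(2), of g] E(2) g that by auto
    show "\<Psi> (\<lambda>t. f t + g t) = \<Psi> f + \<Psi> g"
      using \<Psi>[of "\<lambda>t. E f t + E g t" "\<lambda>t. f t + g t"] E(2) f g c
      by (simp add: hom_add continuous_on_add) (simp add: \<Psi>_def)
    show "\<Psi> (\<lambda>t. f t * g t) = \<Psi> f * \<Psi> g"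
      using \<Psi>[of "\<lambda>t. E f t * E g t" "\<lambda>t. f t * g t"] E(2) f g c
      by (simp add: hom_mult continuous_on_mult) (simp add: \<Psi>_def)
  next
    fix f :: "complex \<Rightarrow> complex" and k
    assume f: "continuous_on (spectrum x) f"
    show "\<Psi> (\<lambda>t. k * f t) = k *\<^sub>C \<Psi> f"
      using \<Psi>[of "\<lambda>t. k * E f t" "\<lambda>t. k * f t"] E(2) f Ec[OF f]
      by (simp add: hom_cmult continuous_on_mult_left) (simp add: \<Psi>_def)
  next
    fix f :: "complex \<Rightarrow> complex"
    assume f: "continuous_on (spectrum x) f"
    show "\<Psi> (\<lambda>t. cnj (f t)) = star (\<Psi> f)"
      using \<Psi>[of "\<lambda>t. cnj (E f t)" "\<lambda>t. cnj (f t)"] E(2) f Ec[OF f]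
      by (simp add: hom_star continuous_on_cnj) (simp add: \<Psi>_def)
  next
    show "\<Psi> (\<lambda>t. 1) = 1" using \<Psi>[of "\<lambda>t. 1" "\<lambda>t. 1"] by (simp add: hom_one)
  qed
  moreover have "\<Psi> (\<lambda>z. z) = x" using \<Psi>[of "\<lambda>z. z" "\<lambda>z. z"] \<Phi>(2) by simp
  ultimately have "\<exists>\<Psi>. unital_star_hom (spectrum x) \<Psi> \<and> \<Psi> (\<lambda>z. z) = x" by blast
  then have "unital_star_hom (spectrum x) (cfc x) \<and> cfc x (\<lambda>z. z) = x"
    unfolding cfc_def by (rule someI_ex)
  then show "unital_star_hom (spectrum x) (cfc x)" "cfc x (\<lambda>z. z) = x" by auto
qed

text \<open>Two homomorphisms with the same value at the identity agree on polynomials, which are dense.\<close>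

lemma hom_unique:
  assumes hom: "unital_star_hom K \<Phi>" "\<Phi> (\<lambda>z. z) = x" "unital_star_hom S \<Psi>" "\<Psi> (\<lambda>z. z) = x"
    and K: "compact K" "S \<subseteq> K" and f: "continuous_on K f"
  shows "\<Phi> f = \<Psi> f"
proof -
  interpret p: star_hom K \<Phi> by (rule star_homI[OF hom(1)])
  interpret s: star_hom K \<Psi> by (rule star_homI[OF unital_star_hom_mono[OF hom(3) K(2)]])
  have "norm (\<Phi> f - \<Psi> f) \<le> e" if "e > 0" for e
  proof -
    obtain F where F: "F \<in> zpoly" "\<And>z. z \<in> K \<Longrightarrow> cmod (f z - F z) < e/2"
      using zpoly_dense[OF K(1) f, of "e/2"] \<open>e > 0\<close> by auto
    obtain y where y: "(F, y) \<in> gen x" using zpoly_gen[OF F(1)] by blast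
    have "\<Phi> F = y" "\<Psi> F = y" using p.hom_gen[OF continuous_on_id hom(2) y] s.hom_gen[OF continuous_on_id hom(4) y] by auto
    moreover have "norm (\<Phi> f - \<Phi> F) \<le> e/2" "norm (\<Psi> f - \<Psi> F) \<le> e/2"
      by (rule p.hom_norm_diff_le[OF f continuous_on_zpoly[OF F(1)]]
          s.hom_norm_diff_le[OF f continuous_on_zpoly[OF F(1)]];
        use F(2) \<open>e > 0\<close> in \<open>auto intro: less_imp_le\<close>)+
    ultimately show ?thesis using norm_triangle_ineq4[of "\<Phi> f - y" "\<Psi> f - y"] by simp
  qed
  then have "norm (\<Phi> f - \<Psi> f) \<le> 0" by (rule dense_ge)
  then show ?thesis by simp
qed

section \<open>Punching holes into the spectrum\<close>

lemma continuous_on_sgn_complex [continuous_intros]: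
  fixes f :: "'t::topological_space \<Rightarrow> complex"
  shows "continuous_on S f \<Longrightarrow> (\<And>x. x \<in> S \<Longrightarrow> f x \<noteq> 0) \<Longrightarrow> continuous_on S (\<lambda>x. sgn (f x))"
  by (rule continuous_on_sgn) auto

locale disc_hom = star_hom K \<Phi> for K :: "complex set" and \<Phi> :: "(complex \<Rightarrow> complex) \<Rightarrow> 'a::cstar_algebra" +
  fixes l :: complex and r :: real
  assumes K: "compact K" and r: "0 < r"
begin

text \<open>The ideal of the functions that vanish on the closed disc of radius \<open>r\<close> around \<open>l\<close> represents what happens outside the disc.\<close>

definition vanishing :: "(complex \<Rightarrow> complex) \<Rightarrow> bool" where
  "vanishing e \<longleftrightarrow> continuous_on K e \<and> (\<forall>z\<in>K. cmod (z - l) \<le> r \<longrightarrow> e z = 0)"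

lemma vanishing_cont: "vanishing e \<Longrightarrow> continuous_on K e"
  by (simp add: vanishing_def)

text \<open>The factor \<open>h\<close> may be undefined inside the disc, as it will be for \<open>sgn (z - l)\<close>: the product is extended by \<open>0\<close>.\<close>

lemma vanishing_mult:
  assumes h: "continuous_on (K - ball l r) h" and e: "vanishing e"
  shows "vanishing (\<lambda>z. h z * e z)"
proof -
  have cover: "K = (K \<inter> cball l r) \<union> (K - ball l r)" by auto
  have "continuous_on ((K \<inter> cball l r) \<union> (K - ball l r)) (\<lambda>z. h z * e z)"
  proof (rule continuous_on_closed_Un)
    show "closed (K \<inter> cball l r)" "closed (K - ball l r)"
      using compact_imp_closed[OF K] by (auto intro: closed_Int closed_Diff)
    have "continuous_on (K \<inter> cball l r) (\<lambda>z. 0::complex)" by simp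
    then show "continuous_on (K \<inter> cball l r) (\<lambda>z. h z * e z)"
      by (rule continuous_on_eq) (use e in \<open>auto simp: vanishing_def dist_norm norm_minus_commute\<close>)
    show "continuous_on (K - ball l r) (\<lambda>z. h z * e z)"
      using h e by (auto simp: vanishing_def intro!: continuous_intros intro: continuous_on_subset)
  qed
  then show ?thesis using e cover by (simp add: vanishing_def)
qed

lemma vanishing_cnj: "vanishing e \<Longrightarrow> vanishing (\<lambda>z. cnj (e z))"
  by (auto simp: vanishing_def intro: continuous_on_cnj)

text \<open>The assertion about \<open>f\<close> is assumed for the identity and its conjugate; it is stable under sums, products and uniform limits, so it
  holds for all continuous functions \<open>f\<close> of \<open>q\<close>.\<close>

lemma intertwine:
  assumes \<Psi>: "unital_star_hom J \<Psi>" "\<Psi> (\<lambda>z. z) = q" and J: "compact J"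
    and \<sigma>: "continuous_on (K - ball l r) \<sigma>" "\<And>z. z \<in> K - ball l r \<Longrightarrow> \<sigma> z \<in> J"
    and q: "\<And>e. vanishing e \<Longrightarrow> q * \<Phi> e = \<Phi> (\<lambda>z. \<sigma> z * e z)"
      "\<And>e. vanishing e \<Longrightarrow> star q * \<Phi> e = \<Phi> (\<lambda>z. cnj (\<sigma> z) * e z)"
    and f: "continuous_on J f" and e: "vanishing e"
  shows "\<Psi> f * \<Phi> e = \<Phi> (\<lambda>z. f (\<sigma> z) * e z)"
proof -
  interpret J: star_hom J \<Psi> by (rule star_homI[OF \<Psi>(1)])
  have comp: "vanishing (\<lambda>z. h (\<sigma> z) * e z)" if "continuous_on J h" "vanishing e" for h e
    by (rule vanishing_mult[OF continuous_on_compose2[OF that(1) \<sigma>(1)] that(2)]) (use \<sigma>(2) in blast)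
  have gen: "y * \<Phi> e = \<Phi> (\<lambda>z. F (\<sigma> z) * e z)" if "(F, y) \<in> gen q" "vanishing e" for F y e
    using that
  proof (induction arbitrary: e rule: gen.induct)
    case (gen_const c)
    then show ?case by (simp add: mult_scaleC_left hom_cmult vanishing_cont)
  next
    case (gen_add F y G z)
    have c: "continuous_on J F" "continuous_on J G"
      using gen_add(1,2) continuous_on_zpoly[OF gen_zpoly] by blast+
    show ?case
      using gen_add.IH(1)[OF gen_add.prems] gen_add.IH(2)[OF gen_add.prems]
        hom_add[OF vanishing_cont[OF comp[OF c(1) gen_add.prems]] vanishing_cont[OF comp[OF c(2) gen_add.prems]]]
      by (simp add: distrib_right)
  next
    case (gen_mult F y G z)
    have c: "continuous_on J F" "continuous_on J G"
      using gen_mult(1,2) continuous_on_zpoly[OF gen_zpoly] by blast+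
    have "y * z * \<Phi> e = y * \<Phi> (\<lambda>t. G (\<sigma> t) * e t)"
      using gen_mult.IH(2)[OF gen_mult.prems] by (simp add: mult.assoc)
    also have "\<dots> = \<Phi> (\<lambda>t. F (\<sigma> t) * (G (\<sigma> t) * e t))"
      by (rule gen_mult.IH(1)[OF comp[OF c(2) gen_mult.prems]])
    finally show ?case by (simp add: mult.assoc)
  qed (use q in auto)
  obtain M where M: "\<And>z. z \<in> K \<Longrightarrow> cmod (e z) \<le> M" "0 < M"
  proof -
    obtain M' where "\<forall>x\<in>e ` K. norm x \<le> M'"
      using compact_imp_bounded[OF compact_continuous_image[OF vanishing_cont[OF e] K]] unfolding bounded_iff by blast
    then show ?thesis using that[of "\<bar>M'\<bar> + 1"] by fastforce
  qed
  have "norm (\<Psi> f * \<Phi> e - \<Phi> (\<lambda>z. f (\<sigma> z) * e z)) \<le> d" if "d > 0" for d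
  proof -
    define d' where "d' = d / (2 * M)"
    have d': "d' > 0" using \<open>d > 0\<close> M by (simp add: d'_def)
    obtain F where F: "F \<in> zpoly" "\<And>z. z \<in> J \<Longrightarrow> cmod (f z - F z) < d'" using zpoly_dense[OF J f d'] by blast
    obtain y where y: "(F, y) \<in> gen q" using zpoly_gen[OF F(1)] by blast
    have \<Psi>F: "\<Psi> F = y" using J.hom_gen[OF continuous_on_id \<Psi>(2) y] by simp
    have "norm (\<Psi> f - \<Psi> F) \<le> d'"
      by (rule J.hom_norm_diff_le[OF f continuous_on_zpoly[OF F(1)]]) (use F(2) d' in \<open>auto intro: less_imp_le\<close>)
    moreover have "norm (\<Phi> e) \<le> M" by (rule hom_norm_le[OF vanishing_cont[OF e] M(1)]) (use M in auto)
    ultimately have "norm ((\<Psi> f - \<Psi> F) * \<Phi> e) \<le> d' * M"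
      by (intro order_trans[OF norm_mult_ineq] mult_mono) (use d' in auto)
    moreover have "norm (\<Phi> (\<lambda>z. F (\<sigma> z) * e z) - \<Phi> (\<lambda>z. f (\<sigma> z) * e z)) \<le> d' * M"
    proof (rule hom_norm_diff_le)
      show "continuous_on K (\<lambda>z. F (\<sigma> z) * e z)" "continuous_on K (\<lambda>z. f (\<sigma> z) * e z)"
        using comp[OF continuous_on_zpoly[OF F(1)] e] comp[OF f e] vanishing_cont by auto
      fix z assume z: "z \<in> K"
      show "cmod (F (\<sigma> z) * e z - f (\<sigma> z) * e z) \<le> d' * M"
      proof (cases "z \<in> ball l r")
        case True
        then have "e z = 0" using e z by (auto simp: vanishing_def dist_norm norm_minus_commute)
        then show ?thesis using d' M by simp
      next
        case False
        then have "cmod (f (\<sigma> z) - F (\<sigma> z)) \<le> d'" using F(2) \<sigma>(2) z by (auto intro: less_imp_le)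
        then have "cmod (F (\<sigma> z) - f (\<sigma> z)) * cmod (e z) \<le> d' * M"
          using M(1)[OF z] d' by (intro mult_mono) (auto simp: norm_minus_commute)
        then show ?thesis by (simp add: left_diff_distrib[symmetric] norm_mult)
      qed
    qed (use d' M in auto)
    moreover have "\<Psi> f * \<Phi> e - \<Phi> (\<lambda>z. f (\<sigma> z) * e z) =
        (\<Psi> f - \<Psi> F) * \<Phi> e + (\<Phi> (\<lambda>z. F (\<sigma> z) * e z) - \<Phi> (\<lambda>z. f (\<sigma> z) * e z))"
      using gen[OF y e] by (simp add: \<Psi>F algebra_simps)
    ultimately have "norm (\<Psi> f * \<Phi> e - \<Phi> (\<lambda>z. f (\<sigma> z) * e z)) \<le> d' * M + d' * M"
      by (simp only: norm_triangle_mono)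
    then show ?thesis using M by (simp add: d'_def)
  qed
  then have "norm (\<Psi> f * \<Phi> e - \<Phi> (\<lambda>z. f (\<sigma> z) * e z)) \<le> 0" by (rule dense_ge)
  then show ?thesis by simp
qed

text \<open>An invertible \<open>y\<close> close to \<open>x - l\<close> is multiplied by a factor close to \<open>1\<close> from the left and by another one from the right. As \<open>x - l\<close>
  has the inverse \<open>k\<close> away from the disc, the factors can be chosen to achieve exact agreement there.\<close>

lemma invertible_agreeing:
  assumes dense: "\<And>(x::'a) e. e > 0 \<Longrightarrow> \<exists>y. invertible_elt y \<and> norm (x - y) < e"
  obtains z where "invertible_elt z" "\<And>e. vanishing e \<Longrightarrow> z * \<Phi> e = \<Phi> (\<lambda>t. (t - l) * e t)"
    "\<And>e. vanishing e \<Longrightarrow> \<Phi> e * z = \<Phi> (\<lambda>t. (t - l) * e t)"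
proof -
  define x0 where "x0 = \<Phi> (\<lambda>t. t - l)"
  define p where "p t = complex_of_real (ramp (2 * cmod (t - l) / r - 1))" for t
  \<comment> \<open>\<open>p\<close> cuts off the half disc, so \<open>\<kappa>\<close> is bounded by \<open>2 / r\<close> and still inverts \<open>t - l\<close> off the disc\<close>
  define \<kappa> where "\<kappa> t = inverse (t - l) * p t" for t
  have pc: "continuous_on K p" unfolding p_def using r by (intro continuous_intros) auto
  have p0: "p t = 0" if "cmod (t - l) \<le> r / 2" for t
  proof -
    have "2 * cmod (t - l) / r - 1 \<le> 0" using that r by (simp add: field_simps)
    then show ?thesis by (simp add: p_def ramp_simps)
  qed
  have p1: "p t = 1" if "r \<le> cmod (t - l)" for t
  proof -
    have "1 \<le> 2 * cmod (t - l) / r - 1" using that r by (simp add: field_simps)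
    then show ?thesis by (simp add: p_def ramp_simps)
  qed
  have pb: "cmod (p t) \<le> 1" "cmod (1 - p t) \<le> 1" for t
  proof -
    show "cmod (p t) \<le> 1" using ramp_bounds by (simp add: p_def)
    have "1 - p t = complex_of_real (1 - ramp (2 * cmod (t - l) / r - 1))" by (simp add: p_def)
    then show "cmod (1 - p t) \<le> 1" using ramp_bounds[of "2 * cmod (t - l) / r - 1"] by (simp only: norm_of_real)
  qed
  interpret half: disc_hom K \<Phi> l "r / 2" using K r by unfold_locales auto
  have \<kappa>c: "continuous_on K \<kappa>" unfolding \<kappa>_def
  proof (rule half.vanishing_cont[OF half.vanishing_mult])
    show "continuous_on (K - ball l (r / 2)) (\<lambda>t. inverse (t - l))"
      using r by (intro continuous_intros) (auto simp: dist_norm)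
    show "half.vanishing p" using pc p0 by (simp add: half.vanishing_def)
  qed
  have \<kappa>b: "cmod (\<kappa> t) \<le> 2 / r" for t
  proof (cases "cmod (t - l) \<le> r / 2")
    case True then show ?thesis using p0 r by (simp add: \<kappa>_def)
  next
    case False
    then have "inverse (cmod (t - l)) \<le> inverse (r / 2)" using r by (intro le_imp_inverse_le) auto
    then have "cmod (inverse (t - l)) * cmod (p t) \<le> inverse (r / 2) * 1"
      using pb r by (intro mult_mono) (auto simp: norm_inverse)
    then show ?thesis by (simp add: \<kappa>_def norm_mult)
  qed
  have \<kappa>p: "\<kappa> t * (t - l) = p t" for t
    using p0[of t] r by (cases "t = l") (auto simp: \<kappa>_def)
  define k where "k = \<Phi> \<kappa>"
  have nk: "norm k \<le> 2 / r" unfolding k_def by (rule hom_norm_le[OF \<kappa>c \<kappa>b]) (use r in auto)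
  have xc: "continuous_on K (\<lambda>t. t - l)" by (intro continuous_intros)
  have kx: "k * x0 = \<Phi> p" "x0 * k = \<Phi> p"
    unfolding k_def x0_def using hom_mult[OF \<kappa>c xc] hom_mult[OF xc \<kappa>c] by (simp_all add: \<kappa>p mult.commute[of "_ - l"])
  have pe: "\<Phi> p * \<Phi> e = \<Phi> e" "\<Phi> e * \<Phi> p = \<Phi> e" if e: "vanishing e" for e
  proof -
    have "\<Phi> (\<lambda>t. p t * e t) = \<Phi> e"
    proof (rule hom_cong)
      show "continuous_on K (\<lambda>t. p t * e t)" by (intro continuous_intros pc vanishing_cont[OF e])
      show "p t * e t = e t" if "t \<in> K" for t
        using p1[of t] e that by (cases "cmod (t - l) \<le> r") (auto simp: vanishing_def)
    qed
    then show "\<Phi> p * \<Phi> e = \<Phi> e" "\<Phi> e * \<Phi> p = \<Phi> e"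
      using hom_mult[OF pc vanishing_cont[OF e]] hom_mult[OF vanishing_cont[OF e] pc] by (simp_all add: mult.commute)
  qed
  obtain y where y: "invertible_elt y" "norm (x0 - y) < r / 8" using dense[of "r / 8" x0] r by auto
  define w where "w = (x0 - y) * k"
  have "norm w \<le> norm (x0 - y) * norm k" unfolding w_def by (rule norm_mult_ineq)
  also have "\<dots> \<le> r / 8 * (2 / r)" using y(2) nk r by (intro mult_mono) auto
  finally have nw: "norm w \<le> 1/4" using r by simp
  obtain a where a: "a * (1 - w) = 1" "(1 - w) * a = 1" "norm a \<le> 1 / (1 - norm w)"
    using neumann_inverse[of w] nw by auto
  have "1 / (1 - norm w) \<le> 4/3" using nw by (simp add: field_simps)
  then have na: "norm a \<le> 4/3" using a(3) by simp
  \<comment> \<open>agrees with \<open>x - l\<close> when multiplied from the left\<close>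
  define z1 where "z1 = a * y"
  have z1e: "z1 * \<Phi> e = x0 * \<Phi> e" if e: "vanishing e" for e
  proof -
    have "k * (x0 * \<Phi> e) = \<Phi> e" using kx(1) pe(1)[OF e] by (simp flip: mult.assoc)
    then have "(1 - w) * (x0 * \<Phi> e) = y * \<Phi> e" by (simp add: w_def left_diff_distrib mult.assoc)
    then have "a * (y * \<Phi> e) = x0 * \<Phi> e" using a(1) by (metis mult.assoc mult_1)
    then show ?thesis by (simp add: z1_def mult.assoc)
  qed
  have "x0 - z1 = a * ((x0 - y) * (1 - \<Phi> p))"
  proof -
    have "(1 - w) * (x0 - z1) = (1 - w) * x0 - ((1 - w) * a) * y"
      by (simp add: z1_def right_diff_distrib mult.assoc)
    also have "\<dots> = (1 - w) * x0 - y" using a(2) by simp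
    also have "\<dots> = (x0 - y) * (1 - k * x0)"
      by (simp add: w_def left_diff_distrib right_diff_distrib mult.assoc)
    also have "\<dots> = (x0 - y) * (1 - \<Phi> p)" by (simp only: kx)
    finally have "(1 - w) * (x0 - z1) = (x0 - y) * (1 - \<Phi> p)" .
    then show ?thesis using a(1) by (metis mult.assoc mult_1)
  qed
  moreover have "norm (1 - \<Phi> p) \<le> 1"
    using hom_norm_le[of "\<lambda>t. 1 - p t" 1] hom_diff[of "\<lambda>_. 1" p] pc pb by (simp add: hom_one continuous_on_diff)
  ultimately have "norm (x0 - z1) \<le> 4/3 * (r / 8 * 1)"
    using na y(2) r by (simp only:) (intro order_trans[OF norm_mult_ineq] mult_mono; simp)
  then have nz1: "norm (x0 - z1) \<le> r / 6" by simp
  define v where "v = k * (x0 - z1)"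
  have "norm v \<le> norm k * norm (x0 - z1)" unfolding v_def by (rule norm_mult_ineq)
  also have "\<dots> \<le> 2 / r * (r / 6)" using nz1 nk r by (intro mult_mono) auto
  finally have nv: "norm v \<le> 1/3" using r by simp
  obtain c where c: "c * (1 - v) = 1" "(1 - v) * c = 1" using neumann_inverse[of v] nv by auto
  \<comment> \<open>agrees with \<open>x - l\<close> from both sides\<close>
  define z where "z = z1 * c"
  have "invertible_elt a" "invertible_elt c" using a c by (auto simp: invertible_elt_def)
  then have "invertible_elt z" unfolding z_def z1_def by (intro invertible_elt_mult y(1))
  moreover have "z * \<Phi> e = \<Phi> (\<lambda>t. (t - l) * e t)" if e: "vanishing e" for e
  proof -
    have "(1 - v) * \<Phi> e = \<Phi> e" using z1e[OF e] by (simp add: v_def left_diff_distrib mult.assoc)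
    then have "c * \<Phi> e = \<Phi> e" using c(1) by (metis mult.assoc mult_1)
    then have "z * \<Phi> e = x0 * \<Phi> e" using z1e[OF e] by (simp add: z_def mult.assoc)
    then show ?thesis unfolding x0_def using hom_mult[OF xc vanishing_cont[OF e]] by simp
  qed
  moreover have "\<Phi> e * z = \<Phi> (\<lambda>t. (t - l) * e t)" if e: "vanishing e" for e
  proof -
    have "\<Phi> e * x0 * k = \<Phi> e" using kx(2) pe(2)[OF e] by (simp add: mult.assoc)
    then have "\<Phi> e * x0 * (1 - v) = \<Phi> e * z1"
      by (simp add: v_def right_diff_distrib flip: mult.assoc)
    then have "\<Phi> e * z1 * c = \<Phi> e * x0" using c(2) by (metis mult.assoc mult_1_right)
    then have "\<Phi> e * z = \<Phi> e * x0" by (simp add: z_def mult.assoc)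
    then show ?thesis unfolding x0_def using hom_mult[OF vanishing_cont[OF e] xc] by (simp add: mult.commute)
  qed
  ultimately show ?thesis using that by blast
qed

end

text \<open>The unitary part of an invertible element that agrees with \<open>x - l\<close> off the disc.\<close>

lemma (in af) polar_unitary:
  fixes \<Phi> :: "(complex \<Rightarrow> complex) \<Rightarrow> 'a"
  assumes "disc_hom K \<Phi> r"
  obtains u where "unitary u"
    "\<And>e. disc_hom.vanishing K l r e \<Longrightarrow> u * \<Phi> e = \<Phi> (\<lambda>t. sgn (t - l) * e t)"
proof -
  interpret disc_hom K \<Phi> l r by fact
  obtain z where z: "invertible_elt z" "\<And>e. vanishing e \<Longrightarrow> z * \<Phi> e = \<Phi> (\<lambda>t. (t - l) * e t)"
    "\<And>e. vanishing e \<Longrightarrow> \<Phi> e * z = \<Phi> (\<lambda>t. (t - l) * e t)"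
  proof (rule invertible_agreeing)
    show "\<exists>y. invertible_elt y \<and> norm (x - y) < e" if "e > 0" for x :: 'a and e
      by (rule invertible_dense[OF that]) blast
  qed blast
  define q where "q = star z * z"
  have qsa: "star q = q" by (simp add: q_def star_mult star_star)
  define sq where "sq t = complex_of_real ((cmod (t - l))\<^sup>2)" for t
  have lin: "vanishing (\<lambda>t. (t - l) * e t)" if "vanishing e" for e
    by (rule vanishing_mult[OF _ that]) (intro continuous_intros)
  have star_z: "star z * \<Phi> g = \<Phi> (\<lambda>t. cnj (t - l) * g t)" if g: "vanishing g" for g
  proof -
    have "\<Phi> (\<lambda>t. cnj (g t)) * z = \<Phi> (\<lambda>t. (t - l) * cnj (g t))" by (rule z(3)[OF vanishing_cnj[OF g]])
    then have "star (star (\<Phi> g) * z) = star (\<Phi> (\<lambda>t. (t - l) * cnj (g t)))"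
      using hom_star[OF vanishing_cont[OF g]] by simp
    also have "\<dots> = \<Phi> (\<lambda>t. cnj ((t - l) * cnj (g t)))"
      by (rule hom_star[symmetric, OF vanishing_cont[OF lin[OF vanishing_cnj[OF g]]]])
    finally show ?thesis by (simp add: star_mult star_star)
  qed
  have qe: "q * \<Phi> e = \<Phi> (\<lambda>t. sq t * e t)" if e: "vanishing e" for e
  proof -
    have "q * \<Phi> e = star z * \<Phi> (\<lambda>t. (t - l) * e t)" using z(2)[OF e] by (simp add: q_def mult.assoc)
    also have "\<dots> = \<Phi> (\<lambda>t. cnj (t - l) * ((t - l) * e t))" by (rule star_z[OF lin[OF e]])
    also have "(\<lambda>t. cnj (t - l) * ((t - l) * e t)) = (\<lambda>t. sq t * e t)"
      by (simp add: sq_def complex_norm_square mult_ac del: of_real_power)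
    finally show ?thesis .
  qed
  obtain \<eta> M0 \<Psi> where \<Psi>: "0 < \<eta>" "unital_star_hom (complex_of_real ` {\<eta>..M0}) \<Psi>" "\<Psi> (\<lambda>t. t) = q"
    unfolding q_def by (rule positive_calculus[OF z(1)])
  obtain M1 where M1: "\<And>t. t \<in> K \<Longrightarrow> (cmod (t - l))\<^sup>2 \<le> M1"
  proof -
    have "bounded ((\<lambda>t. (cmod (t - l))\<^sup>2) ` K)"
      by (intro compact_imp_bounded compact_continuous_image K continuous_intros)
    then show ?thesis using that unfolding bounded_iff by (metis abs_le_D1 image_eqI real_norm_def)
  qed
  define \<eta>' M J where "\<eta>' = min \<eta> (r\<^sup>2)" and "M = max M0 M1" and "J = complex_of_real ` {\<eta>'..M}"
  have \<eta>': "0 < \<eta>'" using \<Psi>(1) r by (simp add: \<eta>'_def)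
  have J: "compact J" unfolding J_def by (intro compact_continuous_image continuous_intros) auto
  have \<Psi>J: "unital_star_hom J \<Psi>"
    by (rule unital_star_hom_mono[OF \<Psi>(2)]) (unfold J_def \<eta>'_def M_def, intro image_mono, auto)
  interpret J: star_hom J \<Psi> by (rule star_homI[OF \<Psi>J])
  define g where "g t = complex_of_real (1 / sqrt (max \<eta>' (Re t)))" for t
  have gc: "continuous_on S g" for S unfolding g_def using \<eta>' by (intro continuous_intros) auto
  define d where "d = \<Psi> g"
  have dsa: "star d = d" unfolding d_def by (rule J.hom_selfadjoint[OF gc]) (simp add: g_def)
  have dqd: "d * q * d = 1"
  proof -
    have "\<Psi> (\<lambda>t. g t * t * g t) = \<Psi> (\<lambda>t. 1)"
    proof (rule J.hom_cong)
      fix t assume "t \<in> J"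
      then obtain s where s: "t = complex_of_real s" "\<eta>' \<le> s" by (auto simp: J_def)
      then have "1 / sqrt s * s * (1 / sqrt s) = 1" using \<eta>' by (simp add: field_simps)
      then have "complex_of_real (1 / sqrt s) * complex_of_real s * complex_of_real (1 / sqrt s) = 1"
        by (metis of_real_1 of_real_mult)
      moreover have "g t = complex_of_real (1 / sqrt s)" unfolding g_def using s by (simp add: max_def)
      ultimately show "g t * t * g t = 1" using s(1) by (simp only:)
    qed (intro continuous_intros gc)
    then show ?thesis using gc by (simp add: J.hom_mult J.hom_one \<Psi>(3) d_def continuous_on_mult)
  qed
  define u where "u = z * d"
  have "star u * u = d * q * d" by (simp add: u_def star_mult dsa q_def mult.assoc)
  then have "star u * u = 1" by (simp only: dqd)
  then have "unitary u" using right_inverse_imp_left_inverse by (auto simp: unitary_def)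
  moreover have "u * \<Phi> e = \<Phi> (\<lambda>t. sgn (t - l) * e t)" if e: "vanishing e" for e
  proof -
    have "d * \<Phi> e = \<Phi> (\<lambda>t. g (sq t) * e t)"
      unfolding d_def
    proof (rule intertwine[OF \<Psi>J \<Psi>(3) J])
      show "continuous_on (K - ball l r) sq" unfolding sq_def by (intro continuous_intros)
      show "sq t \<in> J" if "t \<in> K - ball l r" for t
      proof -
        have "r \<le> cmod (t - l)" using that by (auto simp: dist_norm norm_minus_commute)
        then have "r\<^sup>2 \<le> (cmod (t - l))\<^sup>2" using r by (intro power_mono) auto
        then show ?thesis using M1[of t] that unfolding sq_def J_def
          by (intro imageI) (auto simp: \<eta>'_def M_def)
      qed
      show "star q * \<Phi> e = \<Phi> (\<lambda>z. cnj (sq z) * e z)" if "vanishing e" for e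
        using qe[OF that] qsa by (simp add: sq_def)
    qed (use qe gc e in auto)
    moreover have "vanishing (\<lambda>t. g (sq t) * e t)"
      by (rule vanishing_mult[OF _ e], rule continuous_on_compose2[OF gc[of UNIV]])
        (auto simp: sq_def intro!: continuous_intros)
    ultimately have "u * \<Phi> e = \<Phi> (\<lambda>t. (t - l) * (g (sq t) * e t))" using z(2) by (simp add: u_def mult.assoc)
    also have "\<dots> = \<Phi> (\<lambda>t. sgn (t - l) * e t)"
    proof (rule hom_cong)
      show "continuous_on K (\<lambda>t. (t - l) * (g (sq t) * e t))"
        by (rule vanishing_cont[OF lin]) fact
      fix t assume t: "t \<in> K"
      show "(t - l) * (g (sq t) * e t) = sgn (t - l) * e t"
      proof (cases "cmod (t - l) \<le> r")
        case True then show ?thesis using e t by (simp add: vanishing_def)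
      next
        case False
        then have "r\<^sup>2 \<le> (cmod (t - l))\<^sup>2" using r by (intro power_mono) auto
        then have "max \<eta>' ((cmod (t - l))\<^sup>2) = (cmod (t - l))\<^sup>2" by (simp add: \<eta>'_def max_def min_def)
        then have "g (sq t) = complex_of_real (1 / cmod (t - l))"
          unfolding g_def sq_def Re_complex_of_real by simp
        then show ?thesis by (simp add: sgn_eq)
      qed
    qed
    finally show ?thesis .
  qed
  ultimately show ?thesis using that by blast
qed

text \<open>The functional calculus of the unitary of \<open>polar_unitary\<close>.\<close>

lemma (in af) disc_calculus:
  fixes \<Phi> :: "(complex \<Rightarrow> complex) \<Rightarrow> 'a"
  assumes "disc_hom K \<Phi> r"
  obtains \<Psi> where "unital_star_hom (sphere 0 1) \<Psi>"
    "\<And>f e. continuous_on (sphere 0 1) f \<Longrightarrow> disc_hom.vanishing K l r e \<Longrightarrow> \<Psi> f * \<Phi> e = \<Phi> (\<lambda>t. f (sgn (t - l)) * e t)"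
    "\<And>f e. continuous_on (sphere 0 1) f \<Longrightarrow> disc_hom.vanishing K l r e \<Longrightarrow> \<Phi> e * \<Psi> f = \<Phi> (\<lambda>t. f (sgn (t - l)) * e t)"
proof -
  interpret disc_hom K \<Phi> l r by fact
  obtain u where u: "unitary u" "\<And>e. vanishing e \<Longrightarrow> u * \<Phi> e = \<Phi> (\<lambda>t. sgn (t - l) * e t)"
    by (rule polar_unitary[OF assms]) blast
  obtain \<Psi> where \<Psi>: "unital_star_hom (sphere 0 1) \<Psi>" "\<Psi> (\<lambda>z. z) = u" by (rule unitary_calculus[OF u(1)])
  interpret U: star_hom "sphere 0 1" \<Psi> by (rule star_homI[OF \<Psi>(1)])
  have sc: "continuous_on (K - ball l r) (\<lambda>t. sgn (t - l))"
    using r by (intro continuous_intros) (auto simp: dist_norm)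
  have s1: "sgn (t - l) \<in> sphere 0 1" if "t \<in> K - ball l r" for t
    using that r by (auto simp: norm_sgn dist_norm)
  have us: "star u * \<Phi> e = \<Phi> (\<lambda>t. cnj (sgn (t - l)) * e t)" if e: "vanishing e" for e
  proof -
    have ve: "vanishing (\<lambda>t. cnj (sgn (t - l)) * e t)"
      by (rule vanishing_mult[OF continuous_on_cnj[OF sc] e])
    have "u * \<Phi> (\<lambda>t. cnj (sgn (t - l)) * e t) = \<Phi> (\<lambda>t. sgn (t - l) * (cnj (sgn (t - l)) * e t))"
      by (rule u(2)[OF ve])
    also have "\<dots> = \<Phi> e"
    proof (rule hom_cong[symmetric, OF vanishing_cont[OF e]])
      fix t assume t: "t \<in> K"
      show "e t = sgn (t - l) * (cnj (sgn (t - l)) * e t)"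
      proof (cases "t = l")
        case True then show ?thesis using e t r by (simp add: vanishing_def)
      next
        case False
        then have "sgn (t - l) * cnj (sgn (t - l)) = 1"
          by (metis complex_norm_square norm_sgn of_real_1 one_power2 right_minus_eq)
        then show ?thesis by (metis mult.assoc mult_1)
      qed
    qed
    finally have "star u * (u * \<Phi> (\<lambda>t. cnj (sgn (t - l)) * e t)) = star u * \<Phi> e" by simp
    then show ?thesis using u(1) by (simp add: unitary_def flip: mult.assoc)
  qed
  have left: "\<Psi> f * \<Phi> e = \<Phi> (\<lambda>t. f (sgn (t - l)) * e t)" if "continuous_on (sphere 0 1) f" "vanishing e" for f e
    by (rule intertwine[OF \<Psi> _ sc s1 u(2) us that]) auto
  have right: "\<Phi> e * \<Psi> f = \<Phi> (\<lambda>t. f (sgn (t - l)) * e t)" if f: "continuous_on (sphere 0 1) f" and e: "vanishing e" for f e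
  proof -
    have ve: "vanishing (\<lambda>t. cnj (f (sgn (t - l))) * cnj (e t))"
      by (rule vanishing_mult[OF continuous_on_cnj[OF continuous_on_compose2[OF f sc]] vanishing_cnj[OF e]]) (use s1 in blast)
    have "star (\<Phi> e * \<Psi> f) = \<Psi> (\<lambda>t. cnj (f t)) * \<Phi> (\<lambda>t. cnj (e t))"
      using f e by (simp add: star_mult U.hom_star hom_star vanishing_cont)
    also have "\<dots> = \<Phi> (\<lambda>t. cnj (f (sgn (t - l))) * cnj (e t))"
      by (rule left[OF continuous_on_cnj[OF f] vanishing_cnj[OF e]])
    finally have "\<Phi> e * \<Psi> f = star (\<Phi> (\<lambda>t. cnj (f (sgn (t - l))) * cnj (e t)))" by (metis star_star)
    also have "\<dots> = \<Phi> (\<lambda>t. cnj (cnj (f (sgn (t - l))) * cnj (e t)))"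
      by (rule hom_star[symmetric, OF vanishing_cont[OF ve]])
    finally show ?thesis by simp
  qed
  show ?thesis using that[OF \<Psi>(1) left right] by blast
qed

text \<open>The discs of radius \<open>2/5\<close> around the points of \<open>L\<close> are to be removed from \<open>K\<close>. Since the points have distance at least \<open>1\<close>,
  the discs of radius \<open>1/2\<close>, in which everything takes place, are disjoint. The set \<open>\<Omega>\<close> contains the rest of \<open>K\<close> and the boundary
  circles.\<close>

locale holes = af B + star_hom K \<Phi>
  for B :: "nat \<Rightarrow> 'a::cstar_algebra set" and K :: "complex set" and \<Phi> :: "(complex \<Rightarrow> complex) \<Rightarrow> 'a" +
  fixes L \<Omega> :: "complex set"
  assumes K: "compact K" and L: "finite L" and far: "l \<in> L \<Longrightarrow> m \<in> L \<Longrightarrow> l \<noteq> m \<Longrightarrow> 1 \<le> cmod (l - m)"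
    and \<Omega>: "z \<in> K \<Longrightarrow> (\<And>l. l \<in> L \<Longrightarrow> 2/5 \<le> cmod (z - l)) \<Longrightarrow> z \<in> \<Omega>"
    and circle: "l \<in> L \<Longrightarrow> cmod w = 1 \<Longrightarrow> l + (2/5) * w \<in> \<Omega>"
begin

definition c :: "complex \<Rightarrow> complex \<Rightarrow> complex" where
  "c l z = complex_of_real (ramp (5 - 10 * cmod (z - l)))"

text \<open>The radial projection onto the circle around \<open>l\<close>.\<close>

definition \<rho> :: "complex \<Rightarrow> complex \<Rightarrow> complex" where "\<rho> l z = l + (2/5) * sgn (z - l)"

definition off :: "complex \<Rightarrow> bool" where "off z \<longleftrightarrow> (\<forall>l\<in>L. 2/5 \<le> cmod (z - l))"

text \<open>Subtracting the values of \<open>f\<close> on the circles makes it vanish there, so that the extension by \<open>0\<close> into the discs is continuous.\<close>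

definition f0 :: "(complex \<Rightarrow> complex) \<Rightarrow> complex \<Rightarrow> complex" where
  "f0 f z = (if off z then f z - (\<Sum>l\<in>L. c l z * f (\<rho> l z)) else 0)"

lemma c_cont: "continuous_on S (c l)"
  unfolding c_def by (intro continuous_intros)

lemma c_one: "cmod (z - l) \<le> 2/5 \<Longrightarrow> c l z = 1"
  by (simp add: c_def ramp_simps)

lemma c_zero: "1/2 \<le> cmod (z - l) \<Longrightarrow> c l z = 0"
  by (simp add: c_def ramp_simps)

lemma c_real: "cnj (c l z) = c l z" by (simp add: c_def)

lemma c_bound: "cmod (c l z) \<le> 1" using ramp_bounds by (simp add: c_def)

lemma far_other:
  assumes "l \<in> L" "m \<in> L" "l \<noteq> m" "cmod (z - l) < 1/2" shows "1/2 \<le> cmod (z - m)"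
  using far[OF assms(1-3)] assms(4) norm_triangle_ineq4[of "z - m" "z - l"] by simp

lemma c_orth: "l \<in> L \<Longrightarrow> m \<in> L \<Longrightarrow> l \<noteq> m \<Longrightarrow> c l z * c m z = 0"
  using far_other[of l m z] c_zero[of z l] c_zero[of z m] by (cases "cmod (z - l) < 1/2") auto

lemma c_sum_single:
  assumes "l \<in> L" "cmod (z - l) < 1/2"
  shows "(\<Sum>m\<in>L. c m z * h m) = c l z * h l"
proof -
  have "(\<Sum>m\<in>L. c m z * h m) = (\<Sum>m\<in>{l}. c m z * h m)"
    using assms L c_zero[OF far_other[OF assms(1) _ _ assms(2)]] by (intro sum.mono_neutral_right) auto
  then show ?thesis by simp
qed

lemma c_sum_none:
  assumes "\<And>l. l \<in> L \<Longrightarrow> 1/2 \<le> cmod (z - l)"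
  shows "(\<Sum>m\<in>L. c m z * h m) = 0"
  using assms c_zero by (intro sum.neutral) auto

lemma f0_zero:
  assumes "l \<in> L" "cmod (z - l) \<le> 2/5" shows "f0 f z = 0"
proof (cases "off z")
  case True
  then have e: "cmod (z - l) = 2/5" using assms by (force simp: off_def)
  have "complex_of_real (cmod (z - l)) * sgn (z - l) = z - l" by (simp add: sgn_eq)
  then have "(2/5) * sgn (z - l) = z - l" by (simp add: e)
  then have "l + (2/5) * sgn (z - l) = l + (z - l)" by (rule arg_cong)
  then have "\<rho> l z = z" unfolding \<rho>_def by simp
  then show ?thesis using c_sum_single[OF assms(1), of z "\<lambda>l. f (\<rho> l z)"] assms(2) True by (simp add: f0_def c_one)
qed (simp add: f0_def)

lemma \<rho>_in: "l \<in> L \<Longrightarrow> z \<noteq> l \<Longrightarrow> \<rho> l z \<in> \<Omega>"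
  unfolding \<rho>_def by (rule circle) (auto simp: norm_sgn)

lemma \<rho>_cont: "continuous_on (S - ball l (2/5)) (\<rho> l)"
  unfolding \<rho>_def by (intro continuous_intros) auto

lemma off_neq: "off z \<Longrightarrow> l \<in> L \<Longrightarrow> z \<noteq> l"
  by (force simp: off_def)

lemma f0_cont:
  assumes f: "continuous_on \<Omega> f" shows "continuous_on K (f0 f)"
proof -
  let ?A = "K \<inter> (\<Union>l\<in>L. cball l (2/5))" and ?B = "K - (\<Union>l\<in>L. ball l (2/5))"
  have cover: "K = ?A \<union> ?B" by auto
  have "continuous_on (?A \<union> ?B) (f0 f)"
  proof (rule continuous_on_closed_Un)
    show "closed ?A" using compact_imp_closed[OF K] L by (intro closed_Int closed_UN) auto
    show "closed ?B" using compact_imp_closed[OF K] by (intro closed_Diff) auto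
    have "continuous_on ?A (\<lambda>z. 0::complex)" by simp
    then show "continuous_on ?A (f0 f)"
      by (rule continuous_on_eq) (auto simp: dist_norm norm_minus_commute f0_zero)
    have B: "off z" if "z \<in> ?B" for z using that by (auto simp: off_def dist_norm norm_minus_commute not_less)
    have "continuous_on ?B (\<lambda>z. f z - (\<Sum>l\<in>L. c l z * f (\<rho> l z)))"
    proof (intro continuous_on_diff continuous_on_sum continuous_on_mult c_cont)
      show "continuous_on ?B f"
        by (rule continuous_on_subset[OF f]) (use B \<Omega> in \<open>auto simp: off_def\<close>)
      fix l assume l: "l \<in> L"
      show "continuous_on ?B (\<lambda>z. f (\<rho> l z))"
      proof (rule continuous_on_compose2[OF f])
        show "continuous_on ?B (\<rho> l)" using \<rho>_cont[of K l] l by (rule_tac continuous_on_subset) auto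
        show "\<rho> l ` ?B \<subseteq> \<Omega>" using \<rho>_in[OF l] off_neq[OF B l] by blast
      qed
    qed
    then show "continuous_on ?B (f0 f)"
      by (rule continuous_on_eq) (use B in \<open>simp add: f0_def\<close>)
  qed
  then show ?thesis using cover by simp
qed

lemma disc: "disc_hom K \<Phi> (2/5)" using K by unfold_locales auto

text \<open>The new homomorphism replaces the part of \<open>x\<close> living on the disc around \<open>l\<close> by \<open>l + 2/5 u\<close> with the unitary \<open>u\<close> provided by
  \<open>disc_calculus\<close>: \<open>f\<close> is sent to the image of the remainder \<open>f0 f\<close> plus, for every \<open>l\<close>, \<open>c l\<close> times the value of \<open>f\<close> at
  \<open>l + 2/5 u\<close>. Multiplicativity holds because off the disc \<open>u\<close> acts as multiplication by \<open>sgn (z - l)\<close>.\<close>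

theorem hole_hom:
  obtains \<Phi>' where "unital_star_hom \<Omega> \<Phi>'" "norm (\<Phi>' (\<lambda>z. z) - \<Phi> (\<lambda>z. z)) \<le> 4/5"
proof -
  note van_def = disc_hom.vanishing_def[OF disc]
  define Q where "Q l \<Psi> \<longleftrightarrow> unital_star_hom (sphere 0 1) \<Psi> \<and>
      (\<forall>f e. continuous_on (sphere 0 1) f \<longrightarrow> disc_hom.vanishing K l (2/5) e \<longrightarrow>
        \<Psi> f * \<Phi> e = \<Phi> (\<lambda>t. f (sgn (t - l)) * e t) \<and> \<Phi> e * \<Psi> f = \<Phi> (\<lambda>t. f (sgn (t - l)) * e t))" for l \<Psi>
  have ex: "\<exists>\<Psi>. Q l \<Psi>" for l
  proof (rule disc_calculus[OF disc, where l = l])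
    fix \<Psi>
    assume a: "unital_star_hom (sphere 0 1) \<Psi>"
      "\<And>f e. continuous_on (sphere 0 1) f \<Longrightarrow> disc_hom.vanishing K l (2/5) e \<Longrightarrow> \<Psi> f * \<Phi> e = \<Phi> (\<lambda>t. f (sgn (t - l)) * e t)"
      "\<And>f e. continuous_on (sphere 0 1) f \<Longrightarrow> disc_hom.vanishing K l (2/5) e \<Longrightarrow> \<Phi> e * \<Psi> f = \<Phi> (\<lambda>t. f (sgn (t - l)) * e t)"
    show ?thesis unfolding Q_def by (intro exI[of _ \<Psi>] conjI allI impI a)
  qed
  obtain \<Psi> where Q: "\<And>l. Q l (\<Psi> l)" using ex by metis
  have \<Psi>: "\<And>l. unital_star_hom (sphere 0 1) (\<Psi> l)"
    and \<Psi>e: "\<And>l f e. continuous_on (sphere 0 1) f \<Longrightarrow> disc_hom.vanishing K l (2/5) e \<Longrightarrow>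
        \<Psi> l f * \<Phi> e = \<Phi> (\<lambda>t. f (sgn (t - l)) * e t) \<and> \<Phi> e * \<Psi> l f = \<Phi> (\<lambda>t. f (sgn (t - l)) * e t)"
    using Q unfolding Q_def by blast+
  interpret U: star_hom "sphere 0 1" "\<Psi> l" for l by (rule star_homI[OF \<Psi>])
  define lift where "lift l f w = f (l + (2/5) * w)" for l and f :: "complex \<Rightarrow> complex" and w
  define W where "W l f = \<Psi> l (lift l f)" for l f
  define C where "C l = \<Phi> (c l)" for l
  have lc: "continuous_on (sphere 0 1) (lift l f)" if "continuous_on \<Omega> f" "l \<in> L" for f l
    unfolding lift_def
  proof (rule continuous_on_compose2[OF that(1)])
    show "(\<lambda>w. l + (2/5) * w) ` sphere 0 1 \<subseteq> \<Omega>"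
      by (rule image_subsetI, rule circle[OF that(2)], simp)
  qed (intro continuous_intros)
  have We: "W l f * \<Phi> e = \<Phi> (\<lambda>t. f (\<rho> l t) * e t)" "\<Phi> e * W l f = \<Phi> (\<lambda>t. f (\<rho> l t) * e t)"
    if "continuous_on \<Omega> f" "l \<in> L" "continuous_on K e" "\<And>t. t \<in> K \<Longrightarrow> cmod (t - l) \<le> 2/5 \<Longrightarrow> e t = 0" for f l e
    using \<Psi>e[OF lc[OF that(1,2)], where e = e] that(3,4) by (auto simp: W_def van_def lift_def \<rho>_def)
  have ec: "continuous_on K (\<lambda>t. f (\<rho> l t) * e t)"
    if "continuous_on \<Omega> f" "l \<in> L" "continuous_on K e" "\<And>t. t \<in> K \<Longrightarrow> cmod (t - l) \<le> 2/5 \<Longrightarrow> e t = 0" for f l and e :: "complex \<Rightarrow> complex"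
  proof -
    interpret D: disc_hom K \<Phi> l "2/5" by (rule disc)
    have "D.vanishing (\<lambda>t. f (\<rho> l t) * e t)"
    proof (rule D.vanishing_mult)
      show "continuous_on (K - ball l (2/5)) (\<lambda>t. f (\<rho> l t))"
        by (rule continuous_on_compose2[OF that(1) \<rho>_cont], rule image_subsetI, rule \<rho>_in[OF that(2)]) auto
      show "D.vanishing e" using that(3,4) by (simp add: D.vanishing_def)
    qed
    then show ?thesis by (rule D.vanishing_cont)
  qed
  have comm: "C l * W l f = W l f * C l" if "continuous_on \<Omega> f" "l \<in> L" for f l
  proof -
    have e: "continuous_on K (\<lambda>t. c l t - 1)" by (intro continuous_intros c_cont)
    have "W l f * \<Phi> (\<lambda>t. c l t - 1) = \<Phi> (\<lambda>t. c l t - 1) * W l f"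
      using We[OF that e] c_one by simp
    moreover have "\<Phi> (\<lambda>t. c l t - 1) = C l - 1" using hom_diff[OF c_cont, of "\<lambda>_. 1" l] by (simp add: hom_one C_def)
    ultimately show ?thesis by (simp add: algebra_simps)
  qed
  have CC: "C l * C m = 0" if "l \<in> L" "m \<in> L" "l \<noteq> m" for l m
    using hom_mult[OF c_cont c_cont, of l m] c_orth[OF that] by (simp add: C_def hom_zero)
  define \<Phi>' where "\<Phi>' f = \<Phi> (f0 f) + (\<Sum>l\<in>L. C l * W l f)" for f
  have Wadd: "W l (\<lambda>t. f t + g t) = W l f + W l g" and Wmult: "W l (\<lambda>t. f t * g t) = W l f * W l g"
    if "continuous_on \<Omega> f" "continuous_on \<Omega> g" "l \<in> L" for l f g
    using U.hom_add[OF lc[OF that(1,3)] lc[OF that(2,3)]] U.hom_mult[OF lc[OF that(1,3)] lc[OF that(2,3)]]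
    by (simp_all add: W_def lift_def[abs_def])
  have Wcm: "W l (\<lambda>t. k * f t) = k *\<^sub>C W l f" and Wst: "W l (\<lambda>t. cnj (f t)) = star (W l f)"
    if "continuous_on \<Omega> f" "l \<in> L" for l f k
    using U.hom_cmult[OF lc[OF that]] U.hom_star[OF lc[OF that]] by (simp_all add: W_def lift_def[abs_def])
  have "unital_star_hom \<Omega> \<Phi>'"
    unfolding unital_star_hom_def
  proof (intro conjI allI impI)
    fix f g :: "complex \<Rightarrow> complex"
    assume f: "continuous_on \<Omega> f" and g: "continuous_on \<Omega> g"
    note fg = continuous_on_mult[OF f g]
    show "\<Phi>' f = \<Phi>' g" if eq: "\<forall>t\<in>\<Omega>. f t = g t"
    proof -
      have "\<Phi> (f0 f) = \<Phi> (f0 g)"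
      proof (rule hom_cong[OF f0_cont[OF f]])
        fix z assume "z \<in> K"
        show "f0 f z = f0 g z"
        proof (cases "off z")
          case True
          then have "f z = g z" "\<And>l. l \<in> L \<Longrightarrow> f (\<rho> l z) = g (\<rho> l z)"
            using eq \<Omega>[OF \<open>z \<in> K\<close>] \<rho>_in off_neq by (auto simp: off_def)
          then show ?thesis by (simp add: f0_def)
        qed (simp add: f0_def)
      qed
      moreover have "W l f = W l g" if "l \<in> L" for l
        unfolding W_def by (rule U.hom_cong[OF lc[OF f that]]) (use eq circle[OF that] in \<open>auto simp: lift_def\<close>)
      ultimately show ?thesis by (simp add: \<Phi>'_def)
    qed
    have "f0 (\<lambda>t. f t + g t) = (\<lambda>z. f0 f z + f0 g z)"
      by (auto simp: f0_def distrib_left sum.distrib)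
    then show "\<Phi>' (\<lambda>t. f t + g t) = \<Phi>' f + \<Phi>' g"
      using f g by (simp add: \<Phi>'_def Wadd hom_add f0_cont distrib_left sum.distrib)
    have t2: "\<Phi> (f0 f) * (C l * W l g) = \<Phi> (\<lambda>t. g (\<rho> l t) * (f0 f t * c l t))"
      if l: "l \<in> L" for l
    proof -
      have e: "continuous_on K (\<lambda>t. f0 f t * c l t)" by (intro continuous_intros f0_cont f c_cont)
      have "\<Phi> (f0 f) * (C l * W l g) = \<Phi> (\<lambda>t. f0 f t * c l t) * W l g"
        using hom_mult[OF f0_cont[OF f] c_cont, of l] by (simp add: C_def mult.assoc)
      also have "\<dots> = \<Phi> (\<lambda>t. g (\<rho> l t) * (f0 f t * c l t))" by (rule We(2)[OF g l e]) (use f0_zero[OF l] in auto)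
      finally show ?thesis .
    qed
    have t3: "C l * W l f * \<Phi> (f0 g) = \<Phi> (\<lambda>t. f (\<rho> l t) * (c l t * f0 g t))"
      if l: "l \<in> L" for l
    proof -
      have e: "continuous_on K (\<lambda>t. c l t * f0 g t)" by (intro continuous_intros f0_cont g c_cont)
      have "C l * W l f * \<Phi> (f0 g) = W l f * \<Phi> (\<lambda>t. c l t * f0 g t)"
        using hom_mult[OF c_cont f0_cont[OF g], of l] comm[OF f l] by (simp add: C_def mult.assoc)
      also have "\<dots> = \<Phi> (\<lambda>t. f (\<rho> l t) * (c l t * f0 g t))" by (rule We(1)[OF f l e]) (use f0_zero[OF l] in auto)
      finally show ?thesis .
    qed
    have t4: "C l * W l f * (C m * W m g) =
        (if l = m then C l * W l (\<lambda>t. f t * g t) + \<Phi> (\<lambda>t. (f (\<rho> l t) * g (\<rho> l t)) * (c l t * c l t - c l t)) else 0)"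
      if lm: "l \<in> L" "m \<in> L" for l m
    proof (cases "l = m")
      case True
      have e: "continuous_on K (\<lambda>t. c l t * c l t - c l t)" by (intro continuous_intros c_cont)
      have "\<Phi> (\<lambda>t. c l t * c l t - c l t) = C l * C l - C l"
        using c_cont[of K l] by (simp add: hom_diff hom_mult continuous_on_mult C_def)
      then have "C l * C l = C l + \<Phi> (\<lambda>t. c l t * c l t - c l t)" by simp
      moreover have "\<Phi> (\<lambda>t. c l t * c l t - c l t) * W l (\<lambda>t. f t * g t) =
          \<Phi> (\<lambda>t. (f (\<rho> l t) * g (\<rho> l t)) * (c l t * c l t - c l t))"
        by (rule We(2)[OF fg lm(1) e]) (simp add: c_one)
      moreover have "C l * W l f * (C l * W l g) = C l * C l * W l (\<lambda>t. f t * g t)"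
      proof -
        have "C l * W l f * (C l * W l g) = C l * (W l f * C l) * W l g" by (simp add: mult.assoc)
        also have "\<dots> = C l * C l * (W l f * W l g)" by (simp add: comm[OF f lm(1), symmetric] mult.assoc)
        finally show ?thesis using Wmult[OF f g lm(1)] by simp
      qed
      ultimately have "C l * W l f * (C l * W l g) = C l * W l (\<lambda>t. f t * g t) +
          \<Phi> (\<lambda>t. (f (\<rho> l t) * g (\<rho> l t)) * (c l t * c l t - c l t))"
        by (simp only: distrib_right)
      then show ?thesis using True by simp
    next
      case False
      have "C l * W l f * (C m * W m g) = W l f * (C l * C m) * W m g" by (simp add: comm[OF f lm(1)] mult.assoc)
      then show ?thesis using False CC[OF lm False] by simp
    qed
    have cs: "continuous_on K (\<lambda>t. g (\<rho> l t) * (f0 f t * c l t))"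
      "continuous_on K (\<lambda>t. f (\<rho> l t) * (c l t * f0 g t))"
      "continuous_on K (\<lambda>t. (f (\<rho> l t) * g (\<rho> l t)) * (c l t * c l t - c l t))" if l: "l \<in> L" for l
    proof -
      show "continuous_on K (\<lambda>t. g (\<rho> l t) * (f0 f t * c l t))"
        by (rule ec[OF g l]) (auto intro!: continuous_intros f0_cont f c_cont simp: f0_zero[OF l])
      show "continuous_on K (\<lambda>t. f (\<rho> l t) * (c l t * f0 g t))"
        by (rule ec[OF f l]) (auto intro!: continuous_intros f0_cont g c_cont simp: f0_zero[OF l])
      show "continuous_on K (\<lambda>t. (f (\<rho> l t) * g (\<rho> l t)) * (c l t * c l t - c l t))"
        by (rule ec[OF fg l]) (auto intro!: continuous_intros c_cont simp: c_one)
    qed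
    have "\<Phi>' f * \<Phi>' g = \<Phi> (f0 f) * \<Phi> (f0 g) + (\<Sum>l\<in>L. \<Phi> (f0 f) * (C l * W l g)) + (\<Sum>l\<in>L. C l * W l f * \<Phi> (f0 g))
        + (\<Sum>l\<in>L. \<Sum>m\<in>L. C l * W l f * (C m * W m g))"
    proof -
      have expand: "(a + b) * (a' + b') = a * a' + a * b' + b * a' + b * b'" for a b a' b' :: 'a
        by (simp add: algebra_simps)
      show ?thesis
        unfolding \<Phi>'_def expand sum_product[symmetric] by (simp only: sum_distrib_left sum_distrib_right)
    qed
    also have "(\<Sum>l\<in>L. \<Sum>m\<in>L. C l * W l f * (C m * W m g)) =
        (\<Sum>l\<in>L. \<Sum>m\<in>L. if l = m then C l * W l (\<lambda>t. f t * g t) + \<Phi> (\<lambda>t. (f (\<rho> l t) * g (\<rho> l t)) * (c l t * c l t - c l t)) else 0)"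
      by (intro sum.cong refl t4)
    also have "\<dots> = (\<Sum>l\<in>L. C l * W l (\<lambda>t. f t * g t)) + (\<Sum>l\<in>L. \<Phi> (\<lambda>t. (f (\<rho> l t) * g (\<rho> l t)) * (c l t * c l t - c l t)))"
      using L by (simp add: sum.distrib)
    also have "(\<Sum>l\<in>L. \<Phi> (f0 f) * (C l * W l g)) = (\<Sum>l\<in>L. \<Phi> (\<lambda>t. g (\<rho> l t) * (f0 f t * c l t)))"
      by (intro sum.cong refl t2)
    also have "(\<Sum>l\<in>L. C l * W l f * \<Phi> (f0 g)) = (\<Sum>l\<in>L. \<Phi> (\<lambda>t. f (\<rho> l t) * (c l t * f0 g t)))"
      by (intro sum.cong refl t3)
    finally have 1: "\<Phi>' f * \<Phi>' g = \<Phi> (f0 f) * \<Phi> (f0 g) + (\<Sum>l\<in>L. \<Phi> (\<lambda>t. g (\<rho> l t) * (f0 f t * c l t)))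
        + (\<Sum>l\<in>L. \<Phi> (\<lambda>t. f (\<rho> l t) * (c l t * f0 g t)))
        + ((\<Sum>l\<in>L. C l * W l (\<lambda>t. f t * g t)) + (\<Sum>l\<in>L. \<Phi> (\<lambda>t. (f (\<rho> l t) * g (\<rho> l t)) * (c l t * c l t - c l t))))" .
    have "\<Phi> (f0 (\<lambda>t. f t * g t)) = \<Phi> (\<lambda>z. f0 f z * f0 g z + (\<Sum>l\<in>L. g (\<rho> l z) * (f0 f z * c l z))
        + (\<Sum>l\<in>L. f (\<rho> l z) * (c l z * f0 g z)) + (\<Sum>l\<in>L. (f (\<rho> l z) * g (\<rho> l z)) * (c l z * c l z - c l z)))"
    proof (rule hom_cong[OF f0_cont[OF fg]])
      fix z assume "z \<in> K"
      show "f0 (\<lambda>t. f t * g t) z = f0 f z * f0 g z + (\<Sum>l\<in>L. g (\<rho> l z) * (f0 f z * c l z))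
        + (\<Sum>l\<in>L. f (\<rho> l z) * (c l z * f0 g z)) + (\<Sum>l\<in>L. (f (\<rho> l z) * g (\<rho> l z)) * (c l z * c l z - c l z))"
      proof (cases "\<exists>l\<in>L. cmod (z - l) < 1/2")
        case True
        then obtain l where l: "l \<in> L" "cmod (z - l) < 1/2" by blast
        note s = c_sum_single[OF l]
        have s1: "(\<Sum>m\<in>L. g (\<rho> m z) * (f0 f z * c m z)) = c l z * (g (\<rho> l z) * f0 f z)"
          using s[of "\<lambda>m. g (\<rho> m z) * f0 f z"] by (simp add: mult_ac)
        have s2: "(\<Sum>m\<in>L. f (\<rho> m z) * (c m z * f0 g z)) = c l z * (f (\<rho> l z) * f0 g z)"
          using s[of "\<lambda>m. f (\<rho> m z) * f0 g z"] by (simp add: mult_ac)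
        have s3: "(\<Sum>m\<in>L. (f (\<rho> m z) * g (\<rho> m z)) * (c m z * c m z - c m z)) = c l z * ((f (\<rho> l z) * g (\<rho> l z)) * (c l z - 1))"
          using s[of "\<lambda>m. (f (\<rho> m z) * g (\<rho> m z)) * (c m z - 1)"] by (simp add: algebra_simps)
        show ?thesis
        proof (cases "off z")
          case True
          then have f0h: "f0 h z = h z - c l z * h (\<rho> l z)" for h using s by (simp add: f0_def)
          show ?thesis unfolding s1 s2 s3 unfolding f0h by (simp add: algebra_simps)
        next
          case False
          then have "cmod (z - l) \<le> 2/5" using far_other[OF l(1) _ _ l(2)] by (force simp: off_def)
          then show ?thesis unfolding s1 s2 s3 using False by (simp add: f0_def c_one)
        qed
      next
        case False
        then have no: "\<And>l. l \<in> L \<Longrightarrow> c l z = 0" using c_zero by (auto simp: not_less)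
        then show ?thesis by (simp add: f0_def)
      qed
    qed
    also have "\<dots> = \<Phi> (f0 f) * \<Phi> (f0 g) + (\<Sum>l\<in>L. \<Phi> (\<lambda>t. g (\<rho> l t) * (f0 f t * c l t)))
        + (\<Sum>l\<in>L. \<Phi> (\<lambda>t. f (\<rho> l t) * (c l t * f0 g t)))
        + (\<Sum>l\<in>L. \<Phi> (\<lambda>t. (f (\<rho> l t) * g (\<rho> l t)) * (c l t * c l t - c l t)))"
      using cs f0_cont[OF f] f0_cont[OF g]
      by (simp add: hom_add hom_sum hom_mult continuous_on_add continuous_on_sum continuous_on_mult)
    finally show "\<Phi>' (\<lambda>t. f t * g t) = \<Phi>' f * \<Phi>' g" unfolding 1 by (simp add: \<Phi>'_def add_ac)
  next
    fix f :: "complex \<Rightarrow> complex" and k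
    assume f: "continuous_on \<Omega> f"
    have "f0 (\<lambda>t. k * f t) = (\<lambda>z. k * f0 f z)"
      by (auto simp: f0_def right_diff_distrib sum_distrib_left mult_ac)
    then show "\<Phi>' (\<lambda>t. k * f t) = k *\<^sub>C \<Phi>' f"
      using f by (simp add: \<Phi>'_def Wcm hom_cmult f0_cont scaleC_add_right scaleC_sum_right mult_scaleC_right)
  next
    fix f :: "complex \<Rightarrow> complex"
    assume f: "continuous_on \<Omega> f"
    have "f0 (\<lambda>t. cnj (f t)) = (\<lambda>z. cnj (f0 f z))"
      by (auto simp: f0_def c_real)
    moreover have "star (C l) = C l" for l unfolding C_def by (rule hom_selfadjoint[OF c_cont]) (simp add: c_def)
    ultimately show "\<Phi>' (\<lambda>t. cnj (f t)) = star (\<Phi>' f)"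
      using f comm[OF continuous_on_cnj[OF f]]
      by (simp add: \<Phi>'_def Wst hom_star f0_cont star_add star_sum star_mult)
  next
    have "\<Phi> (f0 (\<lambda>t. 1)) = \<Phi> (\<lambda>z. 1 - (\<Sum>l\<in>L. c l z))"
    proof (rule hom_cong[OF f0_cont])
      fix z
      show "f0 (\<lambda>t. 1) z = 1 - (\<Sum>l\<in>L. c l z)"
      proof (cases "off z")
        case False
        then obtain l where l: "l \<in> L" "cmod (z - l) < 2/5" by (auto simp: off_def)
        then show ?thesis using c_sum_single[of l z "\<lambda>_. 1"] False by (simp add: f0_def c_one)
      qed (simp add: f0_def)
    qed simp
    also have "\<dots> = 1 - (\<Sum>l\<in>L. C l)"
      using c_cont by (simp add: hom_diff hom_sum hom_one C_def continuous_on_sum)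
    finally have "\<Phi> (f0 (\<lambda>t. 1)) = 1 - (\<Sum>l\<in>L. C l)" .
    moreover have "W l (\<lambda>t. 1) = 1" for l by (simp add: W_def lift_def[abs_def] U.hom_one)
    ultimately show "\<Phi>' (\<lambda>t. 1) = 1" by (simp add: \<Phi>'_def)
  qed
  moreover have "norm (\<Phi>' (\<lambda>z. z) - \<Phi> (\<lambda>z. z)) \<le> 4/5"
  proof -
    define u where "u l = \<Psi> l (\<lambda>z. z)" for l
    have Wid: "W l (\<lambda>z. z) = l *\<^sub>C 1 + (2/5) *\<^sub>C u l" for l
    proof -
      have "W l (\<lambda>z. z) = \<Psi> l (\<lambda>z. l + (2/5) * z)" by (simp add: W_def lift_def[abs_def])
      also have "\<dots> = \<Psi> l (\<lambda>z. l) + \<Psi> l (\<lambda>z. (2/5) * z)" by (rule U.hom_add) (intro continuous_intros)+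
      also have "\<Psi> l (\<lambda>z. (2/5) * z) = (2/5) *\<^sub>C u l" unfolding u_def by (rule U.hom_cmult) simp
      finally show ?thesis by (simp only: U.hom_const)
    qed
    \<comment> \<open>the displacement of \<open>x\<close>, apart from the unitaries\<close>
    define h where "h z = f0 (\<lambda>z. z) z - z + (\<Sum>l\<in>L. l * c l z)" for z
    have hc: "continuous_on K h" unfolding h_def by (intro continuous_intros f0_cont c_cont)
    have "\<Phi> h = \<Phi> (f0 (\<lambda>z. z)) - \<Phi> (\<lambda>z. z) + (\<Sum>l\<in>L. l *\<^sub>C C l)"
      unfolding h_def C_def using c_cont[of K] f0_cont[of "\<lambda>z. z"]
      by (simp add: hom_add hom_diff hom_sum hom_cmult continuous_on_diff continuous_on_sum continuous_on_mult_left)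
    moreover have "(\<Sum>l\<in>L. C l * W l (\<lambda>z. z)) = (\<Sum>l\<in>L. l *\<^sub>C C l) + (2/5) *\<^sub>C (\<Sum>l\<in>L. C l * u l)"
      by (simp add: Wid distrib_left mult_scaleC_right sum.distrib scaleC_sum_right)
    ultimately have eq: "\<Phi>' (\<lambda>z. z) - \<Phi> (\<lambda>z. z) = \<Phi> h + (2/5) *\<^sub>C (\<Sum>l\<in>L. C l * u l)"
      by (simp add: \<Phi>'_def)
    have "norm (\<Phi> h) \<le> 2/5"
    proof (rule hom_norm_le[OF hc])
      fix z assume "z \<in> K"
      have s: "(\<Sum>l\<in>L. l * c l z) = (\<Sum>l\<in>L. c l z * l)" by (simp add: mult.commute)
      show "cmod (h z) \<le> 2/5"
      proof (cases "\<exists>l\<in>L. cmod (z - l) < 1/2")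
        case True
        then obtain l where l: "l \<in> L" "cmod (z - l) < 1/2" by blast
        note ss = c_sum_single[OF l]
        show ?thesis
        proof (cases "off z")
          case True
          then have "h z = - (c l z * ((2/5) * sgn (z - l)))"
            unfolding h_def s ss[of "\<lambda>l. l"] using ss[of "\<lambda>l. \<rho> l z"] by (simp add: f0_def \<rho>_def algebra_simps)
          then have "cmod (h z) = cmod (c l z) * (2/5 * cmod (sgn (z - l)))" by (simp add: norm_mult)
          also have "\<dots> \<le> 1 * (2/5 * 1)" using c_bound by (intro mult_mono) (auto simp: norm_sgn)
          finally show ?thesis by simp
        next
          case False
          then have d: "cmod (z - l) \<le> 2/5" using far_other[OF l(1) _ _ l(2)] by (force simp: off_def)
          then have "h z = - (z - l)" unfolding h_def s ss[of "\<lambda>l. l"] using False by (simp add: f0_def c_one)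
          then show ?thesis using d by (simp add: norm_minus_commute)
        qed
      next
        case False
        then have no: "\<And>l. l \<in> L \<Longrightarrow> c l z = 0" and "off z"
          using c_zero by (force simp: not_less off_def)+
        then show ?thesis by (simp add: h_def f0_def)
      qed
    qed simp
    moreover have "norm (\<Sum>l\<in>L. C l * u l) \<le> 1"
    proof -
      have uu: "star (u l) * u l = 1" for l
        using U.hom_unitary[of "\<lambda>z. z" l] by (simp add: u_def unitary_def)
      have cu: "C l * u l = u l * C l" if "l \<in> L" for l
      proof -
        have "C l * W l (\<lambda>z. z) = W l (\<lambda>z. z) * C l" by (rule comm[OF _ that]) simp
        then have "(2/5) *\<^sub>C (C l * u l) = (2/5) *\<^sub>C (u l * C l)"
          by (simp add: Wid distrib_left distrib_right mult_scaleC_left mult_scaleC_right)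
        then show ?thesis by simp
      qed
      have Csa: "star (C l) = C l" for l unfolding C_def by (rule hom_selfadjoint[OF c_cont]) (simp add: c_def)
      have "star (C l * u l) * (C m * u m) = (if l = m then C l * C l else 0)" if lm: "l \<in> L" "m \<in> L" for l m
      proof (cases "l = m")
        case True
        have "star (C l * u l) * (C l * u l) = (C l * star (u l)) * (u l * C l)"
        proof -
          have "star (C l * u l) = star (u l * C l)" using cu[OF lm(1)] by simp
          then show ?thesis by (simp add: star_mult Csa cu[OF lm(1)])
        qed
        also have "\<dots> = C l * (star (u l) * u l) * C l" by (simp add: mult.assoc)
        finally show ?thesis using True uu by simp
      next
        case False
        have "star (C l * u l) * (C m * u m) = star (u l) * (C l * C m) * u m" by (simp add: star_mult Csa mult.assoc)
        then show ?thesis using CC[OF lm False] False by simp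
      qed
      then have "star (\<Sum>l\<in>L. C l * u l) * (\<Sum>l\<in>L. C l * u l) = (\<Sum>l\<in>L. \<Sum>m\<in>L. if l = m then C l * C l else 0)"
        unfolding star_sum sum_product by (intro sum.cong refl) auto
      also have "\<dots> = (\<Sum>l\<in>L. C l * C l)" using L by simp
      also have "\<dots> = \<Phi> (\<lambda>z. \<Sum>l\<in>L. c l z * c l z)"
        using c_cont by (simp add: hom_sum hom_mult C_def continuous_on_mult)
      finally have e: "star (\<Sum>l\<in>L. C l * u l) * (\<Sum>l\<in>L. C l * u l) = \<Phi> (\<lambda>z. \<Sum>l\<in>L. c l z * c l z)" .
      have "norm (\<Phi> (\<lambda>z. \<Sum>l\<in>L. c l z * c l z)) \<le> 1"
      proof (rule hom_norm_le)
        show "continuous_on K (\<lambda>z. \<Sum>l\<in>L. c l z * c l z)" by (intro continuous_intros c_cont)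
        fix z assume "z \<in> K"
        show "cmod (\<Sum>l\<in>L. c l z * c l z) \<le> 1"
        proof (cases "\<exists>l\<in>L. cmod (z - l) < 1/2")
          case True
          then obtain l where l: "l \<in> L" "cmod (z - l) < 1/2" by blast
          then show ?thesis using c_sum_single[OF l, of "\<lambda>l. c l z"] c_bound[of l z]
            by (simp add: norm_mult mult_le_one)
        next
          case False
          then show ?thesis using c_sum_none[of z "\<lambda>l. c l z"] by (simp add: not_less)
        qed
      qed simp
      then show ?thesis using e by (intro norm_isometry_le[of "\<Sum>l\<in>L. C l * u l"]) simp
    qed
    ultimately have "norm (\<Phi> h) + norm ((2/5) *\<^sub>C (\<Sum>l\<in>L. C l * u l)) \<le> 4/5" by (simp add: norm_scaleC norm_divide)
    then show ?thesis unfolding eq by (rule order_trans[OF norm_triangle_ineq])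
  qed
  ultimately show ?thesis using that by blast
qed

end

section \<open>Cutting a graph across its edges\<close>

subsection \<open>Sequences modulo null sequences\<close>

definition eqv :: "(nat \<Rightarrow> 'a::real_normed_vector) \<Rightarrow> (nat \<Rightarrow> 'a) \<Rightarrow> bool"  (infix "\<asymp>" 50) where
  "a \<asymp> b \<longleftrightarrow> (\<lambda>n. a n - b n) \<longlonglongrightarrow> 0"

lemma eqv_refl [simp]: "a \<asymp> a" by (simp add: eqv_def)

lemma eqv_sym: "a \<asymp> b \<Longrightarrow> b \<asymp> a"
  using tendsto_minus[of "\<lambda>n. a n - b n" 0] by (simp add: eqv_def)

lemma eqv_trans [trans]: "a \<asymp> b \<Longrightarrow> b \<asymp> c \<Longrightarrow> a \<asymp> c"
  using tendsto_add[of "\<lambda>n. a n - b n" 0 _ "\<lambda>n. b n - c n" 0] by (simp add: eqv_def)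

lemma eqv_eq_trans [trans]: "a \<asymp> b \<Longrightarrow> b = c \<Longrightarrow> a \<asymp> c" "a = b \<Longrightarrow> b \<asymp> c \<Longrightarrow> a \<asymp> c"
  by auto

lemma eqv_add: "a \<asymp> b \<Longrightarrow> c \<asymp> d \<Longrightarrow> (\<lambda>n. a n + c n) \<asymp> (\<lambda>n. b n + d n)"
  using tendsto_add[of "\<lambda>n. a n - b n" 0 _ "\<lambda>n. c n - d n" 0] by (simp add: eqv_def algebra_simps)

lemma eqv_diff: "a \<asymp> b \<Longrightarrow> c \<asymp> d \<Longrightarrow> (\<lambda>n. a n - c n) \<asymp> (\<lambda>n. b n - d n)"
  using tendsto_diff[of "\<lambda>n. a n - b n" 0 _ "\<lambda>n. c n - d n" 0] by (simp add: eqv_def algebra_simps)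

lemma eqv_sum: "(\<And>i. i \<in> I \<Longrightarrow> a i \<asymp> b i) \<Longrightarrow> (\<lambda>n. \<Sum>i\<in>I. a i n) \<asymp> (\<lambda>n. \<Sum>i\<in>I. b i n)"
  by (induction I rule: infinite_finite_induct) (auto intro: eqv_add)

lemma Bseq_mult_null:
  fixes a c :: "nat \<Rightarrow> 'a::real_normed_algebra"
  assumes "Bseq a" "c \<longlonglongrightarrow> 0"
  shows "(\<lambda>n. a n * c n) \<longlonglongrightarrow> 0" "(\<lambda>n. c n * a n) \<longlonglongrightarrow> 0"
proof -
  obtain M where M: "M > 0" "\<And>n. norm (a n) \<le> M" using assms(1) by (auto simp: Bseq_def)
  have lim: "(\<lambda>n. M * norm (c n)) \<longlonglongrightarrow> 0"
    using tendsto_mult_right_zero[OF tendsto_norm_zero[OF assms(2)]] .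
  have "norm (a n * c n) \<le> M * norm (c n)" "norm (c n * a n) \<le> M * norm (c n)" for n
    using norm_mult_ineq[of "a n" "c n"] norm_mult_ineq[of "c n" "a n"] mult_right_mono[OF M(2)[of n] norm_ge_zero[of "c n"]]
    by (auto simp: mult.commute)
  then show "(\<lambda>n. a n * c n) \<longlonglongrightarrow> 0" "(\<lambda>n. c n * a n) \<longlonglongrightarrow> 0"
    by (auto intro!: Lim_null_comparison[OF always_eventually lim])
qed

lemma eqv_mult:
  fixes a b :: "nat \<Rightarrow> 'a::real_normed_algebra"
  assumes "a \<asymp> a'" "b \<asymp> b'" "Bseq a" "Bseq b'"
  shows "(\<lambda>n. a n * b n) \<asymp> (\<lambda>n. a' n * b' n)"
proof -
  have "(\<lambda>n. a n * (b n - b' n) + (a n - a' n) * b' n) \<longlonglongrightarrow> 0 + 0"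
    using assms by (intro tendsto_add Bseq_mult_null) (auto simp: eqv_def)
  then show ?thesis by (simp add: eqv_def algebra_simps)
qed

lemma eqv_mult_left:
  fixes b :: "nat \<Rightarrow> 'a::real_normed_algebra"
  assumes "b \<asymp> b'" "Bseq a" shows "(\<lambda>n. a n * b n) \<asymp> (\<lambda>n. a n * b' n)"
  using Bseq_mult_null(1)[OF assms(2), of "\<lambda>n. b n - b' n"] assms(1) by (simp add: eqv_def algebra_simps)

lemma eqv_mult_right:
  fixes b :: "nat \<Rightarrow> 'a::real_normed_algebra"
  assumes "b \<asymp> b'" "Bseq a" shows "(\<lambda>n. b n * a n) \<asymp> (\<lambda>n. b' n * a n)"
  using Bseq_mult_null(2)[OF assms(2), of "\<lambda>n. b n - b' n"] assms(1) by (simp add: eqv_def algebra_simps)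

lemma eqv_star: "a \<asymp> b \<Longrightarrow> (\<lambda>n. star (a n)) \<asymp> (\<lambda>n. star (b n :: 'a::cstar_algebra))"
  using tendsto_star[of "\<lambda>n. a n - b n" 0] by (simp add: eqv_def star_diff)

lemma eqv_scaleC: "a \<asymp> b \<Longrightarrow> (\<lambda>n. c *\<^sub>C a n) \<asymp> (\<lambda>n. c *\<^sub>C (b n :: 'a::cstar_algebra))"
  using tendsto_scaleC[of "\<lambda>n. a n - b n" 0 _ c] by (simp add: eqv_def complex_vector.scale_right_diff_distrib)

lemma Bseq_const [simp]: "Bseq (\<lambda>n. c :: 'a::real_normed_vector)"
  by (simp add: Bfun_const)

lemma Bseq_add': "Bseq a \<Longrightarrow> Bseq b \<Longrightarrow> Bseq (\<lambda>n. a n + b n :: 'a::real_normed_vector)"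
proof -
  assume "Bseq a" "Bseq b"
  then obtain M N where "\<And>n. norm (a n) \<le> M" "\<And>n. norm (b n) \<le> N" by (auto simp: Bseq_def)
  then have "norm (a n + b n) \<le> M + N" for n by (meson add_mono norm_triangle_ineq order_trans)
  then show ?thesis by (rule BseqI')
qed

lemma Bseq_mult':
  fixes a b :: "nat \<Rightarrow> 'a::real_normed_algebra"
  shows "Bseq a \<Longrightarrow> Bseq b \<Longrightarrow> Bseq (\<lambda>n. a n * b n)"
proof -
  assume "Bseq a" "Bseq b"
  then obtain M N where *: "M > 0" "\<And>n. norm (a n) \<le> M" "\<And>n. norm (b n) \<le> N" by (auto simp: Bseq_def)
  have "norm (a n * b n) \<le> M * N" for n
    using * by (intro order_trans[OF norm_mult_ineq] mult_mono) (auto intro: less_imp_le)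
  then show ?thesis by (rule BseqI')
qed

lemma Bseq_sum': "(\<And>i. i \<in> I \<Longrightarrow> Bseq (a i)) \<Longrightarrow> Bseq (\<lambda>n. \<Sum>i\<in>I. a i n :: 'a::real_normed_vector)"
  by (induction I rule: infinite_finite_induct) (auto intro: Bseq_add')

lemma Bseq_scaleC: "Bseq a \<Longrightarrow> Bseq (\<lambda>n. c *\<^sub>C (a n :: 'a::cstar_algebra))"
  using Bseq_mult'[OF Bseq_const[of "c *\<^sub>C 1"], of a] by (simp add: mult_scaleC_left)

lemma Bseq_diff': "Bseq a \<Longrightarrow> Bseq b \<Longrightarrow> Bseq (\<lambda>n. a n - b n :: 'a::real_normed_vector)"
  using Bseq_add'[of a "\<lambda>n. - b n"] by (simp add: Bseq_minus_iff)

lemmas Bseq_intros = Bseq_const Bseq_add' Bseq_mult' Bseq_sum' Bseq_scaleC Bseq_diff'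

subsection \<open>Spectral projections of finite-dimensional approximations\<close>

text \<open>Both functions take values in \<open>[0, 1]\<close>; \<open>plateau\<close> is \<open>1\<close> on the left half plane, \<open>core\<close> vanishes off it. A projection onto the left
  half of the circle therefore lies between them.\<close>

definition plateau :: "complex \<Rightarrow> complex" where "plateau w = complex_of_real (ramp (1 - 2 * Re w))"

definition core :: "complex \<Rightarrow> complex" where "core w = complex_of_real (ramp (- 2 * Re w))"

lemma continuous_on_plateau_core:
  "continuous_on S f \<Longrightarrow> continuous_on S (\<lambda>z. plateau (f z))"
  "continuous_on S f \<Longrightarrow> continuous_on S (\<lambda>z. core (f z))"
  unfolding plateau_def core_def by (intro continuous_intros; simp)+

lemma plateau_simps: "Re w \<le> 0 \<Longrightarrow> plateau w = 1" "1/2 \<le> Re w \<Longrightarrow> plateau w = 0" "plateau 1 = 0"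
  by (simp_all add: plateau_def ramp_simps)

lemma core_simps: "Re w \<le> -1/2 \<Longrightarrow> core w = 1" "0 \<le> Re w \<Longrightarrow> core w = 0" "core 1 = 0"
  by (simp_all add: core_def ramp_simps)

text \<open>The projections are the spectral projections, for the left half of the unit circle, of finite-dimensional unitaries converging
  to \<open>\<Phi> \<psi>\<close>. They commute asymptotically with the functions of \<open>\<Phi> \<psi>\<close>, and they lie below \<open>plateau\<close> and above \<open>core\<close>.\<close>

lemma (in af) arc_projections:
  fixes \<Phi> :: "('t::topological_space \<Rightarrow> complex) \<Rightarrow> 'a"
  assumes hom: "unital_star_hom \<Omega> \<Phi>" and \<psi>: "continuous_on \<Omega> \<psi>" "\<And>z. z \<in> \<Omega> \<Longrightarrow> cmod (\<psi> z) = 1"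
  obtains p where "\<And>n::nat. projection (p n)"
    "\<And>G. continuous_on (sphere 0 1) G \<Longrightarrow> (\<lambda>n. \<Phi> (\<lambda>z. G (\<psi> z)) * p n) \<asymp> (\<lambda>n. p n * \<Phi> (\<lambda>z. G (\<psi> z)))"
    "(\<lambda>n. \<Phi> (\<lambda>z. plateau (\<psi> z)) * p n) \<asymp> p"
    "(\<lambda>n. \<Phi> (\<lambda>z. core (\<psi> z)) * p n) \<asymp> (\<lambda>n. \<Phi> (\<lambda>z. core (\<psi> z)))"
proof -
  interpret star_hom \<Omega> \<Phi> by (rule star_homI[OF hom])
  define S where "S = sphere (0::complex) 1"
  have uV: "unitary (\<Phi> \<psi>)" by (rule hom_unitary[OF \<psi>])
  have comp: "continuous_on \<Omega> (\<lambda>z. G (\<psi> z))" if "continuous_on S G" for G :: "complex \<Rightarrow> complex"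
    by (rule continuous_on_compose2[OF that \<psi>(1)]) (use \<psi>(2) in \<open>auto simp: S_def\<close>)
  have chom: "unital_star_hom S (\<lambda>G. \<Phi> (\<lambda>z. G (\<psi> z)))"
    unfolding unital_star_hom_def
  proof (intro conjI allI impI)
    fix f g :: "complex \<Rightarrow> complex" assume fg: "continuous_on S f" "continuous_on S g"
    show "\<Phi> (\<lambda>z. f (\<psi> z)) = \<Phi> (\<lambda>z. g (\<psi> z))" if "\<forall>t\<in>S. f t = g t"
      by (rule hom_cong[OF comp[OF fg(1)]]) (use that \<psi>(2) in \<open>auto simp: S_def\<close>)
    show "\<Phi> (\<lambda>z. f (\<psi> z) + g (\<psi> z)) = \<Phi> (\<lambda>z. f (\<psi> z)) + \<Phi> (\<lambda>z. g (\<psi> z))"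
      by (rule hom_add[OF comp[OF fg(1)] comp[OF fg(2)]])
    show "\<Phi> (\<lambda>z. f (\<psi> z) * g (\<psi> z)) = \<Phi> (\<lambda>z. f (\<psi> z)) * \<Phi> (\<lambda>z. g (\<psi> z))"
      by (rule hom_mult[OF comp[OF fg(1)] comp[OF fg(2)]])
  qed (use comp in \<open>auto intro: hom_cmult hom_star hom_one\<close>)
  have "\<forall>n. \<exists>v. v \<in> D \<and> unitary v \<and> norm (v - \<Phi> \<psi>) < inverse (real (Suc n))"
  proof
    fix n
    have "inverse (real (Suc n)) > 0" by simp
    from approx_unitary[OF uV this] show "\<exists>v. v \<in> D \<and> unitary v \<and> norm (v - \<Phi> \<psi>) < inverse (real (Suc n))" by blast
  qed
  then obtain V where V: "\<And>n. V n \<in> D" "\<And>n. unitary (V n)" "\<And>n. norm (V n - \<Phi> \<psi>) < inverse (real (Suc n))" by metis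
  have "(\<lambda>n. V n - \<Phi> \<psi>) \<longlonglongrightarrow> 0"
    by (rule Lim_null_comparison[OF always_eventually LIMSEQ_inverse_real_of_nat]) (intro allI less_imp_le V(3))
  then have lim: "V \<longlonglongrightarrow> \<Phi> \<psi>" using LIM_zero_cancel by blast
  have "\<forall>n. \<exists>SP. resolution (fst SP) (snd SP) \<and> V n = (\<Sum>l\<in>fst SP. l *\<^sub>C snd SP l)"
  proof
    fix n
    show "\<exists>SP. resolution (fst SP) (snd SP) \<and> V n = (\<Sum>l\<in>fst SP. l *\<^sub>C snd SP l)"
      by (rule spectral_D[OF V(1) normal_unitary[OF V(2)], of n]) auto
  qed
  then obtain SP where SP: "\<And>n. resolution (fst (SP n)) (snd (SP n)) \<and> V n = (\<Sum>l\<in>fst (SP n). l *\<^sub>C snd (SP n) l)"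
    by metis
  define T P where "T n = fst (SP n)" and "P n = snd (SP n)" for n
  have res: "resolution (T n) (P n)" and Veq: "V n = (\<Sum>l\<in>T n. l *\<^sub>C P n l)" for n
    using SP by (auto simp: T_def P_def)
  have TS: "T n \<subseteq> S" for n using unitary_eigen_circle[OF res Veq _ V(2)] by (auto simp: S_def)
  define \<Psi> where "\<Psi> n f = (\<Sum>l\<in>T n. f l *\<^sub>C P n l)" for n and f :: "complex \<Rightarrow> complex"
  have \<Psi>T: "unital_star_hom (T n) (\<Psi> n)" for n unfolding \<Psi>_def by (rule resolution_hom[OF res])
  have \<Psi>S: "unital_star_hom S (\<Psi> n)" for n by (rule unital_star_hom_mono[OF \<Psi>T TS])
  interpret R: star_hom "T n" "\<Psi> n" for n by (rule star_homI[OF \<Psi>T])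
  have fin: "continuous_on (T n) f" for n and f :: "complex \<Rightarrow> complex"
    using res[of n] by (intro continuous_on_finite) (simp add: resolution_def)
  have S: "compact S" by (simp add: S_def)
  have "\<Psi> n (\<lambda>z. z) = V n" for n by (simp add: \<Psi>_def Veq)
  from calculus_limit[OF S \<Psi>S this lim] obtain \<Phi>0 where \<Phi>0: "unital_star_hom S \<Phi>0" "\<Phi>0 (\<lambda>z. z) = \<Phi> \<psi>"
    "\<And>f. continuous_on S f \<Longrightarrow> (\<lambda>n. \<Psi> n f) \<longlonglongrightarrow> \<Phi>0 f" by blast
  have conv: "(\<lambda>n. \<Psi> n G) \<asymp> (\<lambda>n. \<Phi> (\<lambda>z. G (\<psi> z)))" if G: "continuous_on S G" for G
  proof -
    have "\<Phi>0 G = \<Phi> (\<lambda>z. G (\<psi> z))"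
      by (rule hom_unique[OF \<Phi>0(1,2) chom _ S _ G]) auto
    then show ?thesis using \<Phi>0(3)[OF G] by (simp add: eqv_def LIM_zero)
  qed
  define ind where "ind l = (if Re l \<le> 0 then 1 else 0 :: complex)" for l
  define p where "p n = \<Psi> n ind" for n
  have proj: "projection (p n)" for n
  proof -
    have "p n * p n = p n" unfolding p_def
      using R.hom_mult[OF fin fin, of n ind ind] R.hom_cong[OF fin, of n "\<lambda>t. ind t * ind t" ind] by (simp add: ind_def)
    moreover have "star (p n) = p n" unfolding p_def by (rule R.hom_selfadjoint[OF fin]) (simp add: ind_def)
    ultimately show ?thesis by (simp add: projection_def)
  qed
  have Bp: "Bseq p" by (rule BseqI'[of _ 1]) (rule norm_projection_le[OF proj])
  show ?thesis
  proof (rule that[OF proj])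
    have left: "(\<lambda>n. \<Phi> (\<lambda>z. G (\<psi> z)) * p n) \<asymp> (\<lambda>n. \<Psi> n G * p n)"
      and right: "(\<lambda>n. \<Psi> n G * p n) \<asymp> (\<lambda>n. p n * \<Phi> (\<lambda>z. G (\<psi> z)))" if G: "continuous_on S G" for G
    proof -
      show "(\<lambda>n. \<Phi> (\<lambda>z. G (\<psi> z)) * p n) \<asymp> (\<lambda>n. \<Psi> n G * p n)"
        by (rule eqv_mult_right[OF eqv_sym[OF conv[OF G]] Bp])
      have "\<Psi> n G * p n = p n * \<Psi> n G" for n unfolding p_def by (rule R.hom_commute[OF fin fin])
      then show "(\<lambda>n. \<Psi> n G * p n) \<asymp> (\<lambda>n. p n * \<Phi> (\<lambda>z. G (\<psi> z)))"
        using eqv_mult_left[OF conv[OF G] Bp] by simp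
    qed
    show "(\<lambda>n. \<Phi> (\<lambda>z. G (\<psi> z)) * p n) \<asymp> (\<lambda>n. p n * \<Phi> (\<lambda>z. G (\<psi> z)))" if "continuous_on (sphere 0 1) G" for G
      using left right eqv_trans that unfolding S_def by blast
    have pc: "continuous_on S plateau" "continuous_on S core"
      using continuous_on_plateau_core[of S "\<lambda>z. z"] by auto
    have "\<Psi> n plateau * p n = p n" for n
      unfolding p_def using R.hom_mult[OF fin fin, of n plateau ind] R.hom_cong[OF fin, of n "\<lambda>t. plateau t * ind t" ind]
      by (simp add: ind_def plateau_simps)
    then show "(\<lambda>n. \<Phi> (\<lambda>z. plateau (\<psi> z)) * p n) \<asymp> p" using left[OF pc(1)] by simp
    have "\<Psi> n core * p n = \<Psi> n core" for n
      unfolding p_def using R.hom_mult[OF fin fin, of n core ind] R.hom_cong[OF fin, of n "\<lambda>t. core t * ind t" core]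
      by (simp add: ind_def core_simps)
    then show "(\<lambda>n. \<Phi> (\<lambda>z. core (\<psi> z)) * p n) \<asymp> (\<lambda>n. \<Phi> (\<lambda>z. core (\<psi> z)))"
      using left[OF pc(2)] conv[OF pc(2)] eqv_trans by simp
  qed
qed

subsection \<open>Assembling the pieces\<close>

text \<open>The edges \<open>e\<close> are described by maps \<open>\<psi> e\<close> to the unit circle that are constantly \<open>1\<close> off the edge and run once around
  the circle along the edge. The real label \<open>lab\<close> is constant near the vertices and varies only in the middle of the edges; the
  polynomial \<open>m\<close> recovers the position of a vertex from its label. The middle of every edge \<open>e\<close> is assigned to the vertex with label
  \<open>vtx e\<close>.\<close>

locale edges = af B + star_hom \<Omega> \<Phi>
  for B :: "nat \<Rightarrow> 'a::cstar_algebra set" and \<Omega> :: "complex set" and \<Phi> :: "(complex \<Rightarrow> complex) \<Rightarrow> 'a" +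
  fixes E :: "'e set" and \<psi> :: "'e \<Rightarrow> complex \<Rightarrow> complex" and lab m :: "complex \<Rightarrow> complex"
    and vtx :: "'e \<Rightarrow> complex" and \<epsilon> :: real
  assumes E: "finite E" and \<epsilon>: "0 < \<epsilon>"
    and \<psi>: "e \<in> E \<Longrightarrow> continuous_on \<Omega> (\<psi> e)" "e \<in> E \<Longrightarrow> z \<in> \<Omega> \<Longrightarrow> cmod (\<psi> e z) = 1"
    and disj: "e \<in> E \<Longrightarrow> e' \<in> E \<Longrightarrow> e \<noteq> e' \<Longrightarrow> z \<in> \<Omega> \<Longrightarrow> \<psi> e z = 1 \<or> \<psi> e' z = 1"
    and lab: "continuous_on \<Omega> lab" "z \<in> \<Omega> \<Longrightarrow> lab z \<in> \<real>"
    and lab_edge: "e \<in> E \<Longrightarrow> \<exists>G. continuous_on (sphere 0 1) G \<and> (\<forall>z\<in>\<Omega>. plateau (\<psi> e z) * lab z = G (\<psi> e z))"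
    and vtx: "e \<in> E \<Longrightarrow> vtx e \<in> \<real>"
    and m: "m \<in> zpoly"
    and near_edge: "e \<in> E \<Longrightarrow> z \<in> \<Omega> \<Longrightarrow> Re (\<psi> e z) < 1/2 \<Longrightarrow> cmod (z - m (vtx e)) \<le> \<epsilon>"
    and near_vertex: "z \<in> \<Omega> \<Longrightarrow> (\<And>e. e \<in> E \<Longrightarrow> - 1/2 < Re (\<psi> e z)) \<Longrightarrow> cmod (z - m (lab z)) \<le> \<epsilon>"
begin

definition \<theta> :: "'e \<Rightarrow> complex \<Rightarrow> complex" where "\<theta> e z = plateau (\<psi> e z)"
definition co :: "'e \<Rightarrow> complex \<Rightarrow> complex" where "co e z = core (\<psi> e z)"

lemma \<theta>_cont: "e \<in> E \<Longrightarrow> continuous_on \<Omega> (\<theta> e)" and co_cont: "e \<in> E \<Longrightarrow> continuous_on \<Omega> (co e)"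
  using continuous_on_plateau_core[OF \<psi>(1)] by (simp_all add: \<theta>_def[abs_def] co_def[abs_def])

lemma \<theta>_orth: "e \<in> E \<Longrightarrow> e' \<in> E \<Longrightarrow> e \<noteq> e' \<Longrightarrow> z \<in> \<Omega> \<Longrightarrow> \<theta> e z * \<theta> e' z = 0"
  using disj[of e e' z] by (auto simp: \<theta>_def plateau_simps)

lemma co_\<theta>_orth: "e \<in> E \<Longrightarrow> e' \<in> E \<Longrightarrow> e \<noteq> e' \<Longrightarrow> z \<in> \<Omega> \<Longrightarrow> co e z * \<theta> e' z = 0"
  using disj[of e e' z] by (auto simp: \<theta>_def co_def plateau_simps core_simps)

lemma ex_projections:
  "\<exists>p. (\<forall>e\<in>E. (\<forall>n::nat. projection (p e n)) \<and>
      (\<lambda>n. \<Phi> lab * p e n) \<asymp> (\<lambda>n. p e n * \<Phi> lab) \<and>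
      (\<lambda>n. \<Phi> (\<theta> e) * p e n) \<asymp> p e \<and> (\<lambda>n. \<Phi> (co e) * p e n) \<asymp> (\<lambda>n. \<Phi> (co e)))"
proof (rule bchoice, rule ballI)
  fix e assume e: "e \<in> E"
  obtain p where p: "\<And>n::nat. projection (p n)"
    "\<And>G. continuous_on (sphere 0 1) G \<Longrightarrow> (\<lambda>n. \<Phi> (\<lambda>z. G (\<psi> e z)) * p n) \<asymp> (\<lambda>n. p n * \<Phi> (\<lambda>z. G (\<psi> e z)))"
    "(\<lambda>n. \<Phi> (\<lambda>z. plateau (\<psi> e z)) * p n) \<asymp> p"
    "(\<lambda>n. \<Phi> (\<lambda>z. core (\<psi> e z)) * p n) \<asymp> (\<lambda>n. \<Phi> (\<lambda>z. core (\<psi> e z)))"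
    using arc_projections[OF unital_star_hom \<psi>(1)[OF e] \<psi>(2)[OF e]] by blast
  have th_eq: "\<theta> e = (\<lambda>z. plateau (\<psi> e z))" by (simp add: \<theta>_def[abs_def])
  have th: "(\<lambda>n. \<Phi> (\<theta> e) * p n) \<asymp> p" unfolding th_eq by (rule p(3))
  have Bp: "Bseq p" by (rule BseqI'[of _ 1]) (rule norm_projection_le[OF p(1)])
  obtain G where G: "continuous_on (sphere 0 1) G" "\<And>z. z \<in> \<Omega> \<Longrightarrow> plateau (\<psi> e z) * lab z = G (\<psi> e z)"
    using lab_edge[OF e] by blast
  have eqG: "\<Phi> (\<theta> e) * \<Phi> lab = \<Phi> (\<lambda>z. G (\<psi> e z))" "\<Phi> lab * \<Phi> (\<theta> e) = \<Phi> (\<lambda>z. G (\<psi> e z))"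
  proof -
    have "\<Phi> (\<lambda>z. \<theta> e z * lab z) = \<Phi> (\<lambda>z. G (\<psi> e z))"
      by (rule hom_cong[OF continuous_on_mult[OF \<theta>_cont[OF e] lab(1)]]) (simp add: \<theta>_def G(2))
    then show "\<Phi> (\<theta> e) * \<Phi> lab = \<Phi> (\<lambda>z. G (\<psi> e z))" "\<Phi> lab * \<Phi> (\<theta> e) = \<Phi> (\<lambda>z. G (\<psi> e z))"
      using hom_mult[OF \<theta>_cont[OF e] lab(1)] hom_commute[OF \<theta>_cont[OF e] lab(1)] by metis+
  qed
  have star_th: "star (\<Phi> (\<theta> e)) = \<Phi> (\<theta> e)"
    by (rule hom_selfadjoint[OF \<theta>_cont[OF e]]) (simp add: \<theta>_def plateau_def)
  have th': "(\<lambda>n. p n * \<Phi> (\<theta> e)) \<asymp> p"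
    using eqv_star[OF th] p(1) by (simp add: star_mult star_th projection_star)
  have "(\<lambda>n. \<Phi> lab * p n) \<asymp> (\<lambda>n. \<Phi> lab * (\<Phi> (\<theta> e) * p n))"
    by (rule eqv_mult_left[OF eqv_sym[OF th]]) simp
  also have "(\<lambda>n. \<Phi> lab * (\<Phi> (\<theta> e) * p n)) = (\<lambda>n. \<Phi> (\<lambda>z. G (\<psi> e z)) * p n)" by (simp add: eqG flip: mult.assoc)
  also have "\<dots> \<asymp> (\<lambda>n. p n * \<Phi> (\<lambda>z. G (\<psi> e z)))" by (rule p(2)[OF G(1)])
  also have "\<dots> = (\<lambda>n. p n * \<Phi> (\<theta> e) * \<Phi> lab)" by (simp add: eqG mult.assoc)
  also have "\<dots> \<asymp> (\<lambda>n. p n * \<Phi> lab)" by (rule eqv_mult_right[OF th']) simp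
  finally show "\<exists>p. (\<forall>n::nat. projection (p n)) \<and>
      (\<lambda>n. \<Phi> lab * p n) \<asymp> (\<lambda>n. p n * \<Phi> lab) \<and>
      (\<lambda>n. \<Phi> (\<theta> e) * p n) \<asymp> p \<and> (\<lambda>n. \<Phi> (co e) * p n) \<asymp> (\<lambda>n. \<Phi> (co e))"
    using p(1) th p(4) by (intro exI[of _ p]) (simp add: co_def[abs_def])
qed

text \<open>The projections \<open>p e\<close> cut out the middle of the edges, and on the complement \<open>r\<close> of their sum only the neighbourhoods of the vertices
  remain. There the element is approximated by \<open>m\<close> of its label, on \<open>p e\<close> by \<open>m (vtx e)\<close>. Hence \<open>m\<close> of the self-adjoint element
  \<open>T = (\<Sum>e. vtx e p e) + r lab r\<close> approximates the given one, because all parts commute asymptotically and are asymptotically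
  orthogonal.\<close>

theorem polynomial_approximation:
  obtains T y where "star T = T" "(m, y) \<in> gen T" "norm (\<Phi> (\<lambda>z. z) - y) \<le> 6 * \<epsilon>"
proof -
  obtain p where p: "\<And>e n. e \<in> E \<Longrightarrow> projection (p e (n::nat))"
    and pl: "\<And>e. e \<in> E \<Longrightarrow> (\<lambda>n. \<Phi> lab * p e n) \<asymp> (\<lambda>n. p e n * \<Phi> lab)"
    and pth: "\<And>e. e \<in> E \<Longrightarrow> (\<lambda>n. \<Phi> (\<theta> e) * p e n) \<asymp> p e"
    and pco: "\<And>e. e \<in> E \<Longrightarrow> (\<lambda>n. \<Phi> (co e) * p e n) \<asymp> (\<lambda>n. \<Phi> (co e))"
    using ex_projections by metis
  have Bp: "Bseq (p e)" if "e \<in> E" for e by (rule BseqI'[of _ 1]) (rule norm_projection_le[OF p[OF that]])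
  have star_th: "star (\<Phi> (\<theta> e)) = \<Phi> (\<theta> e)" if "e \<in> E" for e
    by (rule hom_selfadjoint[OF \<theta>_cont[OF that]]) (simp add: \<theta>_def plateau_def)
  have pth': "(\<lambda>n. p e n * \<Phi> (\<theta> e)) \<asymp> p e" if "e \<in> E" for e
    using eqv_star[OF pth[OF that]] p[OF that] by (simp add: star_mult star_th[OF that] projection_star)
  have fp0: "(\<lambda>n. \<Phi> f * p e' n) \<asymp> (\<lambda>n. 0)"
    if f: "continuous_on \<Omega> f" and e': "e' \<in> E" and z: "\<And>z. z \<in> \<Omega> \<Longrightarrow> f z * \<theta> e' z = 0" for f e'
  proof -
    have "(\<lambda>n. \<Phi> f * p e' n) \<asymp> (\<lambda>n. \<Phi> f * (\<Phi> (\<theta> e') * p e' n))"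
      by (rule eqv_mult_left[OF eqv_sym[OF pth[OF e']]]) simp
    also have "\<Phi> f * \<Phi> (\<theta> e') = 0"
      using hom_mult[OF f \<theta>_cont[OF e']] hom_cong[of "\<lambda>z. f z * \<theta> e' z" "\<lambda>z. 0"] z f \<theta>_cont[OF e']
      by (simp add: hom_zero continuous_on_mult)
    then have "(\<lambda>n. \<Phi> f * (\<Phi> (\<theta> e') * p e' n)) = (\<lambda>n. 0)" by (simp flip: mult.assoc)
    finally show ?thesis .
  qed
  have pp0: "(\<lambda>n. p e n * p e' n) \<asymp> (\<lambda>n. 0)" if e: "e \<in> E" "e' \<in> E" "e \<noteq> e'" for e e'
  proof -
    have "(\<lambda>n. p e n * p e' n) \<asymp> (\<lambda>n. p e n * \<Phi> (\<theta> e) * p e' n)"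
      by (rule eqv_mult_right[OF eqv_sym[OF pth'[OF e(1)]] Bp[OF e(2)]])
    also have "\<dots> = (\<lambda>n. p e n * (\<Phi> (\<theta> e) * p e' n))" by (simp add: mult.assoc)
    also have "\<dots> \<asymp> (\<lambda>n. p e n * 0)"
      by (rule eqv_mult_left[OF fp0[OF \<theta>_cont[OF e(1)] e(2)] Bp[OF e(1)]]) (rule \<theta>_orth[OF e])
    finally show ?thesis by simp
  qed
  define P where "P n = (\<Sum>e\<in>E. p e n)" for n
  define r where "r n = 1 - P n" for n
  have BP: "Bseq P" unfolding P_def by (rule Bseq_sum') (rule Bp)
  have Br: "Bseq r" unfolding r_def by (intro Bseq_intros BP)
  have Psa: "star (P n) = P n" for n using p by (simp add: P_def star_sum projection_star)
  have rsa: "star (r n) = r n" for n by (simp add: r_def star_diff Psa)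
  have pP: "(\<lambda>n. p e n * P n) \<asymp> p e" if e: "e \<in> E" for e
  proof -
    have "(\<lambda>n. \<Sum>e'\<in>E. p e n * p e' n) \<asymp> (\<lambda>n. \<Sum>e'\<in>E. if e' = e then p e n else 0)"
    proof (rule eqv_sum)
      fix e' assume "e' \<in> E"
      then show "(\<lambda>n. p e n * p e' n) \<asymp> (\<lambda>n. if e' = e then p e n else 0)"
        using pp0[OF e, of e'] p[OF e] by (cases "e' = e") (auto simp: projection_idem)
    qed
    then show ?thesis using E e by (simp add: P_def sum_distrib_left)
  qed
  have pr: "(\<lambda>n. p e n * r n) \<asymp> (\<lambda>n. 0)" if e: "e \<in> E" for e
    using eqv_diff[OF eqv_refl pP[OF e], of "p e"] by (simp add: r_def right_diff_distrib)
  have rp: "(\<lambda>n. r n * p e n) \<asymp> (\<lambda>n. 0)" if e: "e \<in> E" for e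
    using eqv_star[OF pr[OF e]] p[OF e] by (simp add: star_mult rsa projection_star)
  have PP: "(\<lambda>n. P n * P n) \<asymp> P"
  proof -
    have "(\<lambda>n. \<Sum>e\<in>E. p e n * P n) \<asymp> (\<lambda>n. \<Sum>e\<in>E. p e n)" by (rule eqv_sum) (rule pP)
    then show ?thesis by (simp add: P_def[abs_def] sum_distrib_right)
  qed
  have rr: "(\<lambda>n. r n * r n) \<asymp> r"
  proof -
    have "(\<lambda>n. r n - (P n - P n * P n)) \<asymp> (\<lambda>n. r n - (P n - P n))" by (intro eqv_diff eqv_refl PP)
    then show ?thesis by (simp add: r_def[abs_def] algebra_simps)
  qed
  have rl: "(\<lambda>n. \<Phi> lab * r n) \<asymp> (\<lambda>n. r n * \<Phi> lab)"
  proof -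
    have "(\<lambda>n. \<Sum>e\<in>E. \<Phi> lab * p e n) \<asymp> (\<lambda>n. \<Sum>e\<in>E. p e n * \<Phi> lab)" by (rule eqv_sum) (rule pl)
    then have "(\<lambda>n. \<Phi> lab * P n) \<asymp> (\<lambda>n. P n * \<Phi> lab)" by (simp add: P_def sum_distrib_left sum_distrib_right)
    from eqv_diff[OF eqv_refl this, of "\<lambda>n. \<Phi> lab"] show ?thesis by (simp add: r_def algebra_simps)
  qed
  have cr: "(\<lambda>n. \<Phi> (co e) * r n) \<asymp> (\<lambda>n. 0)" if e: "e \<in> E" for e
  proof -
    have "(\<lambda>n. \<Sum>e'\<in>E. \<Phi> (co e) * p e' n) \<asymp> (\<lambda>n. \<Sum>e'\<in>E. if e' = e then \<Phi> (co e) else 0)"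
    proof (rule eqv_sum)
      fix e' assume e': "e' \<in> E"
      show "(\<lambda>n. \<Phi> (co e) * p e' n) \<asymp> (\<lambda>n. if e' = e then \<Phi> (co e) else 0)"
        using pco[OF e] fp0[OF co_cont[OF e] e' co_\<theta>_orth[OF e e']] by (cases "e' = e") auto
    qed
    then have "(\<lambda>n. \<Phi> (co e) * P n) \<asymp> (\<lambda>n. \<Phi> (co e))" using E e by (simp add: P_def sum_distrib_left)
    from eqv_diff[OF eqv_refl this, of "\<lambda>n. \<Phi> (co e)"] show ?thesis by (simp add: r_def algebra_simps)
  qed
  have lsa: "star (\<Phi> lab) = \<Phi> lab" by (rule hom_selfadjoint[OF lab])
  have lc: "continuous_on \<Omega> (\<lambda>z. F (lab z))" if "F \<in> zpoly" for F
    by (rule continuous_on_compose2[OF continuous_on_zpoly[OF that, of UNIV] lab(1)]) auto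
  \<comment> \<open>\<open>r\<close> commutes asymptotically with polynomials in the label\<close>
  have rF: "(\<lambda>n. \<Phi> (\<lambda>z. F (lab z)) * r n) \<asymp> (\<lambda>n. r n * \<Phi> (\<lambda>z. F (lab z)))" if "F \<in> zpoly" for F
    using that
  proof (induction rule: zpoly.induct)
    case (zpoly_const c)
    then show ?case by (simp add: hom_const mult_scaleC_left mult_scaleC_right)
  next
    case zpoly_cnj
    have "\<Phi> (\<lambda>z. cnj (lab z)) = \<Phi> lab" using hom_star[OF lab(1)] lsa by simp
    then show ?case using rl by simp
  next
    case (zpoly_add F G)
    then show ?case
      using eqv_add[OF zpoly_add.IH] lc by (simp add: hom_add distrib_left distrib_right)
  next
    case (zpoly_mult F G)
    let ?F = "\<Phi> (\<lambda>z. F (lab z))" and ?G = "\<Phi> (\<lambda>z. G (lab z))"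
    have "(\<lambda>n. ?F * (?G * r n)) \<asymp> (\<lambda>n. ?F * (r n * ?G))" by (rule eqv_mult_left[OF zpoly_mult.IH(2)]) simp
    also have "\<dots> = (\<lambda>n. ?F * r n * ?G)" by (simp add: mult.assoc)
    also have "\<dots> \<asymp> (\<lambda>n. r n * ?F * ?G)" by (rule eqv_mult_right[OF zpoly_mult.IH(1)]) simp
    finally show ?case using zpoly_mult.hyps lc by (simp add: hom_mult mult.assoc)
  qed (rule rl)
  \<comment> \<open>asymptotically the value of the polynomial \<open>F\<close> at \<open>T n\<close>\<close>
  define S where "S F n = (\<Sum>e\<in>E. F (vtx e) *\<^sub>C p e n) + \<Phi> (\<lambda>z. F (lab z)) * r n" for F n
  have BS: "Bseq (S F)" for F unfolding S_def by (intro Bseq_intros Bp Br)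
  define T where "T n = (\<Sum>e\<in>E. vtx e *\<^sub>C p e n) + r n * \<Phi> lab * r n" for n
  have Tsa: "star (T n) = T n" for n
  proof -
    have "cnj (vtx e) = vtx e" if "e \<in> E" for e using vtx[OF that] by (simp add: Reals_cnj_iff)
    then show ?thesis using p by (simp add: T_def star_add star_sum star_scaleC star_mult rsa lsa mult.assoc projection_star)
  qed
  have BT: "Bseq T" unfolding T_def by (intro Bseq_intros Bp Br)
  have TS: "T \<asymp> S (\<lambda>z. z)"
  proof -
    have "(\<lambda>n. r n * \<Phi> lab * r n) \<asymp> (\<lambda>n. \<Phi> lab * r n * r n)" by (rule eqv_mult_right[OF eqv_sym[OF rl] Br])
    also have "\<dots> = (\<lambda>n. \<Phi> lab * (r n * r n))" by (simp add: mult.assoc)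
    also have "\<dots> \<asymp> (\<lambda>n. \<Phi> lab * r n)" by (rule eqv_mult_left[OF rr]) simp
    finally show ?thesis unfolding S_def T_def by (intro eqv_add eqv_refl)
  qed
  have SS: "(\<lambda>n. S F n * S G n) \<asymp> S (\<lambda>z. F z * G z)" if F: "F \<in> zpoly" and G: "G \<in> zpoly" for F G
  proof -
    let ?F = "\<Phi> (\<lambda>z. F (lab z))" and ?G = "\<Phi> (\<lambda>z. G (lab z))"
    let ?SF = "\<lambda>n. \<Sum>e\<in>E. F (vtx e) *\<^sub>C p e n" and ?SG = "\<lambda>n. \<Sum>e\<in>E. G (vtx e) *\<^sub>C p e n"
    have 1: "(\<lambda>n. ?SF n * ?SG n) \<asymp> (\<lambda>n. \<Sum>e\<in>E. (F (vtx e) * G (vtx e)) *\<^sub>C p e n)"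
    proof -
      have "(\<lambda>n. \<Sum>e\<in>E. \<Sum>e'\<in>E. (F (vtx e) * G (vtx e')) *\<^sub>C (p e n * p e' n)) \<asymp>
          (\<lambda>n. \<Sum>e\<in>E. \<Sum>e'\<in>E. if e = e' then (F (vtx e) * G (vtx e)) *\<^sub>C p e n else 0)"
      proof (intro eqv_sum)
        fix e e' assume e: "e \<in> E" "e' \<in> E"
        show "(\<lambda>n. (F (vtx e) * G (vtx e')) *\<^sub>C (p e n * p e' n)) \<asymp>
            (\<lambda>n. if e = e' then (F (vtx e) * G (vtx e)) *\<^sub>C p e n else 0)"
        proof (cases "e = e'")
          case True
          then show ?thesis using p[OF e(1)] by (simp add: projection_idem)
        next
          case False
          then show ?thesis using eqv_scaleC[OF pp0[OF e False]] by simp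
        qed
      qed
      then show ?thesis using E by (simp add: sum_product mult_scaleC_left mult_scaleC_right scaleC_scaleC mult.commute)
    qed
    have 2: "(\<lambda>n. ?SF n * (?G * r n)) \<asymp> (\<lambda>n. 0)"
    proof -
      have "(\<lambda>n. p e n * (?G * r n)) \<asymp> (\<lambda>n. 0)" if e: "e \<in> E" for e
      proof -
        have "(\<lambda>n. p e n * (?G * r n)) \<asymp> (\<lambda>n. p e n * (r n * ?G))" by (rule eqv_mult_left[OF rF[OF G] Bp[OF e]])
        also have "\<dots> = (\<lambda>n. p e n * r n * ?G)" by (simp add: mult.assoc)
        also have "\<dots> \<asymp> (\<lambda>n. 0 * ?G)" by (rule eqv_mult_right[OF pr[OF e]]) simp
        finally show ?thesis by simp
      qed
      then have "(\<lambda>n. \<Sum>e\<in>E. F (vtx e) *\<^sub>C (p e n * (?G * r n))) \<asymp> (\<lambda>n. \<Sum>e\<in>E. F (vtx e) *\<^sub>C 0)"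
        by (intro eqv_sum eqv_scaleC)
      then show ?thesis by (simp add: sum_distrib_right mult_scaleC_left)
    qed
    have 3: "(\<lambda>n. ?F * r n * ?SG n) \<asymp> (\<lambda>n. 0)"
    proof -
      have "(\<lambda>n. ?F * (r n * p e n)) \<asymp> (\<lambda>n. ?F * 0)" if e: "e \<in> E" for e
        by (rule eqv_mult_left[OF rp[OF e]]) simp
      then have "(\<lambda>n. \<Sum>e\<in>E. G (vtx e) *\<^sub>C (?F * (r n * p e n))) \<asymp> (\<lambda>n. \<Sum>e\<in>E. G (vtx e) *\<^sub>C (?F * 0))"
        by (intro eqv_sum eqv_scaleC)
      then show ?thesis by (simp add: sum_distrib_left mult_scaleC_right mult.assoc)
    qed
    have 4: "(\<lambda>n. ?F * r n * (?G * r n)) \<asymp> (\<lambda>n. \<Phi> (\<lambda>z. F (lab z) * G (lab z)) * r n)"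
    proof -
      have "(\<lambda>n. ?F * (r n * ?G) * r n) \<asymp> (\<lambda>n. ?F * (?G * r n) * r n)"
        by (intro eqv_mult_right[OF eqv_mult_left[OF eqv_sym[OF rF[OF G]]]] Br) simp
      also have "\<dots> = (\<lambda>n. ?F * ?G * (r n * r n))" by (simp add: mult.assoc)
      also have "\<dots> \<asymp> (\<lambda>n. ?F * ?G * r n)" by (rule eqv_mult_left[OF rr]) simp
      finally show ?thesis using hom_mult[OF lc[OF F] lc[OF G]] by (simp add: mult.assoc)
    qed
    have "(\<lambda>n. (?SF n * ?SG n + ?SF n * (?G * r n)) + (?F * r n * ?SG n + ?F * r n * (?G * r n))) \<asymp>
        (\<lambda>n. ((\<Sum>e\<in>E. (F (vtx e) * G (vtx e)) *\<^sub>C p e n) + 0) + (0 + \<Phi> (\<lambda>z. F (lab z) * G (lab z)) * r n))"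
      by (intro eqv_add 1 2 3 4)
    moreover have "(\<lambda>n. (?SF n * ?SG n + ?SF n * (?G * r n)) + (?F * r n * ?SG n + ?F * r n * (?G * r n))) =
        (\<lambda>n. S F n * S G n)"
      unfolding S_def by (simp only: distrib_left distrib_right add.assoc add.left_commute)
    ultimately show ?thesis by (simp add: S_def[abs_def])
  qed
  have genS: "\<exists>y. (\<forall>n. (F, y n) \<in> gen (T n)) \<and> Bseq y \<and> y \<asymp> S F" if "F \<in> zpoly" for F
    using that
  proof (induction rule: zpoly.induct)
    case (zpoly_const c)
    have "S (\<lambda>_. c) n = c *\<^sub>C 1" for n
    proof -
      have "S (\<lambda>_. c) n = c *\<^sub>C P n + c *\<^sub>C r n" by (simp add: S_def P_def hom_const mult_scaleC_left scaleC_sum_right)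
      also have "\<dots> = c *\<^sub>C (P n + r n)" by (simp only: scaleC_add_right)
      finally show ?thesis by (simp add: r_def)
    qed
    then have "S (\<lambda>_. c) = (\<lambda>n. c *\<^sub>C 1)" by auto
    then show ?case by (intro exI[of _ "\<lambda>n. c *\<^sub>C 1"]) (auto intro: gen.intros)
  next
    case zpoly_id
    then show ?case using TS BT by (intro exI[of _ T]) (auto intro: gen.intros)
  next
    case zpoly_cnj
    have "S cnj = S (\<lambda>z. z)"
    proof
      fix n
      have "cnj (vtx e) = vtx e" if "e \<in> E" for e using vtx[OF that] by (simp add: Reals_cnj_iff)
      moreover have "\<Phi> (\<lambda>z. cnj (lab z)) = \<Phi> lab" using hom_star[OF lab(1)] lsa by simp
      ultimately show "S cnj n = S (\<lambda>z. z) n" by (simp add: S_def)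
    qed
    moreover have "(cnj, T n) \<in> gen (T n)" for n using gen_cnj[of "T n"] Tsa by simp
    ultimately show ?case using TS BT by (intro exI[of _ T]) auto
  next
    case (zpoly_add F G)
    then obtain y y' where y: "\<forall>n. (F, y n) \<in> gen (T n)" "Bseq y" "y \<asymp> S F"
      "\<forall>n. (G, y' n) \<in> gen (T n)" "Bseq y'" "y' \<asymp> S G" by blast
    have "S (\<lambda>z. F z + G z) = (\<lambda>n. S F n + S G n)"
      using hom_add[OF lc[OF zpoly_add.hyps(1)] lc[OF zpoly_add.hyps(2)]]
      by (auto simp: S_def scaleC_add_left sum.distrib distrib_right)
    then show ?case using y by (intro exI[of _ "\<lambda>n. y n + y' n"]) (auto intro: gen.intros Bseq_add' eqv_add)
  next
    case (zpoly_mult F G)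
    then obtain y y' where y: "\<forall>n. (F, y n) \<in> gen (T n)" "Bseq y" "y \<asymp> S F"
      "\<forall>n. (G, y' n) \<in> gen (T n)" "Bseq y'" "y' \<asymp> S G" by blast
    have "(\<lambda>n. y n * y' n) \<asymp> (\<lambda>n. S F n * S G n)" by (rule eqv_mult[OF y(3,6,2) BS])
    also have "\<dots> \<asymp> S (\<lambda>z. F z * G z)" by (rule SS[OF zpoly_mult.hyps])
    finally show ?case using y by (intro exI[of _ "\<lambda>n. y n * y' n"]) (auto intro: gen.intros Bseq_mult')
  qed
  obtain y where y: "\<And>n. (m, y n) \<in> gen (T n)" "y \<asymp> S m" using genS[OF m] by blast
  \<comment> \<open>\<open>f1\<close> and \<open>f2\<close> represent the errors on the projections \<open>p e\<close> and on \<open>r\<close>; as functions they are bounded by \<open>\<epsilon>\<close>\<close>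
  define g where "g e z = (z - m (vtx e)) * \<theta> e z" for e z
  define f1 where "f1 z = (\<Sum>e\<in>E. g e z)" for z
  define f2 where "f2 z = (z - m (lab z)) * (1 - (\<Sum>e\<in>E. co e z))" for z
  have gc: "continuous_on \<Omega> (g e)" if "e \<in> E" for e
    unfolding g_def by (intro continuous_intros \<theta>_cont that)
  have f1c: "continuous_on \<Omega> f1" unfolding f1_def by (intro continuous_intros gc)
  have mc: "continuous_on \<Omega> (\<lambda>z. z - m (lab z))" by (intro continuous_intros lc m)
  have f2c: "continuous_on \<Omega> f2" unfolding f2_def by (intro continuous_on_mult mc continuous_intros co_cont)
  have x1: "(\<lambda>n. \<Phi> f1 * P n) \<asymp> (\<lambda>n. \<Sum>e\<in>E. (\<Phi> (\<lambda>z. z) - m (vtx e) *\<^sub>C 1) * p e n)"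
  proof -
    have "(\<lambda>n. \<Sum>e\<in>E. \<Sum>e'\<in>E. \<Phi> (g e) * p e' n) \<asymp>
        (\<lambda>n. \<Sum>e\<in>E. \<Sum>e'\<in>E. if e' = e then (\<Phi> (\<lambda>z. z) - m (vtx e) *\<^sub>C 1) * p e n else 0)"
    proof (intro eqv_sum)
      fix e e' assume e: "e \<in> E" "e' \<in> E"
      show "(\<lambda>n. \<Phi> (g e) * p e' n) \<asymp> (\<lambda>n. if e' = e then (\<Phi> (\<lambda>z. z) - m (vtx e) *\<^sub>C 1) * p e n else 0)"
      proof (cases "e' = e")
        case True
        have "\<Phi> (g e) = (\<Phi> (\<lambda>z. z) - m (vtx e) *\<^sub>C 1) * \<Phi> (\<theta> e)"
          unfolding g_def[abs_def] using hom_mult[of "\<lambda>z. z - m (vtx e)" "\<theta> e"] \<theta>_cont[OF e(1)]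
          by (simp add: hom_diff hom_const continuous_on_diff)
        then have "(\<lambda>n. \<Phi> (g e) * p e n) = (\<lambda>n. (\<Phi> (\<lambda>z. z) - m (vtx e) *\<^sub>C 1) * (\<Phi> (\<theta> e) * p e n))"
          by (simp add: mult.assoc)
        also have "\<dots> \<asymp> (\<lambda>n. (\<Phi> (\<lambda>z. z) - m (vtx e) *\<^sub>C 1) * p e n)"
          by (rule eqv_mult_left[OF pth[OF e(1)]]) simp
        finally show ?thesis using True by simp
      next
        case False
        then show ?thesis
          using fp0[OF gc[OF e(1)] e(2)] \<theta>_orth[OF e] by (auto simp: g_def mult.assoc)
      qed
    qed
    moreover have "\<Phi> f1 = (\<Sum>e\<in>E. \<Phi> (g e))" unfolding f1_def by (rule hom_sum) (rule gc)
    ultimately show ?thesis using E by (simp add: P_def sum_product)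
  qed
  have x2: "(\<lambda>n. \<Phi> f2 * r n) \<asymp> (\<lambda>n. (\<Phi> (\<lambda>z. z) - \<Phi> (\<lambda>z. m (lab z))) * r n)"
  proof -
    let ?d = "\<Phi> (\<lambda>z. z - m (lab z))"
    have "\<Phi> f2 = ?d * (1 - (\<Sum>e\<in>E. \<Phi> (co e)))"
      unfolding f2_def using hom_mult[OF mc, of "\<lambda>z. 1 - (\<Sum>e\<in>E. co e z)"] co_cont
      by (simp add: hom_diff hom_one hom_sum continuous_on_diff continuous_on_sum)
    then have "(\<lambda>n. \<Phi> f2 * r n) = (\<lambda>n. ?d * (r n - (\<Sum>e\<in>E. \<Phi> (co e) * r n)))"
      by (simp add: mult.assoc left_diff_distrib sum_distrib_right)
    also have "\<dots> \<asymp> (\<lambda>n. ?d * (r n - (\<Sum>e\<in>E. 0)))"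
      by (intro eqv_mult_left eqv_diff eqv_refl eqv_sum cr) auto
    finally show ?thesis using lc[OF m] by (simp add: hom_diff)
  qed
  have xS: "(\<lambda>n. \<Phi> (\<lambda>z. z) - S m n) \<asymp> (\<lambda>n. \<Phi> f1 * P n + \<Phi> f2 * r n)"
  proof -
    have "\<Phi> (\<lambda>z. z) - S m n = (\<Sum>e\<in>E. (\<Phi> (\<lambda>z. z) - m (vtx e) *\<^sub>C 1) * p e n) + (\<Phi> (\<lambda>z. z) - \<Phi> (\<lambda>z. m (lab z))) * r n" for n
    proof -
      have "(\<Sum>e\<in>E. (\<Phi> (\<lambda>z. z) - m (vtx e) *\<^sub>C 1) * p e n) = \<Phi> (\<lambda>z. z) * P n - (\<Sum>e\<in>E. m (vtx e) *\<^sub>C p e n)"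
        by (simp add: P_def left_diff_distrib sum_subtractf sum_distrib_left mult_scaleC_left)
      moreover have "\<Phi> (\<lambda>z. z) = \<Phi> (\<lambda>z. z) * P n + \<Phi> (\<lambda>z. z) * r n" by (simp add: r_def algebra_simps)
      ultimately show ?thesis by (simp add: S_def left_diff_distrib)
    qed
    then show ?thesis using eqv_sym[OF eqv_add[OF x1 x2]] by simp
  qed
  have xy: "(\<lambda>n. \<Phi> (\<lambda>z. z) - y n) \<asymp> (\<lambda>n. \<Phi> f1 * P n + \<Phi> f2 * r n)"
    using eqv_trans[OF eqv_diff[OF eqv_refl y(2)] xS] .
  have nf1: "norm (\<Phi> f1) \<le> \<epsilon>"
  proof (rule hom_norm_le[OF f1c])
    fix z assume z: "z \<in> \<Omega>"
    show "cmod (f1 z) \<le> \<epsilon>"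
    proof (cases "\<exists>e\<in>E. \<theta> e z \<noteq> 0")
      case True
      then obtain e where e: "e \<in> E" "\<theta> e z \<noteq> 0" by blast
      have "f1 z = (\<Sum>e'\<in>{e}. g e' z)"
        unfolding f1_def using E e \<theta>_orth[OF e(1) _ _ z] by (intro sum.mono_neutral_right) (auto simp: g_def)
      then have "cmod (f1 z) = cmod (z - m (vtx e)) * cmod (\<theta> e z)" by (simp add: g_def norm_mult)
      moreover have "Re (\<psi> e z) < 1/2" using e(2) plateau_simps(2)[of "\<psi> e z"] by (force simp: \<theta>_def)
      ultimately have "cmod (f1 z) \<le> \<epsilon> * 1"
        using near_edge[OF e(1) z] ramp_bounds \<epsilon>
        by (simp only:) (intro mult_mono; simp add: \<theta>_def plateau_def)
      then show ?thesis by simp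
    next
      case False
      then show ?thesis using \<epsilon> by (simp add: f1_def g_def)
    qed
  qed (use \<epsilon> in simp)
  have nf2: "norm (\<Phi> f2) \<le> \<epsilon>"
  proof (rule hom_norm_le[OF f2c])
    fix z assume z: "z \<in> \<Omega>"
    show "cmod (f2 z) \<le> \<epsilon>"
    proof (cases "\<exists>e\<in>E. co e z \<noteq> 0")
      case True
      then obtain e where e: "e \<in> E" "co e z \<noteq> 0" by blast
      then have "\<psi> e z \<noteq> 1" by (auto simp: co_def core_simps)
      then have one: "\<psi> e' z = 1" if "e' \<in> E" "e' \<noteq> e" for e' using disj[OF that(1) e(1) that(2) z] by auto
      have s: "(\<Sum>e\<in>E. co e z) = co e z"
      proof -
        have "(\<Sum>e\<in>E. co e z) = (\<Sum>e\<in>{e}. co e z)"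
          using E e one by (intro sum.mono_neutral_right) (auto simp: co_def core_simps)
        then show ?thesis by simp
      qed
      have b: "cmod (1 - co e z) \<le> 1"
      proof -
        have "1 - co e z = complex_of_real (1 - ramp (- 2 * Re (\<psi> e z)))" by (simp add: co_def core_def)
        then show ?thesis using ramp_bounds[of "- 2 * Re (\<psi> e z)"] by (simp only: norm_of_real)
      qed
      show ?thesis
      proof (cases "Re (\<psi> e z) \<le> -1/2")
        case True
        then have "co e z = 1" by (simp add: co_def core_simps)
        then show ?thesis using \<epsilon> by (simp add: f2_def s)
      next
        case False
        have "cmod (z - m (lab z)) \<le> \<epsilon>"
        proof (rule near_vertex[OF z])
          fix e' assume "e' \<in> E"
          then show "- 1/2 < Re (\<psi> e' z)" using one[of e'] False by (cases "e' = e") auto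
        qed
        then have "cmod (z - m (lab z)) * cmod (1 - co e z) \<le> \<epsilon> * 1" using b \<epsilon> by (intro mult_mono) auto
        then show ?thesis by (simp add: f2_def s norm_mult)
      qed
    next
      case False
      have "cmod (z - m (lab z)) \<le> \<epsilon>"
      proof (rule near_vertex[OF z])
        fix e' assume "e' \<in> E"
        then show "- 1/2 < Re (\<psi> e' z)" using False core_simps(1)[of "\<psi> e' z"] by (force simp: co_def)
      qed
      then show ?thesis using False by (simp add: f2_def)
    qed
  qed (use \<epsilon> in simp)
  have "eventually (\<lambda>n. norm (P n * P n - P n) < 2) sequentially"
    using PP tendstoD[of "\<lambda>n. P n * P n - P n" 0 sequentially 2] by (simp add: eqv_def)
  moreover have "eventually (\<lambda>n. norm (\<Phi> (\<lambda>z. z) - y n - (\<Phi> f1 * P n + \<Phi> f2 * r n)) < \<epsilon>) sequentially"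
    using xy \<epsilon> tendstoD[of "\<lambda>n. \<Phi> (\<lambda>z. z) - y n - (\<Phi> f1 * P n + \<Phi> f2 * r n)" 0 sequentially \<epsilon>] by (simp add: eqv_def)
  ultimately have "eventually (\<lambda>n. norm (P n * P n - P n) < 2 \<and>
      norm (\<Phi> (\<lambda>z. z) - y n - (\<Phi> f1 * P n + \<Phi> f2 * r n)) < \<epsilon>) sequentially" by (rule eventually_conj)
  then obtain n where n: "norm (P n * P n - P n) < 2" "norm (\<Phi> (\<lambda>z. z) - y n - (\<Phi> f1 * P n + \<Phi> f2 * r n)) < \<epsilon>"
    by (auto dest: eventually_happens)
  have nP: "norm (P n) \<le> 2"
  proof (rule ccontr)
    assume "\<not> norm (P n) \<le> 2"
    then have "2 * norm (P n) \<le> norm (P n) * norm (P n)" by (intro mult_right_mono) auto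
    moreover have "norm (P n * P n) = norm (P n) * norm (P n)"
      using norm_star_mult_self[of "P n"] Psa by (simp add: power2_eq_square)
    moreover have "norm (P n * P n) \<le> norm (P n) + norm (P n * P n - P n)"
      using norm_triangle_ineq[of "P n" "P n * P n - P n"] by simp
    ultimately show False using n(1) \<open>\<not> norm (P n) \<le> 2\<close> by linarith
  qed
  have nr: "norm (r n) \<le> 3" using norm_triangle_ineq4[of 1 "P n"] nP by (simp add: r_def)
  have "norm (\<Phi> f1 * P n) \<le> \<epsilon> * 2" using nf1 nP \<epsilon> by (intro order_trans[OF norm_mult_ineq] mult_mono) auto
  moreover have "norm (\<Phi> f2 * r n) \<le> \<epsilon> * 3" using nf2 nr \<epsilon> by (intro order_trans[OF norm_mult_ineq] mult_mono) auto
  ultimately have "norm (\<Phi> f1 * P n + \<Phi> f2 * r n) \<le> 5 * \<epsilon>"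
    using norm_triangle_ineq[of "\<Phi> f1 * P n" "\<Phi> f2 * r n"] by linarith
  then have "norm (\<Phi> (\<lambda>z. z) - y n) \<le> 6 * \<epsilon>"
    using n(2) norm_triangle_ineq[of "\<Phi> (\<lambda>z. z) - y n - (\<Phi> f1 * P n + \<Phi> f2 * r n)" "\<Phi> f1 * P n + \<Phi> f2 * r n"] by simp
  then show ?thesis using that[OF Tsa y(1)] by blast
qed

end

section \<open>Normal elements are limits of finite-dimensional normal elements\<close>

text \<open>The geometry of the unit grid on the square of half-width \<open>M\<close>: discs around the centers of the cells are removed, and
  what is left is cut across the middle of the edges of the grid.\<close>

text \<open>The flag distinguishes horizontal edges (\<open>True\<close>), along which the real part varies, from vertical ones.\<close>

definition coord :: "bool \<Rightarrow> complex \<Rightarrow> real" where "coord h z = (if h then Re z else Im z)"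

lemma continuous_on_coord [continuous_intros]:
  "continuous_on S f \<Longrightarrow> continuous_on S (\<lambda>z. coord h (f z))"
  unfolding coord_def by (cases h) (auto intro: continuous_intros)

text \<open>Runs once around the circle on the middle half \<open>[1/4, 3/4]\<close> of a unit edge.\<close>

definition winding :: "real \<Rightarrow> complex" where "winding u = exp (\<i> * complex_of_real (2 * pi * ramp (2 * u - 1/2)))"

lemma continuous_on_winding [continuous_intros]:
  "continuous_on S f \<Longrightarrow> continuous_on S (\<lambda>z. winding (f z))"
  unfolding winding_def by (intro continuous_intros)

lemma winding_norm: "cmod (winding u) = 1"
  by (simp add: winding_def norm_exp_i_times)

lemma winding_not_one: "winding u \<noteq> 1 \<Longrightarrow> \<bar>u - 1/2\<bar> < 1/4"
proof (rule ccontr)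
  assume 1: "winding u \<noteq> 1" and "\<not> \<bar>u - 1/2\<bar> < 1/4"
  then have "u \<le> 1/4 \<or> 3/4 \<le> u" by (auto simp: abs_if split: if_splits)
  then have "ramp (2 * u - 1/2) = 0 \<or> ramp (2 * u - 1/2) = 1" by (auto simp: ramp_simps)
  then have "winding u = 1"
    by (auto simp: winding_def exp_two_pi_i' mult.commute)
  with 1 show False by simp
qed

lemma winding_middle:
  assumes "5/12 \<le> u" "u \<le> 7/12"
  shows "Re (winding u) \<le> - 1/2"
proof -
  have r: "ramp (2 * u - 1/2) = 2 * u - 1/2" using assms by (intro ramp_simps) auto
  define a where "a = 2 * pi * (2 * u - 1/2) - pi"
  have a: "\<bar>a\<bar> \<le> pi / 3"
  proof -
    have "a = pi * (4 * u - 2)" by (simp add: a_def algebra_simps)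
    moreover have "\<bar>4 * u - 2\<bar> \<le> 1/3" by (rule abs_leI) (use assms in linarith)+
    ultimately show ?thesis using mult_left_mono[of "\<bar>4 * u - 2\<bar>" "1/3" pi] by (simp add: abs_mult)
  qed
  have "cos (pi / 3) \<le> cos \<bar>a\<bar>" using a by (intro cos_monotone_0_pi_le) auto
  then have "1/2 \<le> cos a" by (simp add: cos_60)
  moreover have "Re (winding u) = cos (a + pi)" by (simp add: winding_def r a_def Re_exp)
  ultimately show ?thesis by simp
qed

definition fraction_of_turn :: "complex \<Rightarrow> real" where "fraction_of_turn w = Arg2pi w / (2 * pi)"

lemma fraction_of_winding:
  assumes "winding u \<noteq> 1"
  shows "fraction_of_turn (winding u) = 2 * u - 1/2"
proof -
  have u: "\<bar>u - 1/2\<bar> < 1/4" by (rule winding_not_one[OF assms])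
  then have r: "ramp (2 * u - 1/2) = 2 * u - 1/2" by (intro ramp_simps) (auto simp: abs_if split: if_splits)
  have "Arg2pi (winding u) = 2 * pi * (2 * u - 1/2)"
  proof (rule Arg2pi_unique[of 1])
    show "complex_of_real 1 * exp (\<i> * complex_of_real (2 * pi * (2 * u - 1/2))) = winding u"
      by (simp add: winding_def r)
    have "0 \<le> 2 * u - 1/2" "2 * u - 1/2 < 1" using u by (auto simp: abs_if split: if_splits)
    then show "0 \<le> 2 * pi * (2 * u - 1/2)" "2 * pi * (2 * u - 1/2) < 2 * pi" by auto
  qed simp
  then show ?thesis by (simp add: fraction_of_turn_def)
qed

locale grid =
  fixes M :: int
  assumes M: "0 < M"
begin

definition centers :: "complex set" where
  "centers = (\<lambda>(i, j). Complex (real_of_int i + 1/2) (real_of_int j + 1/2)) ` ({-M..<M} \<times> {-M..<M})"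

definition region :: "complex set" where
  "region = {z \<in> square M. \<forall>l\<in>centers. 1/4 \<le> \<bar>Re z - Re l\<bar> \<or> 1/4 \<le> \<bar>Im z - Im l\<bar>}"

lemma finite_centers: "finite centers" by (simp add: centers_def)

lemma centersE:
  assumes "l \<in> centers"
  obtains i j where "l = Complex (real_of_int i + 1/2) (real_of_int j + 1/2)" "-M \<le> i" "i < M" "-M \<le> j" "j < M"
  using assms by (auto simp: centers_def)

lemma centers_differ:
  assumes "l \<in> centers" "m \<in> centers" "l \<noteq> m"
  shows "1 \<le> \<bar>Re l - Re m\<bar> \<or> 1 \<le> \<bar>Im l - Im m\<bar>"
proof -
  obtain i j where l: "l = Complex (real_of_int i + 1/2) (real_of_int j + 1/2)" using assms(1) by (rule centersE)
  obtain i' j' where m: "m = Complex (real_of_int i' + 1/2) (real_of_int j' + 1/2)" using assms(2) by (rule centersE)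
  have "i \<noteq> i' \<or> j \<noteq> j'" using assms(3) l m by auto
  then have "1 \<le> \<bar>i - i'\<bar> \<or> 1 \<le> \<bar>j - j'\<bar>" by auto
  then have "1 \<le> \<bar>real_of_int (i - i')\<bar> \<or> 1 \<le> \<bar>real_of_int (j - j')\<bar>" by linarith
  then show ?thesis by (simp add: l m)
qed

lemma small_square: "\<bar>Re z\<bar> < 1/4 \<Longrightarrow> \<bar>Im z\<bar> < 1/4 \<Longrightarrow> cmod z < 2/5"
proof -
  assume "\<bar>Re z\<bar> < 1/4" "\<bar>Im z\<bar> < 1/4"
  then have "\<bar>Re z\<bar>\<^sup>2 \<le> (1/4)\<^sup>2" "\<bar>Im z\<bar>\<^sup>2 \<le> (1/4)\<^sup>2" by (intro power_mono; simp)+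
  then have "(cmod z)\<^sup>2 \<le> (1/4)\<^sup>2 + (1/4)\<^sup>2" by (simp add: cmod_power2)
  also have "\<dots> < (2/5)\<^sup>2" by (simp add: power2_eq_square)
  finally have "(cmod z)\<^sup>2 < (2/5)\<^sup>2" .
  then show ?thesis by (rule power2_less_imp_less) simp
qed

text \<open>The removed squares of half-width \<open>1/4\<close> lie inside the discs of radius \<open>2/5\<close>, since \<open>(1/4)\<^sup>2 + (1/4)\<^sup>2 < (2/5)\<^sup>2\<close>, and these lie inside
  the cells.\<close>

lemma grid_holes:
  assumes "af B" "unital_star_hom (square M) \<Phi>"
  shows "holes B (square M) \<Phi> centers region"
proof (intro holes.intro holes_axioms.intro assms star_homI)
  show "1 \<le> cmod (l - m)" if "l \<in> centers" "m \<in> centers" "l \<noteq> m" for l m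
    using centers_differ[OF that] abs_Re_le_cmod[of "l - m"] abs_Im_le_cmod[of "l - m"] by auto
  show "z \<in> region" if "z \<in> square M" "\<And>l. l \<in> centers \<Longrightarrow> 2/5 \<le> cmod (z - l)" for z
  proof -
    have "1/4 \<le> \<bar>Re z - Re l\<bar> \<or> 1/4 \<le> \<bar>Im z - Im l\<bar>" if l: "l \<in> centers" for l
      using small_square[of "z - l"] \<open>\<And>l. l \<in> centers \<Longrightarrow> 2/5 \<le> cmod (z - l)\<close>[OF l] by force
    then show ?thesis using that(1) by (simp add: region_def)
  qed
  show "l + (2/5) * w \<in> region" if l: "l \<in> centers" and w: "cmod w = 1" for l w
  proof -
    obtain i j where ij: "l = Complex (real_of_int i + 1/2) (real_of_int j + 1/2)" "-M \<le> i" "i < M" "-M \<le> j" "j < M"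
      using l by (rule centersE)
    have wb: "\<bar>Re ((2/5) * w)\<bar> \<le> 2/5" "\<bar>Im ((2/5) * w)\<bar> \<le> 2/5"
      using abs_Re_le_cmod[of w] abs_Im_le_cmod[of w] w by (auto simp: abs_mult)
    have "real_of_int i + 1 \<le> M" "- real_of_int M \<le> i" "real_of_int j + 1 \<le> M" "- real_of_int M \<le> j" using ij by linarith+
    then have sq: "l + (2/5) * w \<in> square M"
      using wb unfolding square_iff by (simp add: ij(1) abs_le_iff)
    have "1/4 \<le> \<bar>Re (l + (2/5) * w) - Re k\<bar> \<or> 1/4 \<le> \<bar>Im (l + (2/5) * w) - Im k\<bar>" if k: "k \<in> centers" for k
    proof (cases "k = l")
      case True
      have "cmod ((2/5) * w) = 2/5" using w by (simp add: norm_mult)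
      then have "\<not> (\<bar>Re ((2/5) * w)\<bar> < 1/4 \<and> \<bar>Im ((2/5) * w)\<bar> < 1/4)" using small_square[of "(2/5) * w"] by linarith
      then show ?thesis using True by auto
    next
      case False
      from centers_differ[OF k l this] show ?thesis
      proof
        assume "1 \<le> \<bar>Re k - Re l\<bar>"
        then have "1/4 \<le> \<bar>Re l + Re ((2/5) * w) - Re k\<bar>" using wb(1) by linarith
        then show ?thesis by simp
      next
        assume "1 \<le> \<bar>Im k - Im l\<bar>"
        then have "1/4 \<le> \<bar>Im l + Im ((2/5) * w) - Im k\<bar>" using wb(2) by linarith
        then show ?thesis by simp
      qed
    qed
    then show ?thesis using sq by (simp add: region_def)
  qed
qed (use finite_centers compact_square in auto)

lemma region_square: "z \<in> region \<Longrightarrow> \<bar>coord h z\<bar> \<le> M"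
  by (auto simp: region_def square_iff coord_def)

lemma not_near_center:
  assumes z: "z \<in> region" and "\<bar>coord h z - real_of_int i - 1/2\<bar> < 1/4"
  shows "1/4 \<le> \<bar>coord (\<not> h) z - real_of_int j - 1/2\<bar>"
proof -
  have key: "1/4 \<le> \<bar>Im z - real_of_int j - 1/2\<bar>" if i: "\<bar>Re z - real_of_int i - 1/2\<bar> < 1/4" for i j
  proof (rule ccontr)
    assume "\<not> 1/4 \<le> \<bar>Im z - real_of_int j - 1/2\<bar>"
    then have j: "\<bar>Im z - real_of_int j - 1/2\<bar> < 1/4" by simp
    have b: "\<bar>Re z\<bar> \<le> M" "\<bar>Im z\<bar> \<le> M" using z by (auto simp: region_def square_iff)
    have "real_of_int i < M" "- real_of_int M < i + 1" "real_of_int j < M" "- real_of_int M < j + 1"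
      using i j b by linarith+
    then have "i < M" "- M \<le> i" "j < M" "-M \<le> j" by linarith+
    then have "Complex (real_of_int i + 1/2) (real_of_int j + 1/2) \<in> centers" by (force simp: centers_def)
    then have "1/4 \<le> \<bar>Re z - (real_of_int i + 1/2)\<bar> \<or> 1/4 \<le> \<bar>Im z - (real_of_int j + 1/2)\<bar>"
      using z by (force simp: region_def)
    then show False using i j by linarith
  qed
  show ?thesis
  proof (cases h)
    case True
    then show ?thesis using key assms(2) by (simp add: coord_def)
  next
    case False
    then show ?thesis using key[of j i] assms(2) by (auto simp: coord_def not_le[symmetric])
  qed
qed

definition edge_set :: "(bool \<times> int \<times> int) set" where "edge_set = UNIV \<times> {-M..M} \<times> {-M..M}"

text \<open>The edge \<open>(True, i, j)\<close> joins the points \<open>i + j \<i>\<close> and \<open>i + 1 + j \<i>\<close>, and \<open>(False, i, j)\<close> joins \<open>j + i \<i>\<close> and \<open>j + (i + 1) \<i>\<close>.\<close>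

definition edge_map :: "bool \<times> int \<times> int \<Rightarrow> complex \<Rightarrow> complex" where
  "edge_map = (\<lambda>(h, i, j) z. if \<bar>coord (\<not> h) z - real_of_int j\<bar> \<le> 1/2 then winding (coord h z - real_of_int i) else 1)"

text \<open>A continuous staircase with value \<open>k\<close> near the integer \<open>k\<close>; it rises on the middle sixth \<open>[k + 5/12, k + 7/12]\<close>, where \<open>winding\<close> has
  real part at most \<open>- 1/2\<close>.\<close>

definition stair :: "real \<Rightarrow> real" where
  "stair s = (\<Sum>k\<in>{-M..<M}. ramp (6 * (s - real_of_int k) - 5/2)) - M"

lemma stair_eq:
  assumes i: "-M \<le> i" "i < M" and s: "real_of_int i - 5/12 \<le> s" "s \<le> real_of_int i + 17/12"
  shows "stair s = real_of_int i + ramp (6 * (s - real_of_int i) - 5/2)"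
proof -
  have "{-M..<M} = {-M..<i} \<union> {i} \<union> {i<..<M}" using i by auto
  then have "(\<Sum>k\<in>{-M..<M}. ramp (6 * (s - real_of_int k) - 5/2)) =
      (\<Sum>k\<in>{-M..<i}. ramp (6 * (s - real_of_int k) - 5/2)) + ramp (6 * (s - real_of_int i) - 5/2)
      + (\<Sum>k\<in>{i<..<M}. ramp (6 * (s - real_of_int k) - 5/2))"
    by (simp only:) (subst sum.union_disjoint; auto)+
  also have "(\<Sum>k\<in>{-M..<i}. ramp (6 * (s - real_of_int k) - 5/2)) = (\<Sum>k\<in>{-M..<i}. 1)"
  proof (intro sum.cong refl ramp_simps)
    fix k assume "k \<in> {-M..<i}"
    then have "real_of_int k + 1 \<le> i" by auto
    then show "1 \<le> 6 * (s - real_of_int k) - 5/2" using s by simp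
  qed
  also have "\<dots> = real_of_int i + M" using i by simp
  also have "(\<Sum>k\<in>{i<..<M}. ramp (6 * (s - real_of_int k) - 5/2)) = 0"
  proof (intro sum.neutral ballI ramp_simps)
    fix k assume "k \<in> {i<..<M}"
    then have "real_of_int i + 1 \<le> k" by auto
    then show "6 * (s - real_of_int k) - 5/2 \<le> 0" using s by simp
  qed
  finally show ?thesis by (simp add: stair_def)
qed

lemma stair_int:
  assumes j: "-M \<le> j" "j \<le> M" and s: "\<bar>s - real_of_int j\<bar> \<le> 5/12"
  shows "stair s = real_of_int j"
proof (cases "j < M")
  case True
  have "ramp (6 * (s - real_of_int j) - 5/2) = 0"
    by (rule ramp_simps) (use abs_le_D1[OF s] in simp)
  moreover have "real_of_int j - 5/12 \<le> s" "s \<le> real_of_int j + 17/12" using abs_le_D1[OF s] abs_le_D2[OF s] by simp_all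
  ultimately show ?thesis using stair_eq[OF j(1) True] by simp
next
  case False
  then have "j = M" using j by simp
  then have "ramp (6 * (s - real_of_int (M - 1)) - 5/2) = 1" by (intro ramp_simps) (use abs_le_D2[OF s] in simp)
  moreover have "real_of_int (M - 1) - 5/12 \<le> s" "s \<le> real_of_int (M - 1) + 17/12" using abs_le_D1[OF s] abs_le_D2[OF s] \<open>j = M\<close> by simp_all
  ultimately show ?thesis using stair_eq[of "M - 1" s] M \<open>j = M\<close> by simp
qed

text \<open>The factor \<open>2 M + 1\<close> separates the labels of different vertices, whose coordinates range over \<open>-M, ..., M\<close>.\<close>

definition label :: "complex \<Rightarrow> complex" where
  "label z = complex_of_real (stair (Re z) + (2 * M + 1) * stair (Im z))"

definition vertex_label :: "int \<Rightarrow> int \<Rightarrow> complex" where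
  "vertex_label a b = complex_of_real (real_of_int a + (2 * M + 1) * real_of_int b)"

lemma vertex_label_inj:
  assumes "-M \<le> a" "a \<le> M" "-M \<le> a'" "a' \<le> M" "vertex_label a b = vertex_label a' b'"
  shows "a = a' \<and> b = b'"
proof -
  have "complex_of_real (real_of_int (a + (2 * M + 1) * b)) = complex_of_real (real_of_int (a' + (2 * M + 1) * b'))"
    using assms(5) by (simp add: vertex_label_def)
  then have eq: "a - a' = (2 * M + 1) * (b' - b)" by (simp only: of_real_eq_iff of_int_eq_iff) (simp add: algebra_simps)
  have "\<bar>a - a'\<bar> < 2 * M + 1" using assms by linarith
  then have "\<bar>b' - b\<bar> * (2 * M + 1) < 1 * (2 * M + 1)" using eq M by (simp add: abs_mult mult.commute)
  then have "\<bar>b' - b\<bar> < 1" using M by (simp only: mult_less_cancel_right)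
  then show ?thesis using eq by simp
qed

text \<open>The initial vertex of an edge.\<close>

definition edge_vertex :: "bool \<times> int \<times> int \<Rightarrow> int \<times> int" where
  "edge_vertex = (\<lambda>(h, i, j). if h then (i, j) else (j, i))"

lemma edge_map_not_one:
  assumes z: "z \<in> region" and e: "edge_map (h, i, j) z \<noteq> 1"
  shows "edge_map (h, i, j) z = winding (coord h z - real_of_int i)" "\<bar>coord h z - real_of_int i - 1/2\<bar> < 1/4"
    "\<bar>coord (\<not> h) z - real_of_int j\<bar> \<le> 1/4" "-M \<le> i" "i < M"
proof -
  have t: "\<bar>coord (\<not> h) z - real_of_int j\<bar> \<le> 1/2" and w: "winding (coord h z - real_of_int i) \<noteq> 1"
    using e by (auto simp: edge_map_def split: if_splits)
  show "edge_map (h, i, j) z = winding (coord h z - real_of_int i)" using t by (simp add: edge_map_def)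
  show s: "\<bar>coord h z - real_of_int i - 1/2\<bar> < 1/4" using winding_not_one[OF w] by simp
  show "\<bar>coord (\<not> h) z - real_of_int j\<bar> \<le> 1/4"
    using not_near_center[OF z s, of j] not_near_center[OF z s, of "j - 1"] t by (auto simp: abs_if split: if_splits)
  have "\<bar>coord h z\<bar> \<le> M" by (rule region_square[OF z])
  then have "real_of_int i < M" "- real_of_int M < i + 1" using s by (auto simp: abs_if split: if_splits)
  then show "-M \<le> i" "i < M" by linarith+
qed

lemma edge_map_cont: "continuous_on region (edge_map e)"
proof -
  obtain h i j where e: "e = (h, i, j)" by (cases e)
  have "continuous_on region (\<lambda>z. if \<bar>coord (\<not> h) z - real_of_int j\<bar> \<le> 1/2 then winding (coord h z - real_of_int i) else 1)"
  proof (rule continuous_on_cases_le)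
    fix z assume z: "z \<in> region" and t: "\<bar>coord (\<not> h) z - real_of_int j\<bar> = 1/2"
    show "winding (coord h z - real_of_int i) = 1"
    proof (rule ccontr)
      assume "winding (coord h z - real_of_int i) \<noteq> 1"
      then have "\<bar>coord h z - real_of_int i - 1/2\<bar> < 1/4" using winding_not_one by auto
      from not_near_center[OF z this, of j] not_near_center[OF z this, of "j - 1"] show False
        using t by (auto simp: abs_if split: if_splits)
    qed
  qed (intro continuous_intros)+
  then show ?thesis by (simp add: e edge_map_def)
qed

lemma edge_map_disjoint:
  assumes z: "z \<in> region" and ne: "e \<noteq> e'"
  shows "edge_map e z = 1 \<or> edge_map e' z = 1"
proof (rule ccontr)
  obtain h i j where e: "e = (h, i, j)" by (cases e)
  obtain h' i' j' where e': "e' = (h', i', j')" by (cases e')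
  assume "\<not> (edge_map e z = 1 \<or> edge_map e' z = 1)"
  then have "edge_map (h, i, j) z \<noteq> 1" "edge_map (h', i', j') z \<noteq> 1" by (auto simp: e e')
  note f = edge_map_not_one(2,3)[OF z this(1)] edge_map_not_one(2,3)[OF z this(2)]
  show False
  proof (cases "h = h'")
    case True
    have "\<bar>real_of_int i - real_of_int i'\<bar> < 1" "\<bar>real_of_int j - real_of_int j'\<bar> < 1"
      using f unfolding True by linarith+
    then have "i = i'" "j = j'" by linarith+
    then show False using ne True e e' by simp
  next
    case False
    then have "h' = (\<not> h)" by auto
    then have "\<bar>coord (\<not> h) z - real_of_int i' - 1/2\<bar> < 1/4" using f(3) by simp
    then have "real_of_int i' < j" "real_of_int j < i' + 1" using f(2) by linarith+
    then have "i' < j" "j < i' + 1" by (simp_all only: of_int_less_iff)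
    then show False by linarith
  qed
qed

text \<open>Along an edge the label is an affine function of the staircase, which in turn is a function of the angle of \<open>winding\<close>.\<close>

lemma edge_label_function:
  "\<exists>G. continuous_on (sphere 0 1) G \<and> (\<forall>z\<in>region. plateau (edge_map (h, i, j) z) * label z = G (edge_map (h, i, j) z))"
  if j: "-M \<le> j" "j \<le> M"
proof -
  define A where "A = (if h then real_of_int i + (2 * M + 1) * j else j + (2 * M + 1) * real_of_int i)"
  define C where "C = (if h then 1 else 2 * real_of_int M + 1)"
  define G where "G w = (if Re w \<le> 1/2 then plateau w * complex_of_real (A + C * ramp (3 * fraction_of_turn w - 1)) else 0)" for w
  have "continuous_on (sphere 0 1) G"
    unfolding G_def
  proof (rule continuous_on_cases_le)
    have "continuous_on {w \<in> sphere 0 1. Re w \<le> 1/2} Arg2pi"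
    proof (rule continuous_at_imp_continuous_on, rule ballI, rule continuous_at_Arg2pi)
      fix w :: complex assume w: "w \<in> {w \<in> sphere 0 1. Re w \<le> 1/2}"
      show "w \<notin> \<real>\<^sub>\<ge>\<^sub>0"
      proof
        assume "w \<in> \<real>\<^sub>\<ge>\<^sub>0"
        then have "Re w \<ge> 0" "w = complex_of_real (Re w)" by (auto simp: complex_nonneg_Reals_iff complex_eq_iff)
        then have "cmod w = Re w" by (metis abs_of_nonneg norm_of_real)
        then show False using w by auto
      qed
    qed
    then show "continuous_on {w \<in> sphere 0 1. Re w \<le> 1/2} (\<lambda>w. plateau w * complex_of_real (A + C * ramp (3 * fraction_of_turn w - 1)))"
      unfolding fraction_of_turn_def by (intro continuous_intros continuous_on_plateau_core) auto
  qed (auto intro!: continuous_intros simp: plateau_simps)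
  moreover have "plateau (edge_map (h, i, j) z) * label z = G (edge_map (h, i, j) z)" if z: "z \<in> region" for z
  proof (cases "Re (edge_map (h, i, j) z) \<le> 1/2")
    case False
    then show ?thesis by (simp add: G_def plateau_simps)
  next
    case True
    then have "edge_map (h, i, j) z \<noteq> 1" by auto
    note f = edge_map_not_one[OF z this]
    have wn: "winding (coord h z - real_of_int i) \<noteq> 1" using f(1) \<open>edge_map (h, i, j) z \<noteq> 1\<close> by simp
    have "stair (coord (\<not> h) z) = real_of_int j" using f(3) j by (intro stair_int) auto
    moreover have "stair (coord h z) = real_of_int i + ramp (6 * (coord h z - real_of_int i) - 5/2)"
      using f(2,4,5) by (intro stair_eq) (auto simp: abs_if split: if_splits)
    moreover have "6 * (coord h z - real_of_int i) - 5/2 = 3 * fraction_of_turn (edge_map (h, i, j) z) - 1"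
      unfolding f(1) fraction_of_winding[OF wn] by simp
    ultimately have "label z = complex_of_real (A + C * ramp (3 * fraction_of_turn (edge_map (h, i, j) z) - 1))"
      by (cases h) (simp_all add: label_def A_def C_def coord_def algebra_simps)
    then show ?thesis using True by (simp add: G_def)
  qed
  ultimately show ?thesis by blast
qed

text \<open>A coordinate within \<open>1/12\<close> of a half-integer would place the point on the middle sixth of an edge, where the edge map has real part
  at most \<open>- 1/2\<close>.\<close>

lemma near_grid_point:
  assumes z: "z \<in> region" and e: "\<And>e. e \<in> edge_set \<Longrightarrow> - 1/2 < Re (edge_map e z)"
  obtains a where "-M \<le> a" "a \<le> M" "stair (coord h z) = real_of_int a" "\<bar>coord h z - real_of_int a\<bar> \<le> 5/12"
proof -
  let ?s = "coord h z" and ?t = "coord (\<not> h) z"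
  have b: "\<bar>?s\<bar> \<le> M" "\<bar>?t\<bar> \<le> M" using region_square[OF z] by auto
  define i where "i = min (M - 1) \<lfloor>?s\<rfloor>"
  have i: "-M \<le> i" "i < M" "real_of_int i \<le> ?s" "?s \<le> i + 1"
  proof -
    have "-M \<le> \<lfloor>?s\<rfloor>" using b(1) by (simp add: le_floor_iff abs_le_iff)
    then show "-M \<le> i" "i < M" using M by (auto simp: i_def)
    show "real_of_int i \<le> ?s" "?s \<le> i + 1" using b(1) by (auto simp: i_def min_def abs_le_iff; linarith)+
  qed
  have "\<not> (5/12 \<le> ?s - i \<and> ?s - i \<le> 7/12)"
  proof
    assume m: "5/12 \<le> ?s - i \<and> ?s - i \<le> 7/12"
    define j where "j = \<lfloor>?t + 1/2\<rfloor>"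
    have j: "\<bar>?t - j\<bar> \<le> 1/2" unfolding j_def using floor_correct[of "?t + 1/2"] by linarith
    have "- real_of_int M - 1 < j" "real_of_int j < M + 1" using j b(2) by linarith+
    then have "-M \<le> j" "j \<le> M" by linarith+
    then have "(h, i, j) \<in> edge_set" using i by (simp add: edge_set_def)
    moreover have "Re (edge_map (h, i, j) z) \<le> - 1/2" using winding_middle[of "?s - i"] m j by (simp add: edge_map_def)
    ultimately show False using e by force
  qed
  then consider "?s - i < 5/12" | "7/12 < ?s - i" by linarith
  then show ?thesis
  proof cases
    case 1
    then show ?thesis using i by (intro that[of i] stair_int) (auto simp: abs_le_iff)
  next
    case 2
    then show ?thesis using i by (intro that[of "i + 1"] stair_int) (auto simp: abs_le_iff)
  qed
qed

lemma grid_edges: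
  assumes "af B" "unital_star_hom region \<Phi>"
  obtains m where "edges B region \<Phi> edge_set edge_map label m (\<lambda>e. vertex_label (fst (edge_vertex e)) (snd (edge_vertex e))) 1"
proof -
  define V where "V = {-M..M} \<times> {-M..M}"
  have inj: "inj_on (\<lambda>(a, b). vertex_label a b) V"
    using vertex_label_inj by (force simp: inj_on_def V_def)
  obtain m where m: "m \<in> zpoly" "\<And>w. w \<in> (\<lambda>(a, b). vertex_label a b) ` V \<Longrightarrow>
      m w = (case the_inv_into V (\<lambda>(a, b). vertex_label a b) w of (a, b) \<Rightarrow> Complex a b)"
    using zpoly_interpolation[of "(\<lambda>(a, b). vertex_label a b) ` V"
        "\<lambda>w. case the_inv_into V (\<lambda>(a, b). vertex_label a b) w of (a, b) \<Rightarrow> Complex a b"] by (auto simp: V_def)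
  have mv: "m (vertex_label a b) = Complex a b" if "-M \<le> a" "a \<le> M" "-M \<le> b" "b \<le> M" for a b
    using m(2)[of "vertex_label a b"] the_inv_into_f_f[OF inj, of "(a, b)"] that by (force simp: V_def)
  have near: "cmod (z - Complex a b) \<le> \<bar>Re z - a\<bar> + \<bar>Im z - b\<bar>" for z a b
    using cmod_le[of "z - Complex a b"] by simp
  show ?thesis
  proof (rule that[of m], intro edges.intro edges_axioms.intro assms star_homI)
    show "finite edge_set" by (simp add: edge_set_def)
    show "cmod (edge_map e z) = 1" for e z by (cases e) (simp add: edge_map_def winding_norm)
    show "edge_map e z = 1 \<or> edge_map e' z = 1" if "e \<noteq> e'" "z \<in> region" for e e' z
      by (rule edge_map_disjoint[OF that(2,1)])
    show "continuous_on region label" unfolding label_def stair_def by (intro continuous_intros)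
    show "label z \<in> \<real>" for z by (simp add: label_def)
    show "\<exists>G. continuous_on (sphere 0 1) G \<and> (\<forall>z\<in>region. plateau (edge_map e z) * label z = G (edge_map e z))"
      if "e \<in> edge_set" for e
      using that edge_label_function by (cases e) (simp add: edge_set_def)
    show "vertex_label (fst (edge_vertex e)) (snd (edge_vertex e)) \<in> \<real>" for e by (simp add: vertex_label_def)
    show "cmod (z - m (vertex_label (fst (edge_vertex e)) (snd (edge_vertex e)))) \<le> 1"
      if e: "e \<in> edge_set" and z: "z \<in> region" and lt: "Re (edge_map e z) < 1/2" for e z
    proof -
      obtain h i j where eq: "e = (h, i, j)" by (cases e)
      have "edge_map (h, i, j) z \<noteq> 1" using lt eq by auto
      note f = edge_map_not_one[OF z this]
      have j: "-M \<le> j" "j \<le> M" using e eq by (auto simp: edge_set_def)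
      have s: "\<bar>coord h z - i\<bar> \<le> 3/4" using f(2) by (auto simp: abs_if split: if_splits)
      show ?thesis
      proof (cases h)
        case True
        then show ?thesis using mv[of i j] near[of z i j] f s j by (simp add: eq edge_vertex_def coord_def)
      next
        case False
        then show ?thesis using mv[of j i] near[of z j i] f s j by (simp add: eq edge_vertex_def coord_def)
      qed
    qed
    show "cmod (z - m (label z)) \<le> 1"
      if z: "z \<in> region" and e: "\<And>e. e \<in> edge_set \<Longrightarrow> - 1/2 < Re (edge_map e z)" for z
    proof -
      obtain a where a: "-M \<le> a" "a \<le> M" "stair (coord True z) = real_of_int a" "\<bar>coord True z - real_of_int a\<bar> \<le> 5/12"
        using near_grid_point[OF z e] by blast
      obtain b where b: "-M \<le> b" "b \<le> M" "stair (coord False z) = real_of_int b" "\<bar>coord False z - real_of_int b\<bar> \<le> 5/12"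
        using near_grid_point[OF z e] by blast
      have "label z = vertex_label a b" using a(3) b(3) by (simp add: label_def vertex_label_def coord_def)
      then show ?thesis using mv[OF a(1,2) b(1,2)] near[of z a b] a(4) b(4) by (simp add: coord_def)
    qed
  qed (auto intro: edge_map_cont m)
qed

end

context af
begin

text \<open>The polynomial in the self-adjoint \<open>T\<close> is approximated by the same polynomial in finite-dimensional self-adjoint approximations of
  \<open>T\<close>, whose values are normal.\<close>

lemma normal_near_finite_dim:
  fixes x :: 'a
  assumes x: "normal_element x"
  obtains b where "b \<in> D" "normal_element b" "norm (x - b) \<le> 8"
proof -
  define M where "M = \<lceil>norm x\<rceil> + 1"
  interpret grid M by unfold_locales (use norm_ge_zero[of x] in \<open>simp add: M_def, linarith\<close>)
  have "norm x < real_of_int M" unfolding M_def using le_of_int_ceiling[of "norm x"] by (simp, linarith)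
  then obtain \<Phi> where \<Phi>: "unital_star_hom (square M) \<Phi>" "\<Phi> (\<lambda>z. z) = x" by (rule normal_calculus[OF x])
  interpret h: holes B "square M" \<Phi> centers region by (rule grid_holes[OF af_axioms \<Phi>(1)])
  obtain \<Phi>' where \<Phi>': "unital_star_hom region \<Phi>'" "norm (\<Phi>' (\<lambda>z. z) - \<Phi> (\<lambda>z. z)) \<le> 4/5" by (rule h.hole_hom)
  obtain m where m: "edges B region \<Phi>' edge_set edge_map label m (\<lambda>e. vertex_label (fst (edge_vertex e)) (snd (edge_vertex e))) 1"
    by (rule grid_edges[OF af_axioms \<Phi>'(1)])
  obtain T y where T: "star T = T" "(m, y) \<in> gen T" "norm (\<Phi>' (\<lambda>z. z) - y) \<le> 6 * 1"
    using edges.polynomial_approximation[OF m] by blast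
  have "\<forall>n. \<exists>b. b \<in> D \<and> star b = b \<and> norm (b - T) < inverse (real (Suc n))"
  proof
    fix n
    have "inverse (real (Suc n)) > 0" by simp
    from approx_selfadjoint[OF T(1) this] show "\<exists>b. b \<in> D \<and> star b = b \<and> norm (b - T) < inverse (real (Suc n))" by blast
  qed
  then obtain t where t: "\<And>n. t n \<in> D" "\<And>n. star (t n) = t n" "\<And>n. norm (t n - T) < inverse (real (Suc n))" by metis
  have "(\<lambda>n. t n - T) \<longlonglongrightarrow> 0"
    by (rule Lim_null_comparison[OF always_eventually LIMSEQ_inverse_real_of_nat]) (intro allI less_imp_le t(3))
  then have "t \<longlonglongrightarrow> T" using LIM_zero_cancel by blast
  from gen_tendsto[OF this T(2)] obtain b where b: "\<And>n. (m, b n) \<in> gen (t n)" "b \<longlonglongrightarrow> y" by blast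
  obtain n where n: "norm (b n - y) < 1" using LIMSEQ_D[OF b(2), of 1] by auto
  obtain k where k: "t n \<in> B k" using t(1) by blast
  have "b n \<in> B k" by (rule gen_in_subalgebra[OF sub one_in k b(1)])
  then have "b n \<in> D" by blast
  moreover have "normal_element (b n)" by (rule gen_normal[OF normal_if_selfadjoint[OF t(2)] b(1)])
  moreover have "norm (x - b n) \<le> 8"
  proof -
    have "x - b n = (\<Phi>' (\<lambda>z. z) - y) - (\<Phi>' (\<lambda>z. z) - \<Phi> (\<lambda>z. z)) - (b n - y)" by (simp add: \<Phi>(2))
    then have "norm (x - b n) \<le> norm (\<Phi>' (\<lambda>z. z) - y) + norm (\<Phi>' (\<lambda>z. z) - \<Phi> (\<lambda>z. z)) + norm (b n - y)"
      by (simp only:) (rule order_trans[OF norm_triangle_ineq4 add_right_mono[OF norm_triangle_ineq4]])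
    then show ?thesis using T(3) \<Phi>'(2) n by simp
  qed
  ultimately show ?thesis using that by blast
qed

text \<open>Every normal element of an AF-algebra is a limit of normal elements of the finite-dimensional subalgebras. The absolute
  constant of the previous lemma suffices because the element may be scaled.\<close>

theorem normal_dense:
  fixes x :: 'a
  assumes x: "normal_element x" and "e > 0"
  obtains b where "b \<in> D" "normal_element b" "norm (b - x) < e"
proof -
  \<comment> \<open>any constant larger than \<open>8\<close>, the error of \<open>normal_near_finite_dim\<close>\<close>
  define t where "t = 9 / e"
  have t: "t > 0" using \<open>e > 0\<close> by (simp add: t_def)
  have sn: "normal_element (complex_of_real s *\<^sub>C y)" if "normal_element y" for s and y :: 'a
    using that by (simp add: normal_element_def star_scaleC mult_scaleC_left mult_scaleC_right)
  obtain b where b: "b \<in> D" "normal_element b" "norm (complex_of_real t *\<^sub>C x - b) \<le> 8"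
    by (rule normal_near_finite_dim[OF sn[OF x]])
  define c where "c = complex_of_real (1 / t) *\<^sub>C b"
  have "x - c = complex_of_real (1 / t) *\<^sub>C (complex_of_real t *\<^sub>C x - b)"
    using t by (simp add: c_def complex_vector.scale_right_diff_distrib scaleC_scaleC)
  then have "norm (x - c) = 1 / t * norm (complex_of_real t *\<^sub>C x - b)" using t by (simp add: norm_scaleC norm_divide)
  also have "\<dots> \<le> 1 / t * 8" using b(3) t by (intro mult_left_mono) auto
  also have "\<dots> < e" using \<open>e > 0\<close> by (simp add: t_def)
  finally have "norm (c - x) < e" by (simp add: norm_minus_commute)
  moreover have "c \<in> D" unfolding c_def by (rule D_closed(3)[OF b(1)])
  moreover have "normal_element c" unfolding c_def by (rule sn[OF b(2)])
  ultimately show ?thesis using that by blast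
qed

end

section \<open>The marriage theorem\<close>

text \<open>If some proper nonempty \<open>S\<close> has no more candidates than members, then \<open>S\<close> and its complement (with the remaining candidates) are
  matched separately; otherwise any candidate may be given to any one element, and the rest still satisfies the condition.\<close>

lemma hall_marriage:
  assumes "finite A" "\<And>a. a \<in> A \<Longrightarrow> finite (N a)"
    and "\<And>S. S \<subseteq> A \<Longrightarrow> card S \<le> card (\<Union>a\<in>S. N a)"
  shows "\<exists>f. inj_on f A \<and> (\<forall>a\<in>A. f a \<in> N a)"
  using assms
proof (induction "card A" arbitrary: A N rule: less_induct)
  case less
  note fin = less.prems(1,2) and hall = less.prems(3)
  have finN: "finite (\<Union>a\<in>S. N a)" if "S \<subseteq> A" for S
    using that fin finite_subset by blast
  show ?case
  proof (cases "A = {}")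
    case False
    show ?thesis
    proof (cases "\<exists>S. S \<subseteq> A \<and> S \<noteq> {} \<and> S \<noteq> A \<and> card (\<Union>a\<in>S. N a) = card S")
      case True
      then obtain S where S: "S \<subseteq> A" "S \<noteq> {}" "S \<noteq> A" "card (\<Union>a\<in>S. N a) = card S" by blast
      have fS: "finite S" using S(1) fin(1) finite_subset by blast
      have "card S < card A" using S fin(1) by (intro psubset_card_mono) auto
      then have "\<exists>f. inj_on f S \<and> (\<forall>a\<in>S. f a \<in> N a)"
      proof (rule less.hyps)
        show "finite (N a)" if "a \<in> S" for a using that S(1) fin(2) by blast
        show "card T \<le> card (\<Union>a\<in>T. N a)" if "T \<subseteq> S" for T by (rule hall[OF subset_trans[OF that S(1)]])
      qed (rule fS)
      then obtain f where f: "inj_on f S" "\<And>a. a \<in> S \<Longrightarrow> f a \<in> N a" by blast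
      define N' where "N' a = N a - (\<Union>a\<in>S. N a)" for a
      have "card (A - S) < card A" using S fin(1) by (intro psubset_card_mono) auto
      moreover have "card T \<le> card (\<Union>a\<in>T. N' a)" if T: "T \<subseteq> A - S" for T
      proof -
        have TA: "T \<union> S \<subseteq> A" "T \<inter> S = {}" using T S(1) by auto
        have fT: "finite T" using T fin(1) finite_subset by blast
        have "card T + card S = card (T \<union> S)" using TA(2) fT fS by (simp add: card_Un_disjoint)
        also have "\<dots> \<le> card (\<Union>a\<in>T \<union> S. N a)" by (rule hall[OF TA(1)])
        also have "(\<Union>a\<in>T \<union> S. N a) = (\<Union>a\<in>T. N' a) \<union> (\<Union>a\<in>S. N a)" by (auto simp: N'_def)
        also have "card \<dots> \<le> card (\<Union>a\<in>T. N' a) + card (\<Union>a\<in>S. N a)" by (rule card_Un_le)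
        finally show ?thesis using S(4) by simp
      qed
      moreover have "finite (A - S)" "\<And>a. a \<in> A - S \<Longrightarrow> finite (N' a)" using fin by (simp_all add: N'_def)
      ultimately have "\<exists>g. inj_on g (A - S) \<and> (\<forall>a\<in>A - S. g a \<in> N' a)" using less.hyps[of "A - S" N'] by meson
      then obtain g where g: "inj_on g (A - S)" "\<And>a. a \<in> A - S \<Longrightarrow> g a \<in> N' a" by blast
      define h where "h a = (if a \<in> S then f a else g a)" for a
      have mem: "h a \<in> N a" if "a \<in> A" for a
        using f(2)[of a] g(2)[of a] that by (auto simp: h_def N'_def)
      have cross: "f a \<noteq> g b" if "a \<in> S" "b \<in> A - S" for a b
        using f(2)[OF that(1)] g(2)[OF that(2)] that(1) unfolding N'_def by (metis DiffD2 UN_I)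
      have "inj_on h A"
      proof (rule inj_onI)
        fix a b assume ab: "a \<in> A" "b \<in> A" "h a = h b"
        consider "a \<in> S" "b \<in> S" | "a \<in> S" "b \<in> A - S" | "a \<in> A - S" "b \<in> S" | "a \<in> A - S" "b \<in> A - S"
          using ab by blast
        then show "a = b"
          using ab(3) cross[of a b] cross[of b a] inj_onD[OF f(1), of a b] inj_onD[OF g(1), of a b]
          by cases (auto simp: h_def)
      qed
      with mem show ?thesis by blast
    next
      case no: False
      obtain a where a: "a \<in> A" using False by blast
      have "1 \<le> card (\<Union>x\<in>{a}. N x)" using hall[of "{a}"] a by simp
      then have "N a \<noteq> {}" by auto
      then obtain b where b: "b \<in> N a" by blast
      define N' where "N' x = N x - {b}" for x
      have "card (A - {a}) < card A" using a fin(1) by (meson card_Diff1_less)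
      moreover have "card T \<le> card (\<Union>x\<in>T. N' x)" if T: "T \<subseteq> A - {a}" for T
      proof (cases "T = {}")
        case nT: False
        have TA: "T \<subseteq> A" "T \<noteq> A" using T a by auto
        have "card T < card (\<Union>x\<in>T. N x)"
          using hall[OF TA(1)] no nT TA by (metis le_neq_implies_less)
        moreover have "(\<Union>x\<in>T. N' x) = (\<Union>x\<in>T. N x) - {b}" by (auto simp: N'_def)
        ultimately show ?thesis using finN[OF TA(1)] by (simp add: card_Diff_singleton_if) linarith
      qed simp
      moreover have "finite (A - {a})" "\<And>x. x \<in> A - {a} \<Longrightarrow> finite (N' x)" using fin by (simp_all add: N'_def)
      ultimately have "\<exists>g. inj_on g (A - {a}) \<and> (\<forall>x\<in>A - {a}. g x \<in> N' x)" using less.hyps[of "A - {a}" N'] by meson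
      then obtain g where g: "inj_on g (A - {a})" "\<And>x. x \<in> A - {a} \<Longrightarrow> g x \<in> N' x" by blast
      define h where "h = g(a := b)"
      have "inj_on h A"
      proof (rule inj_onI)
        fix x y assume xy: "x \<in> A" "y \<in> A" "h x = h y"
        show "x = y"
          using xy g(2)[of x] g(2)[of y] inj_onD[OF g(1), of x y] by (auto simp: h_def N'_def split: if_splits)
      qed
      moreover have "h x \<in> N x" if "x \<in> A" for x
        using g(2)[of x] that b by (auto simp: h_def N'_def)
      ultimately show ?thesis by blast
    qed
  qed simp
qed

section \<open>Comparison of projections in finite-dimensional subalgebras\<close>

context af
begin

definition minimal :: "nat \<Rightarrow> 'a \<Rightarrow> bool" where
  "minimal k p \<longleftrightarrow> p \<in> B k \<and> projection p \<and> p \<noteq> 0 \<and> (\<forall>b\<in>B k. \<exists>c. p * b * p = c *\<^sub>C p)"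

text \<open>Murray-von Neumann equivalence within \<open>B k\<close>.\<close>

definition equivalent :: "nat \<Rightarrow> 'a \<Rightarrow> 'a \<Rightarrow> bool" where
  "equivalent k p q \<longleftrightarrow> (\<exists>w\<in>B k. w * star w = p \<and> star w * w = q)"

lemma partial_isometry:
  assumes "w * star w = p" "star w * w = q" "projection q"
  shows "w * q = w" "p * w = w" "q * star w = star w" "star w * p = star w"
proof -
  have "star (w - w * q) * (w - w * q) = q - q * q - q * q + q * q * q"
  proof -
    have "star (w - w * q) * (w - w * q) = (1 - q) * (star w * w) * (1 - q)"
      using assms(3) by (simp add: star_diff star_mult projection_star algebra_simps)
    then show ?thesis unfolding assms(2) by (simp add: algebra_simps)
  qed
  also have "\<dots> = 0" using assms(3) by (simp add: projection_idem)
  finally have "norm (w - w * q) = 0" using norm_star_mult_self[of "w - w * q"] by simp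
  then show 1: "w * q = w" by simp
  show 2: "p * w = w" using 1 assms by (metis mult.assoc)
  show "q * star w = star w" using arg_cong[OF 1, of star] assms(3) by (simp add: star_mult projection_star)
  have "star p = p" using assms(1) by (metis star_mult star_star)
  then show "star w * p = star w" using arg_cong[OF 2, of star] by (simp add: star_mult)
qed

lemma equivalent_sym: "equivalent k p q \<Longrightarrow> equivalent k q p"
  unfolding equivalent_def by (metis star_star star_subalgebraD(5)[OF sub])

lemma equivalent_trans:
  assumes "equivalent k p q" "equivalent k q s" "projection q" "projection s"
  shows "equivalent k p s"
proof -
  obtain w where w: "w \<in> B k" "w * star w = p" "star w * w = q" using assms(1) by (auto simp: equivalent_def)
  obtain v where v: "v \<in> B k" "v * star v = q" "star v * v = s" using assms(2) by (auto simp: equivalent_def)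
  have "(w * v) * star (w * v) = w * (v * star v) * star w" by (simp add: star_mult mult.assoc)
  also have "\<dots> = p" using v w partial_isometry(1)[OF w(2,3) assms(3)] by simp
  finally have 1: "(w * v) * star (w * v) = p" .
  have "star (w * v) * (w * v) = star v * (star w * w) * v" by (simp add: star_mult mult.assoc)
  also have "\<dots> = s" using v w partial_isometry(2)[OF v(2,3) assms(4)] by (simp add: mult.assoc)
  finally show ?thesis using 1 star_subalgebraD(4)[OF sub w(1) v(1)] unfolding equivalent_def by blast
qed

lemma equivalent_refl: "minimal k p \<Longrightarrow> equivalent k p p"
  unfolding equivalent_def minimal_def by (metis projection_def)

text \<open>Minimal projections \<open>p\<close>, \<open>q\<close> are equivalent as soon as \<open>p b q\<close> is nonzero for some \<open>b\<close>: \<open>star (p b q) (p b q)\<close> is a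
  multiple of \<open>q\<close>, and the multiple is positive.\<close>

lemma minimal_equivalent:
  assumes p: "minimal k p" and q: "minimal k q" and b: "b \<in> B k" "p * b * q \<noteq> 0"
  shows "equivalent k p q"
proof -
  have pp: "projection p" "p \<in> B k" and qq: "projection q" "q \<in> B k" "q \<noteq> 0" using p q by (auto simp: minimal_def)
  define d where "d = p * b * q"
  have dB: "d \<in> B k" unfolding d_def using b(1) pp qq by (intro star_subalgebraD(4)[OF sub])
  have dq: "d * q = d" and pd: "p * d = d" using pp qq by (auto simp: d_def mult.assoc projection_idem) (simp add: projection_idem flip: mult.assoc)
  have "star d * d = q * (star b * p * b) * q"
    using pp qq by (simp add: d_def star_mult projection_star mult.assoc) (metis mult.assoc projection_idem)
  moreover have "star b * p * b \<in> B k" using b(1) pp by (intro star_subalgebraD(4,5)[OF sub])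
  ultimately obtain c where c: "star d * d = c *\<^sub>C q" using q by (auto simp: minimal_def)
  have "star (star d * d) = star d * d" by (simp add: star_mult star_star)
  then have "cnj c *\<^sub>C q = c *\<^sub>C q" using c qq(1) by (simp add: star_scaleC projection_star)
  then have "cnj c = c" using qq(3) complex_vector.scale_right_imp_eq by blast
  then have cr: "c = complex_of_real (Re c)" by (metis Reals_cnj_iff of_real_Re)
  have "c \<noteq> 0"
  proof
    assume "c = 0"
    then have "norm d = 0" using norm_star_mult_self[of d] c by simp
    then show False using b(2) by (simp add: d_def)
  qed
  have scaled: "star (complex_of_real s *\<^sub>C d) * (complex_of_real s *\<^sub>C d) = complex_of_real (s * s * Re c) *\<^sub>C q" for s
    using c cr by (simp add: star_scaleC mult_scaleC_left mult_scaleC_right scaleC_scaleC)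
  have "Re c > 0"
  proof (rule ccontr)
    assume "\<not> Re c > 0"
    moreover have "Re c \<noteq> 0" using cr \<open>c \<noteq> 0\<close> by auto
    ultimately have neg: "Re c < 0" by simp
    define s where "s = 1 / sqrt (- Re c)"
    have "s * s = 1 / (- Re c)" using neg by (simp add: s_def)
    then have "s * s * Re c = -1" using neg by simp
    then have "star (complex_of_real s *\<^sub>C d) * (complex_of_real s *\<^sub>C d) = - q" using scaled[of s] by simp
    moreover have "complex_of_real s *\<^sub>C d \<in> D" using dB star_subalgebraD(2)[OF sub] by blast
    ultimately have "q = 0" using star_mult_self_not_negative qq(1) by blast
    then show False using qq(3) by simp
  qed
  define s where "s = 1 / sqrt (Re c)"
  define w where "w = complex_of_real s *\<^sub>C d"
  have wB: "w \<in> B k" unfolding w_def by (rule star_subalgebraD(2)[OF sub dB])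
  have "s * s * Re c = 1" using \<open>Re c > 0\<close> by (simp add: s_def)
  then have ww: "star w * w = q" using scaled[of s] by (simp add: w_def)
  have pw: "p * w = w" using pd by (simp add: w_def mult_scaleC_right)
  then have wp: "star w * p = star w" using pp(1) by (metis star_mult projection_star)
  have "w * q = w" using dq by (simp add: w_def mult_scaleC_left)
  then have id: "(w * star w) * (w * star w) = w * star w" using ww by (metis mult.assoc)
  have "p * (w * star w) * p = w * star w" using pw wp by (simp add: mult.assoc) (simp flip: mult.assoc)
  moreover have "w * star w \<in> B k" using wB by (intro star_subalgebraD(4,5)[OF sub])
  ultimately obtain c' where c': "w * star w = c' *\<^sub>C p" using p by (metis minimal_def)
  have "norm w \<noteq> 0" using ww qq(3) by auto
  then have "w * star w \<noteq> 0" using norm_mult_star_self[of w] by auto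
  then have "c' \<noteq> 0" using c' by auto
  have "(c' * c') *\<^sub>C p = c' *\<^sub>C p" using id pp(1) unfolding c' by (simp add: mult_scaleC_left mult_scaleC_right scaleC_scaleC projection_idem)
  then have "c' * c' = c'" using p complex_vector.scale_right_imp_eq unfolding minimal_def by blast
  then have "w * star w = p" using c' \<open>c' \<noteq> 0\<close> by simp
  then show ?thesis using wB ww unfolding equivalent_def by blast
qed

definition orthogonal_family :: "nat \<Rightarrow> 'a set \<Rightarrow> bool" where
  "orthogonal_family k \<E> \<longleftrightarrow> finite \<E> \<and> \<E> \<subseteq> B k \<and> resolution \<E> (\<lambda>e. e)"

lemma orthogonal_familyD:
  assumes "orthogonal_family k \<E>"
  shows "finite \<E>" "e \<in> \<E> \<Longrightarrow> e \<in> B k" "e \<in> \<E> \<Longrightarrow> projection e" "e \<in> \<E> \<Longrightarrow> e \<noteq> 0"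
    "e \<in> \<E> \<Longrightarrow> f \<in> \<E> \<Longrightarrow> e \<noteq> f \<Longrightarrow> e * f = 0" "(\<Sum>e\<in>\<E>. e) = 1"
  using assms by (auto simp: orthogonal_family_def resolution_def)

text \<open>Orthogonal nonzero projections are linearly independent.\<close>

lemma orthogonal_family_bounded: "\<exists>N. \<forall>\<E>. orthogonal_family k \<E> \<longrightarrow> card \<E> \<le> N"
proof -
  obtain F where F: "finite F" "B k = complex_vector.span F" using fd[of k] by (auto simp: finite_dim_subalgebra_def)
  have "card \<E> \<le> card F" if \<E>: "orthogonal_family k \<E>" for \<E>
  proof -
    note d = orthogonal_familyD[OF \<E>]
    have "\<not> complex_vector.dependent \<E>"
    proof (rule complex_vector.independent_if_scalars_zero[OF d(1)])
      fix u e assume z: "(\<Sum>x\<in>\<E>. u x *\<^sub>C x) = 0" and e: "e \<in> \<E>"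
      have "resolution \<E> (\<lambda>e. e)" using \<E> by (simp add: orthogonal_family_def)
      from resolution_mult(1)[OF this e, of u] show "u e = 0" using z d(4)[OF e] by simp
    qed
    then show ?thesis using complex_vector.independent_span_bound[OF F(1), of \<E>] d(2) F(2) by blast
  qed
  then show ?thesis by blast
qed

text \<open>A family of maximal cardinality, subordinate to the spectral projections of \<open>b\<close>, consists of minimal projections: if \<open>e\<close> is not
  minimal, then \<open>e B e\<close> contains a self-adjoint element that is not a multiple of \<open>e\<close>, and a spectral projection of it splits \<open>e\<close>.\<close>

theorem minimal_decomposition:
  assumes b: "b \<in> B k" "normal_element b"
  obtains \<E> l where "orthogonal_family k \<E>" "\<And>e. e \<in> \<E> \<Longrightarrow> minimal k e" "b = (\<Sum>e\<in>\<E>. l e *\<^sub>C e)"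
proof -
  obtain S P where SP: "resolution S P" "b = (\<Sum>l\<in>S. l *\<^sub>C P l)" "\<And>l. l \<in> S \<Longrightarrow> P l \<in> B k"
    using finite_dim_spectral[OF fd one_in b] by blast
  define sub_fam where "sub_fam \<E> \<longleftrightarrow> orthogonal_family k \<E> \<and> (\<forall>e\<in>\<E>. \<exists>l\<in>S. P l * e = e)" for \<E>
  have inj: "inj_on P S"
  proof (rule inj_onI, rule ccontr)
    fix l m assume "l \<in> S" "m \<in> S" "P l = P m" "l \<noteq> m"
    moreover have "P l * P m = 0" if "l \<in> S" "m \<in> S" "l \<noteq> m" for l m using SP(1) that by (simp add: resolution_def)
    ultimately have "P l * P l = 0" by metis
    moreover have "P l * P l = P l" "P l \<noteq> 0" using SP(1) \<open>l \<in> S\<close> by (simp_all add: resolution_def projection_def)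
    ultimately show False by simp
  qed
  have "sub_fam (P ` S)"
    using SP(1,3) inj unfolding sub_fam_def orthogonal_family_def resolution_def
    by (auto simp: sum.reindex) (metis projection_idem)
  moreover obtain N where "\<And>\<E>. sub_fam \<E> \<Longrightarrow> card \<E> \<le> N" using orthogonal_family_bounded[of k] by (auto simp: sub_fam_def)
  ultimately obtain \<E> where \<E>: "sub_fam \<E>" "\<And>\<F>. sub_fam \<F> \<Longrightarrow> card \<F> \<le> card \<E>"
    using ex_has_greatest_nat[of sub_fam "P ` S" card "N + 1"] by (metis less_Suc_eq_le Suc_eq_plus1)
  have fam: "orthogonal_family k \<E>" and dom: "\<And>e. e \<in> \<E> \<Longrightarrow> \<exists>l\<in>S. P l * e = e" using \<E>(1) by (auto simp: sub_fam_def)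
  note d = orthogonal_familyD[OF fam]
  have "minimal k e" if e: "e \<in> \<E>" for e
  proof (rule ccontr)
    assume "\<not> minimal k e"
    note ep = d(3)[OF e]
    obtain x where x: "x \<in> B k" "\<And>c. e * x * e \<noteq> c *\<^sub>C e" using \<open>\<not> minimal k e\<close> d(2-4)[OF e] by (auto simp: minimal_def)
    have "\<exists>h\<in>B k. star h = h \<and> e * h = h \<and> h * e = h \<and> (\<forall>c. h \<noteq> c *\<^sub>C e)"
    proof (rule ccontr)
      assume no: "\<not> ?thesis"
      define y where "y = e * x * e"
      have yB: "y \<in> B k" unfolding y_def using x(1) d(2)[OF e] by (intro star_subalgebraD(4)[OF sub])
      have ye: "e * y = y" "y * e = y" using ep by (simp_all add: y_def mult.assoc projection_idem) (simp add: projection_idem flip: mult.assoc)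
      then have yse: "e * star y = star y" "star y * e = star y" using ep by (metis projection_star star_mult)+
      have "\<exists>c. h = c *\<^sub>C e" if "h \<in> B k" "star h = h" "e * h = h" "h * e = h" for h using no that by blast
      note multiple = this
      have yC: "y + star y \<in> B k" "\<i> *\<^sub>C (y - star y) \<in> B k"
        using yB by (simp_all add: star_subalgebraD(1,2,5,6)[OF sub])
      obtain c1 where c1: "y + star y = c1 *\<^sub>C e"
        using multiple[OF yC(1)] ye yse by (auto simp: star_add star_star distrib_left distrib_right add.commute)
      obtain c2 where c2: "\<i> *\<^sub>C (y - star y) = c2 *\<^sub>C e"
        using multiple[OF yC(2)] ye yse
        by (auto simp: star_star star_scaleC star_diff left_diff_distrib right_diff_distrib
            mult_scaleC_left mult_scaleC_right complex_vector.scale_right_diff_distrib)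
      note c = c1 c2
      have "y - star y = (- \<i> * c2) *\<^sub>C e"
      proof -
        have "(- \<i>) *\<^sub>C \<i> *\<^sub>C (y - star y) = (- \<i>) *\<^sub>C c2 *\<^sub>C e" by (simp only: c)
        then show ?thesis by (simp only: scaleC_scaleC) simp
      qed
      with c(1) have "(y + star y) + (y - star y) = (c1 + - \<i> * c2) *\<^sub>C e" by (simp only: scaleC_add_left)
      moreover have "(y + star y) + (y - star y) = 2 *\<^sub>C y" using scaleC_add_left[of 1 1 y] by simp
      ultimately have "(1/2) *\<^sub>C 2 *\<^sub>C y = (1/2) *\<^sub>C (c1 + - \<i> * c2) *\<^sub>C e" by simp
      then have "y = (1/2 * (c1 + - \<i> * c2)) *\<^sub>C e" by (simp add: scaleC_scaleC)
      then show False using x(2)[of "1/2 * (c1 + - \<i> * c2)"] unfolding y_def by simp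
    qed
    then obtain h where h: "h \<in> B k" "star h = h" "e * h = h" "h * e = h" "\<And>c. h \<noteq> c *\<^sub>C e" by blast
    obtain q where q: "ev h q = 0" "q \<noteq> 0" by (rule finite_dim_annihilator[OF fd h(1)])
    obtain U Q where UQ: "resolution U Q" "h = (\<Sum>l\<in>U. l *\<^sub>C Q l)" "\<And>l. l \<in> U \<Longrightarrow> \<exists>p. Q l = ev h p"
      using algebraic_normal_spectral[OF normal_if_selfadjoint[OF h(2)] q] by blast
    have Qe: "Q l * e = e * Q l" and QB: "Q l \<in> B k" and Qp: "projection (Q l)" if l: "l \<in> U" for l
    proof -
      obtain p where p: "Q l = ev h p" using UQ(3)[OF l] by blast
      show "Q l * e = e * Q l" unfolding p by (rule gen_commute_elt[OF ev_gen]) (use h in auto)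
      show "Q l \<in> B k" unfolding p by (rule ev_in_subalgebra[OF sub one_in h(1)])
      show "projection (Q l)" using UQ(1) l by (simp add: resolution_def)
    qed
    have "\<exists>l\<in>U. e * Q l \<noteq> 0 \<and> e * Q l \<noteq> e"
    proof (rule ccontr)
      assume no: "\<not> ?thesis"
      have "(\<Sum>l\<in>U. e * Q l) = e" using UQ(1) by (simp add: resolution_def flip: sum_distrib_left)
      then obtain l where l: "l \<in> U" "e * Q l \<noteq> 0" using d(4)[OF e] by (metis sum.neutral)
      then have el: "e * Q l = e" using no by blast
      have "e * Q m = (if m = l then e else 0)" if m: "m \<in> U" for m
      proof (cases "m = l")
        case False
        have "e * Q m = e * (Q l * Q m)" using el by (metis mult.assoc)
        also have "Q l * Q m = 0" using UQ(1) l(1) m False by (auto simp: resolution_def)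
        finally show ?thesis using False by simp
      qed (use el in simp)
      then have "e * h = (\<Sum>m\<in>U. if m = l then l *\<^sub>C e else 0)"
        unfolding UQ(2) sum_distrib_left by (intro sum.cong) (auto simp: mult_scaleC_right)
      then have "h = l *\<^sub>C e" using h(3) l(1) UQ(1) by (simp add: resolution_def)
      then show False using h(5) by blast
    qed
    then obtain l where l: "l \<in> U" "e * Q l \<noteq> 0" "e * Q l \<noteq> e" by blast
    define f1 f2 where "f1 = e * Q l" and "f2 = e - f1"
    have f1: "projection f1" "e * f1 = f1" "f1 * e = f1"
      using ep Qp[OF l(1)] Qe[OF l(1)] unfolding f1_def projection_def
      by (simp_all add: star_mult mult.assoc) (metis mult.assoc)+
    have f2: "projection f2" "e * f2 = f2" "f2 * e = f2" "f1 * f2 = 0" "f2 * f1 = 0"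
      using f1 ep by (simp_all add: f2_def projection_def star_diff algebra_simps)
    have nz: "f1 \<noteq> 0" "f2 \<noteq> 0" using l by (auto simp: f1_def f2_def)
    have fB: "f1 \<in> B k" "f2 \<in> B k" unfolding f2_def f1_def using d(2)[OF e] QB[OF l(1)] by (simp_all add: star_subalgebraD(4,6)[OF sub])
    define \<R> where "\<R> = \<E> - {e}"
    have orth: "f1 * g = 0" "g * f1 = 0" "f2 * g = 0" "g * f2 = 0" if "g \<in> \<R>" for g
    proof -
      have eg: "e * g = 0" "g * e = 0" using d(5) e that by (auto simp: \<R>_def)
      show "f1 * g = 0" "g * f1 = 0" "f2 * g = 0" "g * f2 = 0"
        using f1 f2 eg by (metis mult.assoc mult_zero_left mult_zero_right)+
    qed
    have notin: "f1 \<notin> \<R>" "f2 \<notin> \<R>" "f1 \<noteq> f2"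
      using orth nz f1(1) f2(1,4) unfolding projection_def by metis+
    have fR: "finite \<R>" using d(1) by (simp add: \<R>_def)
    have "sub_fam (insert f1 (insert f2 \<R>))"
      unfolding sub_fam_def orthogonal_family_def resolution_def
    proof (intro conjI ballI impI)
      show "(\<Sum>g\<in>insert f1 (insert f2 \<R>). g) = 1"
      proof -
        have "(\<Sum>g\<in>insert f1 (insert f2 \<R>). g) = e + (\<Sum>g\<in>\<R>. g)"
          using notin fR by (simp add: f2_def)
        also have "\<dots> = (\<Sum>g\<in>\<E>. g)" using d(1) e by (simp add: \<R>_def sum.remove)
        finally show ?thesis using d(6) by simp
      qed
      fix g assume g: "g \<in> insert f1 (insert f2 \<R>)"
      show "projection g" "g \<noteq> 0" using g f1 f2 nz d by (auto simp: \<R>_def)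
      obtain m where m: "m \<in> S" "P m * e = e" using dom[OF e] by blast
      then have "P m * f1 = f1" "P m * f2 = f2" using f1(2) f2(2) by (metis mult.assoc)+
      then show "\<exists>l\<in>S. P l * g = g" using g m dom by (auto simp: \<R>_def)
      fix g' assume g': "g' \<in> insert f1 (insert f2 \<R>)" "g \<noteq> g'"
      then show "g * g' = 0" using g f2 orth d(5) by (auto simp: \<R>_def)
    qed (use fR fB d(2) in \<open>auto simp: \<R>_def\<close>)
    from \<E>(2)[OF this] have "card \<R> + 2 \<le> card \<E>" using notin fR by simp
    moreover have "card \<E> = card \<R> + 1" using d(1) e unfolding \<R>_def by (metis Suc_eq_plus1 card.remove)
    ultimately show False by simp
  qed
  moreover obtain l where l: "\<And>e. e \<in> \<E> \<Longrightarrow> l e \<in> S \<and> P (l e) * e = e" using dom by metis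
  have "b = (\<Sum>e\<in>\<E>. l e *\<^sub>C e)"
  proof -
    have "b * e = l e *\<^sub>C e" if "e \<in> \<E>" for e
    proof -
      have "b * e = b * P (l e) * e" using l[OF that] by (simp add: mult.assoc)
      also have "\<dots> = l e *\<^sub>C e" using resolution_eigen(1)[OF SP(1,2), of "l e"] l[OF that] by (simp add: mult_scaleC_left)
      finally show ?thesis .
    qed
    then have "(\<Sum>e\<in>\<E>. b * e) = (\<Sum>e\<in>\<E>. l e *\<^sub>C e)" by simp
    then show ?thesis using d(6) by (simp flip: sum_distrib_left)
  qed
  ultimately show ?thesis using that[OF fam] by blast
qed

text \<open>For every \<open>e\<close> in \<open>S\<close> let \<open>w e\<close> be a partial isometry between \<open>e\<^sub>0\<close> and \<open>e\<close>. Multiplication by \<open>X F\<close> from the right, where \<open>F\<close> is the sum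
  of \<open>T\<close>, is injective on the linear span of the \<open>w e\<close>, because multiplication by \<open>X F Y\<close> followed by compression differs from the
  identity by less than \<open>1\<close>. The images lie in the span of partial isometries between \<open>e\<^sub>0\<close> and the members of \<open>T\<close> equivalent to
  it, of which one for each member is enough by minimality.\<close>

lemma card_comparison:
  assumes \<E>: "orthogonal_family k \<E>" and S: "S \<subseteq> \<E>" and T: "orthogonal_family k \<F>" "T \<subseteq> \<F>" "\<And>f. f \<in> \<F> \<Longrightarrow> minimal k f"
    and e0: "minimal k e0" "\<And>e. e \<in> S \<Longrightarrow> equivalent k e0 e"
    and X: "X \<in> B k" and lt: "norm ((\<Sum>e\<in>S. e) - (\<Sum>e\<in>S. e) * X * (\<Sum>f\<in>T. f) * Y * (\<Sum>e\<in>S. e)) < 1"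
  shows "card S \<le> card {f\<in>T. equivalent k e0 f}"
proof -
  define E F where "E = (\<Sum>e\<in>S. e)" and "F = (\<Sum>f\<in>T. f)"
  note d = orthogonal_familyD[OF \<E>] and d' = orthogonal_familyD[OF T(1)]
  have fS: "finite S" using S d(1) finite_subset by blast
  have fT: "finite T" using T(2) d'(1) finite_subset by blast
  have "\<forall>e\<in>S. \<exists>w. w \<in> B k \<and> w * star w = e0 \<and> star w * w = e" using e0(2) by (auto simp: equivalent_def)
  then obtain w where w: "\<And>e. e \<in> S \<Longrightarrow> w e \<in> B k \<and> w e * star (w e) = e0 \<and> star (w e) * w e = e" by metis
  have wpi: "w e * e = w e" "e0 * w e = w e" if "e \<in> S" for e
    using partial_isometry[of "w e" e0 e] w[OF that] d(3) S that by auto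
  have wne: "w e \<noteq> 0" if "e \<in> S" for e using w[OF that] d(4)[of e] S that by auto
  have we': "w e * e' = (if e' = e then w e else 0)" if "e \<in> S" "e' \<in> S" for e e'
  proof (cases "e' = e")
    case False
    then have "e * e' = 0" using d(5)[of e e'] S that by auto
    then show ?thesis using wpi(1)[OF that(1)] False by (metis mult.assoc mult_zero_right)
  qed (use wpi(1)[OF that(1)] in simp)
  have wE: "w e * E = w e" if "e \<in> S" for e
    using we'[OF that] fS that by (simp add: E_def sum_distrib_left cong: sum.cong)
  define v where "v e = w e * X * F" for e
  define T' where "T' = {f\<in>T. equivalent k e0 f}"
  have "\<forall>f\<in>T'. \<exists>u. u \<in> B k \<and> u * star u = e0 \<and> star u * u = f" by (auto simp: equivalent_def T'_def)
  then obtain u where u: "\<And>f. f \<in> T' \<Longrightarrow> u f \<in> B k \<and> u f * star (u f) = e0 \<and> star (u f) * u f = f" by metis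
  have FB: "F \<in> B k" unfolding F_def using d'(2) T(2) by (intro star_subalgebraD(7)[OF sub]) auto
  have vB: "v e \<in> B k" if "e \<in> S" for e unfolding v_def using w[OF that] X FB by (intro star_subalgebraD(4)[OF sub]) auto
  have FF: "F * F = F"
  proof -
    have "F * F = (\<Sum>f\<in>T. \<Sum>g\<in>T. if g = f then f else 0)"
      unfolding F_def sum_product using d'(3,5) T(2) by (intro sum.cong refl) (auto simp: projection_idem)
    then show ?thesis using fT by (simp add: F_def)
  qed
  have vspan: "v e \<in> complex_vector.span (u ` T')" if e: "e \<in> S" for e
  proof -
    have v1: "e0 * v e = v e" using wpi(2)[OF e] by (simp add: v_def flip: mult.assoc)
    have "v e = v e * F" using FF by (simp add: v_def mult.assoc)
    also have "\<dots> = (\<Sum>f\<in>T. v e * f)" by (simp add: F_def sum_distrib_left)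
    also have "\<dots> \<in> complex_vector.span (u ` T')"
    proof (rule complex_vector.span_sum)
      fix f assume f: "f \<in> T"
      show "v e * f \<in> complex_vector.span (u ` T')"
      proof (cases "f \<in> T'")
        case True
        note uf = u[OF True]
        have "projection f" using f d'(3) T(2) by blast
        note pi = partial_isometry[of "u f" e0 f, OF _ _ this]
        have "v e * f = (e0 * v e) * (star (u f) * u f)" using v1 uf by simp
        also have "\<dots> = e0 * (v e * star (u f)) * e0 * u f" using pi uf by (simp add: mult.assoc)
        also obtain c where "e0 * (v e * star (u f)) * e0 = c *\<^sub>C e0"
          using e0(1) vB[OF e] uf star_subalgebraD(4,5)[OF sub] unfolding minimal_def by metis
        also have "c *\<^sub>C e0 * u f = c *\<^sub>C u f" using pi uf by (simp add: mult_scaleC_left)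
        finally show ?thesis using True by (simp add: complex_vector.span_scale complex_vector.span_base)
      next
        case False
        then have "\<not> equivalent k e0 f" using f by (simp add: T'_def)
        then have "e0 * v e * f = 0" using minimal_equivalent[OF e0(1) T(3) vB[OF e]] f T(2) by blast
        then show ?thesis using v1 by (simp add: complex_vector.span_zero)
      qed
    qed
    finally show ?thesis .
  qed
  have zero: "c e = 0" if sum0: "(\<Sum>e\<in>S. c e *\<^sub>C v e) = 0" and e: "e \<in> S" for c e
  proof -
    define y where "y = (\<Sum>e\<in>S. c e *\<^sub>C w e)"
    have "y * X * F = 0" using sum0 by (simp add: y_def v_def sum_distrib_right mult_scaleC_left)
    moreover have yE: "y * E = y" using wE by (simp add: y_def sum_distrib_right mult_scaleC_left)
    ultimately have "y * (E * X * F * Y * E) = 0" by (metis mult.assoc mult_zero_left)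
    then have "y = y * (E - E * X * F * Y * E)" using yE by (simp add: right_diff_distrib)
    then have le: "norm y \<le> norm y * norm (E - E * X * F * Y * E)" by (metis norm_mult_ineq)
    have "y = 0"
    proof (rule ccontr)
      assume "y \<noteq> 0"
      then have "norm y * norm (E - E * X * F * Y * E) < norm y * 1"
        using lt unfolding E_def F_def by (intro mult_strict_left_mono) auto
      then show False using le by simp
    qed
    then have "0 = y * e" by simp
    also have "y * e = (\<Sum>e'\<in>S. if e' = e then c e *\<^sub>C w e else 0)"
      unfolding y_def sum_distrib_right using we' e by (intro sum.cong refl) (auto simp: mult_scaleC_left)
    also have "\<dots> = c e *\<^sub>C w e" using fS e by simp
    finally show ?thesis using wne[OF e] by (metis complex_vector.scale_eq_0_iff)
  qed
  have injv: "inj_on v S"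
  proof (rule inj_onI, rule ccontr)
    fix e e' assume ee: "e \<in> S" "e' \<in> S" "v e = v e'" "e \<noteq> e'"
    define c :: "'a \<Rightarrow> complex" where "c x = (if x = e then 1 else if x = e' then -1 else 0)" for x
    have "(\<Sum>x\<in>S. c x *\<^sub>C v x) = (\<Sum>x\<in>{e, e'}. c x *\<^sub>C v x)"
      using fS ee by (intro sum.mono_neutral_right) (auto simp: c_def)
    also have "\<dots> = 0" using ee by (simp add: c_def)
    finally have "c e = 0" using zero ee(1) by blast
    then show False by (simp add: c_def)
  qed
  have "\<not> complex_vector.dependent (v ` S)"
  proof (rule complex_vector.independent_if_scalars_zero)
    fix c x assume s: "(\<Sum>x\<in>v ` S. c x *\<^sub>C x) = 0" and x: "x \<in> v ` S"
    have "(\<Sum>e\<in>S. c (v e) *\<^sub>C v e) = 0" using s by (simp add: sum.reindex[OF injv])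
    then show "c x = 0" using zero[of "\<lambda>e. c (v e)"] x by auto
  qed (use fS in simp)
  moreover have "finite (u ` T')" using fT by (simp add: T'_def)
  moreover have "v ` S \<subseteq> complex_vector.span (u ` T')" using vspan by blast
  ultimately have "card (v ` S) \<le> card (u ` T')" using complex_vector.independent_span_bound by blast
  also have "\<dots> \<le> card T'" using fT by (intro card_image_le) (simp add: T'_def)
  finally show ?thesis using card_image[OF injv] by (simp add: T'_def)
qed

end

context af
begin

text \<open>If the comparison holds for every set of equivalent eigenprojections and the eigenvalues near it, the marriage theorem pairs
  equivalent eigenprojections with close eigenvalues, which yields a unitary.\<close>

theorem unitary_from_matching:
  assumes \<E>: "orthogonal_family k \<E>" "\<And>e. e \<in> \<E> \<Longrightarrow> minimal k e" and \<F>: "orthogonal_family k \<F>" "\<And>f. f \<in> \<F> \<Longrightarrow> minimal k f"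
    and hall: "\<And>S e0. S \<subseteq> \<E> \<Longrightarrow> S \<noteq> {} \<Longrightarrow> e0 \<in> \<E> \<Longrightarrow> (\<And>e. e \<in> S \<Longrightarrow> equivalent k e0 e) \<Longrightarrow>
      card S \<le> card {f\<in>\<F>. equivalent k e0 f \<and> (\<exists>e\<in>S. cmod (l e - m f) \<le> \<delta>)}"
    and \<delta>: "0 \<le> \<delta>"
  obtains u where "unitary u" "norm (star u * (\<Sum>e\<in>\<E>. l e *\<^sub>C e) * u - (\<Sum>f\<in>\<F>. m f *\<^sub>C f)) \<le> \<delta>"
proof -
  note d = orthogonal_familyD[OF \<E>(1)] and d' = orthogonal_familyD[OF \<F>(1)]
  define N where "N e = {f\<in>\<F>. equivalent k e f \<and> cmod (l e - m f) \<le> \<delta>}" for e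
  define cls where "cls e = {e'\<in>\<E>. equivalent k e e'}" for e
  have tr: "equivalent k p s" if "equivalent k p q" "equivalent k q s" "minimal k q" "minimal k s" for p q s
    using equivalent_trans[OF that(1,2)] that(3,4) by (simp add: minimal_def)
  have "\<exists>f. inj_on f (cls e0) \<and> (\<forall>a\<in>cls e0. f a \<in> N a)" if e0: "e0 \<in> \<E>" for e0
  proof (rule hall_marriage)
    show "finite (cls e0)" using d(1) by (simp add: cls_def)
    show "finite (N a)" for a using d'(1) by (simp add: N_def)
    fix S assume S: "S \<subseteq> cls e0"
    show "card S \<le> card (\<Union>a\<in>S. N a)"
    proof (cases "S = {}")
      case False
      have "card S \<le> card {f\<in>\<F>. equivalent k e0 f \<and> (\<exists>e\<in>S. cmod (l e - m f) \<le> \<delta>)}"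
        by (rule hall[OF _ False e0]) (use S in \<open>auto simp: cls_def\<close>)
      also have "\<dots> \<le> card (\<Union>a\<in>S. N a)"
      proof (rule card_mono)
        show "finite (\<Union>a\<in>S. N a)" by (rule finite_subset[OF _ d'(1)]) (auto simp: N_def)
        show "{f\<in>\<F>. equivalent k e0 f \<and> (\<exists>e\<in>S. cmod (l e - m f) \<le> \<delta>)} \<subseteq> (\<Union>a\<in>S. N a)"
        proof
          fix f assume "f \<in> {f\<in>\<F>. equivalent k e0 f \<and> (\<exists>e\<in>S. cmod (l e - m f) \<le> \<delta>)}"
          then obtain e where e: "f \<in> \<F>" "equivalent k e0 f" "e \<in> S" "cmod (l e - m f) \<le> \<delta>" by blast
          then have "equivalent k e e0" using S equivalent_sym by (auto simp: cls_def)
          then have "equivalent k e f" using tr[of e e0 f] e \<E>(2)[OF e0] \<F>(2) by blast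
          then show "f \<in> (\<Union>a\<in>S. N a)" using e by (auto simp: N_def)
        qed
      qed
      finally show ?thesis .
    qed simp
  qed
  then have "\<forall>C\<in>cls ` \<E>. \<exists>f. inj_on f C \<and> (\<forall>a\<in>C. f a \<in> N a)" by blast
  then obtain g where g: "\<And>C. C \<in> cls ` \<E> \<Longrightarrow> inj_on (g C) C \<and> (\<forall>a\<in>C. g C a \<in> N a)" by metis
  define \<pi> where "\<pi> e = g (cls e) e" for e
  have self: "e \<in> cls e" if "e \<in> \<E>" for e using that equivalent_refl[OF \<E>(2)] by (simp add: cls_def)
  have \<pi>N: "\<pi> e \<in> N e" if "e \<in> \<E>" for e using g[of "cls e"] self[OF that] that by (auto simp: \<pi>_def)
  then have \<pi>F: "\<pi> e \<in> \<F>" and \<pi>eq: "equivalent k e (\<pi> e)" and \<pi>\<delta>: "cmod (l e - m (\<pi> e)) \<le> \<delta>" if "e \<in> \<E>" for e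
    using that by (auto simp: N_def)
  have \<pi>inj: "inj_on \<pi> \<E>"
  proof (rule inj_onI)
    fix e e' assume e: "e \<in> \<E>" "e' \<in> \<E>" "\<pi> e = \<pi> e'"
    have ee: "equivalent k e e'"
      using tr[OF \<pi>eq[OF e(1)]] equivalent_sym[OF \<pi>eq[OF e(2)]] e \<F>(2)[OF \<pi>F] \<E>(2) by metis
    have "cls e = cls e'"
      using tr ee equivalent_sym[OF ee] \<E>(2) e unfolding cls_def by blast
    moreover have "e' \<in> cls e" using ee e by (simp add: cls_def)
    ultimately show "e = e'" using g[of "cls e"] self e unfolding \<pi>_def by (metis imageI inj_onD)
  qed
  have "\<forall>e\<in>\<E>. \<exists>w. w * star w = e \<and> star w * w = \<pi> e" using \<pi>eq by (auto simp: equivalent_def)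
  then obtain w where w: "\<And>e. e \<in> \<E> \<Longrightarrow> w e * star (w e) = e \<and> star (w e) * w e = \<pi> e" by metis
  have wpi: "w e * \<pi> e = w e" "e * w e = w e" "\<pi> e * star (w e) = star (w e)" "star (w e) * e = star (w e)" if "e \<in> \<E>" for e
    using partial_isometry[of "w e" e "\<pi> e"] w[OF that] d'(3)[OF \<pi>F[OF that]] by auto
  have ww: "w e * star (w e') = (if e' = e then e else 0)" if e: "e \<in> \<E>" "e' \<in> \<E>" for e e'
  proof (cases "e' = e")
    case False
    then have "\<pi> e * \<pi> e' = 0" using d'(5) \<pi>F e \<pi>inj by (metis inj_onD)
    moreover have "w e * star (w e') = w e * (\<pi> e * \<pi> e') * star (w e')" using wpi(1)[OF e(1)] wpi(3)[OF e(2)] by (metis mult.assoc)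
    ultimately show ?thesis using False by simp
  qed (use w[OF e(1)] in simp)
  define u where "u = (\<Sum>e\<in>\<E>. w e)"
  have "u * star u = (\<Sum>e\<in>\<E>. \<Sum>e'\<in>\<E>. if e' = e then e else 0)"
    unfolding u_def star_sum sum_product using ww by (intro sum.cong refl) auto
  also have "\<dots> = 1" using d(1,6) by simp
  finally have uu: "u * star u = 1" .
  then have u: "unitary u" using right_inverse_imp_left_inverse by (auto simp: unitary_def)
  have eu: "e * u = w e" if e: "e \<in> \<E>" for e
  proof -
    have "e * u = (\<Sum>e'\<in>\<E>. if e' = e then w e else 0)"
      unfolding u_def sum_distrib_left
    proof (intro sum.cong refl)
      fix e' assume e': "e' \<in> \<E>"
      show "e * w e' = (if e' = e then w e else 0)"
      proof (cases "e' = e")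
        case False
        then have "e * e' = 0" using d(5) e e' by auto
        then show ?thesis using wpi(2)[OF e'] False by (metis mult.assoc mult_zero_left)
      qed (use wpi(2)[OF e] in simp)
    qed
    then show ?thesis using d(1) e by simp
  qed
  have ueu: "star u * e * u = \<pi> e" if e: "e \<in> \<E>" for e
  proof -
    have "star u * e = star (w e)" using arg_cong[OF eu[OF e], of star] d(3)[OF e] by (simp add: star_mult projection_star)
    then have "star u * e * u = star (w e) * (e * u)" using wpi(4)[OF e] by (metis mult.assoc)
    then show ?thesis using eu[OF e] w[OF e] by simp
  qed
  have sum\<pi>: "(\<Sum>e\<in>\<E>. \<pi> e) = 1"
  proof -
    have "(\<Sum>e\<in>\<E>. \<pi> e) = (\<Sum>e\<in>\<E>. star u * e * u)" using ueu by simp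
    also have "\<dots> = star u * (\<Sum>e\<in>\<E>. e) * u" by (simp add: sum_distrib_left sum_distrib_right)
    finally show ?thesis using d(6) u by (simp add: unitary_def)
  qed
  have onto: "\<pi> ` \<E> = \<F>"
  proof (rule ccontr)
    assume "\<pi> ` \<E> \<noteq> \<F>"
    then obtain f where f: "f \<in> \<F>" "f \<notin> \<pi> ` \<E>" using \<pi>F by blast
    have "f * \<pi> e = 0" if "e \<in> \<E>" for e using d'(5)[OF f(1) \<pi>F[OF that]] f(2) that by auto
    then have "f * (\<Sum>e\<in>\<E>. \<pi> e) = 0" by (simp add: sum_distrib_left)
    then show False using sum\<pi> d'(4)[OF f(1)] by simp
  qed
  have res: "resolution \<E> \<pi>"
    using d(1) sum\<pi> d'(3,4,5) \<pi>F \<pi>inj unfolding resolution_def by (auto simp: inj_on_eq_iff)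
  have "star u * (\<Sum>e\<in>\<E>. l e *\<^sub>C e) * u - (\<Sum>f\<in>\<F>. m f *\<^sub>C f) = (\<Sum>e\<in>\<E>. (l e - m (\<pi> e)) *\<^sub>C \<pi> e)"
  proof -
    have "star u * (\<Sum>e\<in>\<E>. l e *\<^sub>C e) * u = (\<Sum>e\<in>\<E>. l e *\<^sub>C (star u * e * u))"
      by (simp add: sum_distrib_left sum_distrib_right mult_scaleC_left mult_scaleC_right)
    moreover have "(\<Sum>f\<in>\<F>. m f *\<^sub>C f) = (\<Sum>e\<in>\<E>. m (\<pi> e) *\<^sub>C \<pi> e)"
      unfolding onto[symmetric] by (simp add: sum.reindex[OF \<pi>inj])
    ultimately show ?thesis using ueu by (simp add: complex_vector.scale_left_diff_distrib sum_subtractf)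
  qed
  also have "norm \<dots> \<le> \<delta>" by (rule resolution_norm_le[OF res \<pi>\<delta> \<delta>])
  finally show ?thesis using that u by blast
qed

end

section \<open>Cuntz comparison of support functions\<close>

lemma support_fun_properties:
  fixes \<Omega> :: "'t::metric_space set"
  assumes "openin (top_of_set \<Omega>) G"
  shows "continuous_on \<Omega> (support_fun \<Omega> G)"
    and "t \<in> \<Omega> \<Longrightarrow> support_fun \<Omega> G t = complex_of_real (Re (support_fun \<Omega> G t))"
    and "t \<in> \<Omega> \<Longrightarrow> 0 \<le> Re (support_fun \<Omega> G t)"
    and "t \<in> \<Omega> \<Longrightarrow> t \<in> G \<Longrightarrow> 0 < Re (support_fun \<Omega> G t)"
    and "t \<in> \<Omega> \<Longrightarrow> t \<notin> G \<Longrightarrow> support_fun \<Omega> G t = 0"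
proof -
  note s = is_support_fun_support_fun[OF assms, unfolded is_support_fun_def]
  show "continuous_on \<Omega> (support_fun \<Omega> G)" using s by blast
  assume t: "t \<in> \<Omega>"
  obtain r where r: "support_fun \<Omega> G t = complex_of_real r" "0 \<le> r" "if t \<in> G then 0 < r else r = 0" using s t by blast
  show "support_fun \<Omega> G t = complex_of_real (Re (support_fun \<Omega> G t))" "0 \<le> Re (support_fun \<Omega> G t)" using r by simp_all
  show "0 < Re (support_fun \<Omega> G t)" if "t \<in> G" using r that by simp
  show "support_fun \<Omega> G t = 0" if "t \<notin> G" using r that by simp
qed

lemma openin_nbhd: "openin (top_of_set \<Omega>) (nbhd \<Omega> G d)"
proof -
  have "nbhd \<Omega> G d = \<Omega> \<inter> (\<Union>s\<in>G. ball s d)" by (auto simp: nbhd_def dist_commute)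
  then show ?thesis by (metis openin_open_Int open_UN open_ball)
qed

lemma (in star_hom) hom_conjugate:
  assumes "continuous_on K f" "continuous_on K w"
  shows "star (\<Phi> w) * \<Phi> f * \<Phi> w = \<Phi> (\<lambda>t. cnj (w t) * f t * w t)"
  using assms by (simp add: hom_mult hom_star continuous_on_mult continuous_on_cnj)

context af
begin

text \<open>The enlarged set is everything (or empty, if \<open>G\<close> is), and a strictly positive function on a compact set is invertible.\<close>

lemma cuntz_le_within_diameter:
  fixes x y :: 'a
  assumes x: "normal_element x" and y: "normal_element y" and \<Omega>: "\<Omega> = spectrum x \<union> spectrum y"
    and G: "openin (top_of_set \<Omega>) G" and M: "\<And>s t. s \<in> \<Omega> \<Longrightarrow> t \<in> \<Omega> \<Longrightarrow> dist t s < M"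
  shows "cfc x (support_fun \<Omega> G) \<lesssim> cfc y (support_fun \<Omega> (nbhd \<Omega> G M))"
proof -
  interpret hx: star_hom \<Omega> "cfc x" by (rule star_homI[OF unital_star_hom_mono[OF cfc_hom(1)[OF x]]]) (simp add: \<Omega>)
  interpret hy: star_hom \<Omega> "cfc y" by (rule star_homI[OF unital_star_hom_mono[OF cfc_hom(1)[OF y]]]) (simp add: \<Omega>)
  note sG = support_fun_properties[OF G]
  show ?thesis
  proof (cases "G = {}")
    case True
    have "cfc x (support_fun \<Omega> G) = cfc x (\<lambda>t. 0)" by (rule hx.hom_cong[OF sG(1)]) (use sG(5) True in auto)
    then have "cfc x (support_fun \<Omega> G) = 0" by (simp add: hx.hom_zero)
    then show ?thesis unfolding cuntz_le_def by (intro exI[of _ "\<lambda>n. 0"]) simp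
  next
    case False
    have "G \<subseteq> \<Omega>" using G by (simp add: openin_imp_subset)
    then have nb: "nbhd \<Omega> G M = \<Omega>" using False M by (auto simp: nbhd_def)
    define f where "f = support_fun \<Omega> \<Omega>"
    note sf = support_fun_properties[where \<Omega> = \<Omega> and G = \<Omega>, OF openin_subtopology_self, folded f_def]
    define v where "v t = complex_of_real (1 / sqrt (Re (f t)))" for t
    define w where "w t = complex_of_real (sqrt (Re (support_fun \<Omega> G t)))" for t
    have cv: "continuous_on \<Omega> v" unfolding v_def using sf(4) by (intro continuous_intros sf(1)) force
    have cw: "continuous_on \<Omega> w" unfolding w_def by (intro continuous_intros sG(1))
    have "star (cfc y v) * cfc y f * cfc y v = cfc y (\<lambda>t. 1)"
      unfolding hy.hom_conjugate[OF sf(1) cv]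
    proof (rule hy.hom_cong)
      show "continuous_on \<Omega> (\<lambda>t. cnj (v t) * f t * v t)" by (intro continuous_intros cv sf(1))
      fix t assume t: "t \<in> \<Omega>"
      have "cnj (v t) * f t * v t = cnj (v t) * complex_of_real (Re (f t)) * v t" using sf(2)[OF t] by simp
      also have "\<dots> = complex_of_real (1 / sqrt (Re (f t)) * Re (f t) * (1 / sqrt (Re (f t))))"
        by (simp only: v_def of_real_mult complex_cnj_complex_of_real)
      also have "1 / sqrt (Re (f t)) * Re (f t) * (1 / sqrt (Re (f t))) = 1" using sf(4)[OF t t] by (simp add: field_simps)
      finally show "cnj (v t) * f t * v t = 1" by simp
    qed
    then have v1: "star (cfc y v) * cfc y f * cfc y v = 1" by (simp add: hy.hom_one)
    have "star (cfc x w) * 1 * cfc x w = cfc x (\<lambda>t. cnj (w t) * 1 * w t)"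
      using hx.hom_conjugate[OF continuous_on_const cw, of 1] by (simp add: hx.hom_one)
    also have "\<dots> = cfc x (support_fun \<Omega> G)"
    proof (rule hx.hom_cong)
      show "continuous_on \<Omega> (\<lambda>t. cnj (w t) * 1 * w t)" by (intro continuous_intros cw)
      fix t assume t: "t \<in> \<Omega>"
      have "cnj (w t) * 1 * w t = complex_of_real (Re (support_fun \<Omega> G t))"
        using sG(3)[OF t] by (simp add: w_def flip: of_real_mult)
      then show "cnj (w t) * 1 * w t = support_fun \<Omega> G t" using sG(2)[OF t] by simp
    qed
    finally have w1: "star (cfc x w) * 1 * cfc x w = cfc x (support_fun \<Omega> G)" .
    have "star (cfc y v * cfc x w) * cfc y f * (cfc y v * cfc x w) = star (cfc x w) * (star (cfc y v) * cfc y f * cfc y v) * cfc x w"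
      by (simp only: star_mult mult.assoc)
    then have "star (cfc y v * cfc x w) * cfc y f * (cfc y v * cfc x w) = cfc x (support_fun \<Omega> G)" by (simp only: v1 w1)
    then show ?thesis unfolding nb f_def[symmetric] cuntz_le_def by (intro exI[of _ "\<lambda>n. cfc y v * cfc x w"]) simp
  qed
qed

text \<open>Since every distance above the diameter of the spectra is admissible, the infima and the supremum defining \<open>Dc\<close> are
  attained up to an arbitrarily small error.\<close>

lemma Dc_comparison:
  fixes x y :: 'a
  assumes x: "normal_element x" and y: "normal_element y" and \<Omega>: "\<Omega> = spectrum x \<union> spectrum y"
    and G: "openin (top_of_set \<Omega>) G" and D': "Dc x y < D'"
  obtains d where "0 < d" "d < D'" "cfc x (support_fun \<Omega> G) \<lesssim> cfc y (support_fun \<Omega> (nbhd \<Omega> G d))"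
proof -
  define I where "I G = {d. 0 < d \<and> cfc x (support_fun \<Omega> G) \<lesssim> cfc y (support_fun \<Omega> (nbhd \<Omega> G d))}" for G
  define M where "M = 2 * (norm x + norm y) + 1"
  have cm: "cmod s \<le> norm x + norm y" if "s \<in> \<Omega>" for s
    using that by (auto simp: \<Omega> dest!: spectrum_bound intro: add_increasing add_increasing2)
  have "dist t s < M" if "s \<in> \<Omega>" "t \<in> \<Omega>" for s t
    using norm_triangle_ineq4[of t s] cm[OF that(1)] cm[OF that(2)] by (simp add: dist_norm M_def)
  then have MI: "M \<in> I G" if "openin (top_of_set \<Omega>) G" for G
    using cuntz_le_within_diameter[OF x y \<Omega> that] by (simp add: I_def M_def add_nonneg_pos)
  have bb: "bdd_below (I G)" for G by (rule bdd_belowI[of _ 0]) (simp add: I_def)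
  have Dc: "Dc x y = Sup {Inf (I G) | G. openin (top_of_set \<Omega>) G}" by (simp add: Dc_def Dc_hom_def I_def \<Omega>)
  have "Inf (I G) \<le> Dc x y"
    unfolding Dc
  proof (rule cSup_upper)
    show "Inf (I G) \<in> {Inf (I G) | G. openin (top_of_set \<Omega>) G}" using G by blast
    show "bdd_above {Inf (I G) | G. openin (top_of_set \<Omega>) G}"
      using cInf_lower[OF MI bb] by (intro bdd_aboveI[of _ M]) blast
  qed
  then have "Inf (I G) < D'" using D' by simp
  then obtain d where d: "d \<in> I G" "d < D'" using cInf_lessD[of "I G" D'] MI[OF G] by blast
  show ?thesis by (rule that[of d]) (use d in \<open>simp_all add: I_def\<close>)
qed

text \<open>A bump function \<open>g\<close> at a finite set \<open>K\<close> is supported in a neighbourhood \<open>G\<close> of \<open>K\<close>. Up to a small error it is a multiple of the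
  support function of \<open>G\<close>, so Cuntz comparison factorises \<open>g(x)\<close> through \<open>h(y)\<close>, where \<open>h\<close> is a bump function at \<open>K\<close> that
  equals \<open>1\<close> on the enlarged neighbourhood.\<close>

lemma bump_factorization:
  fixes x y :: 'a
  assumes x: "normal_element x" and y: "normal_element y" and D': "Dc x y < D'" and \<epsilon>: "0 < \<epsilon>" and K: "finite K" "K \<noteq> {}"
  obtains g h :: "complex \<Rightarrow> complex" and U V where "continuous_on UNIV g" "continuous_on UNIV h"
    "\<And>t k. k \<in> K \<Longrightarrow> dist t k \<le> \<epsilon> / 2 \<Longrightarrow> g t = 1"
    "\<And>t. h t \<noteq> 0 \<Longrightarrow> \<exists>k\<in>K. dist t k \<le> D' + 2 * \<epsilon>"
    "U \<in> D" "norm (cfc x g - U * cfc y h * V) < 1"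
proof -
  define \<Omega> where "\<Omega> = spectrum x \<union> spectrum y"
  interpret hx: star_hom \<Omega> "cfc x" by (rule star_homI[OF unital_star_hom_mono[OF cfc_hom(1)[OF x]]]) (simp add: \<Omega>_def)
  interpret hy: star_hom \<Omega> "cfc y" by (rule star_homI[OF unital_star_hom_mono[OF cfc_hom(1)[OF y]]]) (simp add: \<Omega>_def)
  have comp: "compact \<Omega>" unfolding \<Omega>_def by (intro compact_Un compact_spectrum)
  define G where "G = {t\<in>\<Omega>. infdist t K < \<epsilon>}"
  have "G = \<Omega> \<inter> {t. infdist t K < \<epsilon>}" by (auto simp: G_def)
  moreover have "open {t. infdist t K < \<epsilon>}" by (intro open_Collect_less continuous_intros)
  ultimately have G: "openin (top_of_set \<Omega>) G" by (auto simp: openin_open)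
  obtain d where d: "0 < d" "d < D'" "cfc x (support_fun \<Omega> G) \<lesssim> cfc y (support_fun \<Omega> (nbhd \<Omega> G d))"
    by (rule Dc_comparison[OF x y \<Omega>_def G D'])
  define f f' where "f = support_fun \<Omega> G" and "f' = support_fun \<Omega> (nbhd \<Omega> G d)"
  note sf = support_fun_properties[OF G, folded f_def] and sf' = support_fun_properties[where \<Omega> = \<Omega> and G = "nbhd \<Omega> G d", OF openin_nbhd, folded f'_def]
  define \<gamma> where "\<gamma> t = ramp (2 - 2 * infdist t K / \<epsilon>)" for t
  define g where "g t = complex_of_real (\<gamma> t)" for t
  define h where "h t = complex_of_real (ramp (2 - (infdist t K - d) / \<epsilon>))" for t
  have c\<gamma>: "continuous_on S \<gamma>" for S unfolding \<gamma>_def using \<epsilon> by (intro continuous_intros) auto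
  have cg: "continuous_on S g" for S unfolding g_def by (intro continuous_intros c\<gamma>)
  have ch: "continuous_on S h" for S unfolding h_def using \<epsilon> by (intro continuous_intros) auto
  have \<gamma>01: "0 \<le> \<gamma> t" "\<gamma> t \<le> 1" for t by (simp_all add: \<gamma>_def ramp_bounds)
  have \<gamma>G: "t \<in> G" if "t \<in> \<Omega>" "\<gamma> t \<noteq> 0" for t
  proof (rule ccontr)
    assume "t \<notin> G"
    then have "\<epsilon> \<le> infdist t K" using that by (simp add: G_def)
    then have "2 - 2 * infdist t K / \<epsilon> \<le> 0" using \<epsilon> by (simp add: field_simps)
    then show False using that by (simp add: \<gamma>_def ramp_simps)
  qed
  obtain c where c: "c > 0" "\<And>t. t \<in> \<Omega> \<Longrightarrow> 1/4 \<le> \<gamma> t \<Longrightarrow> c \<le> Re (f t)"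
  proof -
    define L where "L = \<Omega> \<inter> {t. 1/4 \<le> \<gamma> t}"
    have "compact L" unfolding L_def
      by (intro compact_Int_closed comp closed_Collect_le continuous_intros c\<gamma>)
    have "\<exists>c>0. \<forall>t\<in>L. c \<le> Re (f t)"
    proof (cases "L = {}")
      case False
      have "continuous_on L (\<lambda>t. Re (f t))" using continuous_on_subset[OF sf(1), of L] by (intro continuous_intros) (auto simp: L_def)
      then obtain t0 where t0: "t0 \<in> L" "\<And>t. t \<in> L \<Longrightarrow> Re (f t0) \<le> Re (f t)"
        using continuous_attains_inf[OF \<open>compact L\<close> False] by blast
      have "0 < Re (f t0)" using t0(1) \<gamma>G[of t0] sf(4)[of t0] by (auto simp: L_def)
      then show ?thesis using t0 by blast
    qed (auto intro: exI[of _ 1])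
    then show ?thesis using that by (auto simp: L_def)
  qed
  \<comment> \<open>\<open>s f\<close> equals \<open>\<gamma>\<close> where \<open>f \<ge> c\<close>; elsewhere \<open>0 \<le> s f \<le> \<gamma> < 1/4\<close>\<close>
  define s where "s t = \<gamma> t / max (Re (f t)) c" for t
  have mpos: "max (Re (f t)) c > 0" for t using c(1) by simp
  have s0: "0 \<le> s t" for t using \<gamma>01(1)[of t] mpos[of t] by (simp add: s_def)
  define w where "w t = complex_of_real (sqrt (s t))" for t
  have cs: "continuous_on \<Omega> s" unfolding s_def using mpos by (intro continuous_intros c\<gamma> sf(1)) (metis less_irrefl)
  have cw: "continuous_on \<Omega> w" unfolding w_def by (intro continuous_intros cs)
  have err1: "norm (cfc x g - star (cfc x w) * cfc x f * cfc x w) \<le> 1/4"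
    unfolding hx.hom_conjugate[OF sf(1) cw]
  proof (rule hx.hom_norm_diff_le[OF cg])
    show "continuous_on \<Omega> (\<lambda>t. cnj (w t) * f t * w t)" by (intro continuous_intros cw sf(1))
    fix t assume t: "t \<in> \<Omega>"
    have "cnj (w t) * f t * w t = complex_of_real (sqrt (s t)) * complex_of_real (Re (f t)) * complex_of_real (sqrt (s t))"
      using sf(2)[OF t] by (simp add: w_def)
    also have "\<dots> = complex_of_real (sqrt (s t) * sqrt (s t) * Re (f t))" by (simp only: of_real_mult ac_simps)
    also have "sqrt (s t) * sqrt (s t) * Re (f t) = s t * Re (f t)" using s0[of t] by simp
    finally have "g t - cnj (w t) * f t * w t = complex_of_real (\<gamma> t - s t * Re (f t))" by (simp add: g_def)
    then have "cmod (g t - cnj (w t) * f t * w t) = \<bar>\<gamma> t - s t * Re (f t)\<bar>" by (simp only: norm_of_real real_norm_def)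
    also have "\<dots> \<le> 1/4"
    proof (cases "c \<le> Re (f t)")
      case True
      then have "s t * Re (f t) = \<gamma> t" using c(1) by (simp add: s_def max_def)
      then show ?thesis by simp
    next
      case False
      then have "\<gamma> t < 1/4" using c(2)[OF t] by force
      moreover have "Re (f t) \<le> max (Re (f t)) c" by simp
      then have "Re (f t) / max (Re (f t)) c \<le> 1" using mpos[of t] by (metis divide_le_eq_1_pos)
      then have "\<gamma> t * (Re (f t) / max (Re (f t)) c) \<le> \<gamma> t * 1" using \<gamma>01(1) by (rule mult_left_mono)
      then have "s t * Re (f t) \<le> \<gamma> t" by (simp add: s_def)
      moreover have "0 \<le> s t * Re (f t)" using s0 sf(3)[OF t] by (rule mult_nonneg_nonneg)
      ultimately show ?thesis by linarith
    qed
    finally show "cmod (g t - cnj (w t) * f t * w t) \<le> 1/4" .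
  qed simp
  define W where "W = cfc x w"
  obtain Z where Z: "norm (star Z * cfc y f' * Z - cfc x f) < 1 / (4 * ((norm W)\<^sup>2 + 1))"
  proof -
    obtain Zs where Zs: "(\<lambda>n. star (Zs n) * cfc y f' * Zs n) \<longlonglongrightarrow> cfc x f"
      using d(3) unfolding cuntz_le_def f_def f'_def by blast
    have "0 < 1 / (4 * ((norm W)\<^sup>2 + 1))" by (simp add: add_nonneg_pos)
    from LIMSEQ_D[OF Zs this] show ?thesis using that by blast
  qed
  have err2: "norm (star W * cfc x f * W - star W * (star Z * cfc y f' * Z) * W) < 1/4"
  proof -
    have "star W * cfc x f * W - star W * (star Z * cfc y f' * Z) * W = star W * (cfc x f - star Z * cfc y f' * Z) * W"
      by (simp add: algebra_simps)
    also have "norm \<dots> \<le> norm W * norm (cfc x f - star Z * cfc y f' * Z) * norm W"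
      using norm_mult_ineq[of "star W * (cfc x f - star Z * cfc y f' * Z)" W]
        mult_right_mono[OF norm_mult_ineq[of "star W" "cfc x f - star Z * cfc y f' * Z"], of "norm W"] by simp
    also have "\<dots> = (norm W)\<^sup>2 * norm (star Z * cfc y f' * Z - cfc x f)" by (simp add: power2_eq_square norm_minus_commute)
    also have "\<dots> \<le> (norm W)\<^sup>2 * (1 / (4 * ((norm W)\<^sup>2 + 1)))" using Z by (intro mult_left_mono) auto
    also have "\<dots> < 1/4" by (simp add: field_simps add_pos_nonneg)
    finally show ?thesis .
  qed
  have hf': "cfc y h * cfc y f' = cfc y f'"
    unfolding hy.hom_mult[OF ch sf'(1), symmetric]
  proof (rule hy.hom_cong)
    show "continuous_on \<Omega> (\<lambda>t. h t * f' t)" by (intro continuous_intros ch sf'(1))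
    fix t assume t: "t \<in> \<Omega>"
    show "h t * f' t = f' t"
    proof (cases "t \<in> nbhd \<Omega> G d")
      case True
      then obtain s where s: "s \<in> G" "dist t s < d" by (auto simp: nbhd_def)
      have "infdist t K \<le> infdist s K + dist t s" by (rule infdist_triangle)
      then have "infdist t K - d \<le> \<epsilon>" using s by (simp add: G_def)
      then have "1 \<le> 2 - (infdist t K - d) / \<epsilon>" using \<epsilon> by (simp add: field_simps)
      then show ?thesis by (simp add: h_def ramp_simps)
    qed (use sf'(5)[OF t] in simp)
  qed
  define U0 V where "U0 = star W * star Z" and "V = cfc y f' * Z * W"
  have "U0 * cfc y h * V = star W * star Z * (cfc y h * cfc y f') * Z * W" by (simp add: U0_def V_def mult.assoc)
  also have "\<dots> = star W * (star Z * cfc y f' * Z) * W" by (simp only: hf' mult.assoc)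
  finally have UV: "U0 * cfc y h * V = star W * (star Z * cfc y f' * Z) * W" .
  have err: "norm (cfc x g - U0 * cfc y h * V) < 1/2"
    using norm_triangle_ineq[of "cfc x g - star W * cfc x f * W" "star W * cfc x f * W - star W * (star Z * cfc y f' * Z) * W"]
      err1 err2 unfolding UV W_def by simp
  define Q where "Q = norm (cfc y h * V)"
  obtain U where U: "U \<in> D" "norm (U - U0) < 1 / (2 * (Q + 1))"
    by (rule approx[of "1 / (2 * (Q + 1))" U0]) (simp_all add: Q_def add_nonneg_pos)
  have "norm (U0 * cfc y h * V - U * cfc y h * V) < 1/2"
  proof -
    have "U0 * cfc y h * V - U * cfc y h * V = (U0 - U) * (cfc y h * V)" by (simp add: algebra_simps)
    also have "norm \<dots> \<le> norm (U0 - U) * Q" unfolding Q_def by (rule norm_mult_ineq)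
    also have "\<dots> \<le> 1 / (2 * (Q + 1)) * Q" using U(2) by (intro mult_right_mono) (auto simp: norm_minus_commute Q_def)
    also have "\<dots> < 1/2" by (simp add: field_simps Q_def add_pos_nonneg)
    finally show ?thesis .
  qed
  then have final: "norm (cfc x g - U * cfc y h * V) < 1"
    using norm_triangle_ineq[of "cfc x g - U0 * cfc y h * V" "U0 * cfc y h * V - U * cfc y h * V"] err by simp
  show ?thesis
  proof (rule that[OF cg ch _ _ U(1) final])
    show "g t = 1" if "k \<in> K" "dist t k \<le> \<epsilon> / 2" for t k
    proof -
      have "infdist t K \<le> \<epsilon> / 2" using infdist_le[OF that(1), of t] that(2) by simp
      then have "1 \<le> 2 - 2 * infdist t K / \<epsilon>" using \<epsilon> by (simp add: field_simps)
      then show ?thesis by (simp add: g_def \<gamma>_def ramp_simps)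
    qed
    show "\<exists>k\<in>K. dist t k \<le> D' + 2 * \<epsilon>" if "h t \<noteq> 0" for t
    proof -
      obtain k where k: "k \<in> K" "infdist t K = dist t k"
        using infdist_attains_inf[of K t] K finite_imp_closed by blast
      have "\<not> 2 - (infdist t K - d) / \<epsilon> \<le> 0" using that ramp_simps(1) by (auto simp: h_def)
      then have "infdist t K < d + 2 * \<epsilon>" using \<epsilon> by (simp add: field_simps)
      then show ?thesis using k d(2) by (intro bexI[of _ k]) auto
    qed
  qed
qed

section \<open>Unitary equivalence up to the comparison distance\<close>

lemma normal_approximation:
  fixes x :: 'a
  assumes x: "normal_element x" and R: "norm x + 1 \<le> R"
  obtains X \<Psi> where "\<And>n. X n \<in> D" "\<And>n. normal_element (X n)" "\<And>n. norm (X n) < R" "X \<longlonglongrightarrow> x"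
    "\<And>n. unital_star_hom (square R) (\<Psi> n)" "\<And>n. \<Psi> n (\<lambda>z. z) = X n"
    "\<And>f. continuous_on UNIV f \<Longrightarrow> (\<lambda>n. \<Psi> n f) \<longlonglongrightarrow> cfc x f"
proof -
  have "\<exists>b. b \<in> D \<and> normal_element b \<and> norm (b - x) < inverse (real (Suc n))" for n
    using normal_dense[OF x, of "inverse (real (Suc n))"] by (metis inverse_positive_iff_positive of_nat_0_less_iff zero_less_Suc)
  then obtain X where X: "\<And>n. X n \<in> D" "\<And>n. normal_element (X n)" "\<And>n. norm (X n - x) < inverse (real (Suc n))" by metis
  have XR: "norm (X n) < R" for n
  proof -
    have "inverse (real (Suc n)) \<le> 1" by (simp add: field_simps)
    then show ?thesis using X(3)[of n] R norm_triangle_sub[of "X n" x] by linarith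
  qed
  have "(\<lambda>n. X n - x) \<longlonglongrightarrow> 0"
    by (rule Lim_null_comparison[OF _ LIMSEQ_inverse_real_of_nat]) (use X(3) in \<open>auto intro!: always_eventually less_imp_le\<close>)
  then have lim: "X \<longlonglongrightarrow> x" by (simp add: LIM_zero_iff)
  have "\<exists>\<Psi>. unital_star_hom (square R) \<Psi> \<and> \<Psi> (\<lambda>z. z) = X n" for n
    using normal_calculus[OF X(2) XR] by metis
  then obtain \<Psi> where \<Psi>: "\<And>n. unital_star_hom (square R) (\<Psi> n)" "\<And>n. \<Psi> n (\<lambda>z. z) = X n" by metis
  obtain \<Phi> where \<Phi>: "unital_star_hom (square R) \<Phi>" "\<Phi> (\<lambda>z. z) = x"
    "\<And>f. continuous_on (square R) f \<Longrightarrow> (\<lambda>n. \<Psi> n f) \<longlonglongrightarrow> \<Phi> f"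
    by (rule calculus_limit[OF compact_square \<Psi> lim]) blast
  have sp: "spectrum x \<subseteq> square R" using R by (intro spectrum_subset_square) simp
  have "(\<lambda>n. \<Psi> n f) \<longlonglongrightarrow> cfc x f" if f: "continuous_on UNIV f" for f
  proof -
    have f': "continuous_on (square R) f" by (rule continuous_on_subset[OF f]) simp
    show ?thesis using \<Phi>(3)[OF f'] hom_unique[OF \<Phi>(1,2) cfc_hom[OF x] compact_square sp f'] by simp
  qed
  then show ?thesis using that[OF X(1,2) XR lim \<Psi>] by blast
qed

lemma family_calculus:
  assumes \<E>: "orthogonal_family k \<E>" and b: "b = (\<Sum>e\<in>\<E>. l e *\<^sub>C e)" "norm b < R"
    and \<Psi>: "unital_star_hom (square R) \<Psi>" "\<Psi> (\<lambda>z. z) = b"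
  shows "e \<in> \<E> \<Longrightarrow> l e \<in> square R"
    and "continuous_on UNIV f \<Longrightarrow> \<Psi> f = (\<Sum>e\<in>\<E>. f (l e) *\<^sub>C e)"
proof -
  note d = orthogonal_familyD[OF \<E>]
  have res: "resolution \<E> (\<lambda>e. e)" using \<E> by (simp add: orthogonal_family_def)
  show sq: "l e \<in> square R" if e: "e \<in> \<E>" for e
  proof -
    have "b * e = l e *\<^sub>C e" unfolding b(1) using resolution_mult(1)[OF res e, of l] by simp
    moreover have "norm e = 1" using norm_projection[OF d(3)[OF e] d(4)[OF e]] .
    ultimately have "cmod (l e) \<le> norm b" using eigen_norm_diff[of b e "l e" 0] by simp
    then show ?thesis using b(2) abs_Re_le_cmod[of "l e"] abs_Im_le_cmod[of "l e"] unfolding square_iff by linarith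
  qed
  interpret star_hom \<E> "\<lambda>f. \<Sum>e\<in>\<E>. f e *\<^sub>C e" by (rule star_homI[OF resolution_hom[OF res]])
  have cont: "continuous_on \<E> F" for F :: "'a \<Rightarrow> complex" by (rule continuous_on_finite[OF d(1)])
  have "unital_star_hom (l ` \<E>) (\<lambda>f. \<Sum>e\<in>\<E>. f (l e) *\<^sub>C e)"
    unfolding unital_star_hom_def
    using hom_add[OF cont cont] hom_mult[OF cont cont] hom_cmult[OF cont] hom_star[OF cont] hom_one
    by (auto intro!: sum.cong)
  moreover assume f: "continuous_on UNIV f"
  ultimately show "\<Psi> f = (\<Sum>e\<in>\<E>. f (l e) *\<^sub>C e)"
    using hom_unique[OF \<Psi>, of "l ` \<E>" "\<lambda>f. \<Sum>e\<in>\<E>. f (l e) *\<^sub>C e" f] b(1) sq continuous_on_subset[OF f, of "square R"]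
    by (auto simp: compact_square image_subset_iff)
qed

lemma finite_subset_stage: "finite A \<Longrightarrow> A \<subseteq> D \<Longrightarrow> \<exists>k. A \<subseteq> B k"
proof (induction rule: finite_induct)
  case (insert a A)
  then obtain i j where "A \<subseteq> B i" "a \<in> B j" by blast
  then have "insert a A \<subseteq> B (max i j)" using mono[of i "max i j"] mono[of j "max i j"] by auto
  then show ?case by blast
qed simp

text \<open>The eigenvalues of the approximation of \<open>x\<close> are rounded to points of a finite net; to a set \<open>S\<close> of its eigenprojections belongs the set
  \<open>K\<close> of the rounded eigenvalues. As \<open>g(X n)\<close> is the identity on the sum \<open>E\<close> of \<open>S\<close> and \<open>h(Y n)\<close> lives on the eigenprojections of
  \<open>Y n\<close> with eigenvalues near \<open>K\<close>, the factorisation of \<open>g\<close> compares their numbers.\<close>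

theorem unitary_near:
  fixes x y :: 'a
  assumes x: "normal_element x" and y: "normal_element y" and D': "Dc x y < D'" and \<epsilon>: "0 < \<epsilon>"
  obtains u where "unitary u" "norm (star u * x * u - y) \<le> D' + 5 * \<epsilon>"
proof -
  define R where "R = norm x + norm y + 1"
  have Rx: "norm x + 1 \<le> R" and Ry: "norm y + 1 \<le> R" by (simp_all add: R_def)
  obtain X \<Psi> where X: "\<And>n. X n \<in> D" "\<And>n. normal_element (X n)" "\<And>n. norm (X n) < R" "X \<longlonglongrightarrow> x"
    "\<And>n. unital_star_hom (square R) (\<Psi> n)" "\<And>n. \<Psi> n (\<lambda>z. z) = X n"
    "\<And>f. continuous_on UNIV f \<Longrightarrow> (\<lambda>n. \<Psi> n f) \<longlonglongrightarrow> cfc x f"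
    by (rule normal_approximation[OF x Rx]) blast
  obtain Y \<Upsilon> where Y: "\<And>n. Y n \<in> D" "\<And>n. normal_element (Y n)" "\<And>n. norm (Y n) < R" "Y \<longlonglongrightarrow> y"
    "\<And>n. unital_star_hom (square R) (\<Upsilon> n)" "\<And>n. \<Upsilon> n (\<lambda>z. z) = Y n"
    "\<And>f. continuous_on UNIV f \<Longrightarrow> (\<lambda>n. \<Upsilon> n f) \<longlonglongrightarrow> cfc y f"
    by (rule normal_approximation[OF y Ry]) blast
  obtain \<Lambda> where \<Lambda>: "finite \<Lambda>" "square R \<subseteq> (\<Union>c\<in>\<Lambda>. ball c (\<epsilon> / 2))"
    using compact_square[of R] \<epsilon> unfolding compact_eq_totally_bounded by (meson half_gt_zero)
  have "\<exists>c\<in>\<Lambda>. dist z c \<le> \<epsilon> / 2" if z: "z \<in> square R" for z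
  proof -
    obtain c where "c \<in> \<Lambda>" "dist c z < \<epsilon> / 2" using \<Lambda>(2) z unfolding subset_iff UN_iff mem_ball by blast
    then show ?thesis by (metis dist_commute less_imp_le)
  qed
  then obtain r where r: "\<And>z. z \<in> square R \<Longrightarrow> r z \<in> \<Lambda>" "\<And>z. z \<in> square R \<Longrightarrow> dist z (r z) \<le> \<epsilon> / 2" by metis
  define \<K> where "\<K> = Pow \<Lambda> - {{}}"
  define good where "good K g h U V \<longleftrightarrow> continuous_on UNIV g \<and> continuous_on UNIV h \<and>
      (\<forall>t. \<forall>k\<in>K. dist t k \<le> \<epsilon> / 2 \<longrightarrow> g t = 1) \<and> (\<forall>t. h t \<noteq> 0 \<longrightarrow> (\<exists>k\<in>K. dist t k \<le> D' + 2 * \<epsilon>)) \<and>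
      U \<in> D \<and> norm (cfc x g - U * cfc y h * V) < 1" for K g h U V
  have "\<exists>g h U V. good K g h U V" if K: "K \<in> \<K>" for K
  proof -
    have "finite K" "K \<noteq> {}" using K \<Lambda>(1) finite_subset by (auto simp: \<K>_def)
    then obtain g h U V where "continuous_on UNIV g" "continuous_on UNIV h" "\<And>t k. k \<in> K \<Longrightarrow> dist t k \<le> \<epsilon> / 2 \<Longrightarrow> g t = 1"
      "\<And>t. h t \<noteq> 0 \<Longrightarrow> \<exists>k\<in>K. dist t k \<le> D' + 2 * \<epsilon>" "U \<in> D" "norm (cfc x g - U * cfc y h * V) < 1"
      by (rule bump_factorization[OF x y D' \<epsilon>]) blast
    then have "good K g h U V" unfolding good_def by blast
    then show ?thesis by blast
  qed
  then obtain g h U V where good: "\<And>K. K \<in> \<K> \<Longrightarrow> good K (g K) (h K) (U K) (V K)" by metis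
  then have cont: "\<And>K. K \<in> \<K> \<Longrightarrow> continuous_on UNIV (g K)" "\<And>K. K \<in> \<K> \<Longrightarrow> continuous_on UNIV (h K)"
    and g: "\<And>K t k. K \<in> \<K> \<Longrightarrow> k \<in> K \<Longrightarrow> dist t k \<le> \<epsilon> / 2 \<Longrightarrow> g K t = 1"
    and h: "\<And>K t. K \<in> \<K> \<Longrightarrow> h K t \<noteq> 0 \<Longrightarrow> \<exists>k\<in>K. dist t k \<le> D' + 2 * \<epsilon>"
    and U: "\<And>K. K \<in> \<K> \<Longrightarrow> U K \<in> D" and UV: "\<And>K. K \<in> \<K> \<Longrightarrow> norm (cfc x (g K) - U K * cfc y (h K) * V K) < 1"
    unfolding good_def by blast+
  \<comment> \<open>finitely many inequalities between continuous expressions persist under approximation\<close>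
  have "\<forall>\<^sub>F n in sequentially. \<forall>K\<in>\<K>. norm (\<Psi> n (g K) - U K * \<Upsilon> n (h K) * V K) < 1"
  proof (rule eventually_ball_finite)
    show "finite \<K>" using \<Lambda>(1) by (simp add: \<K>_def)
    show "\<forall>K\<in>\<K>. \<forall>\<^sub>F n in sequentially. norm (\<Psi> n (g K) - U K * \<Upsilon> n (h K) * V K) < 1"
    proof
      fix K assume K: "K \<in> \<K>"
      have "(\<lambda>n. norm (\<Psi> n (g K) - U K * \<Upsilon> n (h K) * V K)) \<longlonglongrightarrow> norm (cfc x (g K) - U K * cfc y (h K) * V K)"
        by (intro tendsto_intros X(7) Y(7) cont K)
      then show "\<forall>\<^sub>F n in sequentially. norm (\<Psi> n (g K) - U K * \<Upsilon> n (h K) * V K) < 1"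
        by (rule order_tendstoD(2)[OF _ UV[OF K]])
    qed
  qed
  moreover have "\<forall>\<^sub>F n in sequentially. dist (X n) x < \<epsilon>" "\<forall>\<^sub>F n in sequentially. dist (Y n) y < \<epsilon>"
    using tendstoD[OF X(4) \<epsilon>] tendstoD[OF Y(4) \<epsilon>] .
  ultimately have "\<forall>\<^sub>F n in sequentially. (\<forall>K\<in>\<K>. norm (\<Psi> n (g K) - U K * \<Upsilon> n (h K) * V K) < 1) \<and> dist (X n) x < \<epsilon> \<and> dist (Y n) y < \<epsilon>"
    by (intro eventually_conj)
  then obtain n where n: "\<And>K. K \<in> \<K> \<Longrightarrow> norm (\<Psi> n (g K) - U K * \<Upsilon> n (h K) * V K) < 1" "dist (X n) x < \<epsilon>" "dist (Y n) y < \<epsilon>"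
    unfolding eventually_sequentially by blast
  have "finite (insert (X n) (insert (Y n) (U ` \<K>)))" using \<Lambda>(1) by (simp add: \<K>_def)
  moreover have "insert (X n) (insert (Y n) (U ` \<K>)) \<subseteq> D" using X(1) Y(1) U by (intro insert_subsetI image_subsetI) blast+
  ultimately obtain k where k: "insert (X n) (insert (Y n) (U ` \<K>)) \<subseteq> B k" using finite_subset_stage by blast
  then have XB: "X n \<in> B k" and YB: "Y n \<in> B k" and UB: "\<And>K. K \<in> \<K> \<Longrightarrow> U K \<in> B k" by blast+
  obtain \<E> l where \<E>: "orthogonal_family k \<E>" "\<And>e. e \<in> \<E> \<Longrightarrow> minimal k e" "X n = (\<Sum>e\<in>\<E>. l e *\<^sub>C e)"
    by (rule minimal_decomposition[OF XB X(2)]) blast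
  obtain \<F> m where \<F>: "orthogonal_family k \<F>" "\<And>f. f \<in> \<F> \<Longrightarrow> minimal k f" "Y n = (\<Sum>f\<in>\<F>. m f *\<^sub>C f)"
    by (rule minimal_decomposition[OF YB Y(2)]) blast
  note dE = orthogonal_familyD[OF \<E>(1)] and dF = orthogonal_familyD[OF \<F>(1)]
  note calcX = family_calculus[OF \<E>(1,3) X(3,5,6)] and calcY = family_calculus[OF \<F>(1,3) Y(3,5,6)]
  have resE: "resolution \<E> (\<lambda>e. e)" and resF: "resolution \<F> (\<lambda>f. f)" using \<E>(1) \<F>(1) by (simp_all add: orthogonal_family_def)
  \<comment> \<open>\<open>D' + 2 * \<epsilon>\<close> from the supports of the bump functions and \<open>\<epsilon> / 2\<close> from the rounding\<close>
  define \<delta> where "\<delta> = D' + 3 * \<epsilon>"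
  have hall: "card S \<le> card {f\<in>\<F>. equivalent k e0 f \<and> (\<exists>e\<in>S. cmod (l e - m f) \<le> \<delta>)}"
    if S: "S \<subseteq> \<E>" "S \<noteq> {}" and e0: "e0 \<in> \<E>" and eq: "\<And>e. e \<in> S \<Longrightarrow> equivalent k e0 e" for S e0
  proof -
    define K where "K = (\<lambda>e. r (l e)) ` S"
    have K: "K \<in> \<K>" using S calcX(1) r(1) by (auto simp: \<K>_def K_def)
    define T where "T = {f\<in>\<F>. h K (m f) \<noteq> 0}"
    define E F where "E = (\<Sum>e\<in>S. e)" and "F = (\<Sum>f\<in>T. f)"
    have fS: "finite S" using S(1) dE(1) finite_subset by blast
    have fT: "finite T" using dF(1) by (simp add: T_def)
    have EE: "E * E = E"
    proof -
      have "E * E = (\<Sum>e\<in>S. \<Sum>e'\<in>S. if e' = e then e else 0)"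
        unfolding E_def sum_product using dE(3,5) S(1) by (intro sum.cong refl) (auto simp: projection_idem)
      then show ?thesis using fS by (simp add: E_def)
    qed
    moreover have "star E = E" unfolding E_def star_sum using dE(3) S(1) by (intro sum.cong) (auto simp: projection_star)
    ultimately have E1: "norm E \<le> 1" by (intro norm_projection_le) (simp add: projection_def)
    have gE: "\<Psi> n (g K) * E = E"
      unfolding E_def sum_distrib_left
    proof (rule sum.cong)
      fix e assume e: "e \<in> S"
      have "g K (l e) = 1" using g[OF K, of "r (l e)"] e r(2)[OF calcX(1)] S(1) by (auto simp: K_def)
      then show "\<Psi> n (g K) * e = e"
        using calcX(2)[OF cont(1)[OF K]] resolution_mult(1)[OF resE, of e "\<lambda>e. g K (l e)"] e S(1) by auto
    qed simp
    have hF: "F * \<Upsilon> n (h K) = \<Upsilon> n (h K)"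
    proof -
      have "F * \<Upsilon> n (h K) = (\<Sum>f\<in>T. h K (m f) *\<^sub>C f)"
        unfolding F_def sum_distrib_right calcY(2)[OF cont(2)[OF K]]
        by (intro sum.cong refl resolution_mult(2)[OF resF]) (simp add: T_def)
      also have "\<dots> = (\<Sum>f\<in>\<F>. h K (m f) *\<^sub>C f)" using dF(1) by (intro sum.mono_neutral_left) (auto simp: T_def)
      finally show ?thesis using calcY(2)[OF cont(2)[OF K]] by simp
    qed
    have "E - E * U K * F * (\<Upsilon> n (h K) * V K) * E = E * (\<Psi> n (g K) * E) - E * U K * (F * \<Upsilon> n (h K)) * V K * E"
      using gE EE by (simp add: mult.assoc)
    also have "\<dots> = E * (\<Psi> n (g K) - U K * \<Upsilon> n (h K) * V K) * E" unfolding hF by (simp add: algebra_simps)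
    also have "norm \<dots> \<le> norm E * norm (\<Psi> n (g K) - U K * \<Upsilon> n (h K) * V K) * norm E"
      by (rule order_trans[OF norm_mult_ineq mult_right_mono[OF norm_mult_ineq norm_ge_zero]])
    also have "\<dots> \<le> 1 * norm (\<Psi> n (g K) - U K * \<Upsilon> n (h K) * V K) * 1"
      using E1 by (intro mult_mono mult_nonneg_nonneg) auto
    also have "\<dots> < 1" using n(1)[OF K] by simp
    finally have "card S \<le> card {f\<in>T. equivalent k e0 f}"
      unfolding E_def F_def
      by (intro card_comparison[OF \<E>(1) S(1) \<F>(1) _ \<F>(2) \<E>(2)[OF e0] eq UB[OF K]]) (auto simp: T_def)
    also have "\<dots> \<le> card {f\<in>\<F>. equivalent k e0 f \<and> (\<exists>e\<in>S. cmod (l e - m f) \<le> \<delta>)}"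
    proof (rule card_mono)
      show "finite {f\<in>\<F>. equivalent k e0 f \<and> (\<exists>e\<in>S. cmod (l e - m f) \<le> \<delta>)}" using dF(1) by simp
      show "{f\<in>T. equivalent k e0 f} \<subseteq> {f\<in>\<F>. equivalent k e0 f \<and> (\<exists>e\<in>S. cmod (l e - m f) \<le> \<delta>)}"
      proof
        fix f assume f: "f \<in> {f\<in>T. equivalent k e0 f}"
        then have "h K (m f) \<noteq> 0" by (simp add: T_def)
        from h[OF K this] obtain e where e: "e \<in> S" "dist (m f) (r (l e)) \<le> D' + 2 * \<epsilon>" by (auto simp: K_def)
        have "dist (l e) (r (l e)) \<le> \<epsilon> / 2" using r(2)[OF calcX(1)] e(1) S(1) by blast
        then have "dist (l e) (m f) \<le> \<delta>"
          using e(2) dist_triangle2[of "l e" "m f" "r (l e)"] \<epsilon> by (simp add: \<delta>_def)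
        then show "f \<in> {f\<in>\<F>. equivalent k e0 f \<and> (\<exists>e\<in>S. cmod (l e - m f) \<le> \<delta>)}"
          using f e(1) by (auto simp: T_def dist_norm)
      qed
    qed
    finally show ?thesis .
  qed
  have "0 < D'"
    using Dc_comparison[OF x y refl openin_empty D'] by (metis less_trans)
  then have "0 \<le> \<delta>" using \<epsilon> by (simp add: \<delta>_def)
  obtain u where u: "unitary u" "norm (star u * X n * u - Y n) \<le> \<delta>"
    using unitary_from_matching[OF \<E>(1,2) \<F>(1,2) hall \<open>0 \<le> \<delta>\<close>] unfolding \<E>(3) \<F>(3) by blast
  have "star u * x * u - y = (star u * X n * u - Y n) + star u * (x - X n) * u + (Y n - y)" by (simp add: algebra_simps)
  then have "norm (star u * x * u - y) \<le> norm (star u * X n * u - Y n) + norm (star u * (x - X n) * u) + norm (Y n - y)"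
    using norm_triangle_ineq[of "(star u * X n * u - Y n) + star u * (x - X n) * u" "Y n - y"]
      norm_triangle_ineq[of "star u * X n * u - Y n" "star u * (x - X n) * u"] by simp
  moreover have "norm (star u * (x - X n) * u) \<le> norm (star u) * norm (x - X n) * norm u"
    by (rule order_trans[OF norm_mult_ineq mult_right_mono[OF norm_mult_ineq norm_ge_zero]])
  ultimately have "norm (star u * x * u - y) \<le> D' + 5 * \<epsilon>"
    using u(2) n(2,3) norm_unitary[OF u(1)] by (simp add: \<delta>_def dist_norm norm_minus_commute)
  then show ?thesis using that u(1) by blast
qed

end

theorem theorem3p7:
  fixes x y :: "'a::cstar_algebra"
  assumes "separable_space (euclidean :: 'a topology)"
    and "AF_algebra TYPE('a)"
    and "normal_element x"
    and "normal_element y"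
  shows "setdist (unitary_orbit x) (unitary_orbit y) \<le> Dc x y"
proof (rule field_le_epsilon)
  fix e :: real assume e: "0 < e"
  obtain B :: "nat \<Rightarrow> 'a set" where "af B" using AF_algebra_imp_af[OF assms(2)] by blast
  then interpret af B .
  obtain u where u: "unitary u" "norm (star u * x * u - y) \<le> (Dc x y + e / 2) + 5 * (e / 10)"
    using unitary_near[OF assms(3,4), of "Dc x y + e / 2" "e / 10"] e by auto
  have "star u * x * u \<in> unitary_orbit x"
    unfolding unitary_orbit_def using u(1) closure_subset by fast
  moreover have "unitary (1::'a)" by (simp add: unitary_def)
  then have "star 1 * y * 1 \<in> unitary_orbit y"
    unfolding unitary_orbit_def using closure_subset by fast
  ultimately have "setdist (unitary_orbit x) (unitary_orbit y) \<le> dist (star u * x * u) y"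
    by (intro setdist_le_dist) simp_all
  also have "\<dots> \<le> Dc x y + e" using u(2) by (simp add: dist_norm)
  finally show "setdist (unitary_orbit x) (unitary_orbit y) \<le> Dc x y + e" .
qed

end
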